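(* Let $G=\mathrm{PGL}_3$ (type $\tilde A_2$) and $\pi\in\{\pi_1,\pi_2\}$, or $G=\mathrm{PGSp}_4$ (type $\tilde C_2$) and $\pi\in\{\pi_{\mathrm{spin}},\pi_{\mathrm{st}}\}$. Let $\Gamma$ be a torsion-free finite-index subgroup of $W_{\mathrm{aff}}$ such that $\mathcal A_\Gamma$ is a Klein bottle. Then $$(1-u)^{\epsilon(\pi)N}L(\Gamma\backslash W_{\mathrm{ext}},\pi,u)=Z(\mathcal A_\Gamma,\pi,u)\left(\frac{1+u^{k_\Gamma/n_\Gamma}}{1-u^{k_\Gamma/n_\Gamma}}\right)^{n_\Gamma\,\delta(\pi,\Gamma)},$$ where $\epsilon(\pi)$ is the multiplicity of the trivial weight of $\pi$ and $N$ is the cardinality of $\Gamma\backslash W_{\mathrm{ext}}/W$.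
   Context: **Apartments.** $V$ is a Euclidean plane with inner product $(\cdot,\cdot)$, $W$ the Weyl group, $\Lambda\supset\Lambda_r$ the coweight and coroot lattices; $W_{\mathrm{ext}}=\Lambda\rtimes W$ and $W_{\mathrm{aff}}=\Lambda_r\rtimes W$ act on $V$ by isometries. The apartment $\mathcal A$ is $V$ with the simplicial structure cut out by the walls. Explicitly: - $\mathrm{PGL}_3$: $\Lambda$ is spanned by $\alpha_1,\alpha_2,\alpha_3$ of equal length with sum $0$; $W=S_3$ permutes them; $\Lambda_r=\{\sum c_i\alpha_i:c_i\in\mathbb Z,\ \sum c_i\equiv0\bmod3\}$; walls $\{\sum c_i\alpha_i:c_i-c_j=k\}$, $i\neq j$, $k\in\mathbb Z$. $\pi_1$ is the standard representation of $\hat G(\mathbb C)=\mathrm{SL}_3(\mathbb C)$ with weights $\alpha_1,\alpha_2,\alpha_3$; $\pi_2$ its dual with weights $-\alpha_1,-\alpha_2,-\alpha_3$. - $\mathrm{PGSp}_4$: $\Lambda=\mathbb Ze_1\oplus\mathbb Ze_2$, $e_1,e_2$ orthonormal; $W$ is the group of signed permutations (order 8); $\Lambda_r=\{x_1e_1+x_2e_2:x_1+x_2\text{ even}\}$; walls $x_1=k$, $x_2=k$, $x_1\pm x_2=k$. $\pi_{\mathrm{spin}}$ (degree 4) and $\pi_{\mathrm{st}}$ (degree 5) are representations of $\hat G(\mathbb C)=\mathrm{Spin}_5(\mathbb C)$ with weights $\pm e_1,\pm e_2$, respectively $\pm e_1\pm e_2$ and $0$. $\mathrm{wt}(\pi)$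 is the multiset of weights, $\mathrm{wt}'(\pi)$ the nontrivial ones, of common length $\ell(\pi)$. $\mathcal A_\Gamma=\Gamma\backslash\mathcal A$; it is a Klein bottle exactly when $\Gamma\not\subset\Lambda_r$. **Invariants of $\Gamma$.** $\Gamma$ is generated by a translation $t$ and a glide reflection $\sigma$ with $t\sigma=\sigma t^{-1}$; fix such a choice. Write $\sigma(x)=\sigma_0(x)+a\alpha+b\beta$ with $a,b\in\mathbb Z$, where $\sigma_0(x)=-x+2\frac{(x,\alpha)}{(\alpha,\alpha)}\alpha$, $\alpha$ is a nontrivial weight of one of the two representations ($\pi_1,\pi_2$ for $\tilde A_2$; $\pi_{\mathrm{spin}},\pi_{\mathrm{st}}$ for $\tilde C_2$), and $\beta$ is a nontrivial weight of the other one with $(\alpha,\beta)$ maximal. Then $n_\Gamma=\frac{2(\alpha,\beta)}{(\alpha,\alpha)}$, and $\sigma^2$ is translation by $k_\Gamma\alpha$ with $k_\Gamma=2a+n_\Gamma b$, where the pair $(\alpha,\beta)$ is replaced by $(-\alpha,-\beta)$ if necessary so that $k_\Gamma>0$. $k_\Gamma$ and $n_\Gamma$ depend only on $\Gamma$. $\Gamma$ is said to be of type $\pi$ if $\alpha\in\mathrm{wt}'(\pi)$. Thus $n_\Gamma=1$ for $\tilde A_2$; $n_\Gamma=1$ for $\tilde C_2$ with $\Gamma$ of type $\pi_{\mathrm{st}}$; $n_\Gamma=2$ for $\tilde C_2$ with $\Gamma$ of type $\pi_{\mathrm{spin}}$. Put $\delta(\pi,\Gamma)=1$ if $G$ is of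 type $\tilde A_2$; for type $\tilde C_2$ put $\delta(\pi,\Gamma)=2$ if $\Gamma$ is not of type $\pi$, and $\delta(\pi,\Gamma)=0$ if $\Gamma$ is of type $\pi$. **$L$-function.** An irreducible representation $\rho$ of $W_{\mathrm{ext}}$ is unramified if it has a nonzero $W$-fixed vector; then it is the unique unramified subrepresentation of $\mathrm{Ind}_\Lambda^{W_{\mathrm{ext}}}\chi_\rho$ for a character $\chi_\rho$ of $\Lambda$, unique up to $W$. With $\mathrm{Irr}^{\mathrm{unr}}(\Gamma\backslash W_{\mathrm{ext}})$ the multiset of irreducible unramified subrepresentations of $L^2(\Gamma\backslash W_{\mathrm{ext}})$, $L(\Gamma\backslash W_{\mathrm{ext}},\pi,u)=\prod_{\rho\in\mathrm{Irr}^{\mathrm{unr}}(\Gamma\backslash W_{\mathrm{ext}})}\prod_{\lambda\in\mathrm{wt}(\pi)}(1-\chi_\rho(\lambda)u)^{-1}$. **Zeta function.** A $\pi$-geodesic in $\mathcal A$ is an oriented straight line with the direction of some $\lambda\in\mathrm{wt}'(\pi)$; it is rational if contained in the 1-skeleton. A closed $\pi$-geodesic in $\mathcal A_\Gamma$ is the image of an oriented segment from $v$ to $g(v)$ on a $\pi$-geodesic $L$ with $g\in\Gamma$ and $g(L)=L$ (so directions from $v$ to $g(v)$ and from $g(v)$ to $g^2(v)$ agree); it is rational if $L$ is. Equivalence is change of starting point; primitive means not a repetition of a shorter one; normalized length $l(c)$ is length divided by $\ell(\pi)$. $Z(\mathcal A_\Gamma,\pi,u)=\prod_c(1-u^{l(c)})^{-1}$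 over equivalence classes of primitive rational closed $\pi$-geodesics. *)

theory Defs
  imports
    "HOL-Analysis.Analysis"
    "HOL-Algebra.Generated_Groups"
    "HOL-Library.Function_Algebras"
    "HOL-Library.Multiset"
begin

datatype grp = PGL3 | PGSp4

datatype wrep = Pi1 | Pi2 | Spin | St

fun reps :: "grp \<Rightarrow> wrep set" where
  "reps PGL3 = {Pi1, Pi2}"
| "reps PGSp4 = {Spin, St}"

type_synonym plane = "real^2"

text \<open>The vectors \<open>\<alpha>\<^sub>1, \<alpha>\<^sub>2, \<alpha>\<^sub>3\<close>, normalized to have length 1; every notion below is invariant under
  a common rescaling. The orthonormal vectors \<open>e\<^sub>1, e\<^sub>2\<close> are \<open>axis 1 1\<close> and \<open>axis 2 1\<close>.\<close>

definition alpha :: "3 \<Rightarrow> plane" where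
  "alpha i = (if i = 1 then vector [1, 0]
              else if i = 2 then vector [- 1/2, sqrt 3 / 2]
              else vector [- 1/2, - (sqrt 3 / 2)])"

abbreviation e1 :: plane where "e1 \<equiv> axis 1 1"
abbreviation e2 :: plane where "e2 \<equiv> axis 2 1"

fun wt :: "wrep \<Rightarrow> plane multiset" where
  "wt Pi1 = {# alpha 1, alpha 2, alpha 3 #}"
| "wt Pi2 = {# - alpha 1, - alpha 2, - alpha 3 #}"
| "wt Spin = {# e1, - e1, e2, - e2 #}"
| "wt St = {# e1 + e2, e1 - e2, - e1 + e2, - e1 - e2, 0 #}"

definition wt' :: "wrep \<Rightarrow> plane set" where
  "wt' \<pi> = {w \<in> set_mset (wt \<pi>). w \<noteq> 0}"

definition ell :: "wrep \<Rightarrow> real" where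
  "ell \<pi> = (THE r. norm ` wt' \<pi> = {r})"

definition eps :: "wrep \<Rightarrow> nat" where
  "eps \<pi> = count (wt \<pi>) 0"

fun coweight_lattice :: "grp \<Rightarrow> plane set" where
  "coweight_lattice PGL3 = {\<Sum>i\<in>UNIV. of_int (c i) *\<^sub>R alpha i | c :: 3 \<Rightarrow> int. True}"
| "coweight_lattice PGSp4 = {\<Sum>i\<in>UNIV. of_int (c i) *\<^sub>R axis i 1 | c :: 2 \<Rightarrow> int. True}"

fun coroot_lattice :: "grp \<Rightarrow> plane set" where
  "coroot_lattice PGL3 =
     {\<Sum>i\<in>UNIV. of_int (c i) *\<^sub>R alpha i | c :: 3 \<Rightarrow> int. (\<Sum>i\<in>UNIV. c i) mod 3 = 0}"
| "coroot_lattice PGSp4 =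
     {\<Sum>i\<in>UNIV. of_int (c i) *\<^sub>R axis i 1 | c :: 2 \<Rightarrow> int. even (\<Sum>i\<in>UNIV. c i)}"

fun weyl :: "grp \<Rightarrow> (plane \<Rightarrow> plane) set" where
  "weyl PGL3 =
     {w. linear w \<and> (\<exists>p. p permutes UNIV \<and> (\<forall>i. w (alpha i) = alpha (p i)))}"
| "weyl PGSp4 =
     {w. linear w \<and> (\<exists>p s. p permutes UNIV \<and> (\<forall>i. s i \<in> {1, - 1}) \<and>
            (\<forall>i. w (axis i 1) = s i *\<^sub>R axis (p i) 1))}"

definition transl :: "plane \<Rightarrow> plane \<Rightarrow> plane" where
  "transl v = (\<lambda>x. x + v)"

definition W_ext :: "grp \<Rightarrow> (plane \<Rightarrow> plane) set" where
  "W_ext G = {transl l \<circ> w | l w. l \<in> coweight_lattice G \<and> w \<in> weyl G}"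

definition W_aff :: "grp \<Rightarrow> (plane \<Rightarrow> plane) set" where
  "W_aff G = {transl l \<circ> w | l w. l \<in> coroot_lattice G \<and> w \<in> weyl G}"

definition W_aff_group :: "grp \<Rightarrow> (plane \<Rightarrow> plane) monoid" where
  "W_aff_group G = \<lparr>carrier = W_aff G, mult = (\<circ>), one = id\<rparr>"

fun walls :: "grp \<Rightarrow> plane set set" where
  "walls PGL3 =
     {H. \<exists>i j (k :: int). i \<noteq> j \<and> H = {\<Sum>m\<in>UNIV. c m *\<^sub>R alpha m | c. c i - c j = of_int k}}"
| "walls PGSp4 =
     {H. \<exists>k :: int. H = {x. x $ 1 = of_int k} \<or> H = {x. x $ 2 = of_int k} \<or>
                    H = {x. x $ 1 + x $ 2 = of_int k} \<or> H = {x. x $ 1 - x $ 2 = of_int k}}"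

definition one_skeleton :: "grp \<Rightarrow> plane set" where
  "one_skeleton G = \<Union> (walls G)"

definition torsion_free :: "(plane \<Rightarrow> plane) set \<Rightarrow> bool" where
  "torsion_free \<Gamma> \<longleftrightarrow> (\<forall>g\<in>\<Gamma>. \<forall>n>0. g ^^ n = id \<longrightarrow> g = id)"

definition orbit :: "(plane \<Rightarrow> plane) set \<Rightarrow> plane \<Rightarrow> plane set" where
  "orbit \<Gamma> x = {g x | g. g \<in> \<Gamma>}"

definition quotient_topology :: "'a topology \<Rightarrow> ('a \<Rightarrow> 'b) \<Rightarrow> 'b topology" where
  "quotient_topology X q =
     topology (\<lambda>U. U \<subseteq> q ` topspace X \<and> openin X {x \<in> topspace X. q x \<in> U})"

lemma openin_quotient_topology:
  "openin (quotient_topology X q) U \<longleftrightarrow>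
     U \<subseteq> q ` topspace X \<and> openin X {x \<in> topspace X. q x \<in> U}"
proof -
  have "istopology (\<lambda>U. U \<subseteq> q ` topspace X \<and> openin X {x \<in> topspace X. q x \<in> U})"
    unfolding istopology_def
  proof (intro conjI allI impI)
    fix S T
    assume S: "S \<subseteq> q ` topspace X \<and> openin X {x \<in> topspace X. q x \<in> S}"
      and T: "T \<subseteq> q ` topspace X \<and> openin X {x \<in> topspace X. q x \<in> T}"
    have "{x \<in> topspace X. q x \<in> S \<inter> T} =
          {x \<in> topspace X. q x \<in> S} \<inter> {x \<in> topspace X. q x \<in> T}" by auto
    with S T show "S \<inter> T \<subseteq> q ` topspace X" "openin X {x \<in> topspace X. q x \<in> S \<inter> T}"
      by auto
  next
    fix \<K>
    assume K: "\<forall>K\<in>\<K>. K \<subseteq> q ` topspace X \<and> openin X {x \<in> topspace X. q x \<in> K}"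
    have "{x \<in> topspace X. q x \<in> \<Union> \<K>} = (\<Union>K\<in>\<K>. {x \<in> topspace X. q x \<in> K})" by auto
    with K show "\<Union> \<K> \<subseteq> q ` topspace X" "openin X {x \<in> topspace X. q x \<in> \<Union> \<K>}"
      by auto
  qed
  then show ?thesis
    by (simp add: quotient_topology_def)
qed

lemma quotient_map_quotient_topology: "quotient_map X (quotient_topology X q) q"
proof -
  have *: "{x \<in> topspace X. q x \<in> q ` topspace X} = topspace X"
    by auto
  have "topspace (quotient_topology X q) = q ` topspace X"
  proof
    show "topspace (quotient_topology X q) \<subseteq> q ` topspace X"
      using openin_topspace[of "quotient_topology X q"] unfolding openin_quotient_topology
      by (rule conjunct1)
    have "openin (quotient_topology X q) (q ` topspace X)"
      unfolding openin_quotient_topology * by (simp only: openin_topspace subset_refl simp_thms)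
    then show "q ` topspace X \<subseteq> topspace (quotient_topology X q)"
      by (rule openin_subset)
  qed
  then show ?thesis
    unfolding quotient_map_def openin_quotient_topology by simp
qed

definition apartment_quotient :: "(plane \<Rightarrow> plane) set \<Rightarrow> plane set topology" where
  "apartment_quotient \<Gamma> = quotient_topology euclidean (orbit \<Gamma>)"

text \<open>The Klein bottle: the unit square with \<open>(0,y) \<sim> (1,y)\<close> and \<open>(x,0) \<sim> (1-x,1)\<close>.\<close>

definition klein_glue :: "real \<times> real \<Rightarrow> real \<times> real \<Rightarrow> bool" where
  "klein_glue p q \<longleftrightarrow>
     (\<exists>y\<in>{0..1}. p = (0, y) \<and> q = (1, y)) \<or> (\<exists>x\<in>{0..1}. p = (x, 0) \<and> q = (1 - x, 1))"

definition klein_bottle :: "(real \<times> real) set topology" where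
  "klein_bottle =
     quotient_topology (top_of_set ({0..1} \<times> {0..1})) (\<lambda>p. {q. equivclp klein_glue p q})"

definition is_klein_bottle :: "(plane \<Rightarrow> plane) set \<Rightarrow> bool" where
  "is_klein_bottle \<Gamma> \<longleftrightarrow> apartment_quotient \<Gamma> homeomorphic_space klein_bottle"

text \<open>The presentation of \<open>\<Gamma>\<close> by \<open>t\<close> and \<open>\<sigma>\<close> (and hence \<open>\<tau>, \<alpha>, \<beta>, a, b\<close>) is a choice; \<open>\<tau>\<close> is
  the representation having \<open>\<alpha>\<close> as a weight, i.e. \<open>\<Gamma>\<close> is of type \<open>\<tau>\<close>.\<close>

definition klein_presentation ::
    "grp \<Rightarrow> (plane \<Rightarrow> plane) set \<Rightarrow> wrep \<Rightarrow> plane \<Rightarrow> plane \<Rightarrow> int \<Rightarrow> int \<Rightarrow> bool" where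
  "klein_presentation G \<Gamma> \<tau> \<alpha> \<beta> a b \<longleftrightarrow>
     \<tau> \<in> reps G \<and> \<alpha> \<in> wt' \<tau> \<and>
     (\<exists>\<tau>'\<in>reps G. \<tau>' \<noteq> \<tau> \<and> is_arg_max (\<lambda>\<beta>. \<alpha> \<bullet> \<beta>) (\<lambda>\<beta>. \<beta> \<in> wt' \<tau>') \<beta>) \<and>
     (\<exists>t \<sigma>. t \<in> W_aff G \<and> \<sigma> \<in> W_aff G \<and>
        \<Gamma> = generate (W_aff_group G) {t, \<sigma>} \<and>
        (\<exists>v. t = transl v) \<and>
        \<sigma> = (\<lambda>x. (- x + (2 * (x \<bullet> \<alpha>) / (\<alpha> \<bullet> \<alpha>)) *\<^sub>R \<alpha>) + of_int a *\<^sub>R \<alpha> + of_int b *\<^sub>R \<beta>) \<and>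
        t \<circ> \<sigma> = \<sigma> \<circ> (inv\<^bsub>W_aff_group G\<^esub> t))"

text \<open>\<open>n = n\<^sub>\<Gamma>\<close> and \<open>k = k\<^sub>\<Gamma>\<close>; requiring \<open>k > 0\<close> selects between \<open>(\<alpha>, \<beta>)\<close> and \<open>(-\<alpha>, -\<beta>)\<close>.\<close>

definition klein_invariants ::
    "grp \<Rightarrow> (plane \<Rightarrow> plane) set \<Rightarrow> wrep \<Rightarrow> nat \<Rightarrow> nat \<Rightarrow> bool" where
  "klein_invariants G \<Gamma> \<tau> n k \<longleftrightarrow>
     (\<exists>\<alpha> \<beta> a b. klein_presentation G \<Gamma> \<tau> \<alpha> \<beta> a b \<and>
        real n = 2 * (\<alpha> \<bullet> \<beta>) / (\<alpha> \<bullet> \<alpha>) \<and>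
        int k = 2 * a + int n * b \<and> k > 0)"

text \<open>The last argument is the type of \<open>\<Gamma>\<close>.\<close>

fun delta :: "grp \<Rightarrow> wrep \<Rightarrow> wrep \<Rightarrow> nat" where
  "delta PGL3 \<pi> \<tau> = 1"
| "delta PGSp4 \<pi> \<tau> = (if \<pi> = \<tau> then 0 else 2)"

text \<open>All representations considered are spaces of complex functions on \<open>W\<^sub>e\<^sub>x\<^sub>t\<close> (extended by 0) on
  which \<open>W\<^sub>e\<^sub>x\<^sub>t\<close> acts by right translation.\<close>

type_synonym fn = "(plane \<Rightarrow> plane) \<Rightarrow> complex"

definition cscale :: "complex \<Rightarrow> ('a \<Rightarrow> complex) \<Rightarrow> 'a \<Rightarrow> complex" where
  "cscale c f = (\<lambda>x. c * f x)"

interpretation cfun: vector_space cscale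
  by standard (simp_all only: cscale_def fun_eq_iff plus_fun_apply distrib_left distrib_right mult.assoc mult_1 simp_thms)

definition functions_on :: "grp \<Rightarrow> fn set" where
  "functions_on G = {f. \<forall>g. g \<notin> W_ext G \<longrightarrow> f g = 0}"

definition rtrans :: "(plane \<Rightarrow> plane) \<Rightarrow> fn \<Rightarrow> fn" where
  "rtrans h f = (\<lambda>g. f (g \<circ> h))"

text \<open>Since \<open>\<Gamma>\<close> has finite index, square-summability on \<open>\<Gamma>\<setminus>W\<^sub>e\<^sub>x\<^sub>t\<close> is automatic.\<close>

definition L2 :: "grp \<Rightarrow> (plane \<Rightarrow> plane) set \<Rightarrow> fn set" where
  "L2 G \<Gamma> = {f \<in> functions_on G. \<forall>\<gamma>\<in>\<Gamma>. \<forall>g\<in>W_ext G. f (\<gamma> \<circ> g) = f g}"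

definition lattice_character :: "grp \<Rightarrow> (plane \<Rightarrow> complex) \<Rightarrow> bool" where
  "lattice_character G \<psi> \<longleftrightarrow> \<psi> 0 = 1 \<and>
     (\<forall>l\<in>coweight_lattice G. \<forall>m\<in>coweight_lattice G. \<psi> (l + m) = \<psi> l * \<psi> m)"

definition Ind :: "grp \<Rightarrow> (plane \<Rightarrow> complex) \<Rightarrow> fn set" where
  "Ind G \<psi> = {f \<in> functions_on G.
     \<forall>l\<in>coweight_lattice G. \<forall>g\<in>W_ext G. f (transl l \<circ> g) = \<psi> l * f g}"

definition subrep :: "grp \<Rightarrow> fn set \<Rightarrow> fn set \<Rightarrow> bool" where
  "subrep G U V \<longleftrightarrow> U \<subseteq> V \<and> cfun.subspace U \<and> (\<forall>h\<in>W_ext G. \<forall>f\<in>U. rtrans h f \<in> U)"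

definition irreducible_rep :: "grp \<Rightarrow> fn set \<Rightarrow> bool" where
  "irreducible_rep G U \<longleftrightarrow> subrep G U (functions_on G) \<and> U \<noteq> {0} \<and>
     (\<forall>U'. subrep G U' U \<longrightarrow> U' = {0} \<or> U' = U)"

definition unramified :: "grp \<Rightarrow> fn set \<Rightarrow> bool" where
  "unramified G U \<longleftrightarrow> (\<exists>f\<in>U. f \<noteq> 0 \<and> (\<forall>w\<in>weyl G. rtrans w f = f))"

definition rep_iso :: "grp \<Rightarrow> fn set \<Rightarrow> fn set \<Rightarrow> bool" where
  "rep_iso G U U' \<longleftrightarrow> (\<exists>T. bij_betw T U U' \<and>
     (\<forall>f\<in>U. \<forall>g\<in>U. T (f + g) = T f + T g) \<and>
     (\<forall>c. \<forall>f\<in>U. T (cscale c f) = cscale c (T f)) \<and>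
     (\<forall>h\<in>W_ext G. \<forall>f\<in>U. T (rtrans h f) = rtrans h (T f)))"

definition irreducible_decomposition :: "grp \<Rightarrow> fn set \<Rightarrow> fn set set \<Rightarrow> bool" where
  "irreducible_decomposition G V D \<longleftrightarrow> finite D \<and>
     (\<forall>U\<in>D. subrep G U V \<and> irreducible_rep G U) \<and>
     V = {\<Sum>U\<in>D. x U | x. \<forall>U\<in>D. x U \<in> U} \<and>
     (\<forall>x. (\<forall>U\<in>D. x U \<in> U) \<and> (\<Sum>U\<in>D. x U) = 0 \<longrightarrow> (\<forall>U\<in>D. x U = 0))"

text \<open>The multiset of irreducible unramified subrepresentations of \<open>L\<^sup>2(\<Gamma>\<setminus>W\<^sub>e\<^sub>x\<^sub>t)\<close> is realized by the
  unramified summands of a decomposition into irreducible subspaces: isomorphic summands are distinct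
  as subspaces, so multiplicities are accounted for, and up to isomorphism the choice of the
  decomposition does not matter.\<close>

definition Irr_unr :: "grp \<Rightarrow> (plane \<Rightarrow> plane) set \<Rightarrow> fn set set" where
  "Irr_unr G \<Gamma> = {\<rho> \<in> (SOME D. irreducible_decomposition G (L2 G \<Gamma>) D). unramified G \<rho>}"

text \<open>The character \<open>\<chi>\<^sub>\<rho>\<close> is unique up to the action of \<open>W\<close>, which permutes the weights.\<close>

definition chi :: "grp \<Rightarrow> fn set \<Rightarrow> plane \<Rightarrow> complex" where
  "chi G \<rho> = (SOME \<psi>. lattice_character G \<psi> \<and>
     (\<exists>U. subrep G U (Ind G \<psi>) \<and> irreducible_rep G U \<and> unramified G U \<and> rep_iso G \<rho> U))"

definition L_function :: "grp \<Rightarrow> (plane \<Rightarrow> plane) set \<Rightarrow> wrep \<Rightarrow> complex \<Rightarrow> complex" where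
  "L_function G \<Gamma> \<pi> u =
     (\<Prod>\<rho>\<in>Irr_unr G \<Gamma>. \<Prod>l\<in>#wt \<pi>. inverse (1 - chi G \<rho> l * u))"

definition double_cosets :: "grp \<Rightarrow> (plane \<Rightarrow> plane) set \<Rightarrow> (plane \<Rightarrow> plane) set set" where
  "double_cosets G \<Gamma> = {{\<gamma> \<circ> g \<circ> w | \<gamma> w. \<gamma> \<in> \<Gamma> \<and> w \<in> weyl G} | g. g \<in> W_ext G}"

text \<open>A closed geodesic is encoded as a pair \<open>(c, d)\<close>: its path \<open>c\<close> in \<open>\<A>\<^sub>\<Gamma>\<close>, parametrized by arc
  length and continued periodically to \<open>\<real>\<close> (\<open>c\<close> is the image of the whole oriented line, which has
  period \<open>d\<close> in \<open>\<A>\<^sub>\<Gamma>\<close>), and its length \<open>d\<close>.\<close>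

definition oriented_line :: "plane \<Rightarrow> plane \<Rightarrow> real \<Rightarrow> plane" where
  "oriented_line v l = (\<lambda>s. v + s *\<^sub>R sgn l)"

definition closed_geodesic_on ::
    "(plane \<Rightarrow> plane) set \<Rightarrow> plane \<Rightarrow> plane \<Rightarrow> (real \<Rightarrow> plane set) \<times> real \<Rightarrow> bool" where
  "closed_geodesic_on \<Gamma> v l c \<longleftrightarrow>
     fst c = orbit \<Gamma> \<circ> oriented_line v l \<and>
     (\<exists>g\<in>\<Gamma>. g ` range (oriented_line v l) = range (oriented_line v l) \<and>
        snd c = dist v (g v) \<and> snd c > 0 \<and> g v = oriented_line v l (snd c))"

definition closed_geodesics ::
    "(plane \<Rightarrow> plane) set \<Rightarrow> wrep \<Rightarrow> ((real \<Rightarrow> plane set) \<times> real) set" where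
  "closed_geodesics \<Gamma> \<pi> = {c. \<exists>v. \<exists>l\<in>wt' \<pi>. closed_geodesic_on \<Gamma> v l c}"

definition rational_closed_geodesics ::
    "grp \<Rightarrow> (plane \<Rightarrow> plane) set \<Rightarrow> wrep \<Rightarrow> ((real \<Rightarrow> plane set) \<times> real) set" where
  "rational_closed_geodesics G \<Gamma> \<pi> =
     {c. \<exists>v. \<exists>l\<in>wt' \<pi>. closed_geodesic_on \<Gamma> v l c \<and> range (oriented_line v l) \<subseteq> one_skeleton G}"

text \<open>The \<open>m\<close>-fold repetition of \<open>(c, d)\<close> is \<open>(c, m d)\<close>.\<close>

definition primitive ::
    "(plane \<Rightarrow> plane) set \<Rightarrow> wrep \<Rightarrow> (real \<Rightarrow> plane set) \<times> real \<Rightarrow> bool" where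
  "primitive \<Gamma> \<pi> c \<longleftrightarrow>
     \<not> (\<exists>m::nat. \<exists>c'\<in>closed_geodesics \<Gamma> \<pi>. m \<ge> 2 \<and> fst c' = fst c \<and> snd c = real m * snd c')"

definition primitive_rational ::
    "grp \<Rightarrow> (plane \<Rightarrow> plane) set \<Rightarrow> wrep \<Rightarrow> ((real \<Rightarrow> plane set) \<times> real) set" where
  "primitive_rational G \<Gamma> \<pi> = {c \<in> rational_closed_geodesics G \<Gamma> \<pi>. primitive \<Gamma> \<pi> c}"

definition same_up_to_start :: "((real \<Rightarrow> 'b) \<times> real) rel" where
  "same_up_to_start = {(c, c'). snd c' = snd c \<and> (\<exists>s0. fst c' = (\<lambda>s. fst c (s + s0)))}"

definition geodesic_classes ::
    "grp \<Rightarrow> (plane \<Rightarrow> plane) set \<Rightarrow> wrep \<Rightarrow> ((real \<Rightarrow> plane set) \<times> real) set set" where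
  "geodesic_classes G \<Gamma> \<pi> = primitive_rational G \<Gamma> \<pi> //
     (same_up_to_start \<inter> primitive_rational G \<Gamma> \<pi> \<times> primitive_rational G \<Gamma> \<pi>)"

definition normalized_length :: "wrep \<Rightarrow> ((real \<Rightarrow> 'b) \<times> real) set \<Rightarrow> real" where
  "normalized_length \<pi> C = the_elem (snd ` C) / ell \<pi>"

text \<open>There are only finitely many classes: the 1-skeleton has finitely many lines modulo \<open>\<Gamma>\<close>.
  Exponents are real; for \<open>u\<close> complex, \<open>u powr r\<close> is the ordinary power when \<open>r\<close> is a positive integer,
  as is the case for all lengths of rational closed geodesics and for \<open>k\<^sub>\<Gamma> / n\<^sub>\<Gamma>\<close>.\<close>

definition zeta_function :: "grp \<Rightarrow> (plane \<Rightarrow> plane) set \<Rightarrow> wrep \<Rightarrow> complex \<Rightarrow> complex" where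
  "zeta_function G \<Gamma> \<pi> u =
     (\<Prod>C\<in>geodesic_classes G \<Gamma> \<pi>. inverse (1 - u powr of_real (normalized_length \<pi> C)))"

end

theory Submission
  imports Defs
begin

text \<open>
Let \<open>\<sigma>\<^sub>0\<close> be the reflection in the line of \<open>\<alpha>\<close>, the linear part of \<open>\<sigma>\<close>. In all cases \<open>\<alpha>, \<beta>\<close> is a basis
of the coweight lattice \<open>\<Lambda>\<close>, and in it \<open>\<sigma>\<^sub>0\<close> is \<open>(p, q) \<mapsto> (p + n q, - q)\<close>. The translations in \<open>\<Gamma>\<close> are
spanned by \<open>k \<alpha>\<close> and \<open>c (2 \<beta> - n \<alpha>)\<close> for some \<open>c \<noteq> 0\<close>. Write \<open>X\<close> for the finite group of characters of
\<open>\<Lambda>\<close> trivial on these translations, and \<open>D\<close> for the set of nontrivial weights of \<open>\<pi>\<close>. Composition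
with \<open>\<sigma>\<close> maps \<open>\<phi> \<in> X\<close> to \<open>\<phi> (\<sigma> 0)\<close> times \<open>\<phi> \<circ> \<sigma>\<^sub>0\<close>; if \<open>\<phi> \<circ> \<sigma>\<^sub>0 = \<phi>\<close>, call \<open>\<phi>\<close> fixed, and call
\<open>\<phi> (\<sigma> 0) = \<plusminus> 1\<close> its sign. Both functions are products over characters, and they differ in the fixed
characters only.

\<^emph>\<open>The L-function.\<close> The \<open>W\<close>-invariant vectors of \<open>L\<^sup>2(\<Gamma> \<setminus> W\<^sub>e\<^sub>x\<^sub>t)\<close> are the \<open>\<Gamma>\<close>-invariant functions on \<open>\<Lambda>\<close>.
They have a basis of functions \<open>\<phi> + \<phi> (\<sigma> 0) (\<phi> \<circ> \<sigma>\<^sub>0)\<close>, one for each \<open>\<phi> \<in> X\<close> up to reflection, the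
fixed characters of sign \<open>-1\<close> being left out. Another basis has one vector in each unramified
summand. The product over the weights \<open>l\<close> of \<open>\<pi>\<close> of \<open>1 - u \<sqdot> (right translation by l)\<close> acts by
\<open>\<Prod>\<^sub>l (1 - \<phi> l u)\<close> on the first basis and by \<open>\<Prod>\<^sub>l (1 - \<chi>\<^sub>\<rho> l u)\<close> on the second, so
\<open>L = \<Prod>\<^sub>\<phi> \<Prod>\<^sub>l (1 - \<phi> l u)\<inverse>\<close>, with as many characters as there are double cosets
(\<open>L_function_eq\<close>, \<open>spherical_basis\<close>).

\<^emph>\<open>The zeta function.\<close> A geodesic is rational iff it meets \<open>\<Lambda>\<close>. Hence the classes of primitive rational
closed geodesics are the cycles of the shift \<open>(x, l) \<mapsto> (x + l, l)\<close> on \<open>\<Gamma> \<setminus> (\<Lambda> \<times> D)\<close>, and the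
normalized length is the length of the cycle (\<open>geodesic_classes_bij\<close>). So the inverse of the zeta
function is the characteristic polynomial of the shift on the \<open>\<Gamma>\<close>-invariant functions on \<open>\<Lambda> \<times> D\<close>. These
have a basis of pairs \<open>(\<phi>, l)\<close> up to reflection, with eigenvalue \<open>\<phi> l\<close> (\<open>zeta_function_idx\<close>).

\<^emph>\<open>The comparison.\<close> Split \<open>D\<close> into the directions fixed by \<open>\<sigma>\<^sub>0\<close> and the pairs \<open>{l, \<sigma>\<^sub>0 l}\<close>, with
representatives \<open>l \<in> H\<close>. Then (\<open>klein_product\<close>)
\<open>(1 - u)\<^bsup>\<epsilon> N\<^esup> L = Z \<sqdot> \<Prod>\<^sub>l\<^sub>\<in>\<^sub>H (\<Prod>\<^sub>\<phi>\<^sub>- (1 - \<phi> l u) / \<Prod>\<^sub>\<phi>\<^sub>+ (1 - \<phi> l u))\<close>,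
where \<open>\<phi>\<^sub>-\<close> and \<open>\<phi>\<^sub>+\<close> run over the fixed characters of sign \<open>-1\<close> and \<open>1\<close>. A fixed character is given by
\<open>y = \<phi> \<beta>\<close> and \<open>p = \<phi> \<alpha>\<close> with \<open>p\<^sup>n = y\<^sup>2\<close> and \<open>y\<close> a root of unity of order dividing \<open>2 k / n\<close>; its sign
is \<open>y\<close> to the power \<open>k / n\<close>. If \<open>l = \<plusminus> \<beta>\<close>, the inner quotient is therefore the \<open>n\<close>-th power of
\<open>(1 + u\<^bsup>k/n\<^esup>) / (1 - u\<^bsup>k/n\<^esup>)\<close>; if \<open>l\<close> is orthogonal to \<open>\<alpha>\<close>, it is \<open>1\<close>. Finally \<open>H\<close> is \<open>{\<plusminus> \<beta>}\<close> with
one of the two signs for \<open>PGL3\<close>; for \<open>PGSp4\<close> it is \<open>{\<beta>, - \<beta>}\<close> if \<open>\<Gamma>\<close> is not of type \<open>\<pi>\<close>, and a single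
vector orthogonal to \<open>\<alpha>\<close> if it is.
\<close>

section \<open>Bases of spaces of functions\<close>

text \<open>\<open>e\<close> is a basis of the space \<open>V\<close> of complex functions, written as a family over the finite index set \<open>I\<close>,
  so that eigenvalues with multiplicity can be read off from the indices.\<close>

definition family_basis :: "'i set \<Rightarrow> ('i \<Rightarrow> 'a \<Rightarrow> complex) \<Rightarrow> ('a \<Rightarrow> complex) set \<Rightarrow> bool" where
  "family_basis I e V \<longleftrightarrow> finite I \<and> V = {\<lambda>x. \<Sum>i\<in>I. c i * e i x | c. True} \<and>
     (\<forall>c. (\<forall>x. (\<Sum>i\<in>I. c i * e i x) = 0) \<longrightarrow> (\<forall>i\<in>I. c i = 0))"

lemma family_basisI:
  assumes "finite I" and "\<And>i. i \<in> I \<Longrightarrow> e i \<in> V"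
    and "cfun.subspace V"
    and "\<And>f. f \<in> V \<Longrightarrow> \<exists>c. \<forall>x. f x = (\<Sum>i\<in>I. c i * e i x)"
    and "\<And>c i. \<forall>x. (\<Sum>i\<in>I. c i * e i x) = 0 \<Longrightarrow> i \<in> I \<Longrightarrow> c i = 0"
  shows "family_basis I e V"
proof -
  have "(\<lambda>x. \<Sum>i\<in>I. c i * e i x) \<in> V" for c
  proof -
    have "(\<Sum>i\<in>I. cscale (c i) (e i)) \<in> V"
      using assms(2,3) by (intro cfun.subspace_sum cfun.subspace_scale) auto
    also have "(\<Sum>i\<in>I. cscale (c i) (e i)) = (\<lambda>x. \<Sum>i\<in>I. c i * e i x)"
      using assms(1) by (induction I) (auto simp: cscale_def fun_eq_iff)
    finally show ?thesis .
  qed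
  moreover have "\<exists>c. f = (\<lambda>x. \<Sum>i\<in>I. c i * e i x)" if "f \<in> V" for f
    using assms(4)[OF that] by (simp add: fun_eq_iff)
  ultimately have "V = {\<lambda>x. \<Sum>i\<in>I. c i * e i x | c. True}" by blast
  then show ?thesis
    unfolding family_basis_def using assms(1,5) by simp
qed

lemma family_basis_finite: "family_basis I e V \<Longrightarrow> finite I"
  by (simp add: family_basis_def)

lemma family_basis_comb: "family_basis I e V \<Longrightarrow> (\<lambda>x. \<Sum>i\<in>I. c i * e i x) \<in> V"
  by (auto simp: family_basis_def)

lemma family_basis_mem:
  assumes "family_basis I e V" "i \<in> I" shows "e i \<in> V"
proof -
  have "e i = (\<lambda>x. \<Sum>j\<in>I. (if j = i then 1 else 0) * e j x)"
    using assms family_basis_finite[OF assms(1)]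
    by (auto simp: fun_eq_iff if_distrib[of "\<lambda>z. z * _"] sum.delta cong: if_cong)
  then show ?thesis using family_basis_comb[OF assms(1), of "\<lambda>j. if j = i then 1 else 0"] by simp
qed

lemma family_basis_expand:
  assumes "family_basis I e V" "f \<in> V" shows "\<exists>c. f = (\<lambda>x. \<Sum>i\<in>I. c i * e i x)"
  using assms by (auto simp: family_basis_def)

lemma family_basis_indep:
  assumes "family_basis I e V" "\<And>x. (\<Sum>i\<in>I. c i * e i x) = 0" "i \<in> I" shows "c i = 0"
  using assms by (auto simp: family_basis_def)

lemma family_basis_unique:
  assumes "family_basis I e V" "\<And>x. (\<Sum>i\<in>I. c i * e i x) = (\<Sum>i\<in>I. d i * e i x)" "i \<in> I"
  shows "c i = d i"
proof -
  have "(\<Sum>i\<in>I. (c i - d i) * e i x) = 0" for x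
    using assms(2)[of x] by (simp add: algebra_simps sum_subtractf)
  from family_basis_indep[OF assms(1) this assms(3)] show ?thesis by simp
qed

lemma cfun_sum_apply: "(\<Sum>i\<in>I. f i) x = (\<Sum>i\<in>I. (f i x :: complex))"
  by (induction I rule: infinite_finite_induct) auto

lemma family_basis_card_dim:
  assumes B: "family_basis I e V"
  shows "card I = cfun.dim V"
proof -
  have fin: "finite I" by (rule family_basis_finite[OF B])
  have inj: "inj_on e I"
  proof (rule inj_onI, rule ccontr)
    fix i j assume ij: "i \<in> I" "j \<in> I" "e i = e j" "i \<noteq> j"
    have "(\<Sum>l\<in>I. (if l = i then 1 else 0) * e l x) = (\<Sum>l\<in>I. (if l = j then 1 else 0) * e l x)" for x
      using ij fin by (simp add: if_distrib[of "\<lambda>z. z * _"] sum.delta cong: if_cong)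
    from family_basis_unique[OF B this ij(1)] show False using ij by auto
  qed
  have eq: "(\<Sum>v\<in>e ` I. cscale (u v) v) = (\<lambda>x. \<Sum>i\<in>I. u (e i) * e i x)" for u
    by (simp add: sum.reindex[OF inj] fun_eq_iff cfun_sum_apply cscale_def)
  have ind: "cfun.independent (e ` I)"
  proof (rule cfun.independent_if_scalars_zero)
    show "finite (e ` I)" using fin by simp
    fix f v assume "(\<Sum>v\<in>e ` I. cscale (f v) v) = 0" and v: "v \<in> e ` I"
    then have "(\<lambda>x. \<Sum>i\<in>I. f (e i) * e i x) = 0" by (simp add: eq)
    then have z: "(\<Sum>i\<in>I. f (e i) * e i x) = 0" for x by (simp add: fun_eq_iff)
    have "\<And>i. i \<in> I \<Longrightarrow> f (e i) = 0" using family_basis_indep[OF B z] by blast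
    then show "f v = 0" using v by auto
  qed
  have sp: "V \<subseteq> cfun.span (e ` I)"
  proof
    fix f assume "f \<in> V"
    then obtain c where c: "f = (\<lambda>x. \<Sum>i\<in>I. c i * e i x)" using family_basis_expand[OF B] by auto
    have "f = (\<Sum>v\<in>e ` I. cscale (c (the_inv_into I e v)) v)"
      unfolding eq c by (intro ext sum.cong) (auto simp: the_inv_into_f_f[OF inj])
    also have "\<dots> \<in> cfun.span (e ` I)"
      by (intro cfun.span_sum cfun.span_scale cfun.span_base) auto
    finally show "f \<in> cfun.span (e ` I)" .
  qed
  have "cfun.dim V = card (e ` I)"
    by (rule cfun.dim_unique[OF _ sp ind refl]) (use family_basis_mem[OF B] in auto)
  then show ?thesis by (simp add: card_image[OF inj])
qed

text \<open>Linear maps between spaces of complex functions.\<close>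

definition linear_op :: "(('a \<Rightarrow> complex) \<Rightarrow> ('b \<Rightarrow> complex)) \<Rightarrow> bool" where
  "linear_op A \<longleftrightarrow> (\<forall>f g. A (f + g) = A f + A g) \<and> (\<forall>c f. A (cscale c f) = cscale c (A f))"

lemma linear_op_comb:
  assumes "linear_op A" "finite I"
  shows "A (\<lambda>x. \<Sum>i\<in>I. c i * e i x) = (\<lambda>x. \<Sum>i\<in>I. c i * A (e i) x)"
proof -
  have zero: "A 0 = 0"
  proof -
    have "A (cscale 0 0) = cscale 0 (A 0)" using assms(1) unfolding linear_op_def by blast
    then show ?thesis by (simp only: cfun.scale_zero_left)
  qed
  have "A (\<Sum>i\<in>I. cscale (c i) (e i)) = (\<Sum>i\<in>I. cscale (c i) (A (e i)))"
    using assms(2)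
  proof induction
    case empty
    show ?case by (simp only: sum.empty zero)
  next
    case (insert i I)
    have "A (\<Sum>j\<in>insert i I. cscale (c j) (e j)) = A (cscale (c i) (e i) + (\<Sum>j\<in>I. cscale (c j) (e j)))"
      by (simp only: sum.insert[OF insert(1,2)])
    also have "\<dots> = A (cscale (c i) (e i)) + A (\<Sum>j\<in>I. cscale (c j) (e j))"
      using assms(1) unfolding linear_op_def by blast
    also have "A (cscale (c i) (e i)) = cscale (c i) (A (e i))"
      using assms(1) unfolding linear_op_def by blast
    finally show ?case by (simp only: sum.insert[OF insert(1,2)] insert(3))
  qed
  moreover have "(\<Sum>i\<in>I. cscale (c i) (e i)) = (\<lambda>x. \<Sum>i\<in>I. c i * e i x)"
    by (simp add: fun_eq_iff cfun_sum_apply cscale_def)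
  moreover have "(\<Sum>i\<in>I. cscale (c i) (A (e i))) = (\<lambda>x. \<Sum>i\<in>I. c i * A (e i) x)"
    by (simp add: fun_eq_iff cfun_sum_apply cscale_def)
  ultimately show ?thesis by simp
qed

lemma eigenbasis_eigenspace:
  assumes B: "family_basis I e V" and A: "linear_op A"
    and eig: "\<And>i. i \<in> I \<Longrightarrow> A (e i) = cscale (\<theta> i) (e i)"
  shows "family_basis {i \<in> I. \<theta> i = \<zeta>} e {f \<in> V. A f = cscale \<zeta> f}"
proof -
  let ?J = "{i \<in> I. \<theta> i = \<zeta>}"
  have fin: "finite I" by (rule family_basis_finite[OF B])
  have exts: "(\<Sum>i\<in>?J. c i * e i x) = (\<Sum>i\<in>I. (if \<theta> i = \<zeta> then c i else 0) * e i x)" for c x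
    using fin by (intro sum.mono_neutral_cong_left) auto
  have "{f \<in> V. A f = cscale \<zeta> f} = {\<lambda>x. \<Sum>i\<in>?J. c i * e i x | c. True}" (is "?L = ?R")
  proof (intro equalityI subsetI)
    fix f assume "f \<in> ?L"
    then have f: "f \<in> V" "A f = cscale \<zeta> f" by auto
    then obtain c where c: "f = (\<lambda>x. \<Sum>i\<in>I. c i * e i x)" using family_basis_expand[OF B] by auto
    have "A f = (\<lambda>x. \<Sum>i\<in>I. (c i * \<theta> i) * e i x)"
      unfolding c linear_op_comb[OF A fin] by (intro ext sum.cong) (auto simp: eig cscale_def)
    moreover have "cscale \<zeta> f = (\<lambda>x. \<Sum>i\<in>I. (c i * \<zeta>) * e i x)"
      unfolding c cscale_def by (auto simp: sum_distrib_left mult_ac)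
    ultimately have "(\<lambda>x. \<Sum>i\<in>I. (c i * \<theta> i) * e i x) = (\<lambda>x. \<Sum>i\<in>I. (c i * \<zeta>) * e i x)"
      using f(2) by metis
    then have "\<And>x. (\<Sum>i\<in>I. (c i * \<theta> i) * e i x) = (\<Sum>i\<in>I. (c i * \<zeta>) * e i x)" by meson
    from family_basis_unique[OF B this] have "\<And>i. i \<in> I \<Longrightarrow> c i = (if \<theta> i = \<zeta> then c i else 0)" by auto
    then have "f = (\<lambda>x. \<Sum>i\<in>?J. c i * e i x)"
      unfolding exts c by (intro ext sum.cong) metis+
    then show "f \<in> ?R" by blast
  next
    fix f assume "f \<in> ?R"
    then obtain c where c: "f = (\<lambda>x. \<Sum>i\<in>?J. c i * e i x)" by auto
    have "f \<in> V" unfolding c exts by (rule family_basis_comb[OF B])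
    moreover have "A f = cscale \<zeta> f"
    proof
      fix x
      have "A f = (\<lambda>x. \<Sum>i\<in>?J. c i * A (e i) x)"
        unfolding c by (rule linear_op_comb[OF A]) (use fin in simp)
      then have "A f x = (\<Sum>i\<in>?J. c i * A (e i) x)" by meson
      also have "\<dots> = (\<Sum>i\<in>?J. \<zeta> * (c i * e i x))"
        by (rule sum.cong) (simp_all add: eig cscale_def)
      also have "\<dots> = cscale \<zeta> f x" by (simp only: c cscale_def sum_distrib_left)
      finally show "A f x = cscale \<zeta> f x" .
    qed
    ultimately show "f \<in> ?L" by simp
  qed
  moreover have "\<forall>i\<in>?J. c i = 0" if "\<forall>x. (\<Sum>i\<in>?J. c i * e i x) = 0" for c
  proof
    fix i assume "i \<in> ?J"
    then show "c i = 0"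
      using family_basis_indep[OF B, of "\<lambda>i. if \<theta> i = \<zeta> then c i else 0" i] that unfolding exts by simp
  qed
  ultimately show ?thesis using fin unfolding family_basis_def by simp
qed

lemma prod_eq_by_fibres:
  assumes "finite I" "finite J"
    and "\<And>\<zeta>. card {i \<in> I. \<theta> i = \<zeta>} = card {j \<in> J. \<eta> j = \<zeta>}"
  shows "(\<Prod>i\<in>I. g (\<theta> i)) = (\<Prod>j\<in>J. (g (\<eta> j) :: complex))"
proof -
  have "image_mset \<theta> (mset_set I) = image_mset \<eta> (mset_set J)"
  proof (rule multiset_eqI)
    fix z
    have *: "count (image_mset h (mset_set K)) z = card {i \<in> K. h i = z}"
      if K: "finite K" for h :: "_ \<Rightarrow> 'c" and K :: "'d set"
    proof -
      have "count (image_mset h (mset_set K)) z = (\<Sum>y\<in>{i \<in> K. h i = z}. count (mset_set K) y)"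
        unfolding count_image_mset by (rule sum.cong) (auto simp: K)
      also have "\<dots> = (\<Sum>y\<in>{i \<in> K. h i = z}. 1)" by (rule sum.cong) (auto simp: K)
      finally show ?thesis by simp
    qed
    show "count (image_mset \<theta> (mset_set I)) z = count (image_mset \<eta> (mset_set J)) z"
      using *[OF assms(1), of \<theta>] *[OF assms(2), of \<eta>] assms(3)[of z] by simp
  qed
  then have "(\<Prod>z\<in>#image_mset \<theta> (mset_set I). g z) = (\<Prod>z\<in>#image_mset \<eta> (mset_set J). g z)" by simp
  then show ?thesis by (simp add: prod_unfold_prod_mset image_mset.compositionality o_def)
qed

text \<open>The eigenvalues of \<open>A\<close> on \<open>V\<close> are the same, with multiplicities, for any two eigenbases.\<close>

lemma eigenbasis_prod_eq:
  assumes "family_basis I e V" "family_basis J e' V" "linear_op A"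
    and "\<And>i. i \<in> I \<Longrightarrow> A (e i) = cscale (\<theta> i) (e i)"
    and "\<And>j. j \<in> J \<Longrightarrow> A (e' j) = cscale (\<eta> j) (e' j)"
  shows "(\<Prod>i\<in>I. g (\<theta> i)) = (\<Prod>j\<in>J. (g (\<eta> j) :: complex))"
proof (rule prod_eq_by_fibres[where \<theta> = \<theta> and \<eta> = \<eta> and g = g])
  show "finite I" "finite J" using assms(1,2) by (auto dest: family_basis_finite)
  show "card {i \<in> I. \<theta> i = \<zeta>} = card {j \<in> J. \<eta> j = \<zeta>}" for \<zeta>
    using family_basis_card_dim[OF eigenbasis_eigenspace[OF assms(1,3,4)], of \<zeta>]
      family_basis_card_dim[OF eigenbasis_eigenspace[OF assms(2,3,5)], of \<zeta>] by simp
qed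

lemma family_basis_transport:
  assumes B: "family_basis I e V" and A: "linear_op A" and bij: "bij_betw A V V'"
  shows "family_basis I (\<lambda>i. A (e i)) V'"
proof -
  have fin: "finite I" by (rule family_basis_finite[OF B])
  note comb = linear_op_comb[OF A fin, of _ e]
  have "V' = {\<lambda>x. \<Sum>i\<in>I. c i * A (e i) x | c. True}"
    unfolding comb[symmetric] bij_betw_imp_surj_on[OF bij, symmetric]
    using B by (auto simp: family_basis_def)
  moreover have "\<forall>i\<in>I. c i = 0" if z: "\<forall>x. (\<Sum>i\<in>I. c i * A (e i) x) = 0" for c
  proof -
    have "A (\<lambda>x. \<Sum>i\<in>I. c i * e i x) = A (\<lambda>x. \<Sum>i\<in>I. 0 * e i x)"
      unfolding comb using z by simp
    then have "(\<lambda>x. \<Sum>i\<in>I. c i * e i x) = (\<lambda>x. \<Sum>i\<in>I. 0 * e i x)"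
      using bij_betw_imp_inj_on[OF bij] family_basis_comb[OF B] by (meson inj_onD)
    then have "\<And>x. (\<Sum>i\<in>I. c i * e i x) = 0" by (simp add: fun_eq_iff)
    then show ?thesis using family_basis_indep[OF B] by blast
  qed
  ultimately show ?thesis using fin unfolding family_basis_def by blast
qed

text \<open>Let \<open>S\<close> permute a basis up to scalars \<open>q\<close>, by an involution \<open>s\<close> of the indices. The vectors fixed by \<open>S\<close>
  have a basis with one member for each pair \<open>{i, s i}\<close>, \<open>i \<in> J\<close>, and one for each fixed index with \<open>q i = 1\<close>;
  if \<open>s i = i\<close> and \<open>q i = -1\<close> then \<open>e i + S (e i) = 0\<close>.\<close>

lemma involution_invariants_basis:
  assumes B: "family_basis I e V" and S: "linear_op S"
    and Se: "\<And>i. i \<in> I \<Longrightarrow> S (e i) = cscale (q i) (e (s i))"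
    and sI: "\<And>i. i \<in> I \<Longrightarrow> s i \<in> I" and ss: "\<And>i. i \<in> I \<Longrightarrow> s (s i) = i"
    and qq: "\<And>i. i \<in> I \<Longrightarrow> q i * q (s i) = 1"
    and I: "I = J \<union> s ` J \<union> P \<union> N" and disj: "J \<inter> s ` J = {}" "(J \<union> s ` J) \<inter> (P \<union> N) = {}" "P \<inter> N = {}"
    and P: "\<And>i. i \<in> P \<Longrightarrow> s i = i \<and> q i = 1" and N: "\<And>i. i \<in> N \<Longrightarrow> s i = i \<and> q i = -1"
  shows "family_basis (J \<union> P) (\<lambda>i. e i + S (e i)) {f \<in> V. S f = f}"
proof -
  have fin: "finite I" by (rule family_basis_finite[OF B])
  have finJ: "finite J" "finite P" "finite N" using fin unfolding I by auto
  have inj: "inj_on s J" using ss I by (metis UnI1 inj_onI)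
  have split: "(\<Sum>i\<in>I. h i) = (\<Sum>i\<in>J. h i) + (\<Sum>i\<in>J. h (s i)) + (\<Sum>i\<in>P. h i) + (\<Sum>i\<in>N. h i)" for h :: "'a \<Rightarrow> complex"
  proof -
    have "(\<Sum>i\<in>I. h i) = (\<Sum>i\<in>J \<union> s ` J. h i) + (\<Sum>i\<in>P \<union> N. h i)"
      unfolding I Un_assoc[of "J \<union> s ` J"] using finJ disj by (intro sum.union_disjoint) auto
    also have "(\<Sum>i\<in>J \<union> s ` J. h i) = (\<Sum>i\<in>J. h i) + (\<Sum>i\<in>s ` J. h i)"
      using finJ disj by (intro sum.union_disjoint) auto
    also have "(\<Sum>i\<in>P \<union> N. h i) = (\<Sum>i\<in>P. h i) + (\<Sum>i\<in>N. h i)"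
      using finJ disj by (intro sum.union_disjoint) auto
    finally show ?thesis by (simp add: sum.reindex[OF inj] add.assoc)
  qed
  have split': "(\<Sum>i\<in>J \<union> P. h i) = (\<Sum>i\<in>J. h i) + (\<Sum>i\<in>P. h i)" for h :: "'a \<Rightarrow> complex"
    using finJ disj by (intro sum.union_disjoint) auto
  define w where "w i = e i + S (e i)" for i
  have w: "w i x = e i x + q i * e (s i) x" if "i \<in> I" for i x
    using Se[OF that] by (simp add: w_def cscale_def)
  have Sw: "S (w i) = w i" if "i \<in> I" for i
  proof -
    have "S (w i) = S (e i) + S (cscale (q i) (e (s i)))"
      using S Se[OF that] by (simp add: w_def linear_op_def)
    also have "S (cscale (q i) (e (s i))) = cscale (q i) (S (e (s i)))" using S by (simp add: linear_op_def)
    also have "\<dots> = e i" using qq[OF that] ss[OF that] Se[OF sI[OF that]]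
      by (simp add: cscale_def fun_eq_iff flip: mult.assoc)
    finally show ?thesis by (simp only: w_def add.commute)
  qed
  have JI: "i \<in> I" "s i \<in> I" if "i \<in> J" for i using that I sI by auto
  have PI: "i \<in> I" if "i \<in> P" for i using that I by auto
  have NI: "i \<in> I" if "i \<in> N" for i using that I by auto
  have ws: "w (s i) x = q (s i) * w i x" if "i \<in> I" for i x
    using w[OF that] w[OF sI[OF that]] ss[OF that] qq[OF that] by (simp add: algebra_simps)
  have wN: "w i x = 0" if "i \<in> N" for i x using w[OF NI[OF that]] N[OF that] by simp
  have subV: "cfun.subspace V"
  proof (rule cfun.subspaceI)
    show "0 \<in> V" using family_basis_comb[OF B, of "\<lambda>_. 0"] by (simp add: zero_fun_def)
    fix f g assume "f \<in> V" "g \<in> V"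
    then obtain c d where "f = (\<lambda>x. \<Sum>i\<in>I. c i * e i x)" "g = (\<lambda>x. \<Sum>i\<in>I. d i * e i x)"
      using family_basis_expand[OF B] by blast
    then have "f + g = (\<lambda>x. \<Sum>i\<in>I. (c i + d i) * e i x)"
      by (simp add: fun_eq_iff distrib_right sum.distrib)
    then show "f + g \<in> V" using family_basis_comb[OF B] by simp
  next
    fix a f assume "f \<in> V"
    then obtain c where "f = (\<lambda>x. \<Sum>i\<in>I. c i * e i x)" using family_basis_expand[OF B] by blast
    then have "cscale a f = (\<lambda>x. \<Sum>i\<in>I. (a * c i) * e i x)"
      by (simp add: fun_eq_iff cscale_def sum_distrib_left mult.assoc)
    then show "cscale a f \<in> V" using family_basis_comb[OF B] by simp
  qed
  have "family_basis (J \<union> P) w {f \<in> V. S f = f}"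
  proof (rule family_basisI)
    show "finite (J \<union> P)" using finJ by simp
    show "cfun.subspace {f \<in> V. S f = f}"
    proof -
      have "S 0 = 0" using linear_op_comb[OF S, of "{}"] by (simp add: zero_fun_def)
      then show ?thesis using S subV unfolding cfun.subspace_def linear_op_def by auto
    qed
    show "w i \<in> {f \<in> V. S f = f}" if "i \<in> J \<union> P" for i
    proof -
      have i: "i \<in> I" using that JI PI by auto
      have "w i = e i + cscale (q i) (e (s i))" using w[OF i] by (simp add: fun_eq_iff cscale_def)
      then have "w i \<in> V" using family_basis_mem[OF B] i sI[OF i] subV
        by (simp add: cfun.subspace_add cfun.subspace_scale)
      then show ?thesis using Sw[OF i] by simp
    qed
  next
    fix f assume f: "f \<in> {f \<in> V. S f = f}"
    then obtain d where d: "f = (\<lambda>x. \<Sum>i\<in>I. d i * e i x)" using family_basis_expand[OF B] by blast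
    have "S f = (\<lambda>x. \<Sum>i\<in>I. d i * S (e i) x)" unfolding d by (rule linear_op_comb[OF S fin])
    then have "S f x = (\<Sum>i\<in>I. d i * S (e i) x)" for x by meson
    moreover have "f x = (\<Sum>i\<in>I. d i * e i x)" for x by (simp only: d)
    moreover have "S f x = f x" for x using f by simp
    moreover have "(\<Sum>i\<in>I. d i * w i x) = (\<Sum>i\<in>I. d i * e i x) + (\<Sum>i\<in>I. d i * S (e i) x)" for x
      by (simp add: w_def distrib_left sum.distrib)
    ultimately have "f x + f x = (\<Sum>i\<in>I. d i * w i x)" for x by metis
    moreover have "(\<Sum>i\<in>I. d i * w i x) = (\<Sum>i\<in>J \<union> P. (if i \<in> J then d i + d (s i) * q (s i) else d i) * w i x)" for x
    proof -
      have "(\<Sum>i\<in>J. d (s i) * w (s i) x) = (\<Sum>i\<in>J. d (s i) * q (s i) * w i x)"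
        by (intro sum.cong) (auto simp: ws JI)
      moreover have "(\<Sum>i\<in>P. d i * w i x) = (\<Sum>i\<in>P. (if i \<in> J then d i + d (s i) * q (s i) else d i) * w i x)"
        using disj by (intro sum.cong) auto
      moreover have "(\<Sum>i\<in>J. d i * w i x) + (\<Sum>i\<in>J. d (s i) * q (s i) * w i x) = (\<Sum>i\<in>J. (if i \<in> J then d i + d (s i) * q (s i) else d i) * w i x)"
        by (simp add: sum.distrib distrib_right)
      ultimately show ?thesis unfolding split split' by (simp add: wN)
    qed
    ultimately have "f x = (\<Sum>i\<in>J \<union> P. ((if i \<in> J then d i + d (s i) * q (s i) else d i) / 2) * w i x)" for x
      by (simp add: sum_divide_distrib[symmetric] field_simps)
    then show "\<exists>c. \<forall>x. f x = (\<Sum>i\<in>J \<union> P. c i * w i x)" by metis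
  next
    fix c i assume c: "\<forall>x. (\<Sum>i\<in>J \<union> P. c i * w i x) = 0" and i: "i \<in> J \<union> P"
    \<comment> \<open>The combination of the \<open>w i\<close>, expanded in the \<open>e i\<close>: the vector \<open>w i\<close> is \<open>e i + q i e (s i)\<close> on a pair
      and \<open>2 e i\<close> on a fixed index.\<close>
    define d where "d i = (if i \<in> J then c i else if i \<in> s ` J then c (s i) * q (s i) else if i \<in> P then 2 * c i else 0)" for i
    have "(\<Sum>i\<in>I. d i * e i x) = 0" for x
    proof -
      have "(\<Sum>i\<in>J. d (s i) * e (s i) x) = (\<Sum>i\<in>J. c i * q i * e (s i) x)"
        using disj ss JI by (intro sum.cong) (auto simp: d_def)
      moreover have "(\<Sum>i\<in>J. d i * e i x) = (\<Sum>i\<in>J. c i * e i x)"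
        by (intro sum.cong) (auto simp: d_def)
      moreover have "(\<Sum>i\<in>P. d i * e i x) = (\<Sum>i\<in>P. c i * w i x)"
        using disj P w PI by (intro sum.cong) (auto simp: d_def)
      moreover have "(\<Sum>i\<in>N. d i * e i x) = 0"
        using disj by (intro sum.neutral) (auto simp: d_def)
      moreover have "(\<Sum>i\<in>J. c i * w i x) = (\<Sum>i\<in>J. c i * e i x) + (\<Sum>i\<in>J. c i * q i * e (s i) x)"
        unfolding sum.distrib[symmetric] using w JI by (intro sum.cong) (auto simp: algebra_simps)
      ultimately show ?thesis using c[rule_format, of x] unfolding split split' by simp
    qed
    from family_basis_indep[OF B this] have "d i = 0" using i I by blast
    then show "c i = 0" using i disj by (auto simp: d_def split: if_splits)
  qed
  then show ?thesis unfolding w_def .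
qed

section \<open>Graded equivalence relations\<close>

lemma prod_roots_unity:
  assumes "m > 0"
  shows "(\<Prod>z | z ^ m = 1. 1 - z * u) = 1 - (u :: complex) ^ m"
proof -
  let ?R = "{z::complex. z ^ m = 1}"
  have fin: "finite ?R" and card: "card ?R = m"
    using assms by (auto simp: finite_roots_unity card_roots_unity_eq)
  \<comment> \<open>Both sides have degree at most \<open>m\<close> and agree at \<open>0\<close> and at the \<open>m\<close>-th roots of unity.\<close>
  have "(\<Prod>z\<in>?R. [:1, - z:]) = 1 - monom 1 m"
  proof (rule poly_eqI_degree)
    fix x assume x: "x \<in> insert 0 ?R"
    show "poly (\<Prod>z\<in>?R. [:1, - z:]) x = poly (1 - monom 1 m) x"
    proof (cases "x = 0")
      case True
      then show ?thesis using assms by (simp add: poly_prod poly_monom)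
    next
      case False
      then have xm: "x ^ m = 1" using x by auto
      then have "inverse x \<in> ?R" by (simp add: power_inverse)
      moreover have "poly [:1, - inverse x:] x = 0" using False by simp
      ultimately have "(\<Prod>z\<in>?R. poly [:1, - z:] x) = 0" using fin by (meson prod_zero)
      then show ?thesis using xm by (simp add: poly_prod poly_monom)
    qed
  next
    have "card (insert 0 ?R) = Suc m" using fin card assms
      by (subst card_insert_disjoint) (auto simp: power_0_left)
    moreover have "degree (\<Prod>z\<in>?R. [:1, - z:]) \<le> m"
    proof -
      have "degree (\<Prod>z\<in>?R. [:1, - z:]) \<le> (\<Sum>z\<in>?R. degree [:1, - z:])"
        using degree_prod_sum_le[OF fin, of "\<lambda>z. [:1, - z:]"] unfolding o_def .
      also have "\<dots> \<le> (\<Sum>z\<in>?R. 1)" by (rule sum_mono) simp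
      finally show ?thesis using card by simp
    qed
    moreover have "degree (1 - monom 1 m :: complex poly) \<le> m"
      by (rule degree_diff_le) (auto simp: degree_monom_le)
    ultimately show "card (insert 0 ?R) > degree (\<Prod>z\<in>?R. [:1, - z:])"
      "card (insert 0 ?R) > degree (1 - monom 1 m :: complex poly)" by simp_all
  qed
  then have "poly (\<Prod>z\<in>?R. [:1, - z:]) u = poly (1 - monom 1 m) u" by simp
  then show ?thesis by (simp add: poly_prod poly_monom mult.commute)
qed

text \<open>A set \<open>E\<close> of points and a relation \<open>r m x y\<close>, read as: \<open>x\<close> is \<open>y\<close> moved forward by \<open>m\<close> steps. Points
  related by \<open>r 0\<close> count as equal, every point comes back to itself after some positive number of steps, and there
  are finitely many points up to moving. Modulo \<open>r 0\<close>, the classes of the relation \<open>\<exists>m. r m x y\<close> are then finite cycles.\<close>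

locale graded_equivalence =
  fixes E :: "'e set" and r :: "int \<Rightarrow> 'e \<Rightarrow> 'e \<Rightarrow> bool"
  assumes r_refl: "x \<in> E \<Longrightarrow> r 0 x x"
    and r_sym: "r m x y \<Longrightarrow> r (- m) y x"
    and r_trans: "r m x y \<Longrightarrow> r n y z \<Longrightarrow> r (m + n) x z"
    and r_E: "r m x y \<Longrightarrow> x \<in> E"
    and periodic: "x \<in> E \<Longrightarrow> \<exists>m>0. r m x x"
    and fin_classes: "finite (E // {(x, y). \<exists>m. r m x y})"
begin

lemma r_E2: "r m x y \<Longrightarrow> y \<in> E"
  using r_sym r_E by blast

text \<open>\<open>gclasses\<close> are the cycles, and \<open>len\<close> is the length of a cycle modulo \<open>r 0\<close>.\<close>

definition rel :: "'e rel" where "rel = {(x, y). \<exists>m. r m x y}"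
definition gclasses :: "'e set set" where "gclasses = E // rel"
definition len :: "'e set \<Rightarrow> nat" where
  "len C = (LEAST m. m > 0 \<and> (\<exists>x\<in>C. r (int m) x x))"

lemma equiv_rel: "equiv E rel"
  unfolding rel_def
  by (intro equivI refl_onI symI transI) (use r_E r_E2 r_refl r_sym r_trans in blast)+

lemma finite_gclasses: "finite gclasses"
  using fin_classes by (simp add: gclasses_def rel_def)

lemma period_class:
  assumes "r m x x" "r j x y" shows "r m y y"
  using r_trans[OF r_trans[OF r_sym[OF assms(2)] assms(1)] assms(2)] by simp

lemma class_relD: "C \<in> gclasses \<Longrightarrow> x \<in> C \<Longrightarrow> y \<in> C \<Longrightarrow> \<exists>m. r m x y"
  unfolding gclasses_def using quotient_eq_iff[OF equiv_rel, of C C x y] by (auto simp: rel_def)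

lemma class_closed: "C \<in> gclasses \<Longrightarrow> x \<in> C \<Longrightarrow> r m x y \<Longrightarrow> y \<in> C"
  unfolding gclasses_def using in_quotient_imp_closed[OF equiv_rel] by (auto simp: rel_def)

lemma class_subset: "C \<in> gclasses \<Longrightarrow> C \<subseteq> E"
  unfolding gclasses_def by (rule in_quotient_imp_subset[OF equiv_rel])

lemma class_nonempty: "C \<in> gclasses \<Longrightarrow> \<exists>x. x \<in> C"
  unfolding gclasses_def using in_quotient_imp_non_empty[OF equiv_rel] by blast

lemma class_exists: "x \<in> E \<Longrightarrow> \<exists>C\<in>gclasses. x \<in> C"
  unfolding gclasses_def using equiv_class_self[OF equiv_rel] by (blast intro: quotientI)

lemma class_disjoint: "C \<in> gclasses \<Longrightarrow> C' \<in> gclasses \<Longrightarrow> x \<in> C \<Longrightarrow> x \<in> C' \<Longrightarrow> C = C'"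
  unfolding gclasses_def using quotient_disj[OF equiv_rel] by blast

lemma len_props:
  assumes C: "C \<in> gclasses" and x: "x \<in> C"
  shows "len C > 0" and "r (int (len C)) x x"
    and "r m x x \<Longrightarrow> int (len C) dvd m" and len_multiple: "r (int (len C) * j) x x"
proof -
  have ex: "\<exists>m. m > 0 \<and> (\<exists>x\<in>C. r (int m) x x)"
  proof -
    obtain m where "m > 0" "r m x x" using periodic class_subset[OF C] x by blast
    then have "r (int (nat m)) x x" "nat m > 0" by auto
    then show ?thesis using x by blast
  qed
  from LeastI_ex[OF ex] have L: "len C > 0" "\<exists>x\<in>C. r (int (len C)) x x" by (auto simp: len_def)
  then show "len C > 0" by simp
  obtain y where y: "y \<in> C" "r (int (len C)) y y" using L by blast
  then show per: "r (int (len C)) x x" using class_relD[OF C y(1) x] period_class by blast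
  have mult: "r (int (len C) * int j) x x" for j
  proof (induction j)
    case 0
    then show ?case using r_refl class_subset[OF C] x by auto
  next
    case (Suc j)
    then show ?case using r_trans[OF Suc per] by (simp add: algebra_simps)
  qed
  have multz: "r (int (len C) * j) x x" for j
  proof (cases "j \<ge> 0")
    case True then show ?thesis using mult[of "nat j"] by simp
  next
    case False
    then have "r (- (int (len C) * int (nat (- j)))) x x" using r_sym[OF mult] by blast
    then show ?thesis using False by simp
  qed
  show "r (int (len C) * j) x x" by (rule multz)
  show "int (len C) dvd m" if m: "r m x x"
  proof (rule ccontr)
    assume "\<not> int (len C) dvd m"
    then have "m mod int (len C) \<noteq> 0" by (simp add: dvd_eq_mod_eq_0)
    moreover have "m mod int (len C) \<ge> 0" using L(1) by simp
    ultimately have pos: "m mod int (len C) > 0" by linarith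
    have "r (m mod int (len C)) x x"
      using r_trans[OF m multz[of "- (m div int (len C))"]] by (simp add: minus_mult_div_eq_mod)
    then have "r (int (nat (m mod int (len C)))) x x" using pos by simp
    then have "len C \<le> nat (m mod int (len C))"
      using pos x unfolding len_def[of C] by (intro Least_le) (auto simp: len_def)
    moreover have "m mod int (len C) < int (len C)" using L(1) by simp
    ultimately show False using pos by linarith
  qed
qed

text \<open>Functions multiplied by \<open>\<zeta>\<close> at each step can be nonzero only on the cycles whose length \<open>l\<close> satisfies
  \<open>\<zeta>\<^sup>l = 1\<close>, and on such a cycle they are determined by one value.\<close>

lemma graded_functions_basis:
  assumes \<zeta>: "\<zeta> \<noteq> 0"
  shows "\<exists>e. family_basis {C \<in> gclasses. \<zeta> ^ len C = 1} e
           {F. (\<forall>x. x \<notin> E \<longrightarrow> F x = 0) \<and> (\<forall>m x y. r m x y \<longrightarrow> F x = \<zeta> powi m * F y)}"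
proof -
  define b where "b C = (SOME x. x \<in> C)" for C :: "'e set"
  have b: "b C \<in> C" if "C \<in> gclasses" for C
    unfolding b_def using class_nonempty[OF that] by (rule someI_ex)
  \<comment> \<open>The number of steps from the base point \<open>b C\<close> to \<open>x\<close>, which is unique modulo \<open>len C\<close>.\<close>
  define mm where "mm C x = (SOME m. r m x (b C))" for C x
  have mm: "r (mm C x) x (b C)" if "C \<in> gclasses" "x \<in> C" for C x
    unfolding mm_def using class_relD[OF that(1,2) b[OF that(1)]] by (rule someI_ex)
  define e where "e C x = (if x \<in> C then \<zeta> powi mm C x else 0)" for C x
  let ?I = "{C \<in> gclasses. \<zeta> ^ len C = 1}"
  let ?V = "{F. (\<forall>x. x \<notin> E \<longrightarrow> F x = 0) \<and> (\<forall>m x y. r m x y \<longrightarrow> F x = \<zeta> powi m * F y)}"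
  have comb: "(\<Sum>C\<in>?I. c C * e C x) = (if C \<in> ?I then c C * \<zeta> powi mm C x else 0)"
    if "C \<in> gclasses" "x \<in> C" for c :: "'e set \<Rightarrow> complex" and C x
  proof -
    have "(\<Sum>D\<in>?I. c D * e D x) = (\<Sum>D\<in>?I. if D = C then c C * \<zeta> powi mm C x else 0)"
      by (rule sum.cong) (use that class_disjoint in \<open>auto simp: e_def\<close>)
    then show ?thesis using finite_gclasses by simp
  qed
  have dv: "\<zeta> powi m = 1" if l1: "\<zeta> ^ l = 1" and lm: "int l dvd m" for l m
  proof -
    obtain j where "m = int l * j" using lm unfolding dvd_def by blast
    then show ?thesis using l1 \<zeta> by (simp add: power_int_mult)
  qed
  have "family_basis ?I e ?V"
  proof (rule family_basisI)
    show "finite ?I" using finite_gclasses by simp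
    show "cfun.subspace ?V"
      by (rule cfun.subspaceI) (auto simp: cscale_def algebra_simps)
    show "e C \<in> ?V" if C: "C \<in> ?I" for C
    proof (intro CollectI conjI allI impI)
      show "e C x = 0" if "x \<notin> E" for x using that class_subset C by (auto simp: e_def)
      fix m x y assume rxy: "r m x y"
      show "e C x = \<zeta> powi m * e C y"
      proof (cases "x \<in> C")
        case False
        then have "y \<notin> C" using class_closed[OF _ _ r_sym[OF rxy]] C by auto
        then show ?thesis using False by (simp add: e_def)
      next
        case True
        have C': "C \<in> gclasses" using C by simp
        have y: "y \<in> C" by (rule class_closed[OF C' True rxy])
        have "r (mm C x - m - mm C y) (b C) (b C)"
          using r_trans[OF r_sym[OF mm[OF C' y]] r_trans[OF r_sym[OF rxy] mm[OF C' True]]]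
          by (simp add: algebra_simps)
        then have "int (len C) dvd (mm C x - m - mm C y)" using len_props(3)[OF C' b[OF C']] by blast
        then have "\<zeta> powi (mm C x - m - mm C y) = 1" using C by (intro dv[of "len C"]) auto
        then have "\<zeta> powi (mm C x - m - mm C y) * (\<zeta> powi m * \<zeta> powi mm C y) = \<zeta> powi m * \<zeta> powi mm C y" by simp
        moreover have "\<zeta> powi (mm C x - m - mm C y) * (\<zeta> powi m * \<zeta> powi mm C y) = \<zeta> powi mm C x"
          using \<zeta> by (simp flip: power_int_add)
        ultimately have "\<zeta> powi mm C x = \<zeta> powi m * \<zeta> powi mm C y" by simp
        then show ?thesis using True y by (simp add: e_def)
      qed
    qed
  next
    fix F assume F: "F \<in> ?V"
    have "F x = (\<Sum>C\<in>?I. F (b C) * e C x)" for x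
    proof (cases "x \<in> E")
      case False
      then have "e C x = 0" if "C \<in> ?I" for C using that class_subset[of C] by (auto simp: e_def)
      moreover have "F x = 0" using F False by simp
      ultimately show ?thesis by simp
    next
      case True
      then obtain C where C: "C \<in> gclasses" "x \<in> C" using class_exists by blast
      have Fx: "F x = \<zeta> powi mm C x * F (b C)" using F mm[OF C] by blast
      have "F (b C) = \<zeta> powi (int (len C)) * F (b C)"
        using F len_props(2)[OF C(1) b[OF C(1)]] by blast
      then have "F (b C) = 0 \<or> \<zeta> ^ len C = 1" by simp
      then show ?thesis unfolding comb[OF C] using C Fx by auto
    qed
    then show "\<exists>c. \<forall>x. F x = (\<Sum>C\<in>?I. c C * e C x)"
      by (intro exI[of _ "\<lambda>C. F (b C)"] allI)
  next
    fix c C assume c: "\<forall>x. (\<Sum>C\<in>?I. c C * e C x) = 0" and C: "C \<in> ?I"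
    then have "c C * \<zeta> powi mm C (b C) = 0" using comb[of C "b C" c] b[of C] by auto
    then show "c C = 0" using \<zeta> by simp
  qed
  then show ?thesis by blast
qed

text \<open>The shift \<open>p\<close> by one step acts on the functions on points up to \<open>r 0\<close>. Its eigenvalues on a cycle of
  length \<open>l\<close> are the \<open>l\<close>-th roots of unity, once each.\<close>

lemma shift_eigenvalues:
  assumes p: "\<And>x. x \<in> E \<Longrightarrow> r 1 (p x) x"
    and B: "family_basis I e {F. (\<forall>x. x \<notin> E \<longrightarrow> F x = 0) \<and> (\<forall>x y. r 0 x y \<longrightarrow> F x = F y)}" (is "family_basis I e ?V")
    and eig: "\<And>i x. i \<in> I \<Longrightarrow> x \<in> E \<Longrightarrow> e i (p x) = \<theta> i * e i x"
    and nz: "\<And>i. i \<in> I \<Longrightarrow> \<theta> i \<noteq> 0"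
  shows "card {i \<in> I. \<theta> i = \<zeta>} = card {C \<in> gclasses. \<zeta> ^ len C = 1}"
proof (cases "\<zeta> = 0")
  case True
  then have "{i \<in> I. \<theta> i = \<zeta>} = {}" using nz by auto
  moreover have "{C \<in> gclasses. \<zeta> ^ len C = 1} = {}"
    using True len_props(1) class_nonempty by (fastforce simp: power_0_left)
  ultimately show ?thesis by (simp only: card.empty)
next
  case \<zeta>: False
  define A where "A F = (\<lambda>x. if x \<in> E then F (p x) else 0)" for F :: "'e \<Rightarrow> complex"
  have A: "linear_op A" by (auto simp: linear_op_def A_def cscale_def fun_eq_iff)
  have e: "e i \<in> ?V" if "i \<in> I" for i by (rule family_basis_mem[OF B that])
  have Ae: "A (e i) = cscale (\<theta> i) (e i)" if "i \<in> I" for i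
    using eig[OF that] e[OF that] by (auto simp: A_def cscale_def fun_eq_iff)
  have "{F \<in> ?V. A F = cscale \<zeta> F} =
    {F. (\<forall>x. x \<notin> E \<longrightarrow> F x = 0) \<and> (\<forall>m x y. r m x y \<longrightarrow> F x = \<zeta> powi m * F y)}" (is "?L = ?R")
  proof (intro equalityI subsetI)
    fix F assume F: "F \<in> ?L"
    have Fp: "F (p x) = \<zeta> * F x" if "x \<in> E" for x
    proof -
      have "A F x = cscale \<zeta> F x" using F by simp
      then show ?thesis using that by (simp add: A_def cscale_def)
    qed
    have pw: "r (int j) ((p ^^ j) y) y \<and> F ((p ^^ j) y) = \<zeta> ^ j * F y" if "y \<in> E" for j y
    proof (induction j)
      case 0
      then show ?case using r_refl[OF that] by simp
    next
      case (Suc j)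
      have "(p ^^ j) y \<in> E" using Suc r_E by blast
      then show ?case using r_trans[OF p conjunct1[OF Suc]] Fp Suc by simp
    qed
    have pos: "F x = \<zeta> ^ j * F y" if "r (int j) x y" for j x y
    proof -
      have "r 0 x ((p ^^ j) y)"
        using r_trans[OF that r_sym[OF conjunct1[OF pw[of y j]]]] r_E2[OF that] by simp
      then show ?thesis using F pw[of y j] r_E2[OF that] by auto
    qed
    have "F x = \<zeta> powi m * F y" if rm: "r m x y" for m x y
    proof (cases "m \<ge> 0")
      case True
      then show ?thesis using pos[of "nat m" x y] rm by (simp add: power_int_def)
    next
      case False
      then have "F y = \<zeta> ^ nat (- m) * F x" using pos[of "nat (- m)" y x] r_sym[OF rm] by simp
      then show ?thesis using False \<zeta> by (simp add: power_int_def field_simps)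
    qed
    then show "F \<in> ?R" using F by auto
  next
    fix F assume F: "F \<in> ?R"
    then have "F x = F y" if "r 0 x y" for x y using that by fastforce
    moreover have "F (p x) = \<zeta> * F x" if "x \<in> E" for x
      using F p[OF that] by fastforce
    ultimately show "F \<in> ?L" using F by (auto simp: A_def cscale_def fun_eq_iff)
  qed
  moreover obtain e' where "family_basis {C \<in> gclasses. \<zeta> ^ len C = 1} e' ?R"
    using graded_functions_basis[OF \<zeta>] by blast
  ultimately show ?thesis
    using family_basis_card_dim[OF eigenbasis_eigenspace[OF B A Ae, of \<zeta>]]
    by (simp add: family_basis_card_dim)
qed

lemma shift_product:
  assumes p: "\<And>x. x \<in> E \<Longrightarrow> r 1 (p x) x"
    and B: "family_basis I e {F. (\<forall>x. x \<notin> E \<longrightarrow> F x = 0) \<and> (\<forall>x y. r 0 x y \<longrightarrow> F x = F y)}"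
    and eig: "\<And>i x. i \<in> I \<Longrightarrow> x \<in> E \<Longrightarrow> e i (p x) = \<theta> i * e i x"
    and nz: "\<And>i. i \<in> I \<Longrightarrow> \<theta> i \<noteq> 0"
  shows "(\<Prod>i\<in>I. 1 - \<theta> i * u) = (\<Prod>C\<in>gclasses. 1 - u ^ len C)"
proof -
  let ?S = "SIGMA C:gclasses. {z::complex. z ^ len C = 1}"
  have pos: "len C > 0" if "C \<in> gclasses" for C using len_props(1)[OF that] class_nonempty[OF that] by blast
  have fin: "finite {z::complex. z ^ len C = 1}" if "C \<in> gclasses" for C
    using pos[OF that] finite_roots_unity[of "len C"] by simp
  have "(\<Prod>i\<in>I. 1 - \<theta> i * u) = (\<Prod>s\<in>?S. 1 - snd s * u)"
  proof (rule prod_eq_by_fibres[where g = "\<lambda>z. 1 - z * u" and \<theta> = \<theta> and \<eta> = snd])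
    show "finite I" by (rule family_basis_finite[OF B])
    show "finite ?S" using finite_gclasses fin by auto
    fix \<zeta>
    have "{s \<in> ?S. snd s = \<zeta>} = (\<lambda>C. (C, \<zeta>)) ` {C \<in> gclasses. \<zeta> ^ len C = 1}" by auto
    then have "card {s \<in> ?S. snd s = \<zeta>} = card {C \<in> gclasses. \<zeta> ^ len C = 1}"
      by (simp add: card_image inj_on_def)
    then show "card {i \<in> I. \<theta> i = \<zeta>} = card {s \<in> ?S. snd s = \<zeta>}"
      using shift_eigenvalues[OF p B eig nz] by simp
  qed
  also have "\<dots> = (\<Prod>C\<in>gclasses. \<Prod>z | z ^ len C = 1. 1 - z * u)"
    using finite_gclasses fin by (subst prod.Sigma) (auto simp: case_prod_beta)
  also have "\<dots> = (\<Prod>C\<in>gclasses. 1 - u ^ len C)"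
    by (rule prod.cong) (auto simp: prod_roots_unity pos)
  finally show ?thesis .
qed

end

section \<open>Roots of unity and involutions\<close>

lemma sum_roots_unity_powi:
  assumes "M > 0"
  shows "(\<Sum>z | z ^ M = 1. (z :: complex) powi j) = (if int M dvd j then of_nat M else 0)"
proof (cases "int M dvd j")
  case True
  then obtain i where i: "j = int M * i" unfolding dvd_def by blast
  have "(\<Sum>z | z ^ M = 1. (z :: complex) powi j) = (\<Sum>z::complex | z ^ M = 1. 1)"
  proof (rule sum.cong)
    fix z :: complex assume "z \<in> {z. z ^ M = 1}"
    then show "z powi j = 1" unfolding i by (simp add: power_int_mult)
  qed simp
  then show ?thesis using True assms by (simp add: card_roots_unity_eq)
next
  case False
  define \<omega> where "\<omega> = cis (2 * pi / real M)"
  have "\<omega> ^ M = cis (real M * (2 * pi / real M))" unfolding \<omega>_def by (rule Complex.DeMoivre)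
  then have \<omega>M: "\<omega> ^ M = 1" using assms by simp
  have \<omega>0: "\<omega> \<noteq> 0" by (simp add: \<omega>_def)
  have \<omega>j: "\<omega> powi j \<noteq> 1"
  proof
    assume "\<omega> powi j = 1"
    then have "cis (of_int j * (2 * pi / real M)) = 1" by (simp add: \<omega>_def cis_power_int mult.commute)
    then have "cos (of_int j * (2 * pi / real M)) = 1" by (metis cis.sel(1) one_complex.sel(1))
    then obtain i :: int where "of_int j * (2 * pi / real M) = of_int i * 2 * pi"
      using cos_one_2pi_int by auto
    then have "real_of_int j = real_of_int i * real M" using assms by (simp add: field_simps)
    then have "j = i * int M" by (metis of_int_eq_iff of_int_mult of_int_of_nat_eq)
    then show False using False by simp
  qed
  \<comment> \<open>Multiplication by the root of unity \<open>\<omega>\<close> permutes the terms and multiplies the sum by \<open>\<omega> powi j \<noteq> 1\<close>.\<close>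
  let ?S = "\<Sum>z::complex | z ^ M = 1. z powi j"
  have "?S = (\<Sum>z::complex | z ^ M = 1. (\<omega> * z) powi j)"
  proof (rule sum.reindex_bij_witness[where i = "\<lambda>z. \<omega> * z" and j = "\<lambda>z. z / \<omega>"])
  qed (use \<omega>M \<omega>0 in \<open>auto simp: power_mult_distrib power_divide\<close>)
  also have "\<dots> = \<omega> powi j * ?S" by (simp add: power_int_mult_distrib sum_distrib_left)
  finally have "(1 - \<omega> powi j) * ?S = 0" by (simp add: algebra_simps)
  then show ?thesis using False \<omega>j by simp
qed

lemma sum_swap4:
  "(\<Sum>z\<in>A. \<Sum>w\<in>B. \<Sum>p\<in>C. \<Sum>q\<in>D. g z w p q) = (\<Sum>p\<in>C. \<Sum>q\<in>D. \<Sum>z\<in>A. \<Sum>w\<in>B. (g z w p q :: complex))"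
proof -
  have "(\<Sum>z\<in>A. \<Sum>w\<in>B. \<Sum>p\<in>C. \<Sum>q\<in>D. g z w p q) = (\<Sum>z\<in>A. \<Sum>p\<in>C. \<Sum>w\<in>B. \<Sum>q\<in>D. g z w p q)"
    by (rule sum.cong[OF refl], rule sum.swap)
  also have "\<dots> = (\<Sum>p\<in>C. \<Sum>z\<in>A. \<Sum>w\<in>B. \<Sum>q\<in>D. g z w p q)" by (rule sum.swap)
  also have "\<dots> = (\<Sum>p\<in>C. \<Sum>z\<in>A. \<Sum>q\<in>D. \<Sum>w\<in>B. g z w p q)"
    by (rule sum.cong[OF refl], rule sum.cong[OF refl], rule sum.swap)
  also have "\<dots> = (\<Sum>p\<in>C. \<Sum>q\<in>D. \<Sum>z\<in>A. \<Sum>w\<in>B. g z w p q)"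
    by (rule sum.cong[OF refl], rule sum.swap)
  finally show ?thesis .
qed

text \<open>\<open>Y\<close> contains one element of each two-element orbit of \<open>s\<close>.\<close>

lemma involution_transversal:
  assumes "finite A" "\<And>x. x \<in> A \<Longrightarrow> s x \<in> A" "\<And>x. x \<in> A \<Longrightarrow> s (s x) = x"
  shows "\<exists>Y. Y \<subseteq> A \<and> A = Y \<union> s ` Y \<union> {x \<in> A. s x = x} \<and> Y \<inter> s ` Y = {} \<and>
    (Y \<union> s ` Y) \<inter> {x \<in> A. s x = x} = {}"
  using assms
proof (induction "card A" arbitrary: A rule: less_induct)
  case less
  show ?case
  proof (cases "\<exists>x\<in>A. s x \<noteq> x")
    case False
    then show ?thesis by (intro exI[of _ "{}"]) auto
  next
    case True
    then obtain x where x: "x \<in> A" "s x \<noteq> x" by blast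
    let ?B = "A - {x, s x}"
    have cB: "card ?B < card A" using x less.prems(1) by (intro psubset_card_mono) auto
    have clos: "s y \<in> ?B" if "y \<in> ?B" for y
    proof -
      have "s y \<noteq> x" using that less.prems(3)[of y] by auto
      moreover have "s y \<noteq> s x" using that less.prems(3)[of y] less.prems(3)[OF x(1)] by auto
      ultimately show ?thesis using that less.prems(2) by simp
    qed
    have inv: "s (s y) = y" if "y \<in> ?B" for y using that less.prems(3) by simp
    have finB: "finite ?B" using less.prems(1) by simp
    have ex: "\<exists>Y. Y \<subseteq> ?B \<and> ?B = Y \<union> s ` Y \<union> {x \<in> ?B. s x = x} \<and> Y \<inter> s ` Y = {} \<and>
      (Y \<union> s ` Y) \<inter> {x \<in> ?B. s x = x} = {}"
      by (rule less.hyps[OF cB finB]) (rule clos, assumption, rule inv, assumption)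
    obtain Y where Y: "Y \<subseteq> ?B" "?B = Y \<union> s ` Y \<union> {x \<in> ?B. s x = x}" "Y \<inter> s ` Y = {}"
      "(Y \<union> s ` Y) \<inter> {x \<in> ?B. s x = x} = {}"
      using ex by (elim exE conjE)
    have sYB: "s ` Y \<subseteq> ?B" using Y(2) by blast
    have 1: "{z \<in> A. s z = z} = {z \<in> ?B. s z = z}" using x less.prems(3)[OF x(1)] by auto
    have 2: "A = ?B \<union> {x, s x}" using x less.prems(2) by auto
    show ?thesis
    proof (intro exI[of _ "insert x Y"] conjI)
      show "insert x Y \<subseteq> A" using x Y(1) by auto
      have "?B \<union> {x, s x} = (Y \<union> s ` Y \<union> {z \<in> ?B. s z = z}) \<union> {x, s x}"
        using Y(2) by (rule arg_cong)
      then show "A = insert x Y \<union> s ` insert x Y \<union> {z \<in> A. s z = z}"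
        unfolding 1 using 2 by auto
      show "insert x Y \<inter> s ` insert x Y = {}" using Y(1,3) sYB x by auto
      show "(insert x Y \<union> s ` insert x Y) \<inter> {z \<in> A. s z = z} = {}"
        unfolding 1 using Y(4) by auto
    qed
  qed
qed

section \<open>The lattice, the glide reflection and the translations\<close>

text \<open>The data of a Klein bottle group: a frame \<open>\<alpha>, \<beta>\<close>, the translation part \<open>a \<alpha> + b \<beta>\<close> of the glide
  reflection, and an integer \<open>c\<close> describing the translations in the direction orthogonal to \<open>\<alpha>\<close>. If \<open>n = 2\<close>,
  then \<open>a\<close> is even because the translation part lies in the coroot lattice.\<close>

locale klein_frame =
  fixes \<alpha> \<beta> :: plane and n k :: nat and a b c :: int
  assumes n_cases: "n = 1 \<or> n = 2"
    and indep: "\<And>x y. x *\<^sub>R \<alpha> + y *\<^sub>R \<beta> = 0 \<Longrightarrow> x = 0 \<and> y = 0"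
    and n_inner: "real n * (\<alpha> \<bullet> \<alpha>) = 2 * (\<alpha> \<bullet> \<beta>)"
    and k_eq: "int k = 2 * a + int n * b" and k_pos: "k > 0"
    and even_a: "n = 2 \<Longrightarrow> even a"
begin

text \<open>\<open>lp p q\<close> is the point with coordinates \<open>p, q\<close> in the frame, \<open>lat\<close> the lattice spanned by the frame, \<open>s0\<close> the
  reflection in the line of \<open>\<alpha>\<close>, \<open>sg\<close> the glide reflection, and \<open>trl\<close> the lattice of translations, spanned by
  \<open>k \<alpha>\<close> and \<open>c (2 \<beta> - n \<alpha>)\<close>.\<close>

definition lp :: "int \<Rightarrow> int \<Rightarrow> plane" where
  "lp p q = of_int p *\<^sub>R \<alpha> + of_int q *\<^sub>R \<beta>"
definition lat :: "plane set" where "lat = {lp p q | p q. True}"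
definition s0 :: "plane \<Rightarrow> plane" where
  "s0 x = - x + (2 * (x \<bullet> \<alpha>) / (\<alpha> \<bullet> \<alpha>)) *\<^sub>R \<alpha>"
definition sg :: "plane \<Rightarrow> plane" where "sg x = s0 x + lp a b"
definition trl :: "plane set" where
  "trl = {lp (i * int k - j * c * int n) (2 * j * c) | i j. True}"

lemma \<alpha>_nz: "\<alpha> \<noteq> 0" using indep[of 1 0] by auto
lemma \<alpha>\<alpha>: "\<alpha> \<bullet> \<alpha> \<noteq> 0" using \<alpha>_nz by simp

lemma lp_inject: "lp p q = lp p' q' \<longleftrightarrow> p = p' \<and> q = q'"
proof
  assume "lp p q = lp p' q'"
  then have "of_int (p - p') *\<^sub>R \<alpha> + of_int (q - q') *\<^sub>R \<beta> = 0" by (simp add: lp_def algebra_simps)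
  from indep[OF this] show "p = p' \<and> q = q'" by simp
qed simp

lemma lp_in[simp]: "lp p q \<in> lat" by (auto simp: lat_def)
lemma latE: assumes "x \<in> lat" obtains p q where "x = lp p q" using assms by (auto simp: lat_def)
lemma lp_add: "lp p q + lp p' q' = lp (p + p') (q + q')" by (simp add: lp_def algebra_simps)
lemma lp_minus: "- lp p q = lp (- p) (- q)" by (simp add: lp_def algebra_simps)
lemma lp_0: "lp 0 0 = 0" by (simp add: lp_def)
lemma lp_scale: "of_int m *\<^sub>R lp p q = lp (m * p) (m * q)" by (simp add: lp_def algebra_simps)
lemma lp_1_0: "lp 1 0 = \<alpha>" by (simp add: lp_def)
lemma lp_0_1: "lp 0 1 = \<beta>" by (simp add: lp_def)
lemma \<alpha>_lat[simp]: "\<alpha> \<in> lat" using lp_in[of 1 0] by (simp only: lp_1_0)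
lemma \<beta>_lat[simp]: "\<beta> \<in> lat" using lp_in[of 0 1] by (simp only: lp_0_1)

lemma lat_0[simp]: "0 \<in> lat" using lp_in[of 0 0] by (simp add: lp_0)
lemma lat_add: "x \<in> lat \<Longrightarrow> y \<in> lat \<Longrightarrow> x + y \<in> lat" by (auto elim!: latE simp: lp_add)
lemma lat_minus: "x \<in> lat \<Longrightarrow> - x \<in> lat" by (auto elim!: latE simp: lp_minus)
lemma lat_scale: "x \<in> lat \<Longrightarrow> of_int m *\<^sub>R x \<in> lat" by (auto elim!: latE simp: lp_scale)
lemma lat_add_iff: "y \<in> lat \<Longrightarrow> x + y \<in> lat \<longleftrightarrow> x \<in> lat"
  using lat_add[of "x + y" "- y"] lat_minus[of y] lat_add[of x y] by auto

lemma linear_s0: "linear s0"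
  by (rule linearI) (simp_all add: s0_def algebra_simps inner_add_left add_divide_distrib)
lemma s0_add: "s0 (x + y) = s0 x + s0 y" using linear_s0 by (rule linear_add)
lemma s0_scale: "s0 (r *\<^sub>R x) = r *\<^sub>R s0 x" using linear_s0 by (rule linear_scale)
lemma s0_minus: "s0 (- x) = - s0 x" using linear_s0 by (rule linear_neg)
lemma s0_0[simp]: "s0 0 = 0" using linear_s0 by (rule linear_0)
lemma s0_\<alpha>: "s0 \<alpha> = \<alpha>" using \<alpha>\<alpha> by (simp add: s0_def scaleR_2)
lemma s0_inner_\<alpha>: "s0 x \<bullet> \<alpha> = x \<bullet> \<alpha>" using \<alpha>\<alpha> by (simp add: s0_def inner_diff_left)
lemma s0_s0[simp]: "s0 (s0 x) = x"
proof -
  have "s0 (s0 x) = - s0 x + (2 * (x \<bullet> \<alpha>) / (\<alpha> \<bullet> \<alpha>)) *\<^sub>R \<alpha>"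
    by (subst s0_def) (simp add: s0_inner_\<alpha>)
  then show ?thesis by (simp add: s0_def)
qed
lemma s0_\<beta>: "s0 \<beta> = lp (int n) (- 1)"
proof -
  have "2 * (\<beta> \<bullet> \<alpha>) / (\<alpha> \<bullet> \<alpha>) = real n" using n_inner \<alpha>\<alpha> by (simp add: inner_commute field_simps)
  then show ?thesis by (simp add: s0_def lp_def)
qed
lemma s0_lp: "s0 (lp p q) = lp (p + int n * q) (- q)"
proof -
  have "s0 (lp p q) = of_int p *\<^sub>R \<alpha> + of_int q *\<^sub>R lp (int n) (- 1)"
    by (simp add: lp_def[of p q] s0_add s0_scale s0_\<alpha> s0_\<beta>)
  also have "\<dots> = lp p 0 + lp (q * int n) (q * - 1)" unfolding lp_scale by (simp add: lp_def[of p 0])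
  finally show ?thesis unfolding lp_add by (simp add: algebra_simps)
qed
lemma s0_lat: "s0 x \<in> lat \<longleftrightarrow> x \<in> lat"
proof -
  have "s0 x \<in> lat" if "x \<in> lat" for x using that by (auto elim!: latE simp: s0_lp)
  from this[of x] this[of "s0 x"] show ?thesis by auto
qed
lemma norm_s0: "norm (s0 x) = norm x"
proof -
  have "s0 x \<bullet> s0 x = x \<bullet> x"
    using \<alpha>\<alpha> by (simp add: s0_def inner_diff_left inner_diff_right inner_commute field_simps power2_eq_square)
  then show ?thesis by (simp add: norm_eq_sqrt_inner)
qed

lemma sg_lat: "sg x \<in> lat \<longleftrightarrow> x \<in> lat" by (simp add: sg_def lat_add_iff s0_lat)
lemma sg_add: "sg (x + y) = sg x + s0 y" by (simp add: sg_def s0_add)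
lemma v0_s0: "lp a b + s0 (lp a b) = lp (int k) 0" by (simp add: s0_lp lp_add k_eq)
lemma sg_sg: "sg (sg x) = x + lp (int k) 0"
  by (simp add: sg_def s0_add flip: v0_s0)

lemma trl_lat: "t \<in> trl \<Longrightarrow> t \<in> lat" by (auto simp: trl_def)
lemma trl_0[simp]: "0 \<in> trl" unfolding trl_def by (rule CollectI, rule exI[of _ 0], rule exI[of _ 0]) (simp add: lp_0)
lemma trl_add: assumes "t \<in> trl" "t' \<in> trl" shows "t + t' \<in> trl"
proof -
  obtain i j i' j' where "t = lp (i * int k - j * c * int n) (2 * j * c)" "t' = lp (i' * int k - j' * c * int n) (2 * j' * c)"
    using assms by (auto simp: trl_def)
  then have "t + t' = lp ((i + i') * int k - (j + j') * c * int n) (2 * (j + j') * c)"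
    by (simp add: lp_add algebra_simps)
  then show ?thesis unfolding trl_def by blast
qed
lemma trl_minus: assumes "t \<in> trl" shows "- t \<in> trl"
proof -
  obtain i j where "t = lp (i * int k - j * c * int n) (2 * j * c)" using assms by (auto simp: trl_def)
  then have "- t = lp ((- i) * int k - (- j) * c * int n) (2 * (- j) * c)" by (simp add: lp_minus)
  then show ?thesis unfolding trl_def by blast
qed
lemma trl_s0: assumes "t \<in> trl" shows "s0 t \<in> trl"
proof -
  obtain i j where "t = lp (i * int k - j * c * int n) (2 * j * c)" using assms by (auto simp: trl_def)
  then have "s0 t = lp (i * int k - (- j) * c * int n) (2 * (- j) * c)" by (simp add: s0_lp algebra_simps)
  then show ?thesis unfolding trl_def by blast
qed
lemma trl_k: "lp (int k) 0 \<in> trl"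
  unfolding trl_def by (rule CollectI, rule exI[of _ 1], rule exI[of _ 0]) simp

end

text \<open>For \<open>c \<noteq> 0\<close> the translations have finite index in the lattice.\<close>

locale klein_lattice = klein_frame +
  assumes c_nz: "c \<noteq> 0"
begin

text \<open>A multiple of the exponent of the finite group \<open>lat / trl\<close>.\<close>

definition M :: nat where "M = 2 * k * nat \<bar>c\<bar>"
lemma M_pos: "M > 0" using k_pos c_nz by (simp add: M_def)
lemma M_trl: assumes "x \<in> lat" shows "of_nat M *\<^sub>R x \<in> trl"
proof -
  obtain p q where x: "x = lp p q" using assms by (rule latE)
  have e: "of_nat M *\<^sub>R x = lp (int M * p) (int M * q)" using lp_scale[of "int M" p q] x by simp
  have "\<bar>c\<bar> = sgn c * c" by (simp add: sgn_if)
  then have M: "int M = 2 * int k * (sgn c * c)" by (metis M_def abs_ge_zero nat_0_le of_nat_mult of_nat_numeral)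
  define j where "j = int k * sgn c * q"
  define i where "i = 2 * (sgn c * c) * p + sgn c * c * q * int n"
  have "int M * q = 2 * j * c" unfolding M j_def by algebra
  moreover have "int M * p = i * int k - j * c * int n" unfolding M i_def j_def by algebra
  ultimately show ?thesis unfolding e trl_def by (intro CollectI exI[of _ i] exI[of _ j]) simp
qed
section \<open>Characters\<close>

text \<open>Characters of \<open>lat\<close>, extended by \<open>0\<close> so that they are determined by their values on \<open>lat\<close>;
  \<open>chars\<close> is the dual group of \<open>lat / trl\<close>.\<close>

definition charac :: "(plane \<Rightarrow> complex) \<Rightarrow> bool" where
  "charac \<phi> \<longleftrightarrow> (\<forall>x. x \<notin> lat \<longrightarrow> \<phi> x = 0) \<and> \<phi> 0 = 1 \<and> (\<forall>x\<in>lat. \<forall>y\<in>lat. \<phi> (x + y) = \<phi> x * \<phi> y)"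
definition chars :: "(plane \<Rightarrow> complex) set" where
  "chars = {\<phi>. charac \<phi> \<and> (\<forall>t\<in>trl. \<phi> t = 1)}"

lemma charac_add: "charac \<phi> \<Longrightarrow> x \<in> lat \<Longrightarrow> y \<in> lat \<Longrightarrow> \<phi> (x + y) = \<phi> x * \<phi> y"
  by (simp add: charac_def)
lemma charac_nz: assumes "charac \<phi>" "x \<in> lat" shows "\<phi> x \<noteq> 0"
  using charac_add[OF assms lat_minus[OF assms(2)]] assms(1) by (auto simp: charac_def)
lemma charac_minus: assumes "charac \<phi>" "x \<in> lat" shows "\<phi> (- x) = inverse (\<phi> x)"
proof (rule inverse_unique[symmetric])
  show "\<phi> x * \<phi> (- x) = 1"
    using charac_add[OF assms lat_minus[OF assms(2)]] assms(1) by (simp add: charac_def)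
qed
lemma charac_scale: assumes "charac \<phi>" "x \<in> lat" shows "\<phi> (of_int m *\<^sub>R x) = \<phi> x powi m"
proof -
  have nat: "\<phi> (of_int (int j) *\<^sub>R x) = \<phi> x ^ j" for j
  proof (induction j)
    case 0
    then show ?case using assms(1) by (simp add: charac_def)
  next
    case (Suc j)
    have "of_int (int (Suc j)) *\<^sub>R x = of_int (int j) *\<^sub>R x + x" by (simp add: algebra_simps)
    then have "\<phi> (of_int (int (Suc j)) *\<^sub>R x) = \<phi> (of_int (int j) *\<^sub>R x) * \<phi> x"
      using charac_add[OF assms(1) lat_scale[OF assms(2)] assms(2)] by metis
    then show ?case using Suc by simp
  qed
  show ?thesis
  proof (cases "m \<ge> 0")
    case True
    then show ?thesis using nat[of "nat m"] by (simp add: power_int_def)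
  next
    case False
    have "\<phi> (of_int m *\<^sub>R x) = \<phi> (- (of_int (int (nat (- m))) *\<^sub>R x))" using False by simp
    also have "\<dots> = inverse (\<phi> x ^ nat (- m))"
      unfolding charac_minus[OF assms(1) lat_scale[OF assms(2)]] nat ..
    finally show ?thesis using False by (simp add: power_int_def power_inverse)
  qed
qed
lemma charac_lp: assumes "charac \<phi>" shows "\<phi> (lp p q) = \<phi> \<alpha> powi p * \<phi> \<beta> powi q"
  unfolding lp_def by (simp add: charac_add[OF assms] lat_scale charac_scale[OF assms])
lemma charac_eqI: assumes "charac \<phi>" "charac \<psi>" "\<phi> \<alpha> = \<psi> \<alpha>" "\<phi> \<beta> = \<psi> \<beta>" shows "\<phi> = \<psi>"
proof
  fix x show "\<phi> x = \<psi> x"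
  proof (cases "x \<in> lat")
    case True
    then show ?thesis using assms(3,4) by (auto elim!: latE simp: charac_lp[OF assms(1)] charac_lp[OF assms(2)])
  qed (use assms in \<open>simp add: charac_def\<close>)
qed

text \<open>Coordinates with respect to the frame; their values off \<open>lat\<close> are irrelevant.\<close>

definition cp :: "plane \<Rightarrow> int" where "cp x = (SOME p. \<exists>q. x = lp p q)"
definition cq :: "plane \<Rightarrow> int" where "cq x = (SOME q. \<exists>p. x = lp p q)"
lemma cp_lp[simp]: "cp (lp p q) = p" unfolding cp_def by (rule some_equality) (auto simp: lp_inject)
lemma cq_lp[simp]: "cq (lp p q) = q" unfolding cq_def by (rule some_equality) (auto simp: lp_inject)

text \<open>The character with the values \<open>z\<close> at \<open>\<alpha>\<close> and \<open>w\<close> at \<open>\<beta>\<close>, for nonzero \<open>z\<close> and \<open>w\<close>.\<close>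

definition chr :: "complex \<Rightarrow> complex \<Rightarrow> plane \<Rightarrow> complex" where
  "chr z w x = (if x \<in> lat then z powi cp x * w powi cq x else 0)"
lemma chr_lp[simp]: "chr z w (lp p q) = z powi p * w powi q" by (simp add: chr_def)
lemma chr_\<alpha>[simp]: "chr z w \<alpha> = z" using chr_lp[of z w 1 0] by (simp add: lp_1_0)
lemma chr_\<beta>[simp]: "chr z w \<beta> = w" using chr_lp[of z w 0 1] by (simp add: lp_0_1)
lemma charac_chr: assumes "z \<noteq> 0" "w \<noteq> 0" shows "charac (chr z w)"
  unfolding charac_def
proof (intro conjI ballI allI impI)
  show "chr z w x = 0" if "x \<notin> lat" for x using that by (simp add: chr_def)
  show "chr z w 0 = 1" using chr_lp[of z w 0 0] by (simp add: lp_0)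
  fix x y assume "x \<in> lat" "y \<in> lat"
  then show "chr z w (x + y) = chr z w x * chr z w y"
    using assms by (auto elim!: latE simp: lp_add power_int_add)
qed
lemma charac_chr_eq: assumes "charac \<phi>" shows "\<phi> = chr (\<phi> \<alpha>) (\<phi> \<beta>)"
  by (rule charac_eqI[OF assms]) (use charac_nz[OF assms] in \<open>auto intro: charac_chr\<close>)

text \<open>Linear independence of characters.\<close>

lemma charac_independent:
  assumes "finite X" "\<And>\<phi>. \<phi> \<in> X \<Longrightarrow> charac \<phi>" "\<And>x. x \<in> lat \<Longrightarrow> (\<Sum>\<phi>\<in>X. d \<phi> * \<phi> x) = 0" "\<phi> \<in> X"
  shows "d \<phi> = 0"
  using assms
proof (induction X arbitrary: d \<phi> rule: finite_induct)
  case empty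
  then show ?case by simp
next
  case (insert \<psi> X)
  have \<psi>: "charac \<psi>" using insert.prems by simp
  have sum: "d \<psi> * \<psi> x + (\<Sum>\<phi>\<in>X. d \<phi> * \<phi> x) = 0" if "x \<in> lat" for x
    using insert.prems(2)[OF that] insert.hyps by simp
  have X0: "d \<phi> = 0" if \<phi>: "\<phi> \<in> X" for \<phi>
  proof -
    have cX: "charac \<phi>" using insert.prems \<phi> by simp
    have "\<phi> \<noteq> \<psi>" using \<phi> insert.hyps by auto
    then obtain y where y: "\<phi> y \<noteq> \<psi> y" by (auto simp: fun_eq_iff)
    have yl: "y \<in> lat" by (rule ccontr) (use y cX \<psi> in \<open>simp add: charac_def\<close>)
    \<comment> \<open>The relation at \<open>x + y\<close>, minus \<open>\<psi> y\<close> times the relation at \<open>x\<close>, no longer involves \<open>\<psi>\<close>.\<close>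
    have "(\<Sum>\<phi>\<in>X. (d \<phi> * (\<phi> y - \<psi> y)) * \<phi> x) = 0" if x: "x \<in> lat" for x
    proof -
      have "(\<Sum>\<phi>\<in>X. (d \<phi> * (\<phi> y - \<psi> y)) * \<phi> x) = (\<Sum>\<phi>\<in>X. d \<phi> * \<phi> (x + y)) - \<psi> y * (\<Sum>\<phi>\<in>X. d \<phi> * \<phi> x)"
        unfolding sum_distrib_left sum_subtractf[symmetric]
        by (rule sum.cong) (auto simp: charac_add[OF _ x yl] insert.prems algebra_simps)
      also have "\<dots> = - (d \<psi> * \<psi> (x + y)) + \<psi> y * (d \<psi> * \<psi> x)"
        using sum[OF x, unfolded add_eq_0_iff] sum[OF lat_add[OF x yl], unfolded add_eq_0_iff] by simp
      also have "\<dots> = 0" using charac_add[OF \<psi> x yl] by simp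
      finally show ?thesis .
    qed
    from insert.IH[of "\<lambda>\<phi>. d \<phi> * (\<phi> y - \<psi> y)", OF _ this \<phi>] have "d \<phi> * (\<phi> y - \<psi> y) = 0"
      using insert.prems by simp
    then show ?thesis using y by simp
  qed
  moreover have "d \<psi> = 0"
  proof -
    have "(\<Sum>\<phi>\<in>X. d \<phi> * \<phi> 0) = 0" using X0 by simp
    then show ?thesis using sum[of 0] \<psi> by (simp add: charac_def)
  qed
  ultimately show ?case using insert.prems by auto
qed

lemma chars_charac: "\<phi> \<in> chars \<Longrightarrow> charac \<phi>" by (simp add: chars_def)

lemma chars_root: assumes "\<phi> \<in> chars" "x \<in> lat" shows "\<phi> x ^ M = 1"
  using charac_scale[OF chars_charac[OF assms(1)] assms(2), of "int M"] M_trl[OF assms(2)] assms(1)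
  by (simp add: chars_def)

lemma chars_norm: assumes "\<phi> \<in> chars" "x \<in> lat" shows "norm (\<phi> x) = 1"
proof -
  have "norm (\<phi> x) ^ M = 1" using chars_root[OF assms] by (metis norm_one norm_power)
  then show ?thesis using M_pos by (metis norm_ge_zero power_eq_1_iff real_norm_def abs_of_nonneg less_numeral_extra(3) neq0_conv power_eq_imp_eq_base power_one zero_le_one)
qed

text \<open>The characters of \<open>lat / M lat\<close>, an explicit group containing \<open>chars\<close>.\<close>

definition rootchars :: "(plane \<Rightarrow> complex) set" where
  "rootchars = (\<lambda>(z, w). chr z w) ` ({z. z ^ M = 1} \<times> {z. z ^ M = 1})"

lemma finite_roots_M: "finite {z::complex. z ^ M = 1}" using M_pos by (simp add: finite_roots_unity)
lemma finite_rootchars: "finite rootchars" unfolding rootchars_def using finite_roots_M by auto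
lemma rootchars_charac: assumes "\<phi> \<in> rootchars" shows "charac \<phi>"
proof -
  obtain z w where "\<phi> = chr z w" "z ^ M = 1" "w ^ M = 1" using assms by (auto simp: rootchars_def)
  moreover from this have "z \<noteq> 0" "w \<noteq> 0" using M_pos by (auto simp: power_0_left)
  ultimately show ?thesis by (simp add: charac_chr)
qed
lemma chars_rootchars: "chars \<subseteq> rootchars"
proof
  fix \<phi> assume \<phi>: "\<phi> \<in> chars"
  then show "\<phi> \<in> rootchars"
    unfolding rootchars_def using charac_chr_eq[OF chars_charac[OF \<phi>]] chars_root[OF \<phi>]
    by (intro image_eqI[of _ _ "(\<phi> \<alpha>, \<phi> \<beta>)"]) auto
qed
lemma finite_chars: "finite chars" using chars_rootchars finite_rootchars by (rule finite_subset)

text \<open>Functions on \<open>lat / trl\<close>, extended by \<open>0\<close>.\<close>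

definition periodic_functions :: "(plane \<Rightarrow> complex) set" where
  "periodic_functions = {F. (\<forall>x. x \<notin> lat \<longrightarrow> F x = 0) \<and> (\<forall>x\<in>lat. \<forall>t\<in>trl. F (x + t) = F x)}"

text \<open>Fourier inversion on \<open>lat / M lat\<close>.\<close>

lemma fourier_expansion:
  assumes F: "F \<in> periodic_functions"
  shows "\<exists>d. \<forall>x. F x = (\<Sum>\<phi>\<in>rootchars. d \<phi> * \<phi> x)"
proof -
  let ?R = "{z::complex. z ^ M = 1}" and ?B = "{0..<int M}"
  define d where "d z w = (\<Sum>p\<in>?B. \<Sum>q\<in>?B. z powi (- p) * w powi (- q) * F (lp p q)) / (of_nat M)\<^sup>2" for z w
  have mod: "F (lp p q) = F (lp (p mod int M) (q mod int M))" for p q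
  proof -
    have "lp p q = lp (p mod int M) (q mod int M) + of_nat M *\<^sub>R lp (p div int M) (q div int M)"
      using lp_scale[of "int M"] by (simp add: lp_add)
    then show ?thesis using F M_trl[of "lp (p div int M) (q div int M)"] by (simp add: periodic_functions_def)
  qed
  have nz: "z \<noteq> 0" if "z \<in> ?R" for z using that M_pos by (auto simp: power_0_left)
  have dv: "int M dvd (p0 - p) \<longleftrightarrow> p = p0 mod int M" if "p \<in> ?B" for p p0
    using that M_pos by (auto simp: mod_eq_dvd_iff[symmetric])
  have "F (lp p0 q0) = (\<Sum>z\<in>?R. \<Sum>w\<in>?R. d z w * chr z w (lp p0 q0))" for p0 q0
  proof -
    have "(\<Sum>z\<in>?R. \<Sum>w\<in>?R. d z w * chr z w (lp p0 q0)) =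
      (\<Sum>z\<in>?R. \<Sum>w\<in>?R. \<Sum>p\<in>?B. \<Sum>q\<in>?B. z powi (p0 - p) * w powi (q0 - q) * F (lp p q)) / (of_nat M)\<^sup>2"
      unfolding sum_divide_distrib d_def
      by (intro sum.cong refl) (simp add: sum_divide_distrib sum_distrib_right sum_distrib_left power_int_diff nz field_simps power_int_minus)
    also have "(\<Sum>z\<in>?R. \<Sum>w\<in>?R. \<Sum>p\<in>?B. \<Sum>q\<in>?B. z powi (p0 - p) * w powi (q0 - q) * F (lp p q)) =
      (\<Sum>p\<in>?B. \<Sum>q\<in>?B. \<Sum>z\<in>?R. \<Sum>w\<in>?R. z powi (p0 - p) * w powi (q0 - q) * F (lp p q))"
      by (rule sum_swap4)
    also have "\<dots> = (\<Sum>p\<in>?B. \<Sum>q\<in>?B. (\<Sum>z\<in>?R. z powi (p0 - p)) * (\<Sum>w\<in>?R. w powi (q0 - q)) * F (lp p q))"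
      by (intro sum.cong refl) (simp only: sum_product, simp only: sum_distrib_right)
    also have "\<dots> = (\<Sum>p\<in>?B. \<Sum>q\<in>?B. if q = q0 mod int M then if p = p0 mod int M then (of_nat M)\<^sup>2 * F (lp p q) else 0 else 0)"
      unfolding sum_roots_unity_powi[OF M_pos]
      by (intro sum.cong refl) (auto simp: dv power2_eq_square)
    also have "\<dots> = (of_nat M)\<^sup>2 * F (lp (p0 mod int M) (q0 mod int M))"
      using M_pos by (simp add: sum.delta)
    finally show ?thesis using M_pos mod[of p0 q0] by simp
  qed
  then have 1: "F x = (\<Sum>z\<in>?R. \<Sum>w\<in>?R. d z w * chr z w x)" for x
  proof (cases "x \<in> lat")
    case False
    then show ?thesis using F by (simp add: periodic_functions_def chr_def)
  qed (auto elim: latE)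
  have inj: "inj_on (\<lambda>(z, w). chr z w) (?R \<times> ?R)"
    by (rule inj_onI) (auto, metis chr_\<alpha>, metis chr_\<beta>)
  have "F x = (\<Sum>\<phi>\<in>rootchars. d (\<phi> \<alpha>) (\<phi> \<beta>) * \<phi> x)" for x
    unfolding rootchars_def sum.reindex[OF inj] 1 by (simp add: sum.cartesian_product case_prod_beta)
  then show ?thesis by (intro exI[of _ "\<lambda>\<phi>. d (\<phi> \<alpha>) (\<phi> \<beta>)"] allI)
qed

text \<open>In the Fourier expansion over \<open>rootchars\<close>, invariance under a translation \<open>t\<close> kills the coefficients of the
  characters with \<open>\<phi> t \<noteq> 1\<close>.\<close>

lemma chars_basis: "family_basis chars (\<lambda>\<phi>. \<phi>) periodic_functions"
proof (rule family_basisI[OF finite_chars])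
  show "\<phi> \<in> periodic_functions" if \<phi>: "\<phi> \<in> chars" for \<phi>
    using that trl_lat by (auto simp: periodic_functions_def chars_def charac_def)
  show "cfun.subspace periodic_functions"
    by (rule cfun.subspaceI) (auto simp: cscale_def periodic_functions_def)
  show "d \<phi> = 0" if "\<forall>x. (\<Sum>\<phi>\<in>chars. d \<phi> * \<phi> x) = 0" "\<phi> \<in> chars" for d \<phi>
    by (rule charac_independent[OF finite_chars]) (use that chars_charac in auto)
  fix F assume F: "F \<in> periodic_functions"
  obtain d where d: "\<And>x. F x = (\<Sum>\<phi>\<in>rootchars. d \<phi> * \<phi> x)" using fourier_expansion[OF F] by blast
  have z: "d \<phi> = 0" if \<phi>: "\<phi> \<in> rootchars - chars" for \<phi>
  proof -
    obtain t where t: "t \<in> trl" "\<phi> t \<noteq> 1" using \<phi> rootchars_charac by (auto simp: chars_def)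
    have "(\<Sum>\<phi>\<in>rootchars. (d \<phi> * (\<phi> t - 1)) * \<phi> x) = 0" if x: "x \<in> lat" for x
    proof -
      have "(\<Sum>\<phi>\<in>rootchars. (d \<phi> * (\<phi> t - 1)) * \<phi> x) = F (x + t) - F x"
        unfolding d sum_subtractf[symmetric]
        by (rule sum.cong) (simp_all add: charac_add[OF rootchars_charac x trl_lat[OF t(1)]] ring_distribs mult_ac)
      then show ?thesis using F x t by (simp add: periodic_functions_def)
    qed
    from charac_independent[OF finite_rootchars rootchars_charac this, of \<phi>] have "d \<phi> * (\<phi> t - 1) = 0"
      using \<phi> by simp
    then show ?thesis using t by simp
  qed
  have "F x = (\<Sum>\<phi>\<in>chars. d \<phi> * \<phi> x)" for x
    unfolding d by (rule sum.mono_neutral_right[OF finite_rootchars chars_rootchars]) (use z in auto)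
  then show "\<exists>d. \<forall>x. F x = (\<Sum>\<phi>\<in>chars. d \<phi> * \<phi> x)" by blast
qed

end

section \<open>Reflection of characters\<close>

context klein_lattice begin

text \<open>The glide reflection sends \<open>\<phi>\<close> to \<open>sign_char \<phi>\<close> times \<open>refl_char \<phi>\<close>. The characters fixed by the
  reflection are \<open>plus_chars\<close> and \<open>minus_chars\<close>; \<open>free_chars\<close> contains one of each pair of the remaining ones.\<close>

definition refl_char :: "(plane \<Rightarrow> complex) \<Rightarrow> plane \<Rightarrow> complex" where
  "refl_char \<phi> = (\<lambda>x. \<phi> (s0 x))"
definition sign_char :: "(plane \<Rightarrow> complex) \<Rightarrow> complex" where
  "sign_char \<phi> = \<phi> (lp a b)"
definition fixed_chars :: "(plane \<Rightarrow> complex) set" where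
  "fixed_chars = {\<phi> \<in> chars. refl_char \<phi> = \<phi>}"
definition plus_chars :: "(plane \<Rightarrow> complex) set" where
  "plus_chars = {\<phi> \<in> fixed_chars. sign_char \<phi> = 1}"
definition minus_chars :: "(plane \<Rightarrow> complex) set" where
  "minus_chars = {\<phi> \<in> fixed_chars. sign_char \<phi> = - 1}"
definition free_chars :: "(plane \<Rightarrow> complex) set" where
  "free_chars = (SOME Y. Y \<subseteq> chars \<and> chars = Y \<union> refl_char ` Y \<union> {x \<in> chars. refl_char x = x} \<and>
     Y \<inter> refl_char ` Y = {} \<and> (Y \<union> refl_char ` Y) \<inter> {x \<in> chars. refl_char x = x} = {})"

lemma refl_refl: "refl_char (refl_char \<phi>) = \<phi>" by (simp add: refl_char_def)
lemma refl_charac: "charac \<phi> \<Longrightarrow> charac (refl_char \<phi>)"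
  by (simp add: charac_def refl_char_def s0_lat s0_add)
lemma refl_chars: "\<phi> \<in> chars \<Longrightarrow> refl_char \<phi> \<in> chars"
  using refl_charac by (auto simp: chars_def) (simp add: refl_char_def trl_s0)

lemma sign_mult: assumes "\<phi> \<in> chars" shows "sign_char \<phi> * sign_char (refl_char \<phi>) = 1"
proof -
  have "sign_char \<phi> * sign_char (refl_char \<phi>) = \<phi> (lp a b + s0 (lp a b))"
    unfolding sign_char_def refl_char_def
    using charac_add[OF chars_charac[OF assms], of "lp a b" "s0 (lp a b)"] by (simp add: s0_lat)
  then show ?thesis using trl_k assms unfolding v0_s0 by (simp add: chars_def)
qed

lemma fixed_split: "fixed_chars = plus_chars \<union> minus_chars" "plus_chars \<inter> minus_chars = {}"
proof -
  have "sign_char \<phi> = 1 \<or> sign_char \<phi> = - 1" if "\<phi> \<in> fixed_chars" for \<phi>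
  proof -
    have "sign_char \<phi> * sign_char \<phi> = 1" using sign_mult[of \<phi>] that by (simp add: fixed_chars_def)
    then show ?thesis using square_eq_1_iff by blast
  qed
  then show "fixed_chars = plus_chars \<union> minus_chars" by (auto simp: plus_chars_def minus_chars_def)
  show "plus_chars \<inter> minus_chars = {}" by (auto simp: plus_chars_def minus_chars_def)
qed

lemma free_chars:
  "free_chars \<subseteq> chars" "chars = free_chars \<union> refl_char ` free_chars \<union> (plus_chars \<union> minus_chars)"
  "free_chars \<inter> refl_char ` free_chars = {}"
  "(free_chars \<union> refl_char ` free_chars) \<inter> (plus_chars \<union> minus_chars) = {}"
proof -
  have "\<exists>Y. Y \<subseteq> chars \<and> chars = Y \<union> refl_char ` Y \<union> {x \<in> chars. refl_char x = x} \<and>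
     Y \<inter> refl_char ` Y = {} \<and> (Y \<union> refl_char ` Y) \<inter> {x \<in> chars. refl_char x = x} = {}"
    by (rule involution_transversal[OF finite_chars refl_chars refl_refl])
  from someI_ex[OF this, folded free_chars_def, folded fixed_chars_def, unfolded fixed_split(1)]
  show "free_chars \<subseteq> chars" "chars = free_chars \<union> refl_char ` free_chars \<union> (plus_chars \<union> minus_chars)"
    "free_chars \<inter> refl_char ` free_chars = {}"
    "(free_chars \<union> refl_char ` free_chars) \<inter> (plus_chars \<union> minus_chars) = {}" by blast+
qed

lemma finite_char_parts: "finite free_chars" "finite plus_chars" "finite minus_chars"
  using finite_chars free_chars(2) by (metis finite_Un)+

lemma refl_inj: "inj_on refl_char A" by (rule inj_on_inverseI[of _ refl_char]) (simp add: refl_refl)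

end

section \<open>Lattice points with a direction\<close>

text \<open>A set \<open>D\<close> of directions stable under the reflection: those in \<open>Fx\<close> are fixed, and \<open>H\<close> represents the
  pairs of distinct directions exchanged by it.\<close>

locale klein_directions = klein_lattice +
  fixes D Fx H :: "plane set"
  assumes fin_D: "finite D" and D_lat: "D \<subseteq> lat"
    and D_split: "D = Fx \<union> H \<union> s0 ` H" and D_disj: "H \<inter> s0 ` H = {}" "(H \<union> s0 ` H) \<inter> Fx = {}"
    and s0_Fx: "\<And>l. l \<in> Fx \<Longrightarrow> s0 l = l"
begin

text \<open>Lattice points, each with a direction.\<close>

definition E :: "(plane \<times> plane) set" where "E = lat \<times> D"

text \<open>\<open>r m (x, l) (y, l')\<close> holds iff an element of the group maps \<open>(y, l')\<close> to \<open>(x - m l, l)\<close>; the two disjuncts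
  are the translations and the glide reflections. One step is \<open>(x, l) \<mapsto> (x + l, l)\<close>.\<close>

definition r :: "int \<Rightarrow> plane \<times> plane \<Rightarrow> plane \<times> plane \<Rightarrow> bool" where
  "r m e e' \<longleftrightarrow> e \<in> E \<and> e' \<in> E \<and>
     (\<exists>t\<in>trl. (snd e = snd e' \<and> fst e = fst e' + t + of_int m *\<^sub>R snd e) \<or>
              (snd e = s0 (snd e') \<and> fst e = sg (fst e') + t + of_int m *\<^sub>R snd e))"

lemma s0_D: "l \<in> D \<Longrightarrow> s0 l \<in> D" using D_split s0_Fx by auto

lemma rI1: "t \<in> trl \<Longrightarrow> (y, l) \<in> E \<Longrightarrow> r m (y + t + of_int m *\<^sub>R l, l) (y, l)"
  using D_lat trl_lat[of t] by (auto simp: r_def E_def intro!: lat_add lat_scale)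
lemma rI2: "t \<in> trl \<Longrightarrow> (y, l) \<in> E \<Longrightarrow> r m (sg y + t + of_int m *\<^sub>R s0 l, s0 l) (y, l)"
  using D_lat s0_D trl_lat[of t] by (auto simp: r_def E_def sg_lat s0_lat intro!: lat_add lat_scale)
lemma rI1': "t \<in> trl \<Longrightarrow> (y, l) \<in> E \<Longrightarrow> x = y + t + of_int m *\<^sub>R l \<Longrightarrow> r m (x, l) (y, l)"
  using rI1 by simp
lemma rI2': "t \<in> trl \<Longrightarrow> (y, l) \<in> E \<Longrightarrow> x = sg y + t + of_int m *\<^sub>R s0 l \<Longrightarrow> l' = s0 l \<Longrightarrow> r m (x, l') (y, l)"
  using rI2 by simp

lemma rE:
  assumes "r m e e'"
  obtains (tr) t y l where "t \<in> trl" "(y, l) \<in> E" "e' = (y, l)" "e = (y + t + of_int m *\<^sub>R l, l)"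
  | (gl) t y l where "t \<in> trl" "(y, l) \<in> E" "e' = (y, l)" "e = (sg y + t + of_int m *\<^sub>R s0 l, s0 l)"
proof -
  from assms obtain t where E: "e \<in> E" "e' \<in> E" and t: "t \<in> trl"
    and c: "(snd e = snd e' \<and> fst e = fst e' + t + of_int m *\<^sub>R snd e) \<or>
              (snd e = s0 (snd e') \<and> fst e = sg (fst e') + t + of_int m *\<^sub>R snd e)"
    unfolding r_def by blast
  from c show thesis
  proof
    assume "snd e = snd e' \<and> fst e = fst e' + t + of_int m *\<^sub>R snd e"
    then have "e = (fst e' + t + of_int m *\<^sub>R snd e', snd e')" by (metis prod.collapse)
    then show thesis using tr[OF t, of "fst e'" "snd e'"] E by simp
  next
    assume "snd e = s0 (snd e') \<and> fst e = sg (fst e') + t + of_int m *\<^sub>R snd e"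
    then have "e = (sg (fst e') + t + of_int m *\<^sub>R s0 (snd e'), s0 (snd e'))" by (metis prod.collapse)
    then show thesis using gl[OF t, of "fst e'" "snd e'"] E by simp
  qed
qed

lemma r_refl': "x \<in> E \<Longrightarrow> r 0 x x"
  using rI1[OF trl_0, of "fst x" "snd x" 0] by simp

lemma r_sym': assumes "r m x y" shows "r (- m) y x"
  using assms
proof (cases rule: rE)
  case (tr t z l)
  show ?thesis unfolding tr
    by (rule rI1'[OF trl_minus[OF tr(1)]]) (use assms tr in \<open>auto simp: r_def\<close>)
next
  case (gl t z l)
  have t: "- s0 t - lp (int k) 0 \<in> trl"
    using trl_add[OF trl_minus[OF trl_s0[OF gl(1)]] trl_minus[OF trl_k]] by simp
  have x: "(sg z + t + of_int m *\<^sub>R s0 l, s0 l) \<in> E" using assms gl by (auto simp: r_def)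
  show ?thesis unfolding gl
    by (rule rI2'[OF t x]) (simp_all add: sg_add sg_sg s0_scale)
qed

lemma r_trans': assumes "r m x y" "r m' y z" shows "r (m + m') x z"
  using assms(2)
proof (cases rule: rE)
  case z: (tr t' w l)
  from assms(1) show ?thesis
  proof (cases rule: rE)
    case (tr t y' l')
    have y': "y' = w + t' + of_int m' *\<^sub>R l" "l' = l" using z tr by auto
    show ?thesis unfolding tr(4) z(3) y'(2)
      by (rule rI1'[OF trl_add[OF tr(1) z(1)] z(2)]) (simp add: y' algebra_simps)
  next
    case (gl t y' l')
    have y': "y' = w + t' + of_int m' *\<^sub>R l" "l' = l" using z gl by auto
    show ?thesis unfolding gl(4) z(3)
      by (rule rI2'[OF trl_add[OF gl(1) trl_s0[OF z(1)]] z(2)])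
        (simp_all add: y' sg_add s0_scale, simp add: algebra_simps)
  qed
next
  case z: (gl t' w l)
  from assms(1) show ?thesis
  proof (cases rule: rE)
    case (tr t y' l')
    have y': "y' = sg w + t' + of_int m' *\<^sub>R s0 l" "l' = s0 l" using z tr by auto
    show ?thesis unfolding tr(4) z(3)
      by (rule rI2'[OF trl_add[OF tr(1) z(1)] z(2)]) (simp_all add: y' algebra_simps)
  next
    case (gl t y' l')
    have y': "y' = sg w + t' + of_int m' *\<^sub>R s0 l" "l' = s0 l" using z gl by auto
    show ?thesis unfolding gl(4) z(3) y'(2) s0_s0
      by (rule rI1'[OF trl_add[OF trl_add[OF gl(1) trl_s0[OF z(1)]] trl_k] z(2)])
        (simp add: y' sg_add sg_sg s0_scale, simp add: algebra_simps)
  qed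
qed

lemma r_E': "r m x y \<Longrightarrow> x \<in> E" by (simp add: r_def)

lemma r_periodic: assumes "x \<in> E" shows "\<exists>m>0. r m x x"
proof -
  obtain y l where x: "x = (y, l)" by (cases x)
  have "l \<in> lat" using assms D_lat by (auto simp: x E_def)
  then have "- (of_nat M *\<^sub>R l) \<in> trl" using M_trl trl_minus by blast
  from rI1'[OF this, of y l y "int M"] show ?thesis
    unfolding x using assms M_pos by (intro exI[of _ "int M"]) (auto simp: x)
qed

lemma lat_mod: assumes "x \<in> lat" shows "\<exists>p\<in>{0..<int M}. \<exists>q\<in>{0..<int M}. \<exists>t\<in>trl. x = lp p q + t"
proof -
  obtain p q where x: "x = lp p q" using assms by (rule latE)
  have "of_nat M *\<^sub>R lp (p div int M) (q div int M) \<in> trl" by (rule M_trl) simp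
  moreover have "x = lp (p mod int M) (q mod int M) + of_nat M *\<^sub>R lp (p div int M) (q div int M)"
    using lp_scale[of "int M"] by (simp add: lp_add x)
  ultimately show ?thesis using M_pos
    by (intro bexI[of _ "p mod int M"] bexI[of _ "q mod int M"] bexI[of _ "of_nat M *\<^sub>R lp (p div int M) (q div int M)"]) auto
qed

lemma r_finite: "finite (E // {(x, y). \<exists>m. r m x y})"
proof -
  let ?R = "{(x, y). \<exists>m. r m x y}"
  let ?B = "(\<lambda>(p, q, l). (lp p q, l)) ` ({0..<int M} \<times> {0..<int M} \<times> D)"
  have eq: "equiv E ?R"
    by (intro equivI refl_onI symI transI) (use r_E' r_sym' r_refl' r_trans' in blast)+
  have "E // ?R \<subseteq> (\<lambda>x. ?R `` {x}) ` ?B"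
  proof
    fix C assume "C \<in> E // ?R"
    then obtain x l where x: "(x, l) \<in> E" and C: "C = ?R `` {(x, l)}" by (auto elim!: quotientE)
    then obtain p q t where p: "p \<in> {0..<int M}" "q \<in> {0..<int M}" "t \<in> trl" "x = lp p q + t"
      using lat_mod[of x] by (auto simp: E_def)
    have "r 0 (x, l) (lp p q, l)"
      by (rule rI1'[OF p(3)]) (use x p in \<open>auto simp: E_def\<close>)
    then have "?R `` {(x, l)} = ?R `` {(lp p q, l)}"
      using equiv_class_eq[OF eq] by blast
    moreover have "l \<in> D" using x by (simp add: E_def)
    ultimately show "C \<in> (\<lambda>x. ?R `` {x}) ` ?B" unfolding C using p
      by (intro image_eqI[of _ _ "(lp p q, l)"] image_eqI[of _ _ "(p, q, l)"]) auto
  qed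
  then show ?thesis by (rule finite_subset) (use fin_D in auto)
qed

sublocale ge: graded_equivalence E r
  by unfold_locales (fact r_refl' r_sym' r_trans' r_E' r_periodic r_finite)+

text \<open>\<open>VT\<close> is the space of functions on \<open>lat \<times> D\<close> invariant under translations. Its basis \<open>ebas (\<phi>, l)\<close> is \<open>\<phi>\<close>
  on the points with direction \<open>l\<close>; \<open>glide_op\<close> is composition with the glide reflection.\<close>

definition ebas :: "(plane \<Rightarrow> complex) \<times> plane \<Rightarrow> plane \<times> plane \<Rightarrow> complex" where
  "ebas i e = (if snd e = snd i then fst i (fst e) else 0)"
definition glide_op :: "(plane \<times> plane \<Rightarrow> complex) \<Rightarrow> plane \<times> plane \<Rightarrow> complex" where
  "glide_op F e = F (sg (fst e), s0 (snd e))"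
definition VT :: "(plane \<times> plane \<Rightarrow> complex) set" where
  "VT = {F. (\<forall>e. e \<notin> E \<longrightarrow> F e = 0) \<and> (\<forall>x l t. (x, l) \<in> E \<longrightarrow> t \<in> trl \<longrightarrow> F (x + t, l) = F (x, l))}"

lemma ebas_basis: "family_basis (chars \<times> D) ebas VT"
proof (rule family_basisI)
  show "finite (chars \<times> D)" using finite_chars fin_D by simp
  show "cfun.subspace VT" by (rule cfun.subspaceI) (auto simp: cscale_def VT_def)
  show "ebas i \<in> VT" if "i \<in> chars \<times> D" for i
    using that family_basis_mem[OF chars_basis, of "fst i"]
    by (auto simp: ebas_def VT_def E_def periodic_functions_def)
  have sumD: "(\<Sum>i\<in>chars \<times> D. d i * ebas i (x, l)) = (if l \<in> D then (\<Sum>\<phi>\<in>chars. d (\<phi>, l) * \<phi> x) else 0)" for d x l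
  proof -
    have "(\<Sum>i\<in>chars \<times> D. d i * ebas i (x, l)) = (\<Sum>\<phi>\<in>chars. \<Sum>m\<in>D. d (\<phi>, m) * ebas (\<phi>, m) (x, l))"
      by (simp add: sum.cartesian_product case_prod_beta)
    also have "\<dots> = (\<Sum>\<phi>\<in>chars. \<Sum>m\<in>D. if m = l then d (\<phi>, l) * \<phi> x else 0)"
      by (intro sum.cong refl) (auto simp: ebas_def)
    also have "\<dots> = (if l \<in> D then (\<Sum>\<phi>\<in>chars. d (\<phi>, l) * \<phi> x) else 0)"
      using fin_D by simp
    finally show ?thesis .
  qed
  show "d i = 0" if z: "\<forall>e. (\<Sum>i\<in>chars \<times> D. d i * ebas i e) = 0" and i: "i \<in> chars \<times> D" for d i
  proof -
    obtain \<phi> l where il: "i = (\<phi>, l)" by (cases i)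
    have "(\<Sum>\<phi>\<in>chars. d (\<phi>, l) * \<phi> x) = 0" for x
      using z[rule_format, of "(x, l)"] i unfolding sumD by (simp add: il)
    from family_basis_indep[OF chars_basis this, of \<phi>] show ?thesis using i il by simp
  qed
  fix F assume F: "F \<in> VT"
  have "\<exists>d. \<forall>x. F (x, l) = (\<Sum>\<phi>\<in>chars. d \<phi> * \<phi> x)" for l
  proof (cases "l \<in> D")
    case True
    have "(\<lambda>x. F (x, l)) \<in> periodic_functions"
      using F True by (auto simp: periodic_functions_def VT_def E_def)
    from family_basis_expand[OF chars_basis this] show ?thesis by (metis (no_types))
  next
    case False
    then have "F (x, l) = 0" for x using F by (auto simp: VT_def E_def)
    then show ?thesis by (intro exI[of _ "\<lambda>_. 0"]) simp
  qed
  then obtain d where d: "\<And>x l. F (x, l) = (\<Sum>\<phi>\<in>chars. d l \<phi> * \<phi> x)" by metis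
  have "F e = (\<Sum>i\<in>chars \<times> D. d (snd i) (fst i) * ebas i e)" for e
  proof -
    obtain x l where e: "e = (x, l)" by (cases e)
    show ?thesis unfolding e using sumD[of "\<lambda>i. d (snd i) (fst i)" x l] d[of x l] F
      by (auto simp: VT_def E_def)
  qed
  then show "\<exists>d. \<forall>e. F e = (\<Sum>i\<in>chars \<times> D. d i * ebas i e)" by (intro exI[of _ "\<lambda>i. d (snd i) (fst i)"] allI)
qed

text \<open>Representatives of the pairs \<open>(\<phi>, l)\<close> modulo simultaneous reflection, without the fixed pairs of sign \<open>-1\<close>.
  They index a basis of the functions on \<open>lat \<times> D\<close> that are invariant under the whole group.\<close>

definition idx :: "((plane \<Rightarrow> complex) \<times> plane) set" where
  "idx = (chars \<times> H \<union> free_chars \<times> Fx) \<union> plus_chars \<times> Fx"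

lemma linear_glide_op: "linear_op glide_op"
  by (simp add: linear_op_def glide_op_def fun_eq_iff cscale_def)

lemma glide_ebas: "\<phi> \<in> chars \<Longrightarrow> glide_op (ebas (\<phi>, l)) = cscale (sign_char \<phi>) (ebas (refl_char \<phi>, s0 l))"
proof
  fix e :: "plane \<times> plane" assume \<phi>: "\<phi> \<in> chars"
  obtain x m where e: "e = (x, m)" by (cases e)
  have "\<phi> (sg x) = sign_char \<phi> * \<phi> (s0 x)"
  proof (cases "x \<in> lat")
    case True
    then show ?thesis using charac_add[OF chars_charac[OF \<phi>], of "s0 x" "lp a b"]
      by (simp add: sg_def sign_char_def s0_lat mult.commute)
  next
    case False
    then show ?thesis using chars_charac[OF \<phi>] by (simp add: charac_def sg_lat s0_lat)
  qed
  moreover have "s0 m = l \<longleftrightarrow> m = s0 l" by auto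
  ultimately show "glide_op (ebas (\<phi>, l)) e = cscale (sign_char \<phi>) (ebas (refl_char \<phi>, s0 l)) e"
    unfolding e by (simp add: glide_op_def ebas_def cscale_def refl_char_def)
qed

lemma invariants_eq:
  "{F \<in> VT. glide_op F = F} = {F. (\<forall>x. x \<notin> E \<longrightarrow> F x = 0) \<and> (\<forall>x y. r 0 x y \<longrightarrow> F x = F y)}" (is "?L = ?R")
proof (intro equalityI subsetI)
  fix F assume F: "F \<in> ?L"
  have g: "F (sg x, s0 l) = F (x, l)" for x :: plane and l
  proof -
    have "glide_op F (x, l) = F (x, l)" using F by simp
    then show ?thesis by (simp add: glide_op_def)
  qed
  have "F x = F y" if "r 0 x y" for x y
    using that
  proof (cases rule: rE)
    case (tr t w l)
    then show ?thesis using F by (simp add: VT_def)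
  next
    case (gl t w l)
    have "(sg w, s0 l) \<in> E" using gl(2) s0_D by (simp add: E_def sg_lat)
    then have "F (sg w + t, s0 l) = F (sg w, s0 l)" using F gl(1) by (simp add: VT_def)
    then show ?thesis using gl g by simp
  qed
  then show "F \<in> ?R" using F by (simp add: VT_def)
next
  fix F assume F: "F \<in> ?R"
  have "F (x + t, l) = F (x, l)" if "(x, l) \<in> E" "t \<in> trl" for x l t
    using F rI1'[OF that(2,1), of "x + t" 0] by simp
  moreover have "glide_op F e = F e" for e
  proof (cases "e \<in> E")
    case True
    then have "r 0 (sg (fst e), s0 (snd e)) e"
      using rI2'[OF trl_0, of "fst e" "snd e" "sg (fst e)" 0 "s0 (snd e)"] by simp
    then show ?thesis using F unfolding glide_op_def by blast
  next
    case False
    then have "(sg (fst e), s0 (snd e)) \<notin> E"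
      using s0_D[of "s0 (snd e)"] by (auto simp: E_def sg_lat mem_Times_iff)
    then show ?thesis using F False unfolding glide_op_def by (metis (mono_tags, lifting) mem_Collect_eq)
  qed
  ultimately show "F \<in> ?L" using F by (auto simp: VT_def)
qed

lemma invariants_basis:
  "family_basis idx (\<lambda>i. ebas i + glide_op (ebas i))
     {F. (\<forall>x. x \<notin> E \<longrightarrow> F x = 0) \<and> (\<forall>x y. r 0 x y \<longrightarrow> F x = F y)}"
  unfolding invariants_eq[symmetric] idx_def
proof (rule involution_invariants_basis[OF ebas_basis linear_glide_op,
    where q = "\<lambda>i. sign_char (fst i)" and s = "\<lambda>i. (refl_char (fst i), s0 (snd i))" and N = "minus_chars \<times> Fx"])
  let ?s = "\<lambda>i. (refl_char (fst i), s0 (snd i))"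
  let ?J = "chars \<times> H \<union> free_chars \<times> Fx"
  show "glide_op (ebas i) = cscale (sign_char (fst i)) (ebas (?s i))" if "i \<in> chars \<times> D" for i
    using glide_ebas[of "fst i" "snd i"] that by auto
  show "?s i \<in> chars \<times> D" if "i \<in> chars \<times> D" for i using that refl_chars s0_D by auto
  show "?s (?s i) = i" for i :: "(plane \<Rightarrow> complex) \<times> plane" by (simp add: refl_refl)
  show "sign_char (fst i) * sign_char (fst (?s i)) = 1" if "i \<in> chars \<times> D" for i
    using sign_mult that by auto
  have img: "?s ` (A \<times> B) = refl_char ` A \<times> s0 ` B" for A B by force
  have rc: "refl_char ` chars = chars" using refl_chars refl_refl by (metis (no_types, lifting) image_subset_iff subsetI subset_antisym image_eqI)
  have sF: "s0 ` Fx = Fx" using s0_Fx by auto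
  have sJ: "?s ` ?J = chars \<times> s0 ` H \<union> refl_char ` free_chars \<times> Fx"
    unfolding image_Un img rc sF ..
  show "chars \<times> D = ?J \<union> ?s ` ?J \<union> plus_chars \<times> Fx \<union> minus_chars \<times> Fx"
    unfolding sJ using free_chars(2) unfolding D_split by blast
  show "?J \<inter> ?s ` ?J = {}" unfolding sJ using free_chars(3) D_disj by blast
  show "(?J \<union> ?s ` ?J) \<inter> (plus_chars \<times> Fx \<union> minus_chars \<times> Fx) = {}"
    unfolding sJ using free_chars(4) D_disj by blast
  show "plus_chars \<times> Fx \<inter> minus_chars \<times> Fx = {}" using fixed_split(2) by blast
  show "?s i = i \<and> sign_char (fst i) = 1" if "i \<in> plus_chars \<times> Fx" for i
    using that s0_Fx by (auto simp: plus_chars_def fixed_chars_def)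
  show "?s i = i \<and> sign_char (fst i) = - 1" if "i \<in> minus_chars \<times> Fx" for i
    using that s0_Fx by (auto simp: minus_chars_def fixed_chars_def)
qed

lemma idx_chars: "(\<phi>, l) \<in> idx \<Longrightarrow> \<phi> \<in> chars \<and> l \<in> D"
  unfolding idx_def using free_chars(2) D_split by blast

text \<open>One step in the direction attached to the point.\<close>

definition shift :: "plane \<times> plane \<Rightarrow> plane \<times> plane" where "shift e = (fst e + snd e, snd e)"

lemma shift_r: "e \<in> E \<Longrightarrow> r 1 (shift e) e"
  using rI1'[OF trl_0, of "fst e" "snd e" "fst e + snd e" 1] by (simp add: shift_def)

text \<open>The basis vector of \<open>(\<phi>, l)\<close> is an eigenvector of the shift, with eigenvalue \<open>\<phi> l = (\<phi> \<circ> s0) (s0 l)\<close>.\<close>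

lemma invariants_eigen:
  assumes i: "(\<phi>, l) \<in> idx" and e: "e \<in> E"
  shows "(ebas (\<phi>, l) + glide_op (ebas (\<phi>, l))) (shift e) = \<phi> l * (ebas (\<phi>, l) + glide_op (ebas (\<phi>, l))) e"
proof -
  obtain x m where em: "e = (x, m)" by (cases e)
  have \<phi>: "charac \<phi>" using idx_chars[OF i] chars_charac by blast
  have xm: "x \<in> lat" "m \<in> lat" using e D_lat by (auto simp: em E_def)
  have "\<phi> (x + m) = \<phi> x * \<phi> m" "\<phi> (sg x + s0 m) = \<phi> (sg x) * \<phi> (s0 m)"
    using xm by (auto intro!: charac_add[OF \<phi>] simp: sg_lat s0_lat)
  then show ?thesis unfolding em by (auto simp: ebas_def glide_op_def shift_def sg_add distrib_left mult_ac)
qed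

lemma idx_nz: "(\<phi>, l) \<in> idx \<Longrightarrow> \<phi> l \<noteq> 0"
  using idx_chars charac_nz[OF chars_charac] D_lat by blast

lemma idx_product: "(\<Prod>i\<in>idx. 1 - fst i (snd i) * u) = (\<Prod>C\<in>ge.gclasses. 1 - u ^ ge.len C)"
  using invariants_eigen idx_nz
  by (intro ge.shift_product[OF shift_r invariants_basis]) auto

lemma idx_card: "card {i \<in> idx. fst i (snd i) = \<zeta>} = card {C \<in> ge.gclasses. \<zeta> ^ ge.len C = 1}"
  using invariants_eigen idx_nz
  by (intro ge.shift_eigenvalues[OF shift_r invariants_basis]) auto

end

section \<open>Products over the fixed characters\<close>

lemma prod_roots_minus_unity:
  assumes "m > 0"
  shows "(\<Prod>z | z ^ m = - 1. 1 - z * u) = 1 + (u :: complex) ^ m"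
proof -
  have "card {z::complex. z ^ m = - 1} > 0" using assms by (simp add: card_nth_roots)
  then obtain \<omega> :: complex where \<omega>: "\<omega> ^ m = - 1" by (metis (mono_tags, lifting) card_gt_0_iff equals0I mem_Collect_eq)
  then have \<omega>0: "\<omega> \<noteq> 0" using assms by (auto simp: power_0_left)
  have "(\<Prod>z | z ^ m = - 1. 1 - z * u) = (\<Prod>z | z ^ m = 1. 1 - z * (\<omega> * u))"
    by (rule prod.reindex_bij_witness[where i = "\<lambda>z. z * \<omega>" and j = "\<lambda>z. z / \<omega>"])
      (use \<omega> \<omega>0 in \<open>auto simp: power_mult_distrib power_divide mult.assoc\<close>)
  also have "\<dots> = 1 - (\<omega> * u) ^ m" by (rule prod_roots_unity[OF assms])
  also have "\<dots> = 1 + u ^ m" by (simp add: power_mult_distrib \<omega>)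
  finally show ?thesis .
qed

context klein_lattice begin

text \<open>The exponent \<open>k / n\<close>, an integer because \<open>k = 2 a + n b\<close>.\<close>

definition kn :: nat where "kn = k div n"

lemma n_pos: "n > 0" using n_cases by auto

lemma n_kn: "n * kn = k"
proof -
  have "n dvd k"
  proof (cases "n = 1")
    case False
    then have "n = 2" using n_cases by simp
    then have "int n dvd int k" unfolding k_eq by simp
    then show ?thesis by (simp only: int_dvd_int_iff)
  qed simp
  then show ?thesis by (simp add: kn_def)
qed

lemma kn_pos: "kn > 0" using k_pos n_kn by (metis gr0I mult_0_right)

text \<open>A character fixed by the reflection is given by its values \<open>y\<close> at \<open>\<beta>\<close> and \<open>p\<close> at \<open>\<alpha>\<close>, which satisfy
  \<open>p\<^sup>n = y\<^sup>2\<close> because the reflection maps \<open>\<beta>\<close> to \<open>n \<alpha> - \<beta>\<close>. Its sign is \<open>y\<close> to the power \<open>k / n\<close>.\<close>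

lemma sign_chr:
  assumes "p ^ n = y\<^sup>2" "y \<noteq> 0" "p \<noteq> 0"
  shows "sign_char (chr p y) = y ^ kn"
proof -
  have "p powi a * y powi b = y powi int kn"
  proof (cases "n = 1")
    case True
    then have "p powi a = y powi (2 * a)" using assms by (simp add: power_int_mult)
    then have "p powi a * y powi b = y powi (2 * a + b)" using assms by (simp add: power_int_add)
    then show ?thesis using True k_eq n_kn by simp
  next
    case False
    then have n2: "n = 2" using n_cases by simp
    \<comment> \<open>Here \<open>y\<close> determines \<open>p\<close> only up to sign, so that \<open>a\<close> has to be even.\<close>
    then obtain a' where a': "a = 2 * a'" using even_a by (auto elim: evenE)
    have "p powi a = y powi a" using assms n2 unfolding a' by (simp add: power_int_mult)
    then have "p powi a * y powi b = y powi (a + b)" using assms by (simp add: power_int_add)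
    moreover have "a + b = int kn" using k_eq n_kn n2 by simp
    ultimately show ?thesis by simp
  qed
  then show ?thesis by (simp add: sign_char_def)
qed

lemma chr_fixed:
  assumes p: "p ^ n = y\<^sup>2" and y: "y ^ (2 * kn) = 1"
  shows "chr p y \<in> fixed_chars"
proof -
  have nz: "y \<noteq> 0" "p \<noteq> 0" using y kn_pos p n_pos by (auto simp: power_0_left split: if_splits)
  have "p ^ (n * kn) = 1" by (simp only: power_mult p y[unfolded power_mult])
  then have pk: "p ^ k = 1" by (simp only: n_kn)
  have ch: "charac (chr p y)" using nz by (intro charac_chr)
  have "chr p y t = 1" if t: "t \<in> trl" for t
  proof -
    obtain i j where "t = lp (i * int k - j * c * int n) (2 * j * c)" using t by (auto simp: trl_def)
    then have "chr p y t = p powi (i * int k - j * c * int n) * y powi (2 * j * c)" by (simp only: chr_lp)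
    also have "i * int k - j * c * int n = int k * i - int n * (j * c)" by simp
    also have "2 * j * c = 2 * (j * c)" by simp
    also have "p powi (int k * i - int n * (j * c)) = p powi (int k * i) * inverse (p powi (int n * (j * c)))"
      using nz by (simp only: power_int_diff divide_inverse simp_thms)
    also have "p powi (int k * i) = 1" using pk by (simp add: power_int_mult)
    also have "p powi (int n * (j * c)) = y powi (2 * (j * c))" using p by (simp add: power_int_mult)
    finally show ?thesis using nz by simp
  qed
  then have "chr p y \<in> chars" using ch by (simp add: chars_def)
  moreover have "refl_char (chr p y) = chr p y"
  proof (rule charac_eqI[OF refl_charac[OF ch] ch])
    show "refl_char (chr p y) \<alpha> = chr p y \<alpha>" by (simp add: refl_char_def s0_\<alpha>)
    show "refl_char (chr p y) \<beta> = chr p y \<beta>"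
      using nz p by (simp add: refl_char_def s0_\<beta> power_int_minus power2_eq_square field_simps)
  qed
  ultimately show ?thesis by (simp add: fixed_chars_def)
qed

lemma fixed_chr:
  assumes "\<phi> \<in> fixed_chars"
  shows "\<phi> \<alpha> ^ n = (\<phi> \<beta>)\<^sup>2" "\<phi> \<beta> ^ (2 * kn) = 1" "\<phi> = chr (\<phi> \<alpha>) (\<phi> \<beta>)" "\<phi> \<alpha> \<noteq> 0" "\<phi> \<beta> \<noteq> 0"
proof -
  have \<phi>: "\<phi> \<in> chars" "refl_char \<phi> = \<phi>" using assms by (auto simp: fixed_chars_def)
  have ch: "charac \<phi>" by (rule chars_charac[OF \<phi>(1)])
  show nz: "\<phi> \<alpha> \<noteq> 0" "\<phi> \<beta> \<noteq> 0" using charac_nz[OF ch] by auto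
  show "\<phi> = chr (\<phi> \<alpha>) (\<phi> \<beta>)" by (rule charac_chr_eq[OF ch])
  have "refl_char \<phi> \<beta> = \<phi> \<beta>" using \<phi> by simp
  then have "\<phi> \<alpha> ^ n * inverse (\<phi> \<beta>) = \<phi> \<beta>"
    by (simp add: refl_char_def s0_\<beta> charac_lp[OF ch] power_int_minus)
  then show 1: "\<phi> \<alpha> ^ n = (\<phi> \<beta>)\<^sup>2" using nz by (simp add: field_simps power2_eq_square)
  have "\<phi> (lp (int k) 0) = 1" using \<phi>(1) trl_k by (simp add: chars_def)
  then have "\<phi> \<alpha> ^ (n * kn) = 1" by (simp add: charac_lp[OF ch] n_kn)
  then show "\<phi> \<beta> ^ (2 * kn) = 1" by (simp only: power_mult 1)
qed

lemma sign_chars_bij: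
  assumes "s = 1 \<or> s = - 1"
  shows "bij_betw (\<lambda>(y, p). chr p y) (SIGMA y:{y. y ^ kn = s}. {p. p ^ n = y\<^sup>2}) {\<phi> \<in> fixed_chars. sign_char \<phi> = s}"
proof (rule bij_betw_byWitness[where f' = "\<lambda>\<phi>. (\<phi> \<beta>, \<phi> \<alpha>)"])
  let ?S = "SIGMA y:{y. y ^ kn = s}. {p. p ^ n = y\<^sup>2}"
  have s2: "s\<^sup>2 = 1" using assms by auto
  show "\<forall>x\<in>?S. ((case x of (y, p) \<Rightarrow> chr p y) \<beta>, (case x of (y, p) \<Rightarrow> chr p y) \<alpha>) = x" by auto
  show "\<forall>\<phi>\<in>{\<phi> \<in> fixed_chars. sign_char \<phi> = s}. (case (\<phi> \<beta>, \<phi> \<alpha>) of (y, p) \<Rightarrow> chr p y) = \<phi>"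
    using fixed_chr(3) by auto
  show "(\<lambda>(y, p). chr p y) ` ?S \<subseteq> {\<phi> \<in> fixed_chars. sign_char \<phi> = s}"
  proof
    fix x assume "x \<in> (\<lambda>(y, p). chr p y) ` ?S"
    then obtain y p where x: "x = chr p y" and y: "y ^ kn = s" and p: "p ^ n = y\<^sup>2" by auto
    have "y ^ (2 * kn) = 1" using y s2 by (metis mult.commute power_mult)
    from chr_fixed[OF p this] have f: "chr p y \<in> fixed_chars" .
    then show "x \<in> {\<phi> \<in> fixed_chars. sign_char \<phi> = s}"
      using sign_chr[OF p] y fixed_chr(4,5)[OF f] x by simp
  qed
  show "(\<lambda>\<phi>. (\<phi> \<beta>, \<phi> \<alpha>)) ` {\<phi> \<in> fixed_chars. sign_char \<phi> = s} \<subseteq> ?S"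
  proof
    fix x assume "x \<in> (\<lambda>\<phi>. (\<phi> \<beta>, \<phi> \<alpha>)) ` {\<phi> \<in> fixed_chars. sign_char \<phi> = s}"
    then obtain \<phi> where x: "x = (\<phi> \<beta>, \<phi> \<alpha>)" and \<phi>: "\<phi> \<in> fixed_chars" "sign_char \<phi> = s" by auto
    have "sign_char \<phi> = \<phi> \<beta> ^ kn"
      using sign_chr[OF fixed_chr(1,5,4)[OF \<phi>(1)]] fixed_chr(3)[OF \<phi>(1)] by simp
    then show "x \<in> ?S" using fixed_chr(1)[OF \<phi>(1)] \<phi>(2) x by simp
  qed
qed

lemma sign_chars_prod:
  assumes s: "s = 1 \<or> s = - 1"
  shows "(\<Prod>\<phi>\<in>{\<phi> \<in> fixed_chars. sign_char \<phi> = s}. (g (\<phi> \<beta>) (\<phi> \<alpha>) :: complex)) =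
    (\<Prod>y | y ^ kn = s. \<Prod>p | p ^ n = y\<^sup>2. g y p)"
proof -
  let ?S = "SIGMA y:{y. y ^ kn = s}. {p. p ^ n = y\<^sup>2}"
  have fin: "finite {y::complex. y ^ kn = s}" using kn_pos by (rule finite_nth_roots)
  have fin': "finite {p::complex. p ^ n = y\<^sup>2}" for y using n_pos by (rule finite_nth_roots)
  have "(\<Prod>\<phi>\<in>{\<phi> \<in> fixed_chars. sign_char \<phi> = s}. g (\<phi> \<beta>) (\<phi> \<alpha>)) = (\<Prod>(y, p)\<in>?S. g y p)"
    unfolding prod.reindex_bij_betw[OF sign_chars_bij[OF s], symmetric] by (rule prod.cong) auto
  also have "\<dots> = (\<Prod>y | y ^ kn = s. \<Prod>p | p ^ n = y\<^sup>2. g y p)"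
    by (rule prod.Sigma[symmetric]) (use fin fin' in auto)
  finally show ?thesis .
qed

text \<open>The products over the fixed characters of sign \<open>s\<close> for the directions \<open>\<beta>\<close> and \<open>- \<beta>\<close>.\<close>

lemma sign_chars_prod_\<beta>:
  assumes s: "s = 1 \<or> s = - 1"
  shows "(\<Prod>\<phi>\<in>{\<phi> \<in> fixed_chars. sign_char \<phi> = s}. 1 - \<phi> \<beta> * u) = (1 - s * u ^ kn) ^ n"
    and "(\<Prod>\<phi>\<in>{\<phi> \<in> fixed_chars. sign_char \<phi> = s}. 1 - \<phi> (- \<beta>) * u) = (1 - s * u ^ kn) ^ n"
proof -
  have nz: "y \<noteq> 0" if "y ^ kn = s" for y using that s kn_pos by (auto simp: power_0_left split: if_splits)
  have root: "(\<Prod>y | y ^ kn = s. 1 - y * u) = 1 - s * u ^ kn"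
    using s prod_roots_unity[OF kn_pos, of u] prod_roots_minus_unity[OF kn_pos, of u] by auto
  have inv: "(\<Prod>y | y ^ kn = s. 1 - inverse y * u) = (\<Prod>y | y ^ kn = s. 1 - y * u)"
    by (rule prod.reindex_bij_witness[where i = inverse and j = inverse]) (use s in \<open>auto simp: power_inverse\<close>)
  have card: "card {p::complex. p ^ n = y\<^sup>2} = n" if "y ^ kn = s" for y
    using nz[OF that] n_pos by (intro card_nth_roots) auto
  have gen: "(\<Prod>\<phi>\<in>{\<phi> \<in> fixed_chars. sign_char \<phi> = s}. 1 - h (\<phi> \<beta>) * u) = (\<Prod>y | y ^ kn = s. 1 - h y * u) ^ n" for h
    unfolding sign_chars_prod[OF s, of "\<lambda>y p. 1 - h y * u"] prod_power_distrib
    by (rule prod.cong) (auto simp: card)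
  show "(\<Prod>\<phi>\<in>{\<phi> \<in> fixed_chars. sign_char \<phi> = s}. 1 - \<phi> \<beta> * u) = (1 - s * u ^ kn) ^ n"
    using gen[of "\<lambda>y. y"] root by simp
  have "(\<Prod>\<phi>\<in>{\<phi> \<in> fixed_chars. sign_char \<phi> = s}. 1 - \<phi> (- \<beta>) * u) =
    (\<Prod>\<phi>\<in>{\<phi> \<in> fixed_chars. sign_char \<phi> = s}. 1 - inverse (\<phi> \<beta>) * u)"
    by (rule prod.cong) (auto simp: charac_minus[OF chars_charac] fixed_chars_def)
  then show "(\<Prod>\<phi>\<in>{\<phi> \<in> fixed_chars. sign_char \<phi> = s}. 1 - \<phi> (- \<beta>) * u) = (1 - s * u ^ kn) ^ n"
    using gen[of inverse] inv root by simp
qed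

text \<open>As \<open>e n = 2\<close>, the vector \<open>\<gamma> = e \<beta> - \<alpha>\<close> is orthogonal to \<open>\<alpha>\<close>. For this direction the product does not depend on the sign.\<close>

lemma sign_chars_prod_orthogonal:
  assumes s: "s = 1 \<or> s = - 1" and e: "e * n = 2" and \<gamma>: "\<gamma> = lp (- 1) (int e)"
  shows "(\<Prod>\<phi>\<in>{\<phi> \<in> fixed_chars. sign_char \<phi> = s}. 1 - \<phi> \<gamma> * u) = (\<Prod>q | q ^ n = 1. 1 - inverse q * u) ^ kn"
proof -
  have nz: "y \<noteq> 0" if "y ^ kn = s" for y using that s kn_pos by (auto simp: power_0_left split: if_splits)
  have "(\<Prod>\<phi>\<in>{\<phi> \<in> fixed_chars. sign_char \<phi> = s}. 1 - \<phi> \<gamma> * u) =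
    (\<Prod>\<phi>\<in>{\<phi> \<in> fixed_chars. sign_char \<phi> = s}. 1 - \<phi> \<beta> ^ e * inverse (\<phi> \<alpha>) * u)"
    by (rule prod.cong) (auto simp: \<gamma> charac_lp[OF chars_charac] fixed_chars_def power_int_minus)
  also have "\<dots> = (\<Prod>y | y ^ kn = s. \<Prod>p | p ^ n = y\<^sup>2. 1 - y ^ e * inverse p * u)"
    by (rule sign_chars_prod[OF s, of "\<lambda>y p. 1 - y ^ e * inverse p * u"])
  also have "\<dots> = (\<Prod>y::complex | y ^ kn = s. \<Prod>q | q ^ n = 1. 1 - inverse q * u)"
  proof (rule prod.cong[OF refl])
    fix y :: complex assume "y \<in> {y. y ^ kn = s}"
    then have y: "y \<noteq> 0" using nz by simp
    have ye: "(y ^ e) ^ n = y\<^sup>2" by (simp add: e flip: power_mult)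
    show "(\<Prod>p | p ^ n = y\<^sup>2. 1 - y ^ e * inverse p * u) = (\<Prod>q | q ^ n = 1. 1 - inverse q * u)"
      by (rule prod.reindex_bij_witness[where i = "\<lambda>q. y ^ e * q" and j = "\<lambda>p. p / y ^ e"])
        (use y ye in \<open>auto simp: power_mult_distrib power_divide field_simps\<close>)
  qed
  also have "\<dots> = (\<Prod>q | q ^ n = 1. 1 - inverse q * u) ^ kn"
    using s kn_pos by (simp add: card_nth_roots) (metis card_nth_roots neg_equal_0_iff_equal zero_neq_one)
  finally show ?thesis .
qed

lemma chars_norm_less: "\<phi> \<in> chars \<Longrightarrow> x \<in> lat \<Longrightarrow> norm u \<noteq> 1 \<Longrightarrow> 1 - \<phi> x * u \<noteq> 0"
  using chars_norm[of \<phi> x] by (metis eq_iff_diff_eq_0 mult_1 norm_mult norm_one)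

end

context klein_directions begin

text \<open>The two bases compared: characters modulo reflection with all directions on the left, pairs \<open>(\<phi>, l)\<close>
  modulo reflection on the right.\<close>

lemma spherical_product:
  "(\<Prod>\<phi>\<in>free_chars \<union> plus_chars. \<Prod>l\<in>D. 1 - \<phi> l * u) * (\<Prod>\<phi>\<in>minus_chars. \<Prod>l\<in>H. 1 - \<phi> l * u)
   = (\<Prod>i\<in>idx. 1 - fst i (snd i) * u) * (\<Prod>\<phi>\<in>plus_chars. \<Prod>l\<in>H. 1 - \<phi> l * u)"
proof -
  \<comment> \<open>For \<open>l\<close> in \<open>s0 ` H\<close> the value \<open>\<phi> l\<close> is that of \<open>refl_char \<phi>\<close> at \<open>s0 l \<in> H\<close>, so everything is expressed in \<open>f\<close> and \<open>g\<close>.\<close>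
  define g where "g \<phi> = (\<Prod>l\<in>H. 1 - \<phi> l * u)" for \<phi> :: "plane \<Rightarrow> complex"
  define f where "f \<phi> = (\<Prod>l\<in>Fx. 1 - \<phi> l * u)" for \<phi> :: "plane \<Rightarrow> complex"
  have fin: "finite H" "finite Fx" using fin_D unfolding D_split by auto
  have injs: "inj_on s0 H" by (rule inj_on_inverseI[of _ s0]) simp
  have D: "(\<Prod>l\<in>D. 1 - \<phi> l * u) = f \<phi> * (g \<phi> * g (refl_char \<phi>))" for \<phi>
  proof -
    have "(\<Prod>l\<in>D. 1 - \<phi> l * u) = f \<phi> * (\<Prod>l\<in>H \<union> s0 ` H. 1 - \<phi> l * u)"
      unfolding D_split Un_assoc f_def using fin D_disj by (intro prod.union_disjoint) auto
    also have "(\<Prod>l\<in>H \<union> s0 ` H. 1 - \<phi> l * u) = g \<phi> * (\<Prod>l\<in>s0 ` H. 1 - \<phi> l * u)"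
      unfolding g_def using fin D_disj by (intro prod.union_disjoint) auto
    finally show ?thesis by (simp add: prod.reindex[OF injs] g_def refl_char_def)
  qed
  have rp: "refl_char \<phi> = \<phi>" if "\<phi> \<in> plus_chars" for \<phi> using that by (simp add: plus_chars_def fixed_chars_def)
  have un: "(\<Prod>\<phi>\<in>free_chars \<union> plus_chars. h \<phi>) = (\<Prod>\<phi>\<in>free_chars. h \<phi>) * (\<Prod>\<phi>\<in>plus_chars. h \<phi>)"
    for h :: "(plane \<Rightarrow> complex) \<Rightarrow> complex"
    using finite_char_parts free_chars(4) by (intro prod.union_disjoint) auto
  have ch: "(\<Prod>\<phi>\<in>chars. h \<phi>) = (\<Prod>\<phi>\<in>free_chars. h \<phi>) * (\<Prod>\<phi>\<in>free_chars. h (refl_char \<phi>)) *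
      ((\<Prod>\<phi>\<in>plus_chars. h \<phi>) * (\<Prod>\<phi>\<in>minus_chars. h \<phi>))" for h :: "(plane \<Rightarrow> complex) \<Rightarrow> complex"
  proof -
    have "(\<Prod>\<phi>\<in>chars. h \<phi>) = (\<Prod>\<phi>\<in>free_chars \<union> refl_char ` free_chars. h \<phi>) * (\<Prod>\<phi>\<in>plus_chars \<union> minus_chars. h \<phi>)"
      unfolding free_chars(2) using finite_char_parts free_chars(4) by (intro prod.union_disjoint) auto
    also have "(\<Prod>\<phi>\<in>plus_chars \<union> minus_chars. h \<phi>) = (\<Prod>\<phi>\<in>plus_chars. h \<phi>) * (\<Prod>\<phi>\<in>minus_chars. h \<phi>)"
      using finite_char_parts fixed_split(2) by (intro prod.union_disjoint) auto
    also have "(\<Prod>\<phi>\<in>free_chars \<union> refl_char ` free_chars. h \<phi>) = (\<Prod>\<phi>\<in>free_chars. h \<phi>) * (\<Prod>\<phi>\<in>refl_char ` free_chars. h \<phi>)"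
      using finite_char_parts free_chars(3) by (intro prod.union_disjoint) auto
    finally show ?thesis by (simp add: prod.reindex[OF refl_inj])
  qed
  have I: "(\<Prod>i\<in>idx. 1 - fst i (snd i) * u) = (\<Prod>\<phi>\<in>chars. g \<phi>) * (\<Prod>\<phi>\<in>free_chars \<union> plus_chars. f \<phi>)"
  proof -
    have idx: "idx = chars \<times> H \<union> (free_chars \<union> plus_chars) \<times> Fx" unfolding idx_def by blast
    have "(\<Prod>i\<in>idx. 1 - fst i (snd i) * u) = (\<Prod>i\<in>chars \<times> H. 1 - fst i (snd i) * u) *
      (\<Prod>i\<in>(free_chars \<union> plus_chars) \<times> Fx. 1 - fst i (snd i) * u)"
      unfolding idx using fin finite_chars finite_char_parts D_disj by (intro prod.union_disjoint) auto
    then show ?thesis by (simp add: prod.cartesian_product case_prod_beta g_def f_def)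
  qed
  have pp: "(\<Prod>\<phi>\<in>plus_chars. g (refl_char \<phi>)) = (\<Prod>\<phi>\<in>plus_chars. g \<phi>)"
    by (rule prod.cong) (simp_all add: rp)
  show ?thesis unfolding D I un ch g_def[symmetric] prod.distrib pp by (simp add: mult_ac)
qed

end

section \<open>The group and its cosets\<close>

lemma transl_comp: "transl x \<circ> transl y = transl (x + y)"
  by (auto simp: transl_def fun_eq_iff algebra_simps)
lemma transl_0: "transl 0 = id" by (auto simp: transl_def)
lemma transl_apply: "transl x y = y + x" by (simp add: transl_def)

context klein_frame begin

text \<open>The Klein bottle group: its translations and its glide reflections.\<close>

definition glide_group :: "(plane \<Rightarrow> plane) set" where
  "glide_group = transl ` trl \<union> (\<lambda>t. transl t \<circ> sg) ` trl"

lemma glide_group_transl: "t \<in> trl \<Longrightarrow> transl t \<in> glide_group" unfolding glide_group_def by blast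
lemma glide_group_glide: "t \<in> trl \<Longrightarrow> transl t \<circ> sg \<in> glide_group" unfolding glide_group_def by blast
lemma glide_group_E:
  assumes "\<gamma> \<in> glide_group" obtains (tr) t where "t \<in> trl" "\<gamma> = transl t" | (gl) t where "t \<in> trl" "\<gamma> = transl t \<circ> sg"
  using assms unfolding glide_group_def by blast
lemma sg_transl: "sg \<circ> transl t = transl (s0 t) \<circ> sg" by (auto simp: transl_def sg_add)
lemma sg_comp: "sg \<circ> sg = transl (lp (int k) 0)" by (auto simp: transl_def sg_sg)
lemma glide_group_comp: assumes "\<gamma> \<in> glide_group" "\<delta> \<in> glide_group" shows "\<gamma> \<circ> \<delta> \<in> glide_group"
  using assms(1)
proof (cases rule: glide_group_E)
  case t: (tr t)
  show ?thesis using assms(2)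
  proof (cases rule: glide_group_E)
    case (tr t')
    then show ?thesis using t by (simp only: transl_comp glide_group_transl trl_add)
  next
    case (gl t')
    then show ?thesis using t by (simp only: o_assoc transl_comp glide_group_glide trl_add)
  qed
next
  case t: (gl t)
  show ?thesis using assms(2)
  proof (cases rule: glide_group_E)
    case (tr t')
    have "\<gamma> \<circ> \<delta> = transl (t + s0 t') \<circ> sg" unfolding t tr
      by (metis comp_assoc sg_transl transl_comp)
    then show ?thesis using t tr by (simp only: glide_group_glide trl_add trl_s0)
  next
    case (gl t')
    have "\<gamma> \<circ> \<delta> = transl (t + s0 t' + lp (int k) 0)" unfolding t gl
      by (metis comp_assoc sg_transl transl_comp sg_comp)
    then show ?thesis using t gl by (simp only: glide_group_transl trl_add trl_s0 trl_k)
  qed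
qed
lemma glide_group_inv: assumes "\<gamma> \<in> glide_group" shows "\<exists>\<delta>\<in>glide_group. \<gamma> \<circ> \<delta> = id \<and> \<delta> \<circ> \<gamma> = id"
  using assms
proof (cases rule: glide_group_E)
  case (tr t)
  then show ?thesis
    by (intro bexI[of _ "transl (- t)"]) (simp_all add: transl_comp transl_0 glide_group_transl trl_minus)
next
  case (gl t)
  let ?u = "- s0 t - lp (int k) 0"
  have u: "?u \<in> trl" using trl_add[OF trl_minus[OF trl_s0[OF gl(1)]] trl_minus[OF trl_k]] by simp
  have sk: "s0 (lp (int k) 0) = lp (int k) 0" by (simp add: s0_lp)
  have "\<gamma> \<circ> (transl ?u \<circ> sg) = id" "(transl ?u \<circ> sg) \<circ> \<gamma> = id"
    unfolding gl by (auto simp: fun_eq_iff transl_apply sg_add sg_sg linear_diff[OF linear_s0] s0_minus sk)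
  then show ?thesis using glide_group_glide[OF u] by blast
qed

end

text \<open>The group in the apartment of \<open>G\<close>, whose Weyl group is a finite group of linear maps preserving the lattice and
  contains the reflection.\<close>

locale klein_rep = klein_lattice +
  fixes G :: grp and \<Gamma> :: "(plane \<Rightarrow> plane) set"
  assumes lat_G: "coweight_lattice G = lat"
    and W_linear: "w \<in> weyl G \<Longrightarrow> linear w"
    and W_lat: "w \<in> weyl G \<Longrightarrow> x \<in> lat \<Longrightarrow> w x \<in> lat"
    and W_id: "id \<in> weyl G"
    and W_comp: "w \<in> weyl G \<Longrightarrow> w' \<in> weyl G \<Longrightarrow> w \<circ> w' \<in> weyl G"
    and W_inv: "w \<in> weyl G \<Longrightarrow> \<exists>w'\<in>weyl G. w \<circ> w' = id \<and> w' \<circ> w = id"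
    and W_finite: "finite (weyl G)"
    and W_s0: "s0 \<in> weyl G"
    and \<Gamma>_eq: "\<Gamma> = glide_group"
begin

lemma W_transl: "w \<in> weyl G \<Longrightarrow> w \<circ> transl x = transl (w x) \<circ> w"
  using W_linear by (auto simp: transl_def fun_eq_iff linear_add)
lemma W_0: "w \<in> weyl G \<Longrightarrow> w 0 = 0" using W_linear linear_0 by blast

lemma Wext_I: "x \<in> lat \<Longrightarrow> w \<in> weyl G \<Longrightarrow> transl x \<circ> w \<in> W_ext G"
  unfolding W_ext_def lat_G by blast
lemma Wext_E:
  assumes "g \<in> W_ext G" obtains x w where "x \<in> lat" "w \<in> weyl G" "g = transl x \<circ> w"
  using assms unfolding W_ext_def lat_G by blast
lemma transl_Wext: "x \<in> lat \<Longrightarrow> transl x \<in> W_ext G" using Wext_I[OF _ W_id] by simp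
lemma W_Wext: "w \<in> weyl G \<Longrightarrow> w \<in> W_ext G" using Wext_I[OF lat_0] by (simp add: transl_0)
lemma comp_form: "w \<in> weyl G \<Longrightarrow> (transl x \<circ> w) \<circ> (transl y \<circ> w') = transl (x + w y) \<circ> (w \<circ> w')"
  using W_linear[of w] by (simp add: transl_def fun_eq_iff linear_add)
lemma Wext_comp: assumes "g \<in> W_ext G" "h \<in> W_ext G" shows "g \<circ> h \<in> W_ext G"
proof -
  obtain x w where x: "x \<in> lat" "w \<in> weyl G" "g = transl x \<circ> w" using assms(1) by (rule Wext_E)
  obtain y w' where y: "y \<in> lat" "w' \<in> weyl G" "h = transl y \<circ> w'" using assms(2) by (rule Wext_E)
  show ?thesis unfolding x(3) y(3) comp_form[OF x(2)]
    by (rule Wext_I[OF lat_add[OF x(1) W_lat[OF x(2) y(1)]] W_comp[OF x(2) y(2)]])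
qed
lemma Wext_inv: assumes "g \<in> W_ext G" shows "\<exists>h\<in>W_ext G. g \<circ> h = id \<and> h \<circ> g = id"
proof -
  obtain x w where x: "x \<in> lat" "w \<in> weyl G" "g = transl x \<circ> w" using assms by (rule Wext_E)
  obtain w' where w': "w' \<in> weyl G" "w \<circ> w' = id" "w' \<circ> w = id" using W_inv[OF x(2)] by blast
  let ?h = "transl (w' (- x)) \<circ> w'"
  have "?h \<in> W_ext G" by (rule Wext_I[OF W_lat[OF w'(1) lat_minus[OF x(1)]] w'(1)])
  moreover have "w (w' (- x)) = - x" using w'(2) by (metis comp_apply id_apply)
  moreover have "w' (- x) + w' x = 0" using W_linear[OF w'(1)] by (simp add: linear_neg)
  ultimately show ?thesis unfolding x(3)
    by (intro bexI[of _ ?h]) (simp_all add: comp_form x(2) w' transl_0)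
qed
lemma Wext_0: "g \<in> W_ext G \<Longrightarrow> g 0 \<in> lat" by (elim Wext_E) (simp add: transl_def W_0)
lemma Wext_fix0: "g \<in> W_ext G \<Longrightarrow> g 0 = 0 \<Longrightarrow> g \<in> weyl G"
  by (elim Wext_E) (auto simp: transl_apply W_0 transl_0)
lemma Wext_form: "g \<in> W_ext G \<Longrightarrow> \<exists>w\<in>weyl G. g = transl (g 0) \<circ> w"
  by (elim Wext_E) (auto simp: transl_apply W_0)
lemma Wext_comp_iff: assumes "h \<in> W_ext G" shows "g \<circ> h \<in> W_ext G \<longleftrightarrow> g \<in> W_ext G"
proof
  assume gh: "g \<circ> h \<in> W_ext G"
  obtain h' where h': "h' \<in> W_ext G" "h \<circ> h' = id" using Wext_inv[OF assms] by blast
  have "(g \<circ> h) \<circ> h' = g" using h'(2) by (simp add: comp_assoc)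
  then show "g \<in> W_ext G" using Wext_comp[OF gh h'(1)] by simp
qed (rule Wext_comp[OF _ assms])

lemma sg_form: "transl t \<circ> sg = transl (t + lp a b) \<circ> s0"
  by (auto simp: transl_def sg_def fun_eq_iff algebra_simps)
lemma \<Gamma>_transl: "t \<in> trl \<Longrightarrow> transl t \<in> \<Gamma>" unfolding \<Gamma>_eq glide_group_def by blast
lemma \<Gamma>_glide: "t \<in> trl \<Longrightarrow> transl t \<circ> sg \<in> \<Gamma>" unfolding \<Gamma>_eq glide_group_def by blast
lemma \<Gamma>_E:
  assumes "\<gamma> \<in> \<Gamma>" obtains (tr) t where "t \<in> trl" "\<gamma> = transl t" | (gl) t where "t \<in> trl" "\<gamma> = transl t \<circ> sg"
  using assms unfolding \<Gamma>_eq glide_group_def by blast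
lemma \<Gamma>_Wext: "\<gamma> \<in> \<Gamma> \<Longrightarrow> \<gamma> \<in> W_ext G"
  by (erule \<Gamma>_E) (simp_all only: sg_form transl_Wext trl_lat Wext_I lat_add lp_in W_s0)
lemma \<Gamma>_comp: "\<gamma> \<in> \<Gamma> \<Longrightarrow> \<delta> \<in> \<Gamma> \<Longrightarrow> \<gamma> \<circ> \<delta> \<in> \<Gamma>"
  unfolding \<Gamma>_eq by (rule glide_group_comp)
lemma \<Gamma>_inv: "\<gamma> \<in> \<Gamma> \<Longrightarrow> \<exists>\<delta>\<in>\<Gamma>. \<gamma> \<circ> \<delta> = id \<and> \<delta> \<circ> \<gamma> = id"
  unfolding \<Gamma>_eq by (rule glide_group_inv)
lemma \<Gamma>_id: "id \<in> \<Gamma>" using \<Gamma>_transl[OF trl_0] by (simp add: transl_0)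

section \<open>Complete reducibility\<close>

text \<open>The cosets \<open>\<Gamma> g\<close> in \<open>W\<^sub>e\<^sub>x\<^sub>t\<close>, and a choice of representatives.\<close>

definition gcosets :: "(plane \<Rightarrow> plane) set set" where
  "gcosets = {{\<gamma> \<circ> g | \<gamma>. \<gamma> \<in> \<Gamma>} | g. g \<in> W_ext G}"
definition gcoset :: "(plane \<Rightarrow> plane) \<Rightarrow> (plane \<Rightarrow> plane) set" where "gcoset g = {\<gamma> \<circ> g | \<gamma>. \<gamma> \<in> \<Gamma>}"
definition rep :: "(plane \<Rightarrow> plane) set \<Rightarrow> plane \<Rightarrow> plane" where "rep C = (SOME g. g \<in> C)"

lemma gcoset_in: "g \<in> W_ext G \<Longrightarrow> gcoset g \<in> gcosets" by (auto simp: gcosets_def gcoset_def)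
lemma gcosets_E: assumes "C \<in> gcosets" obtains g where "g \<in> W_ext G" "C = gcoset g" using assms by (auto simp: gcosets_def gcoset_def)
lemma gcoset_self: "g \<in> gcoset g" using \<Gamma>_id unfolding gcoset_def by (intro CollectI exI[of _ id]) simp
lemma gcoset_eq: assumes "\<gamma> \<in> \<Gamma>" shows "gcoset (\<gamma> \<circ> g) = gcoset g"
proof -
  obtain \<delta> where \<delta>: "\<delta> \<in> \<Gamma>" "\<delta> \<circ> \<gamma> = id" using \<Gamma>_inv[OF assms] by blast
  show ?thesis
  proof (intro equalityI subsetI)
    fix x assume "x \<in> gcoset (\<gamma> \<circ> g)"
    then show "x \<in> gcoset g" using \<Gamma>_comp[OF _ assms] unfolding gcoset_def by (auto simp: o_assoc)
  next
    fix x assume "x \<in> gcoset g"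
    then obtain \<eta> where "\<eta> \<in> \<Gamma>" "x = \<eta> \<circ> g" unfolding gcoset_def by auto
    then have "x = (\<eta> \<circ> \<delta>) \<circ> (\<gamma> \<circ> g)" "\<eta> \<circ> \<delta> \<in> \<Gamma>" using \<delta> \<Gamma>_comp by (metis comp_assoc comp_id, blast)
    then show "x \<in> gcoset (\<gamma> \<circ> g)" unfolding gcoset_def by blast
  qed
qed
lemma rep_in: "C \<in> gcosets \<Longrightarrow> rep C \<in> C" unfolding rep_def by (erule gcosets_E) (metis gcoset_self someI)
lemma rep_gcoset: assumes "g \<in> W_ext G" obtains \<gamma> where "\<gamma> \<in> \<Gamma>" "rep (gcoset g) = \<gamma> \<circ> g"
  using rep_in[OF gcoset_in[OF assms]] unfolding gcoset_def by auto
lemma rep_Wext: "C \<in> gcosets \<Longrightarrow> rep C \<in> W_ext G"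
  by (metis gcosets_E rep_gcoset \<Gamma>_Wext Wext_comp)
lemma gcoset_rep: assumes "C \<in> gcosets" shows "gcoset (rep C) = C"
proof -
  obtain g where g: "g \<in> W_ext G" "C = gcoset g" using assms by (rule gcosets_E)
  then show ?thesis using rep_gcoset[OF g(1)] gcoset_eq by metis
qed

lemma finite_gcosets: "finite gcosets"
proof -
  let ?B = "(\<lambda>(p, q, w). gcoset (transl (lp p q) \<circ> w)) ` ({0..<int M} \<times> {0..<int M} \<times> weyl G)"
  have "gcosets \<subseteq> ?B"
  proof
    fix C assume "C \<in> gcosets"
    then obtain g where g: "g \<in> W_ext G" "C = gcoset g" by (rule gcosets_E)
    obtain x w where x: "x \<in> lat" "w \<in> weyl G" "g = transl x \<circ> w" using g(1) by (rule Wext_E)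
    obtain p q where x': "x = lp p q" using x(1) by (rule latE)
    have t: "of_nat M *\<^sub>R lp (p div int M) (q div int M) \<in> trl" (is "?t \<in> _") by (rule M_trl) simp
    have "x = ?t + lp (p mod int M) (q mod int M)"
      using lp_scale[of "int M"] by (simp add: lp_add x')
    then have "g = transl ?t \<circ> (transl (lp (p mod int M) (q mod int M)) \<circ> w)"
      unfolding x(3) by (metis comp_assoc transl_comp)
    then have "C = gcoset (transl (lp (p mod int M) (q mod int M)) \<circ> w)"
      using g(2) gcoset_eq[OF \<Gamma>_transl[OF t]] by simp
    then show "C \<in> ?B" using M_pos x(2)
      by (intro image_eqI[of _ _ "(p mod int M, q mod int M, w)"]) auto
  qed
  then show ?thesis by (rule finite_subset) (use W_finite in auto)
qed

lemma L2_left: "f \<in> L2 G \<Gamma> \<Longrightarrow> \<gamma> \<in> \<Gamma> \<Longrightarrow> f (\<gamma> \<circ> g) = f g"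
proof (cases "g \<in> W_ext G")
  case False
  assume "f \<in> L2 G \<Gamma>" "\<gamma> \<in> \<Gamma>"
  moreover from this have "\<gamma> \<circ> g \<notin> W_ext G"
    using False \<Gamma>_inv[of \<gamma>] \<Gamma>_Wext Wext_comp by (metis comp_assoc id_comp)
  ultimately show ?thesis using False by (simp add: L2_def functions_on_def)
qed (simp add: L2_def)

lemma L2_out: "f \<in> L2 G \<Gamma> \<Longrightarrow> g \<notin> W_ext G \<Longrightarrow> f g = 0"
  by (simp add: L2_def functions_on_def)

lemma L2_rep: "f \<in> L2 G \<Gamma> \<Longrightarrow> g \<in> W_ext G \<Longrightarrow> f (rep (gcoset g)) = f g"
  by (metis rep_gcoset L2_left)

lemma L2_subspace: "cfun.subspace (L2 G \<Gamma>)"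
  by (rule cfun.subspaceI) (auto simp: L2_def functions_on_def cscale_def)

lemma L2_rtrans: assumes "f \<in> L2 G \<Gamma>" "h \<in> W_ext G" shows "rtrans h f \<in> L2 G \<Gamma>"
  unfolding L2_def functions_on_def
proof (intro CollectI conjI allI ballI impI)
  fix g assume "g \<notin> W_ext G"
  then show "rtrans h f g = 0"
    using L2_out[OF assms(1)] Wext_comp_iff[OF assms(2)] by (simp add: rtrans_def)
next
  fix \<gamma> g assume "\<gamma> \<in> \<Gamma>"
  then show "rtrans h f (\<gamma> \<circ> g) = rtrans h f g"
    using L2_left[OF assms(1), of \<gamma> "g \<circ> h"] by (simp add: rtrans_def comp_assoc)
qed

text \<open>The inner product of \<open>L\<^sup>2(\<Gamma> \<setminus> W\<^sub>e\<^sub>x\<^sub>t)\<close>.\<close>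

definition ip :: "fn \<Rightarrow> fn \<Rightarrow> complex" where
  "ip f f' = (\<Sum>C\<in>gcosets. f (rep C) * cnj (f' (rep C)))"

lemma ip_add: "ip (f + g) h = ip f h + ip g h" "ip h (f + g) = ip h f + ip h g"
  by (simp_all add: ip_def algebra_simps sum.distrib)
lemma ip_diff: "ip (f - g) h = ip f h - ip g h" "ip h (f - g) = ip h f - ip h g"
  by (simp_all add: ip_def algebra_simps sum_subtractf)
lemma ip_scale: "ip (cscale q f) h = q * ip f h" "ip h (cscale q f) = cnj q * ip h f"
  by (simp_all add: ip_def cscale_def sum_distrib_left mult_ac)
lemma ip_zero: "ip 0 h = 0" "ip h 0 = 0" by (simp_all add: ip_def)
lemma ip_self: assumes "f \<in> L2 G \<Gamma>" "ip f f = 0" shows "f = 0"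
proof -
  have e: "ip f f = of_real (\<Sum>C\<in>gcosets. (norm (f (rep C)))\<^sup>2)"
    unfolding ip_def of_real_sum by (rule sum.cong) (simp_all only: complex_norm_square)
  have "complex_of_real (\<Sum>C\<in>gcosets. (norm (f (rep C)))\<^sup>2) = 0" using assms(2) unfolding e .
  then have "(\<Sum>C\<in>gcosets. (norm (f (rep C)))\<^sup>2) = 0" by (simp only: of_real_eq_0_iff)
  then have z: "f (rep C) = 0" if "C \<in> gcosets" for C
    using that finite_gcosets by (simp add: sum_nonneg_eq_0_iff)
  have "f g = 0" for g
    using z[OF gcoset_in] L2_rep[OF assms(1)] L2_out[OF assms(1)] by (cases "g \<in> W_ext G") metis+
  then show ?thesis by (simp add: fun_eq_iff)
qed
lemma ip_rtrans:
  assumes "f \<in> L2 G \<Gamma>" "f' \<in> L2 G \<Gamma>" "h \<in> W_ext G"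
  shows "ip (rtrans h f) (rtrans h f') = ip f f'"
proof -
  \<comment> \<open>Right translation by \<open>h\<close> permutes the cosets.\<close>
  define s where "s h C = gcoset (rep C \<circ> h)" for h C
  have sQ: "s h C \<in> gcosets" if "C \<in> gcosets" "h \<in> W_ext G" for C h
    unfolding s_def using that by (intro gcoset_in Wext_comp rep_Wext)
  have ss: "s h' (s h C) = C" if C: "C \<in> gcosets" and h: "h \<in> W_ext G" "h \<circ> h' = id" for C h h'
  proof -
    obtain \<gamma> where \<gamma>: "\<gamma> \<in> \<Gamma>" "rep (gcoset (rep C \<circ> h)) = \<gamma> \<circ> (rep C \<circ> h)"
      using rep_gcoset[OF Wext_comp[OF rep_Wext[OF C] h(1)]] by blast
    have "s h' (s h C) = gcoset (\<gamma> \<circ> (rep C \<circ> (h \<circ> h')))" unfolding s_def \<gamma>(2) by (simp only: comp_assoc)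
    then show ?thesis using h(2) gcoset_eq[OF \<gamma>(1)] gcoset_rep[OF C] by simp
  qed
  obtain h' where h': "h' \<in> W_ext G" "h \<circ> h' = id" "h' \<circ> h = id" using Wext_inv[OF assms(3)] by blast
  have fs: "f (rep (s h C)) = f (rep C \<circ> h)" if "f \<in> L2 G \<Gamma>" "C \<in> gcosets" for f C
    unfolding s_def by (rule L2_rep[OF that(1) Wext_comp[OF rep_Wext[OF that(2)] assms(3)]])
  have "ip (rtrans h f) (rtrans h f') = (\<Sum>C\<in>gcosets. f (rep (s h C)) * cnj (f' (rep (s h C))))"
    unfolding ip_def by (rule sum.cong) (simp_all add: fs assms rtrans_def)
  also have "\<dots> = ip f f'"
    unfolding ip_def
    by (rule sum.reindex_bij_witness[where i = "s h'" and j = "s h"])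
      (use sQ ss h' assms(3) in auto)
  finally show ?thesis .
qed

text \<open>Existence of orthogonal projections, by one Gram-Schmidt step for each spanning vector.\<close>

lemma orthogonal_projection:
  assumes "finite B" "B \<subseteq> L2 G \<Gamma>" "f \<in> L2 G \<Gamma>"
  shows "\<exists>u\<in>cfun.span B. \<forall>v\<in>cfun.span B. ip (f - u) v = 0"
  using assms
proof (induction B arbitrary: f rule: finite_induct)
  case empty
  show ?case unfolding cfun.span_empty using ip_zero(2)[of "f - 0"] by blast
next
  case (insert b B)
  have B: "B \<subseteq> L2 G \<Gamma>" and b: "b \<in> L2 G \<Gamma>" using insert.prems by auto
  have spB: "cfun.span B \<subseteq> L2 G \<Gamma>" by (rule cfun.span_minimal[OF B L2_subspace])
  obtain b0 where b0: "b0 \<in> cfun.span B" "\<And>v. v \<in> cfun.span B \<Longrightarrow> ip (b - b0) v = 0"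
    using insert.IH[OF B b] by blast
  obtain u0 where u0: "u0 \<in> cfun.span B" "\<And>v. v \<in> cfun.span B \<Longrightarrow> ip (f - u0) v = 0"
    using insert.IH[OF B insert.prems(2)] by blast
  define b' where "b' = b - b0"
  have b': "b' \<in> L2 G \<Gamma>" unfolding b'_def using b b0(1) spB L2_subspace
    by (intro cfun.subspace_diff) auto
  show ?case
  proof (cases "ip b' b' = 0")
    case True
    then have "b' = 0" by (rule ip_self[OF b'])
    then have "b \<in> cfun.span B" using b0(1) unfolding b'_def by (simp only: eq_iff_diff_eq_0[symmetric])
    then have "cfun.span (insert b B) = cfun.span B" by (rule cfun.span_redundant)
    then show ?thesis using u0 by metis
  next
    case False
    define q where "q = ip (f - u0) b' / ip b' b'"
    let ?u = "u0 + cscale q b'"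
    have bins: "b \<in> cfun.span (insert b B)" by (rule cfun.span_base) simp
    have sub: "v \<in> cfun.span (insert b B)" if "v \<in> cfun.span B" for v
      using cfun.span_mono[of B "insert b B"] that by blast
    have "?u \<in> cfun.span (insert b B)"
      unfolding b'_def by (intro cfun.span_add cfun.span_scale cfun.span_diff sub u0(1) b0(1) bins)
    moreover have "ip (f - ?u) v = 0" if vin: "v \<in> cfun.span (insert b B)" for v
    proof -
      obtain p where p: "v - cscale p b \<in> cfun.span B" using vin unfolding cfun.span_insert by blast
      define v0 where "v0 = (v - cscale p b) + cscale p b0"
      have v0: "v0 \<in> cfun.span B" unfolding v0_def by (intro cfun.span_add cfun.span_scale p b0(1))
      have v: "v = v0 + cscale p b'"
        by (simp add: v0_def b'_def fun_eq_iff cscale_def algebra_simps)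
      have fu: "ip (f - ?u) w = ip (f - u0) w - q * ip b' w" for w
        by (simp only: ip_diff ip_add ip_scale) (simp add: algebra_simps)
      have "ip (f - ?u) v0 = 0" unfolding fu using u0(2)[OF v0] b0(2)[OF v0] by (simp only: b'_def) simp
      moreover have "ip (f - ?u) b' = 0" unfolding fu using False by (simp add: q_def)
      ultimately show ?thesis unfolding v by (simp only: ip_add ip_scale) simp
    qed
    ultimately show ?thesis by blast
  qed
qed

definition coset_indicator :: "(plane \<Rightarrow> plane) set \<Rightarrow> fn" where "coset_indicator C g = (if g \<in> C then 1 else 0)"

lemma L2_span: "L2 G \<Gamma> \<subseteq> cfun.span (coset_indicator ` gcosets)"
proof
  fix f assume f: "f \<in> L2 G \<Gamma>"
  have "f = (\<Sum>C\<in>gcosets. cscale (f (rep C)) (coset_indicator C))"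
  proof
    fix g
    show "f g = (\<Sum>C\<in>gcosets. cscale (f (rep C)) (coset_indicator C)) g"
    proof (cases "g \<in> W_ext G")
      case True
      have "g \<in> C \<longleftrightarrow> C = gcoset g" if "C \<in> gcosets" for C
      proof
        assume g: "g \<in> C"
        obtain g' where g': "C = gcoset g'" using gcosets_E[OF \<open>C \<in> gcosets\<close>] by metis
        then obtain \<gamma> where "\<gamma> \<in> \<Gamma>" "g = \<gamma> \<circ> g'" using g by (auto simp: gcoset_def)
        then show "C = gcoset g" using gcoset_eq g' by simp
      qed (simp add: gcoset_self)
      then have "(\<Sum>C\<in>gcosets. f (rep C) * coset_indicator C g) = (\<Sum>C\<in>gcosets. if C = gcoset g then f (rep (gcoset g)) else 0)"
        by (intro sum.cong) (auto simp: coset_indicator_def)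
      then show ?thesis using finite_gcosets gcoset_in[OF True] L2_rep[OF f True]
        by (simp add: cfun_sum_apply cscale_def)
    next
      case False
      have "C \<subseteq> W_ext G" if "C \<in> gcosets" for C using that Wext_comp \<Gamma>_Wext by (auto simp: gcosets_def)
      then have "coset_indicator C g = 0" if "C \<in> gcosets" for C using False that by (auto simp: coset_indicator_def)
      then show ?thesis using L2_out[OF f False] by (simp add: cfun_sum_apply cscale_def)
    qed
  qed
  then show "f \<in> cfun.span (coset_indicator ` gcosets)"
    by (metis (no_types, lifting) cfun.span_sum cfun.span_scale cfun.span_base imageI)
qed

lemma L2_independent_finite: assumes "B \<subseteq> L2 G \<Gamma>" "cfun.independent B" shows "finite B"
  using cfun.independent_span_bound[of "coset_indicator ` gcosets" B] finite_gcosets assms L2_span by blast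

lemma dim_less:
  assumes "cfun.subspace U'" "U' \<subseteq> U" "U \<subseteq> L2 G \<Gamma>" "U' \<noteq> U"
  shows "cfun.dim U' < cfun.dim U"
proof -
  obtain B where B: "B \<subseteq> U'" "cfun.independent B" "U' \<subseteq> cfun.span B" "card B = cfun.dim U'"
    by (rule cfun.basis_exists)
  obtain x where x: "x \<in> U" "x \<notin> U'" using assms by blast
  then have "x \<notin> cfun.span B" using cfun.span_minimal[OF B(1) assms(1)] by blast
  then have ind: "cfun.independent (insert x B)" by (rule cfun.independent_insertI[OF _ B(2)])
  obtain B' where B': "insert x B \<subseteq> B'" "B' \<subseteq> U" "cfun.independent B'" "U \<subseteq> cfun.span B'"
    using cfun.maximal_independent_subset_extend[OF _ ind, of U] x B(1) assms(2) by blast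
  have fin: "finite B'" using L2_independent_finite B' assms(3) by blast
  have "card B < card (insert x B)"
    using x B(1) finite_subset[of B B'] fin B'(1) by (subst card_insert_disjoint) auto
  also have "\<dots> \<le> card B'" using fin B'(1) by (rule card_mono)
  also have "card B' = cfun.dim U" by (rule cfun.basis_card_eq_dim[OF B'(2,4,3)])
  finally show ?thesis using B(4) by simp
qed

lemma rtrans_comp: "rtrans h (rtrans h' f) = rtrans (h \<circ> h') f"
  by (simp add: rtrans_def fun_eq_iff comp_assoc)
lemma rtrans_id: "rtrans id f = f" by (simp add: rtrans_def)
lemma rtrans_add: "rtrans h (f + g) = rtrans h f + rtrans h g" by (simp add: rtrans_def fun_eq_iff)
lemma rtrans_scale: "rtrans h (cscale q f) = cscale q (rtrans h f)" by (simp add: rtrans_def fun_eq_iff cscale_def)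
lemma rtrans_zero: "rtrans h 0 = 0" by (simp add: rtrans_def fun_eq_iff)

lemma L2_functions_on: "L2 G \<Gamma> \<subseteq> functions_on G" by (auto simp: L2_def)
lemma subrepD: "subrep G U V \<Longrightarrow> U \<subseteq> V" "subrep G U V \<Longrightarrow> cfun.subspace U"
  "subrep G U V \<Longrightarrow> h \<in> W_ext G \<Longrightarrow> f \<in> U \<Longrightarrow> rtrans h f \<in> U" by (auto simp: subrep_def)

lemma orthogonal_complement:
  assumes U: "subrep G U V" and V: "subrep G V (L2 G \<Gamma>)"
  shows "\<exists>V'. subrep G V' V \<and> U \<inter> V' = {0} \<and> (\<forall>f\<in>V. \<exists>u\<in>U. \<exists>v\<in>V'. f = u + v)"
proof -
  define V' where "V' = {f \<in> V. \<forall>u\<in>U. ip f u = 0}"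
  have VL: "V \<subseteq> L2 G \<Gamma>" and UV: "U \<subseteq> V" using subrepD(1) U V by auto
  have sU: "cfun.subspace U" "cfun.subspace V" using subrepD(2) U V by auto
  have "subrep G V' V"
    unfolding subrep_def
  proof (intro conjI ballI)
    show "V' \<subseteq> V" by (auto simp: V'_def)
    show "cfun.subspace V'"
    proof (rule cfun.subspaceI)
      show "0 \<in> V'" unfolding V'_def using cfun.subspace_0[OF sU(2)] ip_zero(1) by blast
      fix x assume x: "x \<in> V'"
      have "ip (cscale q x) u = 0" if "u \<in> U" for q u
        using x that unfolding ip_scale by (simp add: V'_def)
      then show "cscale q x \<in> V'" for q
        using x cfun.subspace_scale[OF sU(2)] unfolding V'_def by blast
      fix y assume y: "y \<in> V'"
      have "ip (x + y) u = 0" if "u \<in> U" for u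
        using x y that unfolding ip_add by (simp add: V'_def)
      then show "x + y \<in> V'"
        using x y cfun.subspace_add[OF sU(2)] unfolding V'_def by blast
    qed
    fix h f assume h: "h \<in> W_ext G" and f: "f \<in> V'"
    obtain h' where h': "h' \<in> W_ext G" "h \<circ> h' = id" using Wext_inv[OF h] by blast
    have "ip (rtrans h f) u = 0" if u: "u \<in> U" for u
    proof -
      have "u = rtrans h (rtrans h' u)" unfolding rtrans_comp h'(2) rtrans_id ..
      moreover have u': "rtrans h' u \<in> U" by (rule subrepD(3)[OF U h'(1) u])
      moreover have "ip (rtrans h f) (rtrans h (rtrans h' u)) = ip f (rtrans h' u)"
        using f u' UV VL h by (intro ip_rtrans) (auto simp: V'_def)
      ultimately show ?thesis using f by (simp add: V'_def)
    qed
    moreover have "rtrans h f \<in> V" using subrepD(3)[OF V h] f by (simp add: V'_def)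
    ultimately show "rtrans h f \<in> V'" by (simp add: V'_def)
  qed
  moreover have "U \<inter> V' = {0}"
  proof -
    have "f = 0" if "f \<in> U" "f \<in> V'" for f
      using that UV VL by (intro ip_self) (auto simp: V'_def)
    moreover have "0 \<in> U" "0 \<in> V'" using sU cfun.subspace_0 by (auto simp: V'_def ip_zero)
    ultimately show ?thesis by blast
  qed
  moreover have "\<exists>u\<in>U. \<exists>v\<in>V'. f = u + v" if f: "f \<in> V" for f
  proof -
    obtain B where B: "B \<subseteq> U" "cfun.independent B" "U \<subseteq> cfun.span B" by (rule cfun.basis_exists)
    have sp: "cfun.span B = U" using B(3) cfun.span_minimal[OF B(1) sU(1)] by blast
    have BL: "B \<subseteq> L2 G \<Gamma>" using B(1) UV VL by blast
    have fin: "finite B" using L2_independent_finite[OF BL B(2)] .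
    obtain u where u: "u \<in> U" "\<forall>v\<in>U. ip (f - u) v = 0"
      using orthogonal_projection[OF fin BL, of f] f VL sp by auto
    have "f - u \<in> V" using f u(1) UV sU(2) by (intro cfun.subspace_diff) auto
    then have "f - u \<in> V'" using u(2) by (simp only: V'_def mem_Collect_eq simp_thms)
    moreover have "f = u + (f - u)" by (simp add: fun_eq_iff)
    ultimately show ?thesis using u(1) by blast
  qed
  ultimately show ?thesis by (intro exI[of _ V'] conjI ballI)
qed

lemma subrep_trans: "subrep G U V \<Longrightarrow> subrep G V V' \<Longrightarrow> subrep G U V'"
  by (auto simp: subrep_def)

lemma irreducible_exists:
  assumes V: "subrep G V (L2 G \<Gamma>)" and nz: "V \<noteq> {0}"
  shows "\<exists>U. subrep G U V \<and> irreducible_rep G U"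
proof -
  let ?P = "\<lambda>U. subrep G U V \<and> U \<noteq> {0}"
  have "?P V" using V nz by (auto simp: subrep_def)
  then obtain U where U: "?P U" and min: "\<And>U'. ?P U' \<Longrightarrow> cfun.dim U \<le> cfun.dim U'"
    using ex_has_least_nat[of ?P V cfun.dim] by metis
  have UL: "subrep G U (L2 G \<Gamma>)" using subrep_trans U V by blast
  have "U' = {0} \<or> U' = U" if U': "subrep G U' U" for U'
  proof (rule ccontr)
    assume n: "\<not> ?thesis"
    then have "cfun.dim U \<le> cfun.dim U'" using min subrep_trans[OF U'] U by blast
    moreover have "cfun.dim U' < cfun.dim U"
      using n by (intro dim_less[OF subrepD(2)[OF U'] subrepD(1)[OF U'] subrepD(1)[OF UL]]) simp
    ultimately show False by simp
  qed
  moreover have "subrep G U (functions_on G)"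
    using UL L2_functions_on by (auto simp: subrep_def)
  ultimately show ?thesis using U unfolding irreducible_rep_def by blast
qed

text \<open>The inner product is invariant, so invariant subspaces have invariant complements, and a minimal nonzero
  invariant subspace splits off.\<close>

lemma decomposition_exists:
  "subrep G V (L2 G \<Gamma>) \<Longrightarrow> \<exists>D. irreducible_decomposition G V D"
proof (induction "cfun.dim V" arbitrary: V rule: less_induct)
  case less
  show ?case
  proof (cases "V = {0}")
    case True
    then have "irreducible_decomposition G V {}" by (simp add: irreducible_decomposition_def)
    then show ?thesis by blast
  next
    case False
    obtain U where U: "subrep G U V" "irreducible_rep G U" using irreducible_exists[OF less.prems False] by blast
    obtain V' where V': "subrep G V' V" "U \<inter> V' = {0}" "\<forall>f\<in>V. \<exists>u\<in>U. \<exists>v\<in>V'. f = u + v"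
      using orthogonal_complement[OF U(1) less.prems] by (elim exE conjE)
    have Unz: "U \<noteq> {0}" using U(2) by (simp add: irreducible_rep_def)
    have sV: "cfun.subspace V" by (rule subrepD(2)[OF less.prems])
    have "V' \<noteq> V" using V'(2) U(1) Unz by (auto simp: subrep_def)
    then have "cfun.dim V' < cfun.dim V"
      by (rule dim_less[OF subrepD(2)[OF V'(1)] subrepD(1)[OF V'(1)] subrepD(1)[OF less.prems]])
    from less.hyps[OF this subrep_trans[OF V'(1) less.prems]]
    obtain D where D: "irreducible_decomposition G V' D" by blast
    note D' = D[unfolded irreducible_decomposition_def]
    have Dn: "finite D" "\<And>X. X \<in> D \<Longrightarrow> subrep G X V' \<and> irreducible_rep G X"
      "V' = {\<Sum>U\<in>D. x U | x. \<forall>U\<in>D. x U \<in> U}"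
      apply (rule conjunct1[OF D'])
      apply (rule bspec[OF conjunct1[OF conjunct2[OF D']]], assumption)
      apply (rule conjunct1[OF conjunct2[OF conjunct2[OF D']]])
      done
    have Dn4: "\<forall>U\<in>D. x U = 0" if "\<forall>U\<in>D. x U \<in> U" "(\<Sum>U\<in>D. x U) = 0" for x
      by (rule conjunct2[OF conjunct2[OF conjunct2[OF D']], THEN spec, THEN mp, OF conjI[OF that]])
    have UD: "U \<notin> D"
    proof
      assume "U \<in> D"
      then have "U \<subseteq> V'" using Dn(2) by (auto simp: subrep_def)
      then show False using V'(2) Unz by blast
    qed
    have "irreducible_decomposition G V (insert U D)"
      unfolding irreducible_decomposition_def
    proof (intro conjI ballI allI impI)
      show "finite (insert U D)" using Dn(1) by simp
      show "subrep G X V" "irreducible_rep G X" if "X \<in> insert U D" for X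
        using that U Dn(2) subrep_trans[OF _ V'(1)] by auto
      show "V = {\<Sum>U\<in>insert U D. x U | x. \<forall>U\<in>insert U D. x U \<in> U}"
      proof (intro equalityI subsetI)
        fix f assume "f \<in> V"
        then obtain u v where uv: "u \<in> U" "v \<in> V'" "f = u + v" using V'(3) by blast
        then obtain x where x: "v = (\<Sum>U\<in>D. x U)" "\<forall>U\<in>D. x U \<in> U" using Dn(3) by blast
        define y where "y = x(U := u)"
        have "(\<Sum>X\<in>D. y X) = (\<Sum>X\<in>D. x X)" by (rule sum.cong) (use UD in \<open>auto simp: y_def\<close>)
        then have "f = (\<Sum>X\<in>insert U D. y X)"
          unfolding sum.insert[OF Dn(1) UD] uv(3) x(1) by (simp add: y_def)
        moreover have "\<forall>X\<in>insert U D. y X \<in> X" using x(2) uv(1) UD by (auto simp: y_def)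
        ultimately show "f \<in> {\<Sum>U\<in>insert U D. x U | x. \<forall>U\<in>insert U D. x U \<in> U}" by blast
      next
        fix f assume "f \<in> {\<Sum>U\<in>insert U D. x U | x. \<forall>U\<in>insert U D. x U \<in> U}"
        then obtain x where x: "f = (\<Sum>X\<in>insert U D. x X)" "\<forall>X\<in>insert U D. x X \<in> X" by blast
        have "X \<subseteq> V" if "X \<in> insert U D" for X
          using that subrepD(1)[OF U(1)] subrepD(1)[OF V'(1)] subrepD(1) Dn(2) by blast
        then have "x X \<in> V" if "X \<in> insert U D" for X using x(2) that by blast
        then show "f \<in> V" unfolding x(1) by (intro cfun.subspace_sum[OF sV]) auto
      qed
      fix x X assume "(\<forall>U\<in>insert U D. x U \<in> U) \<and> (\<Sum>U\<in>insert U D. x U) = 0" and X: "X \<in> insert U D"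
      then have x: "\<And>X. X \<in> insert U D \<Longrightarrow> x X \<in> X" "x U + (\<Sum>X\<in>D. x X) = 0"
        using Dn(1) UD by auto
      have "(\<Sum>X\<in>D. x X) \<in> V'" using x(1) Dn(3) by blast
      moreover have "x U = - (\<Sum>X\<in>D. x X)" using x(2) by (simp only: add_eq_0_iff2)
      ultimately have "x U \<in> V'" using cfun.subspace_neg[OF subrepD(2)[OF V'(1)]] by simp
      then have xU: "x U = 0" using V'(2) x(1) by blast
      then have "(\<Sum>X\<in>D. x X) = 0" using x(2) by simp
      then have "\<forall>X\<in>D. x X = 0" using Dn4[of x] x(1) by blast
      then show "x X = 0" using X xU by blast
    qed
    then show ?thesis by blast
  qed
qed

end

section \<open>The character of an unramified representation\<close>

context klein_rep begin

text \<open>Fourier coefficients of a periodic function.\<close>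

definition fcoef :: "(plane \<Rightarrow> complex) \<Rightarrow> (plane \<Rightarrow> complex) \<Rightarrow> complex" where
  "fcoef F = (SOME d. \<forall>x. F x = (\<Sum>\<phi>\<in>chars. d \<phi> * \<phi> x))"

lemma fcoef: assumes "F \<in> periodic_functions" shows "F x = (\<Sum>\<phi>\<in>chars. fcoef F \<phi> * \<phi> x)"
proof -
  obtain d where "F = (\<lambda>x. \<Sum>\<phi>\<in>chars. d \<phi> * \<phi> x)" using family_basis_expand[OF chars_basis assms] by blast
  then have "\<forall>x. F x = (\<Sum>\<phi>\<in>chars. d \<phi> * \<phi> x)" by (simp only: simp_thms)
  from someI[of "\<lambda>d. \<forall>x. F x = (\<Sum>\<phi>\<in>chars. d \<phi> * \<phi> x)", OF this]
  show ?thesis unfolding fcoef_def by blast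
qed

lemma fcoef_unique:
  assumes F: "F \<in> periodic_functions" and d: "\<And>x. x \<in> lat \<Longrightarrow> F x = (\<Sum>\<phi>\<in>chars. d \<phi> * \<phi> x)" and \<phi>: "\<phi> \<in> chars"
  shows "fcoef F \<phi> = d \<phi>"
proof (rule family_basis_unique[OF chars_basis _ \<phi>])
  fix x
  have "F x = (\<Sum>\<phi>\<in>chars. d \<phi> * \<phi> x)" if "x \<notin> lat"
  proof -
    have "\<phi> x = 0" if "\<phi> \<in> chars" for \<phi> using chars_charac[OF that] \<open>x \<notin> lat\<close> by (simp add: charac_def)
    then have "(\<Sum>\<phi>\<in>chars. d \<phi> * \<phi> x) = 0" by (intro sum.neutral) simp
    then show ?thesis using F that by (simp add: periodic_functions_def)
  qed
  then show "(\<Sum>\<phi>\<in>chars. fcoef F \<phi> * \<phi> x) = (\<Sum>\<phi>\<in>chars. d \<phi> * \<phi> x)"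
    using fcoef[OF F, of x] d[of x] by (cases "x \<in> lat") auto
qed

text \<open>Left translation by \<open>lat\<close> acts on \<open>L\<^sup>2(\<Gamma> \<setminus> W\<^sub>e\<^sub>x\<^sub>t)\<close> through functions \<open>left_orbit f g\<close> on \<open>lat\<close>; the
  \<open>\<phi>\<close>-component \<open>proj \<phi> f\<close> of \<open>f\<close> lies in the representation induced from \<open>\<phi>\<close>.\<close>

definition left_orbit :: "fn \<Rightarrow> (plane \<Rightarrow> plane) \<Rightarrow> plane \<Rightarrow> complex" where
  "left_orbit f g x = (if x \<in> lat then f (transl x \<circ> g) else 0)"
definition proj :: "(plane \<Rightarrow> complex) \<Rightarrow> fn \<Rightarrow> fn" where
  "proj \<phi> f g = (if g \<in> W_ext G then fcoef (left_orbit f g) \<phi> else 0)"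

lemma left_orbit_periodic: assumes "f \<in> L2 G \<Gamma>" shows "left_orbit f g \<in> periodic_functions"
proof -
  have "f (transl (x + t) \<circ> g) = f (transl x \<circ> g)" if "t \<in> trl" for x t
  proof -
    have "transl (x + t) \<circ> g = transl t \<circ> (transl x \<circ> g)" by (simp add: o_assoc transl_comp add.commute)
    then show ?thesis using L2_left[OF assms \<Gamma>_transl[OF that]] by metis
  qed
  then show ?thesis by (auto simp: periodic_functions_def left_orbit_def lat_add trl_lat)
qed

lemma proj_sum: assumes f: "f \<in> L2 G \<Gamma>" shows "f g = (\<Sum>\<phi>\<in>chars. proj \<phi> f g)"
proof (cases "g \<in> W_ext G")
  case True
  have "\<phi> 0 = 1" if "\<phi> \<in> chars" for \<phi> using chars_charac[OF that] by (simp add: charac_def)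
  then have "(\<Sum>\<phi>\<in>chars. fcoef (left_orbit f g) \<phi> * \<phi> 0) = (\<Sum>\<phi>\<in>chars. proj \<phi> f g)"
    using True by (intro sum.cong) (auto simp: proj_def)
  then show ?thesis using fcoef[OF left_orbit_periodic[OF f], of g 0]
    by (simp add: left_orbit_def transl_0)
qed (simp add: proj_def L2_out[OF f])

lemma proj_add: assumes "f \<in> L2 G \<Gamma>" "f' \<in> L2 G \<Gamma>" "\<phi> \<in> chars"
  shows "proj \<phi> (f + f') = proj \<phi> f + proj \<phi> f'"
proof
  fix g
  have ff: "f + f' \<in> L2 G \<Gamma>" using assms L2_subspace by (simp add: cfun.subspace_add)
  have "fcoef (left_orbit (f + f') g) \<phi> = fcoef (left_orbit f g) \<phi> + fcoef (left_orbit f' g) \<phi>"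
  proof (rule fcoef_unique[OF left_orbit_periodic[OF ff] _ assms(3)])
    fix x assume "x \<in> lat"
    then have "left_orbit (f + f') g x = left_orbit f g x + left_orbit f' g x" by (simp add: left_orbit_def)
    then show "left_orbit (f + f') g x = (\<Sum>\<psi>\<in>chars. (fcoef (left_orbit f g) \<psi> + fcoef (left_orbit f' g) \<psi>) * \<psi> x)"
      using fcoef[OF left_orbit_periodic[OF assms(1)], of g x] fcoef[OF left_orbit_periodic[OF assms(2)], of g x]
      by (simp add: distrib_right sum.distrib)
  qed
  then show "proj \<phi> (f + f') g = (proj \<phi> f + proj \<phi> f') g" by (simp add: proj_def)
qed

lemma proj_scale: assumes "f \<in> L2 G \<Gamma>" "\<phi> \<in> chars"
  shows "proj \<phi> (cscale q f) = cscale q (proj \<phi> f)"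
proof
  fix g
  have ff: "cscale q f \<in> L2 G \<Gamma>" using assms L2_subspace by (simp add: cfun.subspace_scale)
  have "fcoef (left_orbit (cscale q f) g) \<phi> = q * fcoef (left_orbit f g) \<phi>"
  proof (rule fcoef_unique[OF left_orbit_periodic[OF ff] _ assms(2)])
    fix x assume "x \<in> lat"
    then have "left_orbit (cscale q f) g x = q * left_orbit f g x" by (simp add: left_orbit_def cscale_def)
    then show "left_orbit (cscale q f) g x = (\<Sum>\<psi>\<in>chars. (q * fcoef (left_orbit f g) \<psi>) * \<psi> x)"
      using fcoef[OF left_orbit_periodic[OF assms(1)], of g x]
      by (simp add: sum_distrib_left mult.assoc)
  qed
  then show "proj \<phi> (cscale q f) g = cscale q (proj \<phi> f) g" by (simp add: proj_def cscale_def)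
qed

lemma proj_rtrans: assumes "h \<in> W_ext G" shows "proj \<phi> (rtrans h f) = rtrans h (proj \<phi> f)"
proof
  fix g
  have "left_orbit (rtrans h f) g = left_orbit f (g \<circ> h)"
    by (auto simp: left_orbit_def rtrans_def comp_assoc)
  then show "proj \<phi> (rtrans h f) g = rtrans h (proj \<phi> f) g"
    by (simp add: proj_def rtrans_def Wext_comp_iff[OF assms])
qed

lemma proj_Ind: assumes f: "f \<in> L2 G \<Gamma>" and \<phi>: "\<phi> \<in> chars" shows "proj \<phi> f \<in> Ind G \<phi>"
  unfolding Ind_def functions_on_def lat_G
proof (intro CollectI conjI allI impI ballI)
  show "proj \<phi> f g = 0" if "g \<notin> W_ext G" for g using that by (simp add: proj_def)
  fix l g assume l: "l \<in> lat" and g: "g \<in> W_ext G"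
  have "fcoef (left_orbit f (transl l \<circ> g)) \<phi> = \<phi> l * fcoef (left_orbit f g) \<phi>"
  proof (rule fcoef_unique[OF left_orbit_periodic[OF f] _ \<phi>])
    fix x assume x: "x \<in> lat"
    have "left_orbit f (transl l \<circ> g) x = left_orbit f g (x + l)"
      using x l lat_add[OF x l] by (simp add: left_orbit_def o_assoc transl_comp)
    also have "\<dots> = (\<Sum>\<psi>\<in>chars. fcoef (left_orbit f g) \<psi> * \<psi> (x + l))"
      by (rule fcoef[OF left_orbit_periodic[OF f]])
    also have "\<dots> = (\<Sum>\<psi>\<in>chars. (\<psi> l * fcoef (left_orbit f g) \<psi>) * \<psi> x)"
      by (rule sum.cong) (simp_all add: charac_add[OF chars_charac x l] mult_ac)
    finally show "left_orbit f (transl l \<circ> g) x = (\<Sum>\<psi>\<in>chars. (\<psi> l * fcoef (left_orbit f g) \<psi>) * \<psi> x)" .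
  qed
  then show "proj \<phi> f (transl l \<circ> g) = \<phi> l * proj \<phi> f g"
    using g Wext_comp[OF transl_Wext[OF l] g] by (simp add: proj_def)
qed

lemma chars_lattice_character: "\<phi> \<in> chars \<Longrightarrow> lattice_character G \<phi>"
  using chars_charac by (auto simp: lattice_character_def lat_G charac_def)

text \<open>For an irreducible \<open>\<rho>\<close>, some projection \<open>proj \<phi>\<close> is nonzero on \<open>\<rho>\<close>. It commutes with right translations,
  so it is injective and identifies \<open>\<rho>\<close> with a subrepresentation induced from \<open>\<phi>\<close>. In particular the character
  chosen in the definition of the L-function has the property required of it.\<close>

lemma character_exists:
  assumes \<rho>: "subrep G \<rho> (L2 G \<Gamma>)" and irr: "irreducible_rep G \<rho>" and unr: "unramified G \<rho>"
  shows "\<exists>\<psi>. lattice_character G \<psi> \<and>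
     (\<exists>U. subrep G U (Ind G \<psi>) \<and> irreducible_rep G U \<and> unramified G U \<and> rep_iso G \<rho> U)"
proof -
  have \<rho>L: "f \<in> L2 G \<Gamma>" if "f \<in> \<rho>" for f using subrepD(1)[OF \<rho>] that by blast
  have s\<rho>: "cfun.subspace \<rho>" by (rule subrepD(2)[OF \<rho>])
  have min: "U' = {0} \<or> U' = \<rho>" if "subrep G U' \<rho>" for U' using irr that by (simp add: irreducible_rep_def)
  obtain f0 where f0: "f0 \<in> \<rho>" "f0 \<noteq> 0" "\<And>w. w \<in> weyl G \<Longrightarrow> rtrans w f0 = f0" using unr by (auto simp: unramified_def)
  have "\<exists>\<phi>\<in>chars. proj \<phi> f0 \<noteq> 0"
  proof (rule ccontr)
    assume "\<not> ?thesis"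
    then have "proj \<phi> f0 g = 0" if "\<phi> \<in> chars" for \<phi> g using that by (metis zero_fun_apply)
    then have "f0 g = 0" for g using proj_sum[OF \<rho>L[OF f0(1)], of g] by simp
    then show False using f0(2) by (simp add: fun_eq_iff)
  qed
  then obtain \<phi> where \<phi>: "\<phi> \<in> chars" "proj \<phi> f0 \<noteq> 0" by blast
  define T where "T = proj \<phi>"
  have Tadd: "T (f + g) = T f + T g" if "f \<in> \<rho>" "g \<in> \<rho>" for f g
    unfolding T_def by (rule proj_add[OF \<rho>L[OF that(1)] \<rho>L[OF that(2)] \<phi>(1)])
  have Tsc: "T (cscale q f) = cscale q (T f)" if "f \<in> \<rho>" for q f
    unfolding T_def by (rule proj_scale[OF \<rho>L[OF that] \<phi>(1)])
  have Trt: "T (rtrans h f) = rtrans h (T f)" if "h \<in> W_ext G" for h f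
    unfolding T_def by (rule proj_rtrans[OF that])
  have z\<rho>: "0 \<in> \<rho>" by (rule cfun.subspace_0[OF s\<rho>])
  have T0: "T 0 = 0" using Tsc[OF z\<rho>, of 0] by (simp only: cfun.scale_zero_left)
  \<comment> \<open>Preimages under \<open>T\<close> of invariant subspaces are invariant.\<close>
  have pre: "subrep G {f \<in> \<rho>. T f \<in> U'} \<rho>"
    if U': "cfun.subspace U'" "\<And>h f. h \<in> W_ext G \<Longrightarrow> f \<in> U' \<Longrightarrow> rtrans h f \<in> U'" for U'
    unfolding subrep_def
  proof (intro conjI ballI)
    show "cfun.subspace {f \<in> \<rho>. T f \<in> U'}"
    proof (rule cfun.subspaceI)
      show "0 \<in> {f \<in> \<rho>. T f \<in> U'}" using z\<rho> cfun.subspace_0[OF U'(1)] T0 by (metis (mono_tags, lifting) mem_Collect_eq)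
      fix x assume x: "x \<in> {f \<in> \<rho>. T f \<in> U'}"
      then show "cscale q x \<in> {f \<in> \<rho>. T f \<in> U'}" for q
        using cfun.subspace_scale[OF s\<rho>] cfun.subspace_scale[OF U'(1)] Tsc by simp
      fix y assume y: "y \<in> {f \<in> \<rho>. T f \<in> U'}"
      have "x + y \<in> \<rho>" using x y cfun.subspace_add[OF s\<rho>] by blast
      moreover have "T (x + y) \<in> U'" using x y Tadd[of x y] cfun.subspace_add[OF U'(1)] by (metis (mono_tags, lifting) mem_Collect_eq)
      ultimately show "x + y \<in> {f \<in> \<rho>. T f \<in> U'}" by blast
    qed
    show "rtrans h f \<in> {f \<in> \<rho>. T f \<in> U'}" if "h \<in> W_ext G" "f \<in> {f \<in> \<rho>. T f \<in> U'}" for h f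
      using that subrepD(3)[OF \<rho>] U'(2) Trt by simp
  qed auto
  have zero_sub: "cfun.subspace {0}" by (rule cfun.subspace_single_0)
  have "subrep G {f \<in> \<rho>. T f \<in> {0}} \<rho>" by (rule pre[OF zero_sub]) (metis rtrans_zero singleton_iff)
  then have "{f \<in> \<rho>. T f \<in> {0}} = {0} \<or> {f \<in> \<rho>. T f \<in> {0}} = \<rho>" by (rule min)
  moreover have "f0 \<notin> {f \<in> \<rho>. T f \<in> {0}}" using \<phi>(2) unfolding T_def by blast
  ultimately have ker: "{f \<in> \<rho>. T f \<in> {0}} = {0}" using f0(1) by blast
  have inj: "inj_on T \<rho>"
  proof (rule inj_onI)
    fix f g assume fg: "f \<in> \<rho>" "g \<in> \<rho>" "T f = T g"
    have g': "cscale (- 1) g \<in> \<rho>" by (rule cfun.subspace_scale[OF s\<rho> fg(2)])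
    have "T (f + cscale (- 1) g) = T f + cscale (- 1) (T g)" using Tadd[OF fg(1) g'] Tsc[OF fg(2)] by metis
    also have "\<dots> = 0" using fg(3) by (simp add: fun_eq_iff cscale_def)
    finally have "f + cscale (- 1) g \<in> {f \<in> \<rho>. T f \<in> {0}}" using cfun.subspace_add[OF s\<rho> fg(1) g'] by blast
    then have "f + cscale (- 1) g = 0" unfolding ker by blast
    then show "f = g" by (simp add: fun_eq_iff cscale_def)
  qed
  define U where "U = T ` \<rho>"
  have UI: "U \<subseteq> Ind G \<phi>" unfolding U_def T_def using proj_Ind[OF \<rho>L \<phi>(1)] by blast
  have sU: "cfun.subspace U"
  proof (rule cfun.subspaceI)
    show "0 \<in> U" unfolding U_def using z\<rho> T0 by (metis imageI)
    fix x assume "x \<in> U"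
    then obtain x' where x': "x' \<in> \<rho>" "x = T x'" unfolding U_def by blast
    show "cscale q x \<in> U" for q
      unfolding U_def x'(2) using Tsc[OF x'(1), of q] cfun.subspace_scale[OF s\<rho> x'(1), of q] by (metis imageI)
    fix y assume "y \<in> U"
    then obtain y' where y': "y' \<in> \<rho>" "y = T y'" unfolding U_def by blast
    show "x + y \<in> U"
      unfolding U_def x'(2) y'(2) using Tadd[OF x'(1) y'(1)] cfun.subspace_add[OF s\<rho> x'(1) y'(1)] by (metis imageI)
  qed
  have rU: "rtrans h f \<in> U" if hW: "h \<in> W_ext G" and fU: "f \<in> U" for h f
  proof -
    obtain f' where f': "f' \<in> \<rho>" "f = T f'" using fU unfolding U_def by blast
    have "rtrans h f = T (rtrans h f')" unfolding f'(2) by (rule Trt[OF hW, symmetric])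
    then show ?thesis unfolding U_def using subrepD(3)[OF \<rho> hW f'(1)] by blast
  qed
  have subU: "subrep G U (Ind G \<phi>)" using UI sU rU by (simp add: subrep_def)
  have irrU: "irreducible_rep G U"
    unfolding irreducible_rep_def
  proof (intro conjI allI impI)
    show "subrep G U (functions_on G)" using sU rU UI by (auto simp: subrep_def Ind_def)
    have "T f0 \<in> U" unfolding U_def by (rule imageI[OF f0(1)])
    then show "U \<noteq> {0}" using \<phi>(2)[folded T_def] by (metis singletonD)
    fix U' assume U': "subrep G U' U"
    let ?P = "{f \<in> \<rho>. T f \<in> U'}"
    have img: "T ` ?P = U'" using subrepD(1)[OF U'] unfolding U_def by blast
    have "?P = {0} \<or> ?P = \<rho>" by (rule min[OF pre[OF subrepD(2)[OF U'] subrepD(3)[OF U']]])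
    then show "U' = {0} \<or> U' = U"
    proof
      assume "?P = {0}"
      then have "U' = {T 0}" using img by (metis image_empty image_insert)
      then show ?thesis unfolding T0 by (rule disjI1)
    next
      assume "?P = \<rho>"
      then show ?thesis using img unfolding U_def by metis
    qed
  qed
  have "T f0 \<in> U" "T f0 \<noteq> 0" using imageI[OF f0(1), of T] \<phi>(2) unfolding U_def T_def by simp_all
  moreover have "rtrans w (T f0) = T f0" if "w \<in> weyl G" for w
    using Trt[OF W_Wext[OF that]] f0(3)[OF that] by metis
  ultimately have "unramified G U" unfolding unramified_def by blast
  moreover have "rep_iso G \<rho> U"
    unfolding rep_iso_def using inj Tadd Tsc Trt by (intro exI[of _ T]) (auto simp: bij_betw_def U_def)
  ultimately show ?thesis using subU irrU chars_lattice_character[OF \<phi>(1)] by blast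
qed

section \<open>The Hecke operator\<close>

text \<open>The product over the list of the operators \<open>1 - u R\<^sub>l\<close>, where \<open>R\<^sub>l\<close> is right translation by \<open>l\<close>. If the
  list is stable under \<open>W\<close> as a multiset, it is a central element of the group algebra of \<open>W\<^sub>e\<^sub>x\<^sub>t\<close>.\<close>

primrec hecke :: "complex \<Rightarrow> plane list \<Rightarrow> fn \<Rightarrow> fn" where
  "hecke u [] f = f"
| "hecke u (l # ls) f = hecke u ls f + cscale (- u) (rtrans (transl l) (hecke u ls f))"

lemma hecke_linear: "linear_op (hecke u ls)"
proof (induction ls)
  case Nil
  then show ?case by (simp add: linear_op_def)
next
  case (Cons l ls)
  have a: "hecke u ls (f + g) = hecke u ls f + hecke u ls g" for f g using Cons unfolding linear_op_def by blast
  have s: "hecke u ls (cscale q f) = cscale q (hecke u ls f)" for q f using Cons unfolding linear_op_def by blast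
  show ?case unfolding linear_op_def hecke.simps a s
    by (simp add: fun_eq_iff cscale_def rtrans_def algebra_simps)
qed

lemma hecke_Ind_value:
  assumes \<psi>: "lattice_character G \<psi>" and f: "f \<in> Ind G \<psi>" and w: "w \<in> weyl G"
  shows "set ls \<subseteq> lat \<Longrightarrow> x \<in> lat \<Longrightarrow>
    hecke u ls f (transl x \<circ> w) = (\<Prod>l\<leftarrow>ls. 1 - \<psi> (w l) * u) * f (transl x \<circ> w)"
proof (induction ls arbitrary: x)
  case Nil
  then show ?case by simp
next
  case (Cons l ls)
  have wl: "w l \<in> lat" using Cons.prems W_lat[OF w, of l] by auto
  have "transl x \<circ> w \<circ> transl l = transl (x + w l) \<circ> w"
    by (metis W_transl[OF w] comp_assoc transl_comp)
  then have "hecke u (l # ls) f (transl x \<circ> w) = hecke u ls f (transl x \<circ> w) - u * hecke u ls f (transl (x + w l) \<circ> w)"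
    by (simp add: cscale_def rtrans_def)
  also have "hecke u ls f (transl (x + w l) \<circ> w) = (\<Prod>l\<leftarrow>ls. 1 - \<psi> (w l) * u) * f (transl (x + w l) \<circ> w)"
    by (rule Cons.IH) (use Cons.prems lat_add wl in auto)
  also have "f (transl (x + w l) \<circ> w) = \<psi> (w l) * f (transl x \<circ> w)"
  proof -
    have "transl (x + w l) \<circ> w = transl (w l) \<circ> (transl x \<circ> w)" by (simp add: o_assoc transl_comp add.commute)
    then show ?thesis using f wl Wext_I[OF Cons.prems(2) w] by (simp add: Ind_def lat_G)
  qed
  also have "hecke u ls f (transl x \<circ> w) = (\<Prod>l\<leftarrow>ls. 1 - \<psi> (w l) * u) * f (transl x \<circ> w)"
    by (rule Cons.IH) (use Cons.prems in auto)
  finally have e: "hecke u (l # ls) f (transl x \<circ> w) = (\<Prod>l\<leftarrow>ls. 1 - \<psi> (w l) * u) * f (transl x \<circ> w) -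
    u * ((\<Prod>l\<leftarrow>ls. 1 - \<psi> (w l) * u) * (\<psi> (w l) * f (transl x \<circ> w)))" .
  show ?case unfolding e list.map prod_list.Cons by (simp only: algebra_simps mult_1_left)
qed

lemma hecke_out: "(\<And>g. g \<notin> W_ext G \<Longrightarrow> f g = 0) \<Longrightarrow> set ls \<subseteq> lat \<Longrightarrow> g \<notin> W_ext G \<Longrightarrow> hecke u ls f g = 0"
proof (induction ls arbitrary: g)
  case (Cons l ls)
  then have "g \<circ> transl l \<notin> W_ext G" using Wext_comp_iff[OF transl_Wext] by auto
  then show ?case using Cons by (simp add: cscale_def rtrans_def)
qed simp

text \<open>Being central, the operator acts by a scalar on the whole induced representation, not only on its spherical
  functions.\<close>

lemma hecke_Ind:
  assumes \<psi>: "lattice_character G \<psi>" and f: "f \<in> Ind G \<psi>" and ls: "set ls \<subseteq> lat"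
    and inv: "\<And>w. w \<in> weyl G \<Longrightarrow> mset (map w ls) = mset ls"
  shows "hecke u ls f = cscale (\<Prod>l\<leftarrow>ls. 1 - \<psi> l * u) f"
proof
  fix g
  show "hecke u ls f g = cscale (\<Prod>l\<leftarrow>ls. 1 - \<psi> l * u) f g"
  proof (cases "g \<in> W_ext G")
    case True
    then obtain x w where x: "x \<in> lat" "w \<in> weyl G" "g = transl x \<circ> w" by (rule Wext_E)
    have "(\<Prod>l\<leftarrow>ls. 1 - \<psi> (w l) * u) = prod_mset (image_mset (\<lambda>l. 1 - \<psi> l * u) (mset (map w ls)))"
      by (simp add: prod_mset_prod_list image_mset.compositionality o_def flip: mset_map)
    also have "\<dots> = (\<Prod>l\<leftarrow>ls. 1 - \<psi> l * u)" unfolding inv[OF x(2)] by (simp add: prod_mset_prod_list flip: mset_map)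
    finally show ?thesis using hecke_Ind_value[OF \<psi> f x(2) ls x(1)] by (simp add: x(3) cscale_def)
  next
    case False
    have "f g = 0" if "g \<notin> W_ext G" for g using f that by (simp add: Ind_def functions_on_def)
    then show ?thesis using False hecke_out[OF _ ls False, of f] by (simp add: cscale_def)
  qed
qed

lemma hecke_intertwine:
  assumes \<rho>: "subrep G \<rho> V"
    and Tadd: "\<And>f g. f \<in> \<rho> \<Longrightarrow> g \<in> \<rho> \<Longrightarrow> T (f + g) = T f + T g"
    and Tsc: "\<And>q f. f \<in> \<rho> \<Longrightarrow> T (cscale q f) = cscale q (T f)"
    and Trt: "\<And>h f. h \<in> W_ext G \<Longrightarrow> f \<in> \<rho> \<Longrightarrow> T (rtrans h f) = rtrans h (T f)"
    and f: "f \<in> \<rho>"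
  shows "set ls \<subseteq> lat \<Longrightarrow> hecke u ls f \<in> \<rho> \<and> T (hecke u ls f) = hecke u ls (T f)"
proof (induction ls)
  case (Cons l ls)
  have l: "transl l \<in> W_ext G" using Cons.prems by (auto intro: transl_Wext)
  have IH: "hecke u ls f \<in> \<rho>" "T (hecke u ls f) = hecke u ls (T f)" using Cons by auto
  note s = subrepD(2)[OF \<rho>]
  have 1: "rtrans (transl l) (hecke u ls f) \<in> \<rho>" by (rule subrepD(3)[OF \<rho> l IH(1)])
  have 2: "cscale (- u) (rtrans (transl l) (hecke u ls f)) \<in> \<rho>" by (rule cfun.subspace_scale[OF s 1])
  show ?case unfolding hecke.simps Tadd[OF IH(1) 2] Tsc[OF 1] Trt[OF l IH(1)] IH(2)
    using cfun.subspace_add[OF s IH(1) 2] by blast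
qed (use f in simp)

end

section \<open>Spherical functions from unramified representations\<close>

context klein_rep begin

text \<open>The spherical functions.\<close>

definition L2W :: "fn set" where "L2W = {f \<in> L2 G \<Gamma>. \<forall>w\<in>weyl G. rtrans w f = f}"

lemma L2W_subspace: "cfun.subspace L2W"
proof (rule cfun.subspaceI)
  show "0 \<in> L2W" unfolding L2W_def using cfun.subspace_0[OF L2_subspace] rtrans_zero by blast
  fix x assume x: "x \<in> L2W"
  then show "cscale q x \<in> L2W" for q
    using cfun.subspace_scale[OF L2_subspace] by (simp add: L2W_def rtrans_scale)
  fix y assume y: "y \<in> L2W"
  have "rtrans w (x + y) = x + y" if "w \<in> weyl G" for w
    using x y that unfolding rtrans_add by (simp add: L2W_def)
  then show "x + y \<in> L2W"
    using x y cfun.subspace_add[OF L2_subspace] unfolding L2W_def by blast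
qed

lemma L2_subrep: "subrep G (L2 G \<Gamma>) (L2 G \<Gamma>)"
  using L2_subspace L2_rtrans by (simp add: subrep_def)

text \<open>The summands of the decomposition on which the L-function is based.\<close>

definition irreps :: "fn set set" where "irreps = (SOME D. irreducible_decomposition G (L2 G \<Gamma>) D)"

lemma irreps: "irreducible_decomposition G (L2 G \<Gamma>) irreps"
  unfolding irreps_def using decomposition_exists[OF L2_subrep] by (rule someI_ex)

lemma irreps_finite: "finite irreps"
  and irreps_subrep: "\<rho> \<in> irreps \<Longrightarrow> subrep G \<rho> (L2 G \<Gamma>)"
  and irreps_irreducible: "\<rho> \<in> irreps \<Longrightarrow> irreducible_rep G \<rho>"
  and irreps_span: "L2 G \<Gamma> = {\<Sum>U\<in>irreps. x U | x. \<forall>U\<in>irreps. x U \<in> U}"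
proof -
  note d = irreps[unfolded irreducible_decomposition_def]
  show "finite irreps" by (rule conjunct1[OF d])
  show "subrep G \<rho> (L2 G \<Gamma>)" "irreducible_rep G \<rho>" if "\<rho> \<in> irreps"
    using bspec[OF conjunct1[OF conjunct2[OF d]] that] by (rule conjunct1, rule conjunct2)
  show "L2 G \<Gamma> = {\<Sum>U\<in>irreps. x U | x. \<forall>U\<in>irreps. x U \<in> U}"
    by (rule conjunct1[OF conjunct2[OF conjunct2[OF d]]])
qed

lemma irreps_direct:
  assumes "\<forall>U\<in>irreps. x U \<in> U" "(\<Sum>U\<in>irreps. x U) = 0" "U \<in> irreps"
  shows "x U = 0"
  by (rule bspec[OF mp[OF spec[OF conjunct2[OF conjunct2[OF conjunct2[OF
    irreps[unfolded irreducible_decomposition_def]]]]] conjI[OF assms(1,2)]] assms(3)])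

lemma Irr_unr_eq: "Irr_unr G \<Gamma> = {\<rho> \<in> irreps. unramified G \<rho>}"
  by (simp add: Irr_unr_def irreps_def)

lemma Irr_unr_iso:
  assumes "\<rho> \<in> Irr_unr G \<Gamma>"
  obtains T where "lattice_character G (chi G \<rho>)" "inj_on T \<rho>" "T ` \<rho> \<subseteq> Ind G (chi G \<rho>)"
    "\<And>f g. f \<in> \<rho> \<Longrightarrow> g \<in> \<rho> \<Longrightarrow> T (f + g) = T f + T g"
    "\<And>q f. f \<in> \<rho> \<Longrightarrow> T (cscale q f) = cscale q (T f)"
    "\<And>h f. h \<in> W_ext G \<Longrightarrow> f \<in> \<rho> \<Longrightarrow> T (rtrans h f) = rtrans h (T f)"
proof -
  have \<rho>: "subrep G \<rho> (L2 G \<Gamma>)" "irreducible_rep G \<rho>" "unramified G \<rho>"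
    using assms irreps_subrep irreps_irreducible by (auto simp: Irr_unr_eq)
  from someI_ex[OF character_exists[OF \<rho>], folded chi_def]
  obtain U where U: "lattice_character G (chi G \<rho>)" "subrep G U (Ind G (chi G \<rho>))" "rep_iso G \<rho> U" by blast
  from U(3) obtain T where T: "bij_betw T \<rho> U" "\<forall>f\<in>\<rho>. \<forall>g\<in>\<rho>. T (f + g) = T f + T g"
    "\<forall>q. \<forall>f\<in>\<rho>. T (cscale q f) = cscale q (T f)" "\<forall>h\<in>W_ext G. \<forall>f\<in>\<rho>. T (rtrans h f) = rtrans h (T f)"
    unfolding rep_iso_def by (elim exE conjE)
  show thesis
  proof (rule that[of T])
    show "lattice_character G (chi G \<rho>)" by (rule U(1))
    show "inj_on T \<rho>" by (rule bij_betw_imp_inj_on[OF T(1)])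
    show "T ` \<rho> \<subseteq> Ind G (chi G \<rho>)" using bij_betw_imp_surj_on[OF T(1)] subrepD(1)[OF U(2)] by simp
    show "T (f + g) = T f + T g" if "f \<in> \<rho>" "g \<in> \<rho>" for f g using T(2) that by blast
    show "T (cscale q f) = cscale q (T f)" if "f \<in> \<rho>" for q f using T(3) that by blast
    show "T (rtrans h f) = rtrans h (T f)" if "h \<in> W_ext G" "f \<in> \<rho>" for h f using T(4) that by blast
  qed
qed

text \<open>A spherical function in an induced representation is determined by its value at the identity.\<close>

lemma Ind_spherical_unique:
  assumes "F \<in> Ind G \<psi>" "F' \<in> Ind G \<psi>"
    and "\<And>w. w \<in> weyl G \<Longrightarrow> rtrans w F = F" "\<And>w. w \<in> weyl G \<Longrightarrow> rtrans w F' = F'"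
    and "F id = q * F' id"
  shows "F = cscale q F'"
proof
  fix g
  show "F g = cscale q F' g"
  proof (cases "g \<in> W_ext G")
    case True
    then obtain x w where x: "x \<in> lat" "w \<in> weyl G" "g = transl x \<circ> w" by (rule Wext_E)
    have *: "H g = \<psi> x * H id" if "H \<in> Ind G \<psi>" "rtrans w H = H" for H
    proof -
      have "H g = \<psi> x * H w" using that(1) x W_Wext[OF x(2)] by (simp add: Ind_def lat_G)
      also have "H w = rtrans w H id" by (simp add: rtrans_def)
      finally show ?thesis using that(2) by simp
    qed
    show ?thesis
      using *[OF assms(1) assms(3)[OF x(2)]] *[OF assms(2) assms(4)[OF x(2)]] assms(5) by (simp add: cscale_def)
  next
    case False
    then show ?thesis using assms(1,2) by (simp add: Ind_def functions_on_def cscale_def)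
  qed
qed

lemma Irr_unr_spherical:
  assumes \<rho>: "\<rho> \<in> Irr_unr G \<Gamma>" and f: "f \<in> \<rho>" "f \<noteq> 0" "\<And>w. w \<in> weyl G \<Longrightarrow> rtrans w f = f"
    and g: "g \<in> \<rho>" "\<And>w. w \<in> weyl G \<Longrightarrow> rtrans w g = g"
  shows "\<exists>q. g = cscale q f"
proof -
  obtain T where T: "lattice_character G (chi G \<rho>)" "inj_on T \<rho>" "T ` \<rho> \<subseteq> Ind G (chi G \<rho>)"
    "\<And>f g. f \<in> \<rho> \<Longrightarrow> g \<in> \<rho> \<Longrightarrow> T (f + g) = T f + T g"
    "\<And>q f. f \<in> \<rho> \<Longrightarrow> T (cscale q f) = cscale q (T f)"
    "\<And>h f. h \<in> W_ext G \<Longrightarrow> f \<in> \<rho> \<Longrightarrow> T (rtrans h f) = rtrans h (T f)"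
    using Irr_unr_iso[OF \<rho>] by metis
  have s\<rho>: "cfun.subspace \<rho>" using \<rho> irreps_subrep subrepD(2) by (auto simp: Irr_unr_eq)
  have Tf: "T f \<in> Ind G (chi G \<rho>)" "T g \<in> Ind G (chi G \<rho>)" using T(3) f(1) g(1) by blast+
  have Tw: "rtrans w (T f) = T f" "rtrans w (T g) = T g" if "w \<in> weyl G" for w
    using T(6)[OF W_Wext[OF that]] f(1,3) g that by metis+
  have "T f id \<noteq> 0"
  proof
    assume "T f id = 0"
    then have "T f = cscale 0 (T f)" by (intro Ind_spherical_unique[OF Tf(1) Tf(1) Tw(1) Tw(1)]) auto
    then have "T f = T (cscale 0 f)" using T(5)[OF f(1), of 0] by metis
    then have "f = cscale 0 f" using inj_onD[OF T(2)] f(1) cfun.subspace_scale[OF s\<rho> f(1)] by blast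
    then show False using f(2) cfun.scale_zero_left by metis
  qed
  then have "T g = cscale (T g id / T f id) (T f)"
    by (intro Ind_spherical_unique[OF Tf(2) Tf(1) Tw(2) Tw(1)]) auto
  then have "T g = T (cscale (T g id / T f id) f)" using T(5)[OF f(1)] by metis
  then have "g = cscale (T g id / T f id) f"
    using inj_onD[OF T(2)] g(1) cfun.subspace_scale[OF s\<rho> f(1)] by blast
  then show ?thesis by blast
qed

lemma Irr_unr_hecke:
  assumes \<rho>: "\<rho> \<in> Irr_unr G \<Gamma>" and f: "f \<in> \<rho>" and ls: "set ls \<subseteq> lat"
    and inv: "\<And>w. w \<in> weyl G \<Longrightarrow> mset (map w ls) = mset ls"
  shows "hecke u ls f = cscale (\<Prod>l\<leftarrow>ls. 1 - chi G \<rho> l * u) f"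
proof -
  obtain T where T: "lattice_character G (chi G \<rho>)" "inj_on T \<rho>" "T ` \<rho> \<subseteq> Ind G (chi G \<rho>)"
    "\<And>f g. f \<in> \<rho> \<Longrightarrow> g \<in> \<rho> \<Longrightarrow> T (f + g) = T f + T g"
    "\<And>q f. f \<in> \<rho> \<Longrightarrow> T (cscale q f) = cscale q (T f)"
    "\<And>h f. h \<in> W_ext G \<Longrightarrow> f \<in> \<rho> \<Longrightarrow> T (rtrans h f) = rtrans h (T f)"
    using Irr_unr_iso[OF \<rho>] by metis
  have sub: "subrep G \<rho> (L2 G \<Gamma>)" using \<rho> irreps_subrep by (auto simp: Irr_unr_eq)
  have i: "hecke u ls f \<in> \<rho> \<and> T (hecke u ls f) = hecke u ls (T f)"
    by (rule hecke_intertwine[OF sub T(4,5,6) f ls])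
  have "hecke u ls (T f) = cscale (\<Prod>l\<leftarrow>ls. 1 - chi G \<rho> l * u) (T f)"
    using T(3) f by (intro hecke_Ind[OF T(1) _ ls inv]) auto
  then have "T (hecke u ls f) = T (cscale (\<Prod>l\<leftarrow>ls. 1 - chi G \<rho> l * u) f)"
    using i T(5)[OF f] by metis
  then show ?thesis using inj_onD[OF T(2)] i cfun.subspace_scale[OF subrepD(2)[OF sub] f] by blast
qed

text \<open>A spherical vector of an unramified representation, unique up to scalars.\<close>

definition sph :: "fn set \<Rightarrow> fn" where
  "sph \<rho> = (SOME f. f \<in> \<rho> \<and> f \<noteq> 0 \<and> (\<forall>w\<in>weyl G. rtrans w f = f))"

lemma sph: assumes "\<rho> \<in> Irr_unr G \<Gamma>"
  shows "sph \<rho> \<in> \<rho>" "sph \<rho> \<noteq> 0" "\<And>w. w \<in> weyl G \<Longrightarrow> rtrans w (sph \<rho>) = sph \<rho>"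
proof -
  have "\<exists>f. f \<in> \<rho> \<and> f \<noteq> 0 \<and> (\<forall>w\<in>weyl G. rtrans w f = f)"
    using assms unfolding Irr_unr_eq unramified_def by blast
  from someI_ex[OF this, folded sph_def]
  show "sph \<rho> \<in> \<rho>" "sph \<rho> \<noteq> 0" "\<And>w. w \<in> weyl G \<Longrightarrow> rtrans w (sph \<rho>) = sph \<rho>" by blast+
qed

text \<open>The components of a spherical function in the irreducible summands are again spherical, and each unramified
  summand contains exactly one line of spherical vectors.\<close>

lemma Irr_unr_basis: "family_basis (Irr_unr G \<Gamma>) sph L2W"
proof (rule family_basisI)
  show fin: "finite (Irr_unr G \<Gamma>)" using irreps_finite by (simp add: Irr_unr_eq)
  show "cfun.subspace L2W" by (rule L2W_subspace)
  show "sph \<rho> \<in> L2W" if "\<rho> \<in> Irr_unr G \<Gamma>" for \<rho>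
    using sph[OF that] that irreps_subrep subrepD(1) unfolding L2W_def Irr_unr_eq by blast
  show "q \<rho> = 0" if z: "\<forall>x. (\<Sum>\<rho>\<in>Irr_unr G \<Gamma>. q \<rho> * sph \<rho> x) = 0" and \<rho>: "\<rho> \<in> Irr_unr G \<Gamma>" for q \<rho>
  proof -
    define y where "y U = (if U \<in> Irr_unr G \<Gamma> then cscale (q U) (sph U) else 0)" for U
    have "\<forall>U\<in>irreps. y U \<in> U"
    proof
      fix U assume "U \<in> irreps"
      then have "cfun.subspace U" using irreps_subrep subrepD(2) by blast
      then show "y U \<in> U" unfolding y_def using sph(1) by (metis cfun.subspace_scale cfun.subspace_0)
    qed
    moreover have "(\<Sum>U\<in>irreps. y U) = 0"
    proof
      fix x
      have "(\<Sum>U\<in>irreps. y U) x = (\<Sum>U\<in>Irr_unr G \<Gamma>. q U * sph U x)"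
        unfolding cfun_sum_apply
        by (rule sum.mono_neutral_cong_right[OF irreps_finite]) (auto simp: Irr_unr_eq y_def cscale_def)
      then show "(\<Sum>U\<in>irreps. y U) x = 0 x" using z by simp
    qed
    ultimately have "y \<rho> = 0" using irreps_direct \<rho> unfolding Irr_unr_eq by blast
    then have "cscale (q \<rho>) (sph \<rho>) = 0" using \<rho> by (simp only: y_def if_True)
    then show "q \<rho> = 0" using sph(2)[OF \<rho>] cfun.scale_eq_0_iff by blast
  qed
  fix f assume f: "f \<in> L2W"
  then have "f \<in> L2 G \<Gamma>" by (simp add: L2W_def)
  then obtain x where x: "f = (\<Sum>U\<in>irreps. x U)" "\<forall>U\<in>irreps. x U \<in> U" using irreps_span by blast
  have xw: "rtrans w (x U) = x U" if w: "w \<in> weyl G" and U: "U \<in> irreps" for w U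
  proof -
    define y where "y U = rtrans w (x U) + cscale (- 1) (x U)" for U
    have "\<forall>U\<in>irreps. y U \<in> U"
    proof
      fix U assume U: "U \<in> irreps"
      note s = irreps_subrep[OF U]
      show "y U \<in> U" unfolding y_def using x(2) U
        by (intro cfun.subspace_add cfun.subspace_scale subrepD(2)[OF s] subrepD(3)[OF s] W_Wext[OF w]) auto
    qed
    moreover have "(\<Sum>U\<in>irreps. y U) = 0"
    proof
      fix g
      have "rtrans w f g = f g" using f w by (simp add: L2W_def)
      then have "(\<Sum>U\<in>irreps. x U (g \<circ> w)) = (\<Sum>U\<in>irreps. x U g)"
        unfolding rtrans_def x(1) cfun_sum_apply .
      then show "(\<Sum>U\<in>irreps. y U) g = 0 g"
        unfolding cfun_sum_apply y_def by (simp add: rtrans_def cscale_def sum_subtractf)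
    qed
    ultimately have "y U = 0" using irreps_direct U by blast
    then show ?thesis by (simp add: y_def fun_eq_iff cscale_def)
  qed
  have "\<exists>q. x U = cscale q (sph U)" if U: "U \<in> Irr_unr G \<Gamma>" for U
    using Irr_unr_spherical[OF U sph(1,2,3)[OF U]] x(2) xw U unfolding Irr_unr_eq by blast
  then obtain q where q: "\<And>U. U \<in> Irr_unr G \<Gamma> \<Longrightarrow> x U = cscale (q U) (sph U)" by metis
  have z: "x U = 0" if "U \<in> irreps - Irr_unr G \<Gamma>" for U
    using that x(2) xw unfolding Irr_unr_eq unramified_def by blast
  have "f g = (\<Sum>U\<in>Irr_unr G \<Gamma>. q U * sph U g)" for g
    unfolding x(1) cfun_sum_apply
    by (rule sum.mono_neutral_cong_right[OF irreps_finite]) (auto simp: Irr_unr_eq q z cscale_def)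
  then show "\<exists>q. \<forall>g. f g = (\<Sum>U\<in>Irr_unr G \<Gamma>. q U * sph U g)" by (intro exI[of _ q] allI)
qed

section \<open>Spherical functions from characters\<close>

text \<open>The single direction \<open>0\<close> reduces functions on \<open>lat \<times> D\<close> to functions on \<open>lat\<close>. The cycles of this instance are
  the orbits of the group on \<open>lat\<close>, all of length 1.\<close>

lemma directions_0: "klein_directions \<alpha> \<beta> n k a b c {0} {0} {}"
  by unfold_locales (auto)

text \<open>A function on \<open>lat\<close> as a \<open>W\<close>-invariant function on \<open>W\<^sub>e\<^sub>x\<^sub>t\<close>, constant on the cosets \<open>g W\<close>.\<close>

definition lift :: "(plane \<times> plane \<Rightarrow> complex) \<Rightarrow> fn" where
  "lift F g = (if g \<in> W_ext G then F (g 0, 0) else 0)"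

lemma linear_lift: "linear_op lift" by (auto simp: linear_op_def lift_def cscale_def fun_eq_iff)

text \<open>The characters modulo reflection give a second basis of the spherical functions, again of eigenvectors of
  the Hecke operator. Its cardinality is the number of orbits of \<open>\<Gamma>\<close> on \<open>lat\<close>, i.e. of double cosets.\<close>

lemma spherical_basis:
  fixes u :: complex
  assumes ls: "set ls \<subseteq> lat" and inv: "\<And>w. w \<in> weyl G \<Longrightarrow> mset (map w ls) = mset ls"
  shows "\<exists>e. family_basis ((free_chars \<union> plus_chars) \<times> {0::plane}) e L2W \<and>
    (\<forall>i\<in>(free_chars \<union> plus_chars) \<times> {0}. hecke u ls (e i) = cscale (\<Prod>l\<leftarrow>ls. 1 - fst i l * u) (e i))"
    and "card (free_chars \<union> plus_chars) = card (double_cosets G \<Gamma>)"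
proof -
  interpret d: klein_directions \<alpha> \<beta> n k a b c "{0}" "{0}" "{}" by (rule directions_0)
  have idx: "d.idx = (free_chars \<union> plus_chars) \<times> {0}" unfolding d.idx_def by blast
  let ?V = "{F. (\<forall>x. x \<notin> d.E \<longrightarrow> F x = 0) \<and> (\<forall>x y. d.r 0 x y \<longrightarrow> F x = F y)}"
  have r\<Gamma>: "d.r 0 (\<gamma> x, 0) (x, 0)" if "\<gamma> \<in> \<Gamma>" "x \<in> lat" for \<gamma> x
    using that(1)
  proof (cases rule: \<Gamma>_E)
    case (tr t)
    then show ?thesis using that(2) by (intro d.rI1'[of t]) (auto simp: d.E_def transl_apply)
  next
    case (gl t)
    then show ?thesis using that(2) by (intro d.rI2'[of t]) (auto simp: d.E_def transl_apply)
  qed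
  have \<Gamma>r: "\<exists>\<gamma>\<in>\<Gamma>. x = \<gamma> y" if "d.r m (x, l) (y, l')" for m x y l l'
    using that
  proof (cases rule: d.rE)
    case (tr t z l'')
    then show ?thesis using \<Gamma>_transl[OF tr(1)] by (intro bexI[of _ "transl t"]) (auto simp: transl_apply d.E_def)
  next
    case (gl t z l'')
    then show ?thesis using \<Gamma>_glide[OF gl(1)] by (intro bexI[of _ "transl t \<circ> sg"]) (auto simp: transl_apply d.E_def)
  qed
  have bij: "bij_betw lift ?V L2W"
  proof (rule bij_betw_imageI)
    show "inj_on lift ?V"
    proof (rule inj_onI)
      fix F F' assume F: "F \<in> ?V" "F' \<in> ?V" "lift F = lift F'"
      have in_E: "F (x, 0) = F' (x, 0)" if "x \<in> lat" for x
      proof -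
        have "lift F (transl x) = lift F' (transl x)" using F(3) by simp
        then show ?thesis using transl_Wext[OF that] by (simp add: lift_def transl_apply)
      qed
      have out_E: "F e = F' e" if "e \<notin> d.E" for e using F(1,2) that by (cases e) simp
      show "F = F'"
      proof
        fix e show "F e = F' e" using in_E[of "fst e"] out_E[of e] by (cases e) (auto simp: d.E_def)
      qed
    qed
    show "lift ` ?V = L2W"
    proof (intro equalityI subsetI)
      fix f assume "f \<in> lift ` ?V"
      then obtain F where F: "F \<in> ?V" "f = lift F" by blast
      have "lift F (\<gamma> \<circ> g) = lift F g" if "\<gamma> \<in> \<Gamma>" "g \<in> W_ext G" for \<gamma> g
      proof -
        have "F (\<gamma> (g 0), 0) = F (g 0, 0)" using F(1) r\<Gamma>[OF that(1) Wext_0[OF that(2)]] by blast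
        then show ?thesis using that Wext_comp[OF \<Gamma>_Wext[OF that(1)] that(2)] by (simp add: lift_def)
      qed
      moreover have "rtrans w (lift F) = lift F" if "w \<in> weyl G" for w
        using Wext_comp_iff[OF W_Wext[OF that]] W_0[OF that] by (auto simp: rtrans_def lift_def)
      ultimately show "f \<in> L2W" unfolding F(2) by (auto simp: L2W_def L2_def functions_on_def lift_def)
    next
      fix f assume f: "f \<in> L2W"
      have fL: "f \<in> L2 G \<Gamma>" and fw: "\<And>w g. w \<in> weyl G \<Longrightarrow> f (g \<circ> w) = f g"
      proof -
        show "f \<in> L2 G \<Gamma>" using f by (simp add: L2W_def)
        fix w g assume "w \<in> weyl G"
        then have "rtrans w f g = f g" using f by (simp add: L2W_def)
        then show "f (g \<circ> w) = f g" by (simp add: rtrans_def)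
      qed
      define F where "F e = (if e \<in> d.E then f (transl (fst e)) else 0)" for e :: "plane \<times> plane"
      have g0: "f g = f (transl (g 0))" if "g \<in> W_ext G" for g
        using Wext_form[OF that] fw by metis
      have "F e = F e'" if r0: "d.r 0 e e'" for e e'
      proof -
        obtain x l y l' where e: "e = (x, l)" "e' = (y, l')" by (cases e, cases e')
        obtain \<gamma> where \<gamma>: "\<gamma> \<in> \<Gamma>" "x = \<gamma> y" using \<Gamma>r r0 unfolding e by blast
        have y: "y \<in> lat" and E: "e \<in> d.E" "e' \<in> d.E" using r0 unfolding e by (auto simp: d.r_def d.E_def)
        have "f (transl y) = f (\<gamma> \<circ> transl y)" by (rule L2_left[OF fL \<gamma>(1), symmetric])
        also have "\<dots> = f (transl ((\<gamma> \<circ> transl y) 0))"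
          by (rule g0[OF Wext_comp[OF \<Gamma>_Wext[OF \<gamma>(1)] transl_Wext[OF y]]])
        finally show ?thesis using E \<gamma>(2) unfolding F_def e by (simp add: transl_apply)
      qed
      then have "F \<in> ?V" by (simp add: F_def)
      moreover have "f = lift F"
        using g0 Wext_0 L2_out[OF fL] by (auto simp: lift_def F_def d.E_def fun_eq_iff)
      ultimately show "f \<in> lift ` ?V" by blast
    qed
  qed
  let ?e = "\<lambda>i. lift (d.ebas i + d.glide_op (d.ebas i))"
  have basis: "family_basis d.idx ?e L2W"
    by (rule family_basis_transport[OF d.invariants_basis linear_lift bij])
  have liftInd: "lift (d.ebas (\<phi>, 0)) \<in> Ind G \<phi>" if "\<phi> \<in> chars" for \<phi>
    unfolding Ind_def functions_on_def lat_G
  proof (intro CollectI conjI allI impI ballI)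
    show "lift (d.ebas (\<phi>, 0)) g = 0" if "g \<notin> W_ext G" for g using that by (simp add: lift_def)
    fix l g assume "l \<in> lat" "g \<in> W_ext G"
    then show "lift (d.ebas (\<phi>, 0)) (transl l \<circ> g) = \<phi> l * lift (d.ebas (\<phi>, 0)) g"
      using Wext_comp[OF transl_Wext] charac_add[OF chars_charac[OF that] Wext_0, of g l]
      by (simp add: lift_def d.ebas_def transl_apply mult.commute)
  qed
  have "hecke u ls (?e i) = cscale (\<Prod>l\<leftarrow>ls. 1 - fst i l * u) (?e i)" if i: "i \<in> d.idx" for i
  proof -
    obtain \<phi> where i\<phi>: "i = (\<phi>, 0)" and \<phi>: "\<phi> \<in> chars" using i d.idx_chars by (cases i) auto
    let ?P = "\<Prod>l\<leftarrow>ls. 1 - \<phi> l * u"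
    have a: "lift (f + g) = lift f + lift g" for f g using linear_lift unfolding linear_op_def by blast
    have s: "lift (cscale q f) = cscale q (lift f)" for q f using linear_lift unfolding linear_op_def by blast
    have ha: "hecke u ls (f + g) = hecke u ls f + hecke u ls g" for f g using hecke_linear unfolding linear_op_def by blast
    have hs: "hecke u ls (cscale q f) = cscale q (hecke u ls f)" for q f using hecke_linear unfolding linear_op_def by blast
    have 1: "hecke u ls (lift (d.ebas (\<psi>, 0))) = cscale (\<Prod>l\<leftarrow>ls. 1 - \<psi> l * u) (lift (d.ebas (\<psi>, 0)))"
      if "\<psi> \<in> chars" for \<psi>
      by (rule hecke_Ind[OF chars_lattice_character[OF that] liftInd[OF that] ls inv])
    \<comment> \<open>The reflection belongs to \<open>W\<close>, so \<open>\<phi>\<close> and its reflection give the same eigenvalue.\<close>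
    have "(\<Prod>l\<leftarrow>ls. 1 - refl_char \<phi> l * u) = prod_mset (image_mset (\<lambda>l. 1 - \<phi> l * u) (mset (map s0 ls)))"
      by (simp add: refl_char_def prod_mset_prod_list image_mset.compositionality o_def flip: mset_map)
    also have "\<dots> = ?P" unfolding inv[OF W_s0] by (simp add: prod_mset_prod_list flip: mset_map)
    finally have r: "(\<Prod>l\<leftarrow>ls. 1 - refl_char \<phi> l * u) = ?P" .
    have e: "?e i = lift (d.ebas (\<phi>, 0)) + cscale (sign_char \<phi>) (lift (d.ebas (refl_char \<phi>, 0)))"
      unfolding i\<phi> d.glide_ebas[OF \<phi>] a s s0_0 ..
    show ?thesis unfolding e ha hs 1[OF \<phi>] 1[OF refl_chars[OF \<phi>]] r
      by (simp add: i\<phi> fun_eq_iff cscale_def algebra_simps)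
  qed
  then show "\<exists>e. family_basis ((free_chars \<union> plus_chars) \<times> {0::plane}) e L2W \<and>
    (\<forall>i\<in>(free_chars \<union> plus_chars) \<times> {0}. hecke u ls (e i) = cscale (\<Prod>l\<leftarrow>ls. 1 - fst i l * u) (e i))"
    using basis unfolding idx by (intro exI[of _ ?e]) blast
  have "card (free_chars \<union> plus_chars) = card {i \<in> d.idx. fst i (snd i) = 1}"
  proof -
    have "{i \<in> d.idx. fst i (snd i) = 1} = d.idx"
      using d.idx_chars chars_charac by (force simp: charac_def idx)
    then show ?thesis unfolding idx by (simp add: card_cartesian_product)
  qed
  also have "\<dots> = card d.ge.gclasses" unfolding d.idx_card by simp
  also have "\<dots> = card (double_cosets G \<Gamma>)"
  proof (rule bij_betw_same_card)
    \<comment> \<open>The double coset of the elements that map the vertex \<open>0\<close> into a given orbit.\<close>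
    define K where "K C = {g \<in> W_ext G. (g 0, 0) \<in> C}" for C :: "(plane \<times> plane) set"
    have CE: "C \<subseteq> d.E" if "C \<in> d.ge.gclasses" for C by (rule d.ge.class_subset[OF that])
    have Kx: "K C = {\<gamma> \<circ> transl x \<circ> w | \<gamma> w. \<gamma> \<in> \<Gamma> \<and> w \<in> weyl G}"
      if C: "C \<in> d.ge.gclasses" and x: "(x, 0) \<in> C" for C x
    proof (intro equalityI subsetI)
      fix g assume "g \<in> K C"
      then have g: "g \<in> W_ext G" "(g 0, 0) \<in> C" by (auto simp: K_def)
      obtain m where "d.r m (g 0, 0) (x, 0)" using d.ge.class_relD[OF C g(2) x] by blast
      then obtain \<gamma> where \<gamma>: "\<gamma> \<in> \<Gamma>" "g 0 = \<gamma> x" using \<Gamma>r by blast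
      have xl: "x \<in> lat" using CE[OF C] x by (auto simp: d.E_def)
      have gx: "\<gamma> \<circ> transl x \<in> W_ext G" by (rule Wext_comp[OF \<Gamma>_Wext[OF \<gamma>(1)] transl_Wext[OF xl]])
      obtain h where h: "h \<in> W_ext G" "(\<gamma> \<circ> transl x) \<circ> h = id" "h \<circ> (\<gamma> \<circ> transl x) = id" using Wext_inv[OF gx] by blast
      have "(h \<circ> g) 0 = 0"
      proof -
        have "(h \<circ> g) 0 = (h \<circ> (\<gamma> \<circ> transl x)) 0" using \<gamma>(2) by (simp add: transl_apply)
        then show ?thesis unfolding h(3) by simp
      qed
      then have "h \<circ> g \<in> weyl G" using Wext_fix0[OF Wext_comp[OF h(1) g(1)]] by blast
      moreover have "g = \<gamma> \<circ> transl x \<circ> (h \<circ> g)" using h(2) by (metis comp_assoc id_comp)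
      ultimately show "g \<in> {\<gamma> \<circ> transl x \<circ> w | \<gamma> w. \<gamma> \<in> \<Gamma> \<and> w \<in> weyl G}" using \<gamma>(1) by blast
    next
      fix g assume "g \<in> {\<gamma> \<circ> transl x \<circ> w | \<gamma> w. \<gamma> \<in> \<Gamma> \<and> w \<in> weyl G}"
      then obtain \<gamma> w where g: "g = \<gamma> \<circ> transl x \<circ> w" "\<gamma> \<in> \<Gamma>" "w \<in> weyl G" by blast
      have xl: "x \<in> lat" using CE[OF C] x by (auto simp: d.E_def)
      have "g \<in> W_ext G" unfolding g(1)
        by (intro Wext_comp \<Gamma>_Wext[OF g(2)] transl_Wext[OF xl] W_Wext[OF g(3)])
      moreover have "g 0 = \<gamma> x" using W_0[OF g(3)] by (simp add: g(1) transl_apply)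
      moreover have "(\<gamma> x, 0) \<in> C" using d.ge.class_closed[OF C x d.ge.r_sym[OF r\<Gamma>[OF g(2) xl]]] .
      ultimately show "g \<in> K C" by (simp add: K_def)
    qed
    have ex: "\<exists>x. (x, 0) \<in> C" if "C \<in> d.ge.gclasses" for C
      using d.ge.class_nonempty[OF that] CE[OF that] by (auto simp: d.E_def)
    have dc: "{\<gamma> \<circ> g \<circ> w | \<gamma> w. \<gamma> \<in> \<Gamma> \<and> w \<in> weyl G} = {\<gamma> \<circ> transl (g 0) \<circ> w | \<gamma> w. \<gamma> \<in> \<Gamma> \<and> w \<in> weyl G}"
      if g: "g \<in> W_ext G" for g
    proof -
      obtain w0 where w0: "w0 \<in> weyl G" "g = transl (g 0) \<circ> w0" using Wext_form[OF g] by blast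
      obtain w1 where w1: "w1 \<in> weyl G" "w0 \<circ> w1 = id" using W_inv[OF w0(1)] by blast
      have 1: "\<gamma> \<circ> g \<circ> w = \<gamma> \<circ> transl (g 0) \<circ> (w0 \<circ> w)" for \<gamma> w using w0(2) by (metis comp_assoc)
      have 2: "\<gamma> \<circ> transl (g 0) \<circ> w = \<gamma> \<circ> g \<circ> (w1 \<circ> w)" for \<gamma> w
        using w0(2) w1(2) by (metis comp_assoc id_comp)
      show ?thesis
        using 1 2 W_comp[OF w0(1)] W_comp[OF w1(1)] by blast
    qed
    show "bij_betw K d.ge.gclasses (double_cosets G \<Gamma>)"
    proof (rule bij_betw_imageI)
      show "inj_on K d.ge.gclasses"
      proof (rule inj_onI)
        fix C C' assume C: "C \<in> d.ge.gclasses" "C' \<in> d.ge.gclasses" "K C = K C'"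
        obtain x where x: "(x, 0) \<in> C" using ex[OF C(1)] by blast
        have "x \<in> lat" using CE[OF C(1)] x by (auto simp: d.E_def)
        then have "transl x \<in> K C" using x transl_Wext by (simp add: K_def transl_apply)
        then have "(x, 0) \<in> C'" unfolding C(3) by (simp add: K_def transl_apply)
        then show "C = C'" using d.ge.class_disjoint[OF C(1,2) x] by blast
      qed
      show "K ` d.ge.gclasses = double_cosets G \<Gamma>"
      proof (intro equalityI subsetI)
        fix X assume "X \<in> K ` d.ge.gclasses"
        then obtain C where C: "C \<in> d.ge.gclasses" "X = K C" by blast
        obtain x where x: "(x, 0) \<in> C" using ex[OF C(1)] by blast
        have "x \<in> lat" using CE[OF C(1)] x by (auto simp: d.E_def)
        then show "X \<in> double_cosets G \<Gamma>"
          unfolding C(2) Kx[OF C(1) x] double_cosets_def using transl_Wext by blast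
      next
        fix X assume "X \<in> double_cosets G \<Gamma>"
        then obtain g where g: "g \<in> W_ext G" "X = {\<gamma> \<circ> g \<circ> w | \<gamma> w. \<gamma> \<in> \<Gamma> \<and> w \<in> weyl G}"
          unfolding double_cosets_def by blast
        have "(g 0, 0) \<in> d.E" using Wext_0[OF g(1)] by (simp add: d.E_def)
        then obtain C where C: "C \<in> d.ge.gclasses" "(g 0, 0) \<in> C" using d.ge.class_exists by blast
        have "X = K C" unfolding g(2) dc[OF g(1)] Kx[OF C] ..
        then show "X \<in> K ` d.ge.gclasses" using C(1) by blast
      qed
    qed
  qed
  finally show "card (free_chars \<union> plus_chars) = card (double_cosets G \<Gamma>)" .
qed

lemma L_function_eq:
  assumes ls: "set ls \<subseteq> lat" and inv: "\<And>w. w \<in> weyl G \<Longrightarrow> mset (map w ls) = mset ls" and wt: "mset ls = wt \<pi>"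
  shows "L_function G \<Gamma> \<pi> u = (\<Prod>\<phi>\<in>free_chars \<union> plus_chars. inverse (\<Prod>l\<leftarrow>ls. 1 - \<phi> l * u))"
proof -
  obtain e where e: "family_basis ((free_chars \<union> plus_chars) \<times> {0::plane}) e L2W"
    "\<And>i. i \<in> (free_chars \<union> plus_chars) \<times> {0} \<Longrightarrow> hecke u ls (e i) = cscale (\<Prod>l\<leftarrow>ls. 1 - fst i l * u) (e i)"
    using spherical_basis(1)[OF ls inv] by blast
  have s: "hecke u ls (sph \<rho>) = cscale (\<Prod>l\<leftarrow>ls. 1 - chi G \<rho> l * u) (sph \<rho>)" if "\<rho> \<in> Irr_unr G \<Gamma>" for \<rho>
    by (rule Irr_unr_hecke[OF that sph(1)[OF that] ls inv])
  have invp: "prod_mset (image_mset (\<lambda>l. inverse (g l)) (wt \<pi>)) = inverse (\<Prod>l\<leftarrow>ls. g l)" for g :: "plane \<Rightarrow> complex"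
    unfolding wt[symmetric] by (induction ls) auto
  have "L_function G \<Gamma> \<pi> u = (\<Prod>\<rho>\<in>Irr_unr G \<Gamma>. inverse (\<Prod>l\<leftarrow>ls. 1 - chi G \<rho> l * u))"
    unfolding L_function_def invp ..
  also have "\<dots> = (\<Prod>i\<in>(free_chars \<union> plus_chars) \<times> {0::plane}. inverse (\<Prod>l\<leftarrow>ls. 1 - fst i l * u))"
    by (rule eigenbasis_prod_eq[OF Irr_unr_basis e(1) hecke_linear s e(2)])
  also have "\<dots> = (\<Prod>\<phi>\<in>free_chars \<union> plus_chars. inverse (\<Prod>l\<leftarrow>ls. 1 - \<phi> l * u))"
    by (rule prod.reindex_bij_witness[where i = "\<lambda>\<phi>. (\<phi>, 0)" and j = fst]) auto
  finally show ?thesis .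
qed

end

section \<open>The zeta function\<close>

text \<open>The directions are now the nontrivial weights of \<open>\<pi>\<close>, and \<open>\<Theta>\<close> is a finite set of normal vectors of the
  walls, so that the walls are the lines \<open>x \<bullet> \<theta> \<in> \<int>\<close>. Every weight is parallel to walls, lines in walls with the
  direction of a weight contain lattice points, and weights are primitive in the lattice.\<close>

locale klein_geodesics =
  klein_rep \<alpha> \<beta> n k a b c G \<Gamma> + klein_directions \<alpha> \<beta> n k a b c D Fx H
  for \<alpha> \<beta> :: plane and n k :: nat and a b c :: int and G :: grp
    and \<Gamma> :: "(plane \<Rightarrow> plane) set" and D Fx H :: "plane set" +
  fixes \<pi> :: wrep and \<Theta> :: "plane set"
  assumes wt_D: "wt' \<pi> = D"
    and norm_D: "l \<in> D \<Longrightarrow> norm l = ell \<pi>" and ell_pos: "ell \<pi> > 0"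
    and finite_\<Theta>: "finite \<Theta>" and skeleton: "one_skeleton G = {x. \<exists>\<theta>\<in>\<Theta>. x \<bullet> \<theta> \<in> \<int>}"
    and \<Theta>_lat: "\<theta> \<in> \<Theta> \<Longrightarrow> x \<in> lat \<Longrightarrow> x \<bullet> \<theta> \<in> \<int>"
    and \<Theta>_parallel: "l \<in> D \<Longrightarrow> \<exists>\<theta>\<in>\<Theta>. l \<bullet> \<theta> = 0"
    and \<Theta>_vertex: "l \<in> D \<Longrightarrow> \<theta> \<in> \<Theta> \<Longrightarrow> l \<bullet> \<theta> = 0 \<Longrightarrow> v \<bullet> \<theta> \<in> \<int> \<Longrightarrow> \<exists>s. v + s *\<^sub>R l \<in> lat"
    and primitive_weight: "l \<in> D \<Longrightarrow> s *\<^sub>R l \<in> lat \<Longrightarrow> s \<in> \<int>"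
begin

lemma line_eq: "l \<in> D \<Longrightarrow> oriented_line v l s = v + (s / ell \<pi>) *\<^sub>R l"
  by (simp add: oriented_line_def sgn_div_norm norm_D field_simps)
lemma line_scaled: "l \<in> D \<Longrightarrow> oriented_line v l (ell \<pi> * s) = v + s *\<^sub>R l"
  using ell_pos by (simp add: line_eq)
lemma line_shift: "oriented_line (oriented_line v l s1) l s = oriented_line v l (s + s1)"
  by (simp add: oriented_line_def algebra_simps)
lemma line_0: "oriented_line v l 0 = v" by (simp add: oriented_line_def)

text \<open>The linear part \<open>g0\<close> of an element of \<open>\<Gamma>\<close>. The square of a glide reflection is a translation without fixed points.\<close>

lemma \<Gamma>_lin:
  assumes "\<gamma> \<in> \<Gamma>"
  obtains g0 where "\<And>x y. \<gamma> (x + y) = \<gamma> x + g0 y" "linear g0" "\<And>y. norm (g0 y) = norm y"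
    "g0 = (\<lambda>x. x) \<or> g0 = s0 \<and> (\<forall>x. \<gamma> (\<gamma> x) \<noteq> x)"
  using assms
proof (cases rule: \<Gamma>_E)
  case (tr t)
  show thesis
    by (rule that[of "\<lambda>x. x"]) (auto simp: tr transl_apply linear_id[unfolded id_def])
next
  case (gl t)
  have ne: "\<gamma> (\<gamma> x) \<noteq> x" for x
  proof
    assume fx: "\<gamma> (\<gamma> x) = x"
    obtain i j where t: "t = lp (i * int k - j * c * int n) (2 * j * c)" using gl(1) by (auto simp: trl_def)
    have "\<gamma> (\<gamma> x) = x + lp (int k) 0 + (s0 t + t)" by (simp add: gl transl_apply sg_add sg_sg)
    also have "s0 t + t = lp (2 * i * int k) 0" by (simp add: t s0_lp lp_add algebra_simps)
    finally have "lp (int k) 0 + lp (2 * i * int k) 0 = lp 0 0" using fx by (simp add: lp_0 add.assoc)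
    then have "(1 + 2 * i) * int k = 0" by (simp add: lp_add lp_inject algebra_simps)
    then have "1 + 2 * i = 0" using k_pos by simp
    then show False by presburger
  qed
  then show thesis
    by (intro that[of s0]) (auto simp: gl transl_apply sg_add linear_s0 norm_s0)
qed

lemma \<Gamma>_lat: "\<gamma> \<in> \<Gamma> \<Longrightarrow> x \<in> lat \<Longrightarrow> \<gamma> x \<in> lat"
  by (erule \<Gamma>_E) (simp_all add: transl_apply lat_add trl_lat sg_lat)

lemma orbit_eq: assumes "\<gamma> \<in> \<Gamma>" shows "orbit \<Gamma> (\<gamma> x) = orbit \<Gamma> x"
proof -
  obtain \<delta> where \<delta>: "\<delta> \<in> \<Gamma>" "\<delta> \<circ> \<gamma> = id" using \<Gamma>_inv[OF assms] by blast
  have 1: "\<eta> (\<gamma> x) = (\<eta> \<circ> \<gamma>) x" for \<eta> by simp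
  have 2: "\<eta> x = (\<eta> \<circ> \<delta>) (\<gamma> x)" for \<eta> using \<delta>(2) by (metis comp_apply id_apply)
  show ?thesis unfolding orbit_def using 1 2 \<Gamma>_comp[OF _ assms] \<Gamma>_comp[OF _ \<delta>(1)] by blast
qed
lemma orbit_self: "x \<in> orbit \<Gamma> x" unfolding orbit_def using \<Gamma>_id by (intro CollectI exI[of _ id]) simp

text \<open>The grading in terms of lines: \<open>\<gamma>\<close> maps one parametrized line to the other, with a shift of the parameter by \<open>m\<close>.\<close>

lemma r_iff:
  assumes "(x, l) \<in> E" "(y, l') \<in> E"
  shows "r m (x, l) (y, l') \<longleftrightarrow> (\<exists>\<gamma>\<in>\<Gamma>. \<forall>s. \<gamma> (y + s *\<^sub>R l') = x + (s - of_int m) *\<^sub>R l)"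
proof
  assume "r m (x, l) (y, l')"
  then show "\<exists>\<gamma>\<in>\<Gamma>. \<forall>s. \<gamma> (y + s *\<^sub>R l') = x + (s - of_int m) *\<^sub>R l"
  proof (cases rule: rE)
    case (tr t z l'')
    then show ?thesis using \<Gamma>_transl[OF tr(1)]
      by (intro bexI[of _ "transl t"]) (auto simp: transl_apply algebra_simps)
  next
    case (gl t z l'')
    then show ?thesis using \<Gamma>_glide[OF gl(1)]
      by (intro bexI[of _ "transl t \<circ> sg"]) (auto simp: transl_apply sg_add s0_scale scaleR_diff_left)
  qed
next
  assume "\<exists>\<gamma>\<in>\<Gamma>. \<forall>s. \<gamma> (y + s *\<^sub>R l') = x + (s - of_int m) *\<^sub>R l"
  then obtain \<gamma> where \<gamma>: "\<gamma> \<in> \<Gamma>" "\<And>s. \<gamma> (y + s *\<^sub>R l') = x + (s - of_int m) *\<^sub>R l" by blast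
  have 0: "\<gamma> y = x - of_int m *\<^sub>R l" using \<gamma>(2)[of 0] by simp
  have 1: "\<gamma> (y + l') = \<gamma> y + l" using \<gamma>(2)[of 1] unfolding 0 by (simp add: scaleR_diff_left)
  show "r m (x, l) (y, l')" using \<gamma>(1)
  proof (cases rule: \<Gamma>_E)
    case (tr t)
    then have ll: "l' = l" using 1 by (simp add: transl_apply)
    show ?thesis unfolding ll using 0 tr assms ll
      by (intro rI1'[OF tr(1)]) (auto simp: transl_apply algebra_simps)
  next
    case (gl t)
    then have l: "l = s0 l'" using 1 by (simp add: transl_apply sg_add)
    show ?thesis using 0 gl assms l by (intro rI2'[OF gl(1)]) (auto simp: transl_apply algebra_simps)
  qed
qed

text \<open>\<open>d\<close> is a period of the image in the quotient of the oriented line.\<close>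

definition period :: "plane \<Rightarrow> plane \<Rightarrow> real \<Rightarrow> bool" where
  "period v l d \<longleftrightarrow> (\<exists>\<gamma>\<in>\<Gamma>. \<forall>s. \<gamma> (oriented_line v l s) = oriented_line v l (s + d))"

text \<open>An element of \<open>\<Gamma>\<close> that preserves a line and moves \<open>v\<close> forward on it cannot reverse the line, because its square
  would fix \<open>v\<close>.\<close>

lemma closed_geodesic_period:
  assumes l: "l \<in> D"
  shows "closed_geodesic_on \<Gamma> v l q \<longleftrightarrow> fst q = orbit \<Gamma> \<circ> oriented_line v l \<and> snd q > 0 \<and> period v l (snd q)"
proof
  assume q: "closed_geodesic_on \<Gamma> v l q"
  then obtain \<gamma> where \<gamma>: "\<gamma> \<in> \<Gamma>" "\<gamma> ` range (oriented_line v l) = range (oriented_line v l)"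
    "snd q > 0" "\<gamma> v = oriented_line v l (snd q)" unfolding closed_geodesic_on_def by blast
  obtain g0 where g0: "\<And>x y. \<gamma> (x + y) = \<gamma> x + g0 y" "linear g0" "\<And>y. norm (g0 y) = norm y"
    "g0 = (\<lambda>x. x) \<or> g0 = s0 \<and> (\<forall>x. \<gamma> (\<gamma> x) \<noteq> x)"
    using \<Gamma>_lin[OF \<gamma>(1)] by metis
  let ?e = "sgn l"
  have ln: "l \<noteq> 0" using norm_D[OF l] ell_pos by auto
  have e: "norm ?e = 1" using ln by (simp add: norm_sgn)
  have line: "\<gamma> (oriented_line v l s) = v + snd q *\<^sub>R ?e + s *\<^sub>R g0 ?e" for s
    using g0(1)[of v "s *\<^sub>R ?e"] \<gamma>(4) g0(2) by (simp add: oriented_line_def linear_scale)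
  have "\<gamma> (oriented_line v l 1) \<in> range (oriented_line v l)" using \<gamma>(2) by blast
  then obtain s where "\<gamma> (oriented_line v l 1) = oriented_line v l s" by blast
  then have "v + snd q *\<^sub>R ?e + g0 ?e = v + s *\<^sub>R ?e" unfolding line by (simp add: oriented_line_def)
  then have ge: "g0 ?e = (s - snd q) *\<^sub>R ?e" by (simp add: algebra_simps)
  have "\<bar>s - snd q\<bar> = 1" using g0(3)[of ?e] unfolding ge using e by simp
  moreover have "s - snd q \<noteq> - 1"
  proof
    assume m: "s - snd q = - 1"
    have ge': "g0 ?e = - ?e" using ge m by simp
    have "\<gamma> (\<gamma> v) = v" using line[of "snd q"] \<gamma>(4) ge' by simp
    then have "g0 = (\<lambda>x. x)" using g0(4) by blast
    then have "?e = - ?e" using ge' by simp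
    then have "?e + ?e = 0" by (metis add.right_inverse)
    then have "2 *\<^sub>R ?e = 0" by (simp add: scaleR_2)
    then show False using e by simp
  qed
  ultimately have "s - snd q = 1" by linarith
  then have "g0 ?e = ?e" using ge by simp
  then have "\<gamma> (oriented_line v l s) = oriented_line v l (s + snd q)" for s
    unfolding line by (simp add: oriented_line_def algebra_simps)
  then show "fst q = orbit \<Gamma> \<circ> oriented_line v l \<and> snd q > 0 \<and> period v l (snd q)"
    using q \<gamma> unfolding closed_geodesic_on_def period_def by blast
next
  assume q: "fst q = orbit \<Gamma> \<circ> oriented_line v l \<and> snd q > 0 \<and> period v l (snd q)"
  then obtain \<gamma> where \<gamma>: "\<gamma> \<in> \<Gamma>" "\<And>s. \<gamma> (oriented_line v l s) = oriented_line v l (s + snd q)"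
    unfolding period_def by blast
  have ln: "l \<noteq> 0" using norm_D[OF l] ell_pos by auto
  have gv: "\<gamma> v = oriented_line v l (snd q)" using \<gamma>(2)[of 0] by (simp add: line_0)
  have "\<gamma> ` range (oriented_line v l) = range (oriented_line v l)"
  proof (intro equalityI subsetI)
    fix x assume "x \<in> range (oriented_line v l)"
    then obtain s where "x = oriented_line v l s" by blast
    then have "x = \<gamma> (oriented_line v l (s - snd q))" using \<gamma>(2) by simp
    then show "x \<in> \<gamma> ` range (oriented_line v l)" by blast
  qed (use \<gamma>(2) in auto)
  moreover have "dist v (\<gamma> v) = snd q" using q ln unfolding gv by (simp add: oriented_line_def dist_norm norm_sgn)
  ultimately show "closed_geodesic_on \<Gamma> v l q" unfolding closed_geodesic_on_def using q \<gamma>(1) gv by metis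
qed

lemma period_shift: "period (oriented_line v l s1) l d \<longleftrightarrow> period v l d"
proof -
  have "(\<forall>s. \<gamma> (oriented_line v l (s + s1)) = oriented_line v l (s + d + s1)) \<longleftrightarrow>
    (\<forall>s. \<gamma> (oriented_line v l s) = oriented_line v l (s + d))" for \<gamma>
  proof (intro iffI allI)
    fix s assume A: "\<forall>s. \<gamma> (oriented_line v l (s + s1)) = oriented_line v l (s + d + s1)"
    show "\<gamma> (oriented_line v l s) = oriented_line v l (s + d)"
      using A[rule_format, of "s - s1"] by (simp add: algebra_simps)
  next
    fix s assume A: "\<forall>s. \<gamma> (oriented_line v l s) = oriented_line v l (s + d)"
    show "\<gamma> (oriented_line v l (s + s1)) = oriented_line v l (s + d + s1)"
      using A[rule_format, of "s + s1"] by (simp add: algebra_simps)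
  qed
  then show ?thesis unfolding period_def line_shift by simp
qed

text \<open>Through a lattice point, the positive periods are the multiples of the cycle length, in units of the length of a
  weight: a period maps a lattice point of the line to another one, and the weight is primitive.\<close>

lemma period_class:
  assumes C: "C \<in> ge.gclasses" and x: "(x, l) \<in> C" and d: "d > 0"
  shows "period x l d \<longleftrightarrow> (\<exists>m>0. d = ell \<pi> * of_nat m \<and> ge.len C dvd m)"
proof -
  have xE: "(x, l) \<in> E" using ge.class_subset[OF C] x by blast
  then have xl: "x \<in> lat" "l \<in> D" by (auto simp: E_def)
  have per: "period x l (ell \<pi> * of_int m) \<longleftrightarrow> int (ge.len C) dvd m" for m
  proof -
    have "period x l (ell \<pi> * of_int m) \<longleftrightarrow> (\<exists>\<gamma>\<in>\<Gamma>. \<forall>s. \<gamma> (x + s *\<^sub>R l) = x + (s - of_int (- m)) *\<^sub>R l)"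
      unfolding period_def
    proof (rule bex_cong[OF refl])
      fix \<gamma>
      have "(\<forall>s. \<gamma> (oriented_line x l s) = oriented_line x l (s + ell \<pi> * of_int m)) \<longleftrightarrow>
        (\<forall>s. \<gamma> (oriented_line x l (ell \<pi> * s)) = oriented_line x l (ell \<pi> * (s + of_int m)))"
      proof (intro iffI allI)
        fix s assume A: "\<forall>s. \<gamma> (oriented_line x l (ell \<pi> * s)) = oriented_line x l (ell \<pi> * (s + of_int m))"
        show "\<gamma> (oriented_line x l s) = oriented_line x l (s + ell \<pi> * of_int m)"
          using A[rule_format, of "s / ell \<pi>"] ell_pos by (simp add: distrib_left)
      qed (simp add: distrib_left)
      then show "(\<forall>s. \<gamma> (oriented_line x l s) = oriented_line x l (s + ell \<pi> * of_int m)) \<longleftrightarrow>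
        (\<forall>s. \<gamma> (x + s *\<^sub>R l) = x + (s - of_int (- m)) *\<^sub>R l)" by (simp add: line_scaled[OF xl(2)])
    qed
    also have "\<dots> \<longleftrightarrow> r (- m) (x, l) (x, l)" by (rule r_iff[OF xE xE, symmetric])
    also have "\<dots> \<longleftrightarrow> r m (x, l) (x, l)" using ge.r_sym[of m "(x, l)" "(x, l)"] ge.r_sym[of "- m" "(x, l)" "(x, l)"] by auto
    also have "\<dots> \<longleftrightarrow> int (ge.len C) dvd m"
    proof
      assume "int (ge.len C) dvd m"
      then obtain j where j: "m = int (ge.len C) * j" by (auto elim: dvdE)
      show "r m (x, l) (x, l)" unfolding j by (rule ge.len_multiple[OF C x])
    qed (rule ge.len_props(3)[OF C x])
    finally show ?thesis .
  qed
  show ?thesis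
  proof
    assume p: "period x l d"
    then obtain \<gamma> where "\<gamma> \<in> \<Gamma>" "\<gamma> (oriented_line x l 0) = oriented_line x l (0 + d)" unfolding period_def by blast
    then have "oriented_line x l d \<in> lat" using \<Gamma>_lat xl(1) by (metis add_0 line_0)
    then have "(d / ell \<pi>) *\<^sub>R l \<in> lat"
      using lat_add[OF _ lat_minus[OF xl(1)]] unfolding line_eq[OF xl(2)] by fastforce
    then obtain m where m: "d / ell \<pi> = of_int m" using primitive_weight[OF xl(2)] by (blast elim: Ints_cases)
    then have dm: "d = ell \<pi> * of_int m" using ell_pos by (simp add: field_simps)
    have "m > 0" using m d ell_pos by (metis of_int_0_less_iff zero_less_divide_iff)
    moreover have "int (ge.len C) dvd m" using p per dm by simp
    ultimately show "\<exists>m>0. d = ell \<pi> * of_nat m \<and> ge.len C dvd m"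
      using dm by (intro exI[of _ "nat m"]) (auto simp: int_dvd_int_iff[symmetric])
  next
    assume "\<exists>m>0. d = ell \<pi> * of_nat m \<and> ge.len C dvd m"
    then obtain m where "d = ell \<pi> * of_int (int m)" "int (ge.len C) dvd int m" by auto
    then show "period x l d" using per by blast
  qed
qed

lemma countable_\<Gamma>: "countable \<Gamma>"
proof -
  have "trl \<subseteq> (\<lambda>(i, j). lp (i * int k - j * c * int n) (2 * j * c)) ` (UNIV :: (int \<times> int) set)"
    unfolding trl_def by auto
  then have "countable trl" by (rule countable_subset) (rule countable_image, simp)
  then show ?thesis unfolding \<Gamma>_eq glide_group_def by (intro countable_Un countable_image)
qed

text \<open>Two lines with the same image in the quotient differ by an element of the group, because the
  group is countable and the real line is not.\<close>

lemma same_path: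
  assumes "\<And>s. orbit \<Gamma> (oriented_line v l s) = orbit \<Gamma> (oriented_line v' l' (s + s0'))"
  shows "\<exists>\<gamma>\<in>\<Gamma>. \<forall>s. \<gamma> (oriented_line v l s) = oriented_line v' l' (s + s0')"
proof -
  have "\<exists>\<gamma>\<in>\<Gamma>. \<gamma> (oriented_line v l s) = oriented_line v' l' (s + s0')" for s
  proof -
    have "oriented_line v' l' (s + s0') \<in> orbit \<Gamma> (oriented_line v l s)"
      unfolding assms[of s] by (rule orbit_self)
    then show ?thesis unfolding orbit_def by force
  qed
  then obtain f where f: "\<And>s. f s \<in> \<Gamma>" "\<And>s. f s (oriented_line v l s) = oriented_line v' l' (s + s0')" by metis
  have "\<not> inj f"
  proof
    assume "inj f"
    moreover have "countable (range f)" using countable_\<Gamma> f(1) by (meson countable_subset image_subsetI)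
    ultimately have "countable (UNIV :: real set)" by (simp add: countable_image_inj_eq)
    then show False using uncountable_UNIV_real by simp
  qed
  then obtain s1 s2 where s12: "s1 \<noteq> s2" "f s1 = f s2" by (auto simp: inj_def)
  define \<gamma> where "\<gamma> = f s1"
  have \<gamma>: "\<gamma> \<in> \<Gamma>" "\<gamma> (oriented_line v l s1) = oriented_line v' l' (s1 + s0')"
    "\<gamma> (oriented_line v l s2) = oriented_line v' l' (s2 + s0')"
    using f(1)[of s1] f(2)[of s1] f(2)[of s2] s12(2) by (simp_all add: \<gamma>_def)
  obtain g0 where g0: "\<And>x y. \<gamma> (x + y) = \<gamma> x + g0 y" "linear g0" using \<Gamma>_lin[OF \<gamma>(1)] by metis
  have g: "\<gamma> (oriented_line v l s) = \<gamma> (oriented_line v l s1) + (s - s1) *\<^sub>R g0 (sgn l)" for s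
  proof -
    have "oriented_line v l s = oriented_line v l s1 + (s - s1) *\<^sub>R sgn l" by (simp add: oriented_line_def algebra_simps)
    then show ?thesis using g0 by (simp add: linear_scale)
  qed
  have "(s2 - s1) *\<^sub>R g0 (sgn l) = (s2 - s1) *\<^sub>R sgn l'"
    using g[of s2] \<gamma>(2,3) by (simp add: oriented_line_def algebra_simps)
  then have gl: "g0 (sgn l) = sgn l'" using s12(1) by simp
  have "\<gamma> (oriented_line v l s) = oriented_line v' l' (s + s0')" for s
    unfolding g[of s] \<gamma>(2) gl by (simp add: oriented_line_def algebra_simps)
  then show ?thesis using \<gamma>(1) by blast
qed

lemma period_transport:
  assumes \<gamma>: "\<gamma> \<in> \<Gamma>" "\<And>s. \<gamma> (oriented_line v l s) = oriented_line v' l' (s + s1)" and p: "period v l d"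
  shows "period v' l' d"
proof -
  obtain \<eta> where \<eta>: "\<eta> \<in> \<Gamma>" "\<And>s. \<eta> (oriented_line v l s) = oriented_line v l (s + d)" using p unfolding period_def by blast
  obtain \<delta> where \<delta>: "\<delta> \<in> \<Gamma>" "\<delta> \<circ> \<gamma> = id" using \<Gamma>_inv[OF \<gamma>(1)] by blast
  have "(\<gamma> \<circ> \<eta> \<circ> \<delta>) (oriented_line v' l' s) = oriented_line v' l' (s + d)" for s
  proof -
    have "\<delta> (oriented_line v' l' s) = oriented_line v l (s - s1)"
      using \<gamma>(2)[of "s - s1"] \<delta>(2) by (metis comp_apply diff_add_cancel id_apply)
    then show ?thesis using \<eta>(2) \<gamma>(2) by simp
  qed
  moreover have "\<gamma> \<circ> \<eta> \<circ> \<delta> \<in> \<Gamma>" using \<Gamma>_comp \<gamma>(1) \<eta>(1) \<delta>(1) by blast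
  ultimately show ?thesis unfolding period_def by blast
qed

text \<open>A geodesic lies in the 1-skeleton iff it meets the lattice.\<close>

lemma rational_iff:
  assumes l: "l \<in> D"
  shows "range (oriented_line v l) \<subseteq> one_skeleton G \<longleftrightarrow> (\<exists>s. oriented_line v l s \<in> lat)"
proof
  assume "\<exists>s. oriented_line v l s \<in> lat"
  then obtain s1 where s1: "oriented_line v l s1 \<in> lat" by blast
  obtain \<theta> where \<theta>: "\<theta> \<in> \<Theta>" "l \<bullet> \<theta> = 0" using \<Theta>_parallel[OF l] by blast
  have "oriented_line v l s \<bullet> \<theta> = oriented_line v l s1 \<bullet> \<theta>" for s
    using \<theta>(2) by (simp add: line_eq[OF l] inner_add_left)
  then have "oriented_line v l s \<bullet> \<theta> \<in> \<int>" for s using \<Theta>_lat[OF \<theta>(1) s1] by metis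
  then show "range (oriented_line v l) \<subseteq> one_skeleton G" using \<theta>(1) unfolding skeleton by auto
next
  assume rat: "range (oriented_line v l) \<subseteq> one_skeleton G"
  \<comment> \<open>A line meets the walls not parallel to it in countably many points only, so it has a point on a parallel wall, which then contains it.\<close>
  let ?B = "\<Union>\<theta>\<in>{\<theta> \<in> \<Theta>. l \<bullet> \<theta> \<noteq> 0}. {s. oriented_line v l s \<bullet> \<theta> \<in> \<int>}"
  have "countable ?B"
  proof (rule countable_UN)
    show "countable {\<theta> \<in> \<Theta>. l \<bullet> \<theta> \<noteq> 0}" using finite_\<Theta> by (simp add: countable_finite)
    fix \<theta> assume "\<theta> \<in> {\<theta> \<in> \<Theta>. l \<bullet> \<theta> \<noteq> 0}"
    then have nz: "l \<bullet> \<theta> \<noteq> 0" by simp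
    have "{s. oriented_line v l s \<bullet> \<theta> \<in> \<int>} \<subseteq> (\<lambda>i. (of_int i - v \<bullet> \<theta>) * ell \<pi> / (l \<bullet> \<theta>)) ` UNIV"
    proof
      fix s assume "s \<in> {s. oriented_line v l s \<bullet> \<theta> \<in> \<int>}"
      then obtain i where "oriented_line v l s \<bullet> \<theta> = of_int i" by (auto elim: Ints_cases)
      then have "s = (of_int i - v \<bullet> \<theta>) * ell \<pi> / (l \<bullet> \<theta>)"
        using nz ell_pos by (simp add: line_eq[OF l] inner_add_left field_simps)
      then show "s \<in> (\<lambda>i. (of_int i - v \<bullet> \<theta>) * ell \<pi> / (l \<bullet> \<theta>)) ` UNIV" by blast
    qed
    then show "countable {s. oriented_line v l s \<bullet> \<theta> \<in> \<int>}" by (rule countable_subset) simp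
  qed
  then have "?B \<noteq> UNIV" using uncountable_UNIV_real by metis
  then obtain s where s: "s \<notin> ?B" by blast
  obtain \<theta> where \<theta>: "\<theta> \<in> \<Theta>" "oriented_line v l s \<bullet> \<theta> \<in> \<int>" using rat unfolding skeleton by blast
  then have l0: "l \<bullet> \<theta> = 0" using s by blast
  then have "v \<bullet> \<theta> \<in> \<int>" using \<theta>(2) by (simp add: line_eq[OF l] inner_add_left)
  then obtain s' where "v + s' *\<^sub>R l \<in> lat" using \<Theta>_vertex[OF l \<theta>(1) l0] by blast
  then have "oriented_line v l (ell \<pi> * s') \<in> lat" by (simp add: line_scaled[OF l])
  then show "\<exists>s. oriented_line v l s \<in> lat" by blast
qed

text \<open>The closed geodesics obtained by going once around the cycle \<open>C\<close>, from any starting point.\<close>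

definition Geo :: "(plane \<times> plane) set \<Rightarrow> ((real \<Rightarrow> plane set) \<times> real) set" where
  "Geo C = {((\<lambda>s. orbit \<Gamma> (oriented_line x l (s + s1))), ell \<pi> * of_nat (ge.len C)) | x l s1. (x, l) \<in> C}"

lemma Geo_primitive: assumes C: "C \<in> ge.gclasses" and q: "q \<in> Geo C" shows "q \<in> primitive_rational G \<Gamma> \<pi>"
proof -
  obtain x l s1 where x: "(x, l) \<in> C" and q1: "fst q = (\<lambda>s. orbit \<Gamma> (oriented_line x l (s + s1)))"
    and q2: "snd q = ell \<pi> * of_nat (ge.len C)" using q unfolding Geo_def by auto
  have lp: "ge.len C > 0" by (rule ge.len_props(1)[OF C x])
  have xl: "x \<in> lat" "l \<in> D" using ge.class_subset[OF C] x by (auto simp: E_def)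
  let ?v = "oriented_line x l s1"
  have pos: "snd q > 0" using q2 lp ell_pos by simp
  have "period x l (snd q)" unfolding period_class[OF C x pos] using q2 lp by (intro exI[of _ "ge.len C"]) simp
  then have cg: "closed_geodesic_on \<Gamma> ?v l q"
    unfolding closed_geodesic_period[OF xl(2)] period_shift using pos
    by (auto simp: q1 fun_eq_iff line_shift)
  have "oriented_line ?v l (- s1) \<in> lat" unfolding line_shift using xl(1) by (simp add: line_0)
  then have "range (oriented_line ?v l) \<subseteq> one_skeleton G" using rational_iff[OF xl(2)] by blast
  then have "q \<in> rational_closed_geodesics G \<Gamma> \<pi>"
    unfolding rational_closed_geodesics_def wt_D using cg xl(2) by blast
  moreover have "primitive \<Gamma> \<pi> q"
    unfolding primitive_def
  proof
    assume "\<exists>m::nat. \<exists>c'\<in>closed_geodesics \<Gamma> \<pi>. m \<ge> 2 \<and> fst c' = fst q \<and> snd q = real m * snd c'"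
    then obtain m :: nat and c' v' l' where m: "m \<ge> 2" and c': "fst c' = fst q" "snd q = real m * snd c'"
      and l': "l' \<in> D" "closed_geodesic_on \<Gamma> v' l' c'" unfolding closed_geodesics_def wt_D by blast
    from l'(2) have p: "fst c' = orbit \<Gamma> \<circ> oriented_line v' l'" "snd c' > 0" "period v' l' (snd c')"
      unfolding closed_geodesic_period[OF l'(1)] by auto
    have "orbit \<Gamma> (oriented_line v' l' s) = orbit \<Gamma> (oriented_line x l (s + s1))" for s
      using p(1) c'(1) q1 by (metis comp_apply)
    from same_path[OF this] obtain \<gamma> where \<gamma>: "\<gamma> \<in> \<Gamma>" "\<And>s. \<gamma> (oriented_line v' l' s) = oriented_line x l (s + s1)" by blast
    have "period x l (snd c')" by (rule period_transport[OF \<gamma> p(3)])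
    then obtain m' where m': "m' > 0" "snd c' = ell \<pi> * of_nat m'" "ge.len C dvd m'"
      unfolding period_class[OF C x p(2)] by blast
    have "ell \<pi> * of_nat (ge.len C) = ell \<pi> * of_nat (m * m')" using q2 c'(2) unfolding m'(2) of_nat_mult by (metis mult.left_commute)
    then have "real (ge.len C) = of_nat (m * m')" using ell_pos by simp
    then have "ge.len C = m * m'" by (simp only: of_nat_eq_iff)
    moreover have "ge.len C \<le> m'" using m' by (simp add: dvd_imp_le)
    moreover have "2 * m' \<le> m * m'" using m by simp
    ultimately show False using m'(1) by linarith
  qed
  ultimately show ?thesis by (simp add: primitive_rational_def)
qed

lemma primitive_Geo: assumes q: "q \<in> primitive_rational G \<Gamma> \<pi>" shows "\<exists>C\<in>ge.gclasses. q \<in> Geo C"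
proof -
  obtain v l where l: "l \<in> D" and cg: "closed_geodesic_on \<Gamma> v l q" and rat: "range (oriented_line v l) \<subseteq> one_skeleton G"
    using q unfolding primitive_rational_def rational_closed_geodesics_def wt_D by blast
  from cg have p: "fst q = orbit \<Gamma> \<circ> oriented_line v l" "snd q > 0" "period v l (snd q)"
    unfolding closed_geodesic_period[OF l] by auto
  obtain s1 where s1: "oriented_line v l s1 \<in> lat" using rat rational_iff[OF l] by blast
  define x where "x = oriented_line v l s1"
  have xE: "(x, l) \<in> E" using s1 l by (simp add: E_def x_def)
  obtain C where C: "C \<in> ge.gclasses" "(x, l) \<in> C" using ge.class_exists[OF xE] by blast
  have "period x l (snd q)" unfolding x_def period_shift by (rule p(3))
  then obtain m where m: "m > 0" "snd q = ell \<pi> * of_nat m" "ge.len C dvd m"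
    unfolding period_class[OF C p(2)] by blast
  obtain j where j: "m = ge.len C * j" using m(3) by (auto elim: dvdE)
  have path: "fst q = (\<lambda>s. orbit \<Gamma> (oriented_line x l (s + (- s1))))"
    unfolding x_def line_shift p(1) by (simp add: comp_def)
  let ?c = "(fst q, ell \<pi> * of_nat (ge.len C))"
  have "?c \<in> Geo C" unfolding Geo_def path using C(2) by blast
  then have "?c \<in> closed_geodesics \<Gamma> \<pi>"
    using Geo_primitive[OF C(1)] unfolding primitive_rational_def rational_closed_geodesics_def closed_geodesics_def by blast
  moreover have "snd q = real j * snd ?c" using m(2) j by simp
  moreover have "primitive \<Gamma> \<pi> q" using q by (simp add: primitive_rational_def)
  \<comment> \<open>\<open>q\<close> is the \<open>j\<close>-fold repetition of \<open>?c\<close>, and primitivity leaves only \<open>j = 1\<close>.\<close>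
  ultimately have "\<not> j \<ge> 2" unfolding primitive_def by (metis fst_conv)
  moreover have "j \<noteq> 0" using m(1) j by auto
  ultimately have "j = 1" by linarith
  then have "q = ?c" using m(2) j by (simp add: prod_eq_iff)
  then show ?thesis using \<open>?c \<in> Geo C\<close> C(1) by metis
qed

lemma Geo_same_path:
  assumes C: "C \<in> ge.gclasses" and x: "(x, l) \<in> C" and y: "(y, l') \<in> C"
  shows "\<exists>s0'. \<forall>s. orbit \<Gamma> (oriented_line y l' s) = orbit \<Gamma> (oriented_line x l (s + s0'))"
proof -
  have E: "(x, l) \<in> E" "(y, l') \<in> E" using ge.class_subset[OF C] x y by auto
  then have D: "l \<in> D" "l' \<in> D" by (auto simp: E_def)
  obtain m where "r m (x, l) (y, l')" using ge.class_relD[OF C x y] by blast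
  then obtain \<gamma> where \<gamma>: "\<gamma> \<in> \<Gamma>" "\<And>s. \<gamma> (y + s *\<^sub>R l') = x + (s - of_int m) *\<^sub>R l" unfolding r_iff[OF E] by blast
  have "orbit \<Gamma> (oriented_line y l' s) = orbit \<Gamma> (oriented_line x l (s + (- ell \<pi> * of_int m)))" for s
  proof -
    have "\<gamma> (oriented_line y l' s) = oriented_line x l (s + (- ell \<pi> * of_int m))"
      unfolding line_eq[OF D(1)] line_eq[OF D(2)] \<gamma>(2) using ell_pos by (simp add: field_simps)
    then show ?thesis using orbit_eq[OF \<gamma>(1)] by metis
  qed
  then show ?thesis by blast
qed

lemma Geo_same: assumes C: "C \<in> ge.gclasses" and q: "q \<in> Geo C" "q' \<in> Geo C" shows "(q, q') \<in> same_up_to_start"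
proof -
  obtain x l s1 where x: "(x, l) \<in> C" and q1: "fst q = (\<lambda>s. orbit \<Gamma> (oriented_line x l (s + s1)))"
    and q2: "snd q = ell \<pi> * of_nat (ge.len C)" using q(1) unfolding Geo_def by auto
  obtain y l' s2 where y: "(y, l') \<in> C" and q1': "fst q' = (\<lambda>s. orbit \<Gamma> (oriented_line y l' (s + s2)))"
    and q2': "snd q' = ell \<pi> * of_nat (ge.len C)" using q(2) unfolding Geo_def by auto
  obtain s3 where s3: "\<And>s. orbit \<Gamma> (oriented_line y l' s) = orbit \<Gamma> (oriented_line x l (s + s3))"
    using Geo_same_path[OF C x y] by blast
  have "fst q' = (\<lambda>s. fst q (s + (s2 + s3 - s1)))"
    unfolding q1 q1' s3 by (simp add: algebra_simps)
  then show ?thesis unfolding same_up_to_start_def using q2 q2' by (cases q, cases q') auto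
qed

lemma Geo_closed: assumes q: "q \<in> Geo C" and "(q, q') \<in> same_up_to_start" shows "q' \<in> Geo C"
proof -
  obtain x l s1 where x: "(x, l) \<in> C" and q1: "q = ((\<lambda>s. orbit \<Gamma> (oriented_line x l (s + s1))), ell \<pi> * of_nat (ge.len C))"
    using q unfolding Geo_def by auto
  obtain s2 where "snd q' = snd q" "fst q' = (\<lambda>s. fst q (s + s2))" using assms(2) by (auto simp: same_up_to_start_def)
  then have "q' = ((\<lambda>s. orbit \<Gamma> (oriented_line x l (s + (s2 + s1)))), ell \<pi> * of_nat (ge.len C))"
    by (simp add: q1 prod_eq_iff add.assoc)
  then show ?thesis unfolding Geo_def using x by blast
qed

lemma Geo_disjoint: assumes C: "C \<in> ge.gclasses" "C' \<in> ge.gclasses" and q: "q \<in> Geo C" "q \<in> Geo C'" shows "C = C'"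
proof -
  obtain x l s1 where x: "(x, l) \<in> C" and q1: "fst q = (\<lambda>s. orbit \<Gamma> (oriented_line x l (s + s1)))" using q(1) unfolding Geo_def by auto
  obtain y l' s2 where y: "(y, l') \<in> C'" and q1': "fst q = (\<lambda>s. orbit \<Gamma> (oriented_line y l' (s + s2)))" using q(2) unfolding Geo_def by auto
  have E: "(x, l) \<in> E" "(y, l') \<in> E" using ge.class_subset C x y by blast+
  then have D: "l \<in> D" "l' \<in> D" "x \<in> lat" "y \<in> lat" by (auto simp: E_def)
  have "orbit \<Gamma> (oriented_line x l s) = orbit \<Gamma> (oriented_line y l' (s + (s2 - s1)))" for s
  proof -
    have "fst q (s - s1) = orbit \<Gamma> (oriented_line x l s)" unfolding q1 by simp
    moreover have "fst q (s - s1) = orbit \<Gamma> (oriented_line y l' (s + (s2 - s1)))" unfolding q1' by (simp add: algebra_simps)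
    ultimately show ?thesis by metis
  qed
  from same_path[OF this] obtain \<gamma> where \<gamma>: "\<gamma> \<in> \<Gamma>" "\<And>s. \<gamma> (oriented_line x l s) = oriented_line y l' (s + (s2 - s1))" by blast
  have "oriented_line y l' (s2 - s1) \<in> lat" using \<Gamma>_lat[OF \<gamma>(1) D(3)] \<gamma>(2)[of 0] by (simp add: line_0)
  then have "((s2 - s1) / ell \<pi>) *\<^sub>R l' \<in> lat"
    using lat_add[OF _ lat_minus[OF D(4)]] unfolding line_eq[OF D(2)] by fastforce
  then obtain m where m: "(s2 - s1) / ell \<pi> = of_int m" using primitive_weight[OF D(2)] by (blast elim: Ints_cases)
  have "\<gamma> (x + s *\<^sub>R l) = y + (s - of_int (- m)) *\<^sub>R l'" for s
  proof -
    have "(ell \<pi> * s + (s2 - s1)) / ell \<pi> = s + of_int m" using m ell_pos by (simp add: add_divide_distrib)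
    then show ?thesis using \<gamma>(2)[of "ell \<pi> * s"] unfolding line_scaled[OF D(1)] line_eq[OF D(2)] by simp
  qed
  then have "r (- m) (y, l') (x, l)" unfolding r_iff[OF E(2,1)] using \<gamma>(1) by blast
  then have "(x, l) \<in> C'" using ge.class_closed[OF C(2) y] by blast
  then show ?thesis using ge.class_disjoint[OF C x] by blast
qed

lemma Geo_nonempty: "C \<in> ge.gclasses \<Longrightarrow> \<exists>q. q \<in> Geo C"
  using ge.class_nonempty[of C] unfolding Geo_def by fastforce

text \<open>The classes of primitive rational closed geodesics are the cycles.\<close>

lemma geodesic_classes_bij: "bij_betw Geo ge.gclasses (geodesic_classes G \<Gamma> \<pi>)"
proof -
  let ?P = "primitive_rational G \<Gamma> \<pi>"
  let ?R = "same_up_to_start \<inter> ?P \<times> ?P"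
  have img: "?R `` {q} = Geo C" if C: "C \<in> ge.gclasses" and q: "q \<in> Geo C" for C q
    using Geo_primitive[OF C] q Geo_same[OF C q] Geo_closed[OF q] by blast
  show ?thesis
  proof (rule bij_betw_imageI)
    show "inj_on Geo ge.gclasses"
      by (rule inj_onI) (metis Geo_disjoint Geo_nonempty)
    show "Geo ` ge.gclasses = geodesic_classes G \<Gamma> \<pi>"
    proof (intro equalityI subsetI)
      fix X assume "X \<in> Geo ` ge.gclasses"
      then obtain C where C: "C \<in> ge.gclasses" "X = Geo C" by blast
      obtain q where q: "q \<in> Geo C" using Geo_nonempty[OF C(1)] by blast
      show "X \<in> geodesic_classes G \<Gamma> \<pi>"
        unfolding geodesic_classes_def C(2) img[OF C(1) q, symmetric]
        by (rule quotientI[OF Geo_primitive[OF C(1) q]])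
    next
      fix X assume "X \<in> geodesic_classes G \<Gamma> \<pi>"
      then obtain q where q: "q \<in> ?P" "X = ?R `` {q}" unfolding geodesic_classes_def by (auto elim: quotientE)
      obtain C where C: "C \<in> ge.gclasses" "q \<in> Geo C" using primitive_Geo[OF q(1)] by blast
      then show "X \<in> Geo ` ge.gclasses" using img[OF C] q(2) by blast
    qed
  qed
qed

lemma zeta_function_eq: "zeta_function G \<Gamma> \<pi> u = (\<Prod>C\<in>ge.gclasses. inverse (1 - u ^ ge.len C))"
proof -
  have "zeta_function G \<Gamma> \<pi> u =
    (\<Prod>C\<in>ge.gclasses. inverse (1 - u powr of_real (normalized_length \<pi> (Geo C))))"
    unfolding zeta_function_def by (rule prod.reindex_bij_betw[OF geodesic_classes_bij, symmetric])
  also have "\<dots> = (\<Prod>C\<in>ge.gclasses. inverse (1 - u ^ ge.len C))"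
  proof (rule prod.cong[OF refl])
    fix C assume C: "C \<in> ge.gclasses"
    have "snd ` Geo C = {ell \<pi> * of_nat (ge.len C)}"
      using Geo_nonempty[OF C] unfolding Geo_def by force
    then have "normalized_length \<pi> (Geo C) = of_nat (ge.len C)"
      using ell_pos by (simp add: normalized_length_def)
    moreover have "ge.len C > 0" using ge.len_props(1)[OF C] ge.class_nonempty[OF C] by blast
    ultimately show "inverse (1 - u powr of_real (normalized_length \<pi> (Geo C))) = inverse (1 - u ^ ge.len C)"
      by (simp add: powr_nat')
  qed
  finally show ?thesis .
qed

lemma zeta_function_idx: "zeta_function G \<Gamma> \<pi> u = inverse (\<Prod>i\<in>idx. 1 - fst i (snd i) * u)"
  unfolding zeta_function_eq idx_product by (simp add: prod_inversef[symmetric] o_def)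

end

section \<open>Groups permuting a spanning family up to sign\<close>

text \<open>Linear maps permuting a family \<open>v\<close> up to factors in \<open>S\<close>. Both Weyl groups are of this form.\<close>

definition signed_perm :: "('i::finite \<Rightarrow> plane) \<Rightarrow> real set \<Rightarrow> (plane \<Rightarrow> plane) \<Rightarrow> ('i \<Rightarrow> 'i) \<Rightarrow> ('i \<Rightarrow> real) \<Rightarrow> bool" where
  "signed_perm v S w p s \<longleftrightarrow> linear w \<and> p permutes UNIV \<and> (\<forall>i. s i \<in> S) \<and> (\<forall>i. w (v i) = s i *\<^sub>R v (p i))"

definition signed_perms :: "('i::finite \<Rightarrow> plane) \<Rightarrow> real set \<Rightarrow> (plane \<Rightarrow> plane) set" where
  "signed_perms v S = {w. \<exists>p s. signed_perm v S w p s}"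

lemma signed_perms_id: "1 \<in> S \<Longrightarrow> id \<in> signed_perms v S"
  unfolding signed_perms_def signed_perm_def
  by (intro CollectI exI[of _ id] exI[of _ "\<lambda>_. 1"]) (auto simp: linear_id permutes_id)

lemma signed_perms_comp:
  assumes S: "\<And>s t. s \<in> S \<Longrightarrow> t \<in> S \<Longrightarrow> s * t \<in> S" and w: "w \<in> signed_perms v S" "w' \<in> signed_perms v S"
  shows "w \<circ> w' \<in> signed_perms v S"
proof -
  obtain p s p' s' where p: "signed_perm v S w p s" "signed_perm v S w' p' s'" using w unfolding signed_perms_def by blast
  then have "signed_perm v S (w \<circ> w') (p \<circ> p') (\<lambda>i. s' i * s (p' i))"
    using S unfolding signed_perm_def
    by (auto simp: linear_scale linear_compose intro!: permutes_compose)
  then show ?thesis unfolding signed_perms_def by blast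
qed

lemma signed_perms_inv:
  assumes S: "S \<subseteq> {1, - 1}" and v: "span (range v) = UNIV" and w: "w \<in> signed_perms v S"
  shows "\<exists>w'\<in>signed_perms v S. w \<circ> w' = id \<and> w' \<circ> w = id"
proof -
  obtain p s where p: "linear w" "p permutes UNIV" "\<And>i. s i \<in> S" "\<And>i. w (v i) = s i *\<^sub>R v (p i)"
    using w unfolding signed_perms_def signed_perm_def by blast
  have ss: "s i * s i = 1" for i using p(3)[of i] S by auto
  let ?q = "inv_into UNIV p"
  have q: "?q permutes UNIV" using p(2) by (rule permutes_inv)
  have pq: "p (?q i) = i" for i using p(2) by (rule permutes_inverses(1))
  have "range v \<subseteq> range w"
  proof
    fix x assume "x \<in> range v"
    then obtain i where x: "x = v i" by blast
    have "w (s (?q i) *\<^sub>R v (?q i)) = x" using ss[of "?q i"] p(1,4) pq by (simp add: linear_scale x)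
    then show "x \<in> range w" by blast
  qed
  then have "span (range v) \<subseteq> range w"
    by (intro span_minimal) (auto intro: linear_subspace_image[OF p(1)] subspace_UNIV)
  then have surj: "surj w" using v by auto
  obtain w' where w': "linear w'" "\<And>x. w' (w x) = x" "\<And>x. w (w' x) = x"
    using linear_surjective_isomorphism[OF p(1) surj] by auto
  have "w' (v i) = s (?q i) *\<^sub>R v (?q i)" for i
  proof -
    have "v i = w (s (?q i) *\<^sub>R v (?q i))" using ss[of "?q i"] p(1,4) pq by (simp add: linear_scale)
    then show ?thesis using w'(2) by metis
  qed
  then have "signed_perm v S w' ?q (\<lambda>i. s (?q i))" using w'(1) q p(3) by (simp add: signed_perm_def)
  then show ?thesis using w' unfolding signed_perms_def by (intro bexI[of _ w']) (auto simp: fun_eq_iff)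
qed

lemma signed_perms_finite:
  assumes S: "finite S" and v: "span (range v) = UNIV"
  shows "finite (signed_perms v S)"
proof -
  let ?A = "(\<lambda>(s, i). s *\<^sub>R v i) ` (S \<times> UNIV)"
  let ?F = "\<lambda>w i. w (v i)"
  have "?F ` signed_perms v S \<subseteq> PiE UNIV (\<lambda>_. ?A)"
    unfolding signed_perms_def signed_perm_def by fastforce
  moreover have "finite (PiE UNIV (\<lambda>_::'a. ?A))" using S by (intro finite_PiE) auto
  ultimately have "finite (?F ` signed_perms v S)" by (rule finite_subset)
  moreover have "inj_on ?F (signed_perms v S)"
  proof (rule inj_onI)
    fix w w' assume w: "w \<in> signed_perms v S" "w' \<in> signed_perms v S" "?F w = ?F w'"
    then have "linear w" "linear w'" by (auto simp: signed_perms_def signed_perm_def)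
    moreover have "\<And>x. x \<in> range v \<Longrightarrow> w x = w' x" using w(3) by (auto simp: fun_eq_iff)
    ultimately show "w = w'" using linear_eq_on_span[of w w' "range v"] v by auto
  qed
  ultimately show ?thesis by (rule finite_imageD)
qed

section \<open>The plane in coordinates\<close>

text \<open>The point with coordinates \<open>x, y\<close>.\<close>

definition mk :: "real \<Rightarrow> real \<Rightarrow> plane" where "mk x y = vector [x, y]"

lemma mk_nth[simp]: "mk x y $ 1 = x" "mk x y $ 2 = y" by (simp_all add: mk_def)
lemma mk_eq[simp]: "mk x y = mk x' y' \<longleftrightarrow> x = x' \<and> y = y'" by (auto simp: vec_eq_iff forall_2)
lemma mk_add[simp]: "mk x y + mk x' y' = mk (x + x') (y + y')" by (simp add: vec_eq_iff forall_2)
lemma mk_diff[simp]: "mk x y - mk x' y' = mk (x - x') (y - y')" by (simp add: vec_eq_iff forall_2)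
lemma mk_minus[simp]: "- mk x y = mk (- x) (- y)" by (simp add: vec_eq_iff forall_2)
lemma mk_scale[simp]: "r *\<^sub>R mk x y = mk (r * x) (r * y)" by (simp add: vec_eq_iff forall_2)
lemma mk_inner[simp]: "mk x y \<bullet> mk x' y' = x * x' + y * y'" by (simp add: inner_vec_def sum_2)
lemma mk_0: "0 = mk 0 0" by (simp add: vec_eq_iff forall_2)
lemma mk_eq_0[simp]: "mk x y = 0 \<longleftrightarrow> x = 0 \<and> y = 0" by (simp add: mk_0)
lemma mk_cases: obtains x y where "v = mk x y"
  using that[of "v $ 1" "v $ 2"] by (simp add: vec_eq_iff forall_2)
lemma mk_axis: "axis 1 1 = mk 1 0" "axis 2 1 = mk 0 1" by (simp_all add: vec_eq_iff forall_2 axis_def)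
lemma norm_mk: "norm (mk x y) = sqrt (x\<^sup>2 + y\<^sup>2)" by (simp add: norm_eq_sqrt_inner power2_eq_square)

lemma alpha_inner: "alpha i \<bullet> alpha j = (if i = j then 1 else - 1 / 2)"
  using exhaust_3[of i] exhaust_3[of j]
  by (auto simp: alpha_def mk_def[symmetric])

text \<open>The three vectors form a tight frame with constant \<open>3/2\<close>.\<close>

lemma alpha_frame: "x = (2 / 3) *\<^sub>R (\<Sum>m\<in>UNIV. (x \<bullet> alpha m) *\<^sub>R alpha m)"
proof -
  obtain a b where x: "x = mk a b" by (rule mk_cases)
  show ?thesis unfolding x by (simp add: sum_3 alpha_def mk_def[symmetric] field_simps)
qed

lemma alpha_span: "span (range alpha) = UNIV"
proof -
  have "x \<in> span (range alpha)" for x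
    by (subst alpha_frame) (intro span_scale span_sum span_base, auto)
  then show ?thesis by blast
qed

lemma alpha_third: assumes "i \<noteq> j" "i \<noteq> m" "j \<noteq> m" shows "alpha m = - alpha i - alpha j"
proof -
  have "alpha m - (- alpha i - alpha j) = 0"
    by (subst inner_eq_zero_iff[symmetric])
      (use assms in \<open>simp add: inner_diff_left inner_diff_right inner_add_left inner_add_right inner_minus_left inner_minus_right alpha_inner\<close>)
  then show ?thesis by simp
qed

lemma three_sum:
  fixes f :: "3 \<Rightarrow> 'a::comm_monoid_add"
  assumes "i \<noteq> j" "i \<noteq> m" "j \<noteq> m" shows "(\<Sum>x\<in>UNIV. f x) = f i + f j + f m"
proof -
  have "card {i, j, m} = 3" using assms by simp
  then have "{i, j, m} = UNIV" by (intro card_subset_eq) auto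
  then show ?thesis using assms by (simp flip: \<open>{i, j, m} = UNIV\<close> add: add.assoc)
qed

lemma three_third: fixes i j :: 3 assumes "i \<noteq> j" obtains m where "i \<noteq> m" "j \<noteq> m"
proof -
  have "card {i, j} < card (UNIV :: 3 set)" by (rule le_less_trans[OF card_insert_le_m1[of 2]]) auto
  then have "{i, j} \<noteq> UNIV" by force
  then obtain m where "m \<notin> {i, j}" by blast
  then show thesis using that[of m] by auto
qed

lemma alpha_comb_inner: "(\<Sum>m\<in>UNIV. c m *\<^sub>R alpha m) \<bullet> (alpha i - alpha j) = (3 / 2) * (c i - c j)"
proof (cases "i = j")
  case False
  obtain m where m: "i \<noteq> m" "j \<noteq> m" using three_third[OF False] by metis
  show ?thesis unfolding three_sum[OF False m]
    using False m by (simp add: inner_add_left inner_diff_right alpha_inner)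
qed simp

text \<open>Coordinates of a point with respect to two of the three vectors.\<close>

lemma alpha_comb_two:
  assumes "i \<noteq> j" "i \<noteq> m" "j \<noteq> m"
  shows "(\<Sum>x\<in>UNIV. c x *\<^sub>R alpha x) = (c i - c m) *\<^sub>R alpha i + (c j - c m) *\<^sub>R alpha j"
  unfolding three_sum[OF assms] alpha_third[OF assms] by (simp add: algebra_simps)

section \<open>The Weyl groups\<close>

lemma weyl_PGL3: "weyl PGL3 = signed_perms alpha {1}"
proof -
  have "(\<forall>i. s i \<in> {1}) \<longleftrightarrow> s = (\<lambda>_. 1)" for s :: "3 \<Rightarrow> real" by auto
  then show ?thesis unfolding weyl.simps signed_perms_def signed_perm_def by auto
qed

lemma weyl_PGSp4: "weyl PGSp4 = signed_perms (\<lambda>i. axis i 1) {1, - 1}"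
  unfolding weyl.simps signed_perms_def signed_perm_def by auto

lemma axis_span: "span (range (\<lambda>i::2. axis i 1 :: plane)) = UNIV"
proof -
  have "x \<in> span (range (\<lambda>i::2. axis i 1))" for x :: plane
  proof -
    have "x = (\<Sum>i\<in>UNIV. x $ i *\<^sub>R axis i 1)" by (simp add: vec_eq_iff forall_2 sum_2 axis_def)
    also have "\<dots> \<in> span (range (\<lambda>i::2. axis i 1))" by (intro span_sum span_scale span_base) auto
    finally show ?thesis .
  qed
  then show ?thesis by blast
qed

lemma weyl_linear: "w \<in> weyl G \<Longrightarrow> linear w" by (cases G) auto
lemma weyl_id: "id \<in> weyl G"
  by (cases G) (simp_all only: weyl_PGL3 weyl_PGSp4 signed_perms_id insertI1)
lemma weyl_comp: "w \<in> weyl G \<Longrightarrow> w' \<in> weyl G \<Longrightarrow> w \<circ> w' \<in> weyl G"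
proof (cases G)
  case PGL3
  then show "w \<in> weyl G \<Longrightarrow> w' \<in> weyl G \<Longrightarrow> ?thesis"
    unfolding PGL3 weyl_PGL3 by (intro signed_perms_comp) auto
next
  case PGSp4
  then show "w \<in> weyl G \<Longrightarrow> w' \<in> weyl G \<Longrightarrow> ?thesis"
    unfolding PGSp4 weyl_PGSp4 by (intro signed_perms_comp) auto
qed
lemma weyl_inv: "w \<in> weyl G \<Longrightarrow> \<exists>w'\<in>weyl G. w \<circ> w' = id \<and> w' \<circ> w = id"
  using signed_perms_inv[OF _ alpha_span, of "{1}"] signed_perms_inv[OF _ axis_span, of "{1, - 1}"]
  by (cases G) (simp_all only: weyl_PGL3 weyl_PGSp4 subset_refl insert_subset insertI1 empty_subsetI simp_thms)
lemma weyl_finite: "finite (weyl G)"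
  using signed_perms_finite[OF _ alpha_span, of "{1}"] signed_perms_finite[OF _ axis_span, of "{1, - 1}"]
  by (cases G) (simp_all only: weyl_PGL3 weyl_PGSp4 finite.intros simp_thms)

lemma weyl_PGL3_E:
  assumes "w \<in> weyl PGL3" obtains p where "p permutes UNIV" "\<And>i. w (alpha i) = alpha (p i)" "linear w"
proof -
  obtain p where "p permutes UNIV" "\<forall>i. w (alpha i) = alpha (p i)" "linear w"
    using assms unfolding weyl.simps by (elim CollectE exE conjE)
  then show thesis using that[of p] by blast
qed

lemma weyl_PGSp4_E:
  assumes w: "w \<in> weyl PGSp4"
  obtains s t where "s \<in> {1, - 1}" "t \<in> {1, - 1}" "\<And>x y. w (mk x y) = mk (s * x) (t * y)"
  | s t where "s \<in> {1, - 1}" "t \<in> {1, - 1}" "\<And>x y. w (mk x y) = mk (t * y) (s * x)"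
proof -
  obtain p s where p: "linear w" "p permutes UNIV" "\<And>i. s i \<in> {1, - 1}" "\<And>i. w (axis i 1) = s i *\<^sub>R axis (p i) 1"
    using w by auto
  have w: "w (mk x y) = (x * s 1) *\<^sub>R axis (p 1) 1 + (y * s 2) *\<^sub>R axis (p 2) 1" for x y
  proof -
    have "mk x y = x *\<^sub>R axis 1 1 + y *\<^sub>R axis 2 1" by (simp add: mk_axis)
    then show ?thesis using p(1,4) by (simp add: linear_add linear_scale)
  qed
  have "p 1 \<noteq> p 2" by (simp add: inj_eq[OF permutes_inj[OF p(2)]])
  then consider "p 1 = 1" "p 2 = 2" | "p 1 = 2" "p 2 = 1" using exhaust_2[of "p 1"] exhaust_2[of "p 2"] by metis
  then show thesis
  proof cases
    case 1
    then show ?thesis using w p(3) by (intro that(1)[of "s 1" "s 2"]) (simp_all add: mk_axis mult.commute)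
  next
    case 2
    then show ?thesis using w p(3) by (intro that(2)[of "s 1" "s 2"]) (simp_all add: mk_axis mult.commute)
  qed
qed

section \<open>The lattices\<close>

lemma coweight_PGSp4: "coweight_lattice PGSp4 = {mk (of_int p) (of_int q) | p q. True}"
proof (intro equalityI subsetI)
  fix x assume "x \<in> coweight_lattice PGSp4"
  then obtain c :: "2 \<Rightarrow> int" where "x = (\<Sum>i\<in>UNIV. of_int (c i) *\<^sub>R axis i 1)" by auto
  then have "x = mk (of_int (c 1)) (of_int (c 2))" by (simp add: sum_2 mk_axis)
  then show "x \<in> {mk (of_int p) (of_int q) | p q. True}" by blast
next
  fix x assume "x \<in> {mk (of_int p) (of_int q) | p q. True}"
  then obtain p q where x: "x = mk (of_int p) (of_int q)" by blast
  define c :: "2 \<Rightarrow> int" where "c i = (if i = 1 then p else q)" for i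
  have "x = (\<Sum>i\<in>UNIV. of_int (c i) *\<^sub>R axis i 1)" by (simp add: x sum_2 mk_axis c_def)
  then show "x \<in> coweight_lattice PGSp4" by auto
qed

lemma coroot_PGSp4: "coroot_lattice PGSp4 = {mk (of_int p) (of_int q) | p q. even (p + q)}"
proof (intro equalityI subsetI)
  fix x assume "x \<in> coroot_lattice PGSp4"
  then obtain c :: "2 \<Rightarrow> int" where "x = (\<Sum>i\<in>UNIV. of_int (c i) *\<^sub>R axis i 1)" "even (\<Sum>i\<in>UNIV. c i)" by auto
  then have "x = mk (of_int (c 1)) (of_int (c 2))" "even (c 1 + c 2)" by (simp_all add: sum_2 mk_axis)
  then show "x \<in> {mk (of_int p) (of_int q) | p q. even (p + q)}" by blast
next
  fix x assume "x \<in> {mk (of_int p) (of_int q) | p q. even (p + q)}"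
  then obtain p q where x: "x = mk (of_int p) (of_int q)" "even (p + q)" by blast
  define c :: "2 \<Rightarrow> int" where "c i = (if i = 1 then p else q)" for i
  have "x = (\<Sum>i\<in>UNIV. of_int (c i) *\<^sub>R axis i 1)" "even (\<Sum>i\<in>UNIV. c i)" using x by (simp_all add: sum_2 mk_axis c_def)
  then show "x \<in> coroot_lattice PGSp4" by auto
qed

text \<open>Integral combinations of the three vectors. The coefficients are unique only up to adding a constant.\<close>

definition acomb :: "(3 \<Rightarrow> int) \<Rightarrow> plane" where "acomb c = (\<Sum>i\<in>UNIV. of_int (c i) *\<^sub>R alpha i)"

lemma coweight_PGL3: "coweight_lattice PGL3 = range acomb" by (auto simp: acomb_def)
lemma coroot_PGL3: "coroot_lattice PGL3 = {acomb c | c. 3 dvd (\<Sum>i\<in>UNIV. c i)}"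
  unfolding acomb_def dvd_eq_mod_eq_0 by (rule coroot_lattice.simps(1))
lemma coroot_PGL3_I: "3 dvd (\<Sum>i\<in>UNIV. c i) \<Longrightarrow> acomb c \<in> coroot_lattice PGL3"
  unfolding coroot_PGL3 by blast
lemma coroot_PGSp4_I: "even (p + q) \<Longrightarrow> mk (of_int p) (of_int q) \<in> coroot_lattice PGSp4"
  unfolding coroot_PGSp4 by blast
lemma acomb_add: "acomb c + acomb d = acomb (\<lambda>i. c i + d i)" by (simp add: acomb_def algebra_simps sum.distrib)
lemma acomb_minus: "- acomb c = acomb (\<lambda>i. - c i)" by (simp add: acomb_def sum_negf)
lemma acomb_scale: "of_int m *\<^sub>R acomb c = acomb (\<lambda>i. m * c i)" by (simp add: acomb_def scaleR_sum_right)
lemma acomb_0: "acomb (\<lambda>_. 0) = 0" by (simp add: acomb_def)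
lemma acomb_two: "i \<noteq> j \<Longrightarrow> i \<noteq> m \<Longrightarrow> j \<noteq> m \<Longrightarrow>
  acomb c = of_int (c i - c m) *\<^sub>R alpha i + of_int (c j - c m) *\<^sub>R alpha j"
  unfolding acomb_def by (subst alpha_comb_two) auto

lemma weyl_acomb:
  assumes "w \<in> weyl PGL3" shows "\<exists>d. w (acomb c) = acomb d \<and> (\<Sum>i\<in>UNIV. d i) = (\<Sum>i\<in>UNIV. c i)"
proof -
  obtain p where p: "p permutes UNIV" "\<And>i. w (alpha i) = alpha (p i)" "linear w" using assms by (rule weyl_PGL3_E) blast
  let ?q = "inv_into UNIV p"
  have q: "?q permutes UNIV" using p(1) by (rule permutes_inv)
  have pq: "p (?q i) = i" for i using p(1) by (rule permutes_inverses(1))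
  have "w (acomb c) = (\<Sum>i\<in>UNIV. of_int (c i) *\<^sub>R alpha (p i))"
    using p(2,3) by (simp add: acomb_def linear_sum linear_scale)
  also have "\<dots> = (\<Sum>i\<in>UNIV. of_int (c (?q i)) *\<^sub>R alpha i)"
    by (subst sum.permute[OF q]) (simp add: o_def pq)
  finally have "w (acomb c) = acomb (c \<circ> ?q)" by (simp add: acomb_def)
  moreover have "(\<Sum>i\<in>UNIV. (c \<circ> ?q) i) = (\<Sum>i\<in>UNIV. c i)" using sum.permute[OF q, of c] by (simp add: o_def)
  ultimately show ?thesis by blast
qed

lemma weyl_coweight: assumes "w \<in> weyl G" "x \<in> coweight_lattice G" shows "w x \<in> coweight_lattice G"
proof (cases G)
  case PGL3
  then show ?thesis using assms weyl_acomb unfolding PGL3 coweight_PGL3 by blast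
next
  case PGSp4
  obtain p q where x: "x = mk (of_int p) (of_int q)" using assms(2) unfolding PGSp4 coweight_PGSp4 by blast
  have i: "s * of_int m \<in> \<int>" if "s \<in> {1, - 1}" for s :: real and m using that by auto
  have g: "mk u v \<in> coweight_lattice PGSp4" if "u \<in> \<int>" "v \<in> \<int>" for u v
    using that unfolding coweight_PGSp4 by (auto elim!: Ints_cases)
  from assms(1)[unfolded PGSp4] show ?thesis unfolding x PGSp4
    by (cases rule: weyl_PGSp4_E) (simp_all only: g i)
qed

lemma weyl_coroot: assumes "w \<in> weyl G" "x \<in> coroot_lattice G" shows "w x \<in> coroot_lattice G"
proof (cases G)
  case PGL3
  obtain c where c: "x = acomb c" "3 dvd (\<Sum>i\<in>UNIV. c i)" using assms(2) unfolding PGL3 coroot_PGL3 by (elim CollectE exE conjE)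
  obtain d where d: "w (acomb c) = acomb d" "(\<Sum>i\<in>UNIV. d i) = (\<Sum>i\<in>UNIV. c i)"
    using weyl_acomb[OF assms(1)[unfolded PGL3], of c] by (elim exE conjE)
  show ?thesis unfolding PGL3 c(1) d(1) by (rule coroot_PGL3_I) (simp only: d(2) c(2))
next
  case PGSp4
  obtain p q where x: "x = mk (of_int p) (of_int q)" "even (p + q)" using assms(2) unfolding PGSp4 coroot_PGSp4 by (elim CollectE exE conjE)
  have i: "\<exists>m'. s * of_int m = of_int m' \<and> even (m' + m)" if "s \<in> {1, - 1}" for s :: real and m :: int
    using that by (auto intro: exI[of _ m] exI[of _ "- m"])
  have g: "mk u v \<in> coroot_lattice PGSp4" if "u = of_int m" "v = of_int m'" "even (m + m')" for u v m m'
    using that unfolding coroot_PGSp4 by blast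
  from assms(1)[unfolded PGSp4] show ?thesis unfolding x PGSp4
  proof (cases rule: weyl_PGSp4_E)
    case (1 s t)
    obtain p' q' where "s * of_int p = of_int p'" "even (p' + p)" "t * of_int q = of_int q'" "even (q' + q)"
      using i[OF 1(1)] i[OF 1(2)] by blast
    then show "w (mk (of_int p) (of_int q)) \<in> coroot_lattice PGSp4" unfolding 1(3) using x(2) by (intro g[of _ p' _ q']) auto
  next
    case (2 s t)
    obtain p' q' where "s * of_int p = of_int p'" "even (p' + p)" "t * of_int q = of_int q'" "even (q' + q)"
      using i[OF 2(1)] i[OF 2(2)] by blast
    then show "w (mk (of_int p) (of_int q)) \<in> coroot_lattice PGSp4" unfolding 2(3) using x(2) by (intro g[of _ q' _ p']) auto
  qed
qed

lemma coroot_add: assumes "x \<in> coroot_lattice G" "y \<in> coroot_lattice G" shows "x + y \<in> coroot_lattice G"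
proof (cases G)
  case PGL3
  obtain c d where c: "x = acomb c" "3 dvd (\<Sum>i\<in>UNIV. c i)" "y = acomb d" "3 dvd (\<Sum>i\<in>UNIV. d i)"
    using assms unfolding PGL3 coroot_PGL3 by (elim CollectE exE conjE)
  show ?thesis unfolding PGL3 c(1,3) acomb_add
    by (rule coroot_PGL3_I) (simp only: sum.distrib dvd_add c(2,4))
next
  case PGSp4
  obtain p q p' q' where x: "x = mk (of_int p) (of_int q)" "even (p + q)" "y = mk (of_int p') (of_int q')" "even (p' + q')"
    using assms unfolding PGSp4 coroot_PGSp4 by (elim CollectE exE conjE)
  have "x + y = mk (of_int (p + p')) (of_int (q + q'))" "even ((p + p') + (q + q'))" using x by auto
  then show ?thesis unfolding PGSp4 using coroot_PGSp4_I by metis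
qed

lemma coroot_minus: assumes "x \<in> coroot_lattice G" shows "- x \<in> coroot_lattice G"
proof (cases G)
  case PGL3
  obtain c where c: "x = acomb c" "3 dvd (\<Sum>i\<in>UNIV. c i)"
    using assms unfolding PGL3 coroot_PGL3 by (elim CollectE exE conjE)
  show ?thesis unfolding PGL3 c(1) acomb_minus
    by (rule coroot_PGL3_I) (simp only: sum_negf dvd_minus_iff c(2))
next
  case PGSp4
  obtain p q where x: "x = mk (of_int p) (of_int q)" "even (p + q)"
    using assms unfolding PGSp4 coroot_PGSp4 by (elim CollectE exE conjE)
  have "- x = mk (of_int (- p)) (of_int (- q))" "even (- p + - q)" using x by auto
  then show ?thesis unfolding PGSp4 using coroot_PGSp4_I by metis
qed

text \<open>The quotient of the coweight lattice by the coroot lattice has order 3 or 2, so that it is annihilated by 6.\<close>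

lemma coroot_six: assumes "x \<in> coweight_lattice G" shows "of_int (6 * m) *\<^sub>R x \<in> coroot_lattice G"
proof (cases G)
  case PGL3
  obtain c where c: "x = acomb c" using assms unfolding PGL3 coweight_PGL3 by blast
  have "(\<Sum>i\<in>UNIV. 6 * m * c i) = 3 * (2 * m * (\<Sum>i\<in>UNIV. c i))" by (simp add: sum_distrib_left mult.assoc)
  then show ?thesis unfolding PGL3 c(1) acomb_scale by (intro coroot_PGL3_I) (simp only: dvd_triv_left)
next
  case PGSp4
  obtain p q where x: "x = mk (of_int p) (of_int q)" using assms unfolding PGSp4 coweight_PGSp4 by blast
  have "of_int (6 * m) *\<^sub>R x = mk (of_int (6 * m * p)) (of_int (6 * m * q))" "even (6 * m * p + 6 * m * q)" using x by auto
  then show ?thesis unfolding PGSp4 using coroot_PGSp4_I by metis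
qed

lemma coroot_coweight: "coroot_lattice G \<subseteq> coweight_lattice G"
  by (cases G) (auto simp only: coroot_PGL3 coweight_PGL3 coroot_PGSp4 coweight_PGSp4)

lemma coroot_0: "0 \<in> coroot_lattice G"
proof -
  have "(0::plane) \<in> coweight_lattice G"
  proof (cases G)
    case PGL3
    then show ?thesis using rangeI[of acomb "\<lambda>_. 0"] by (simp only: coweight_PGL3 acomb_0)
  next
    case PGSp4
    have "mk (of_int 0) (of_int 0) \<in> coweight_lattice PGSp4" unfolding coweight_PGSp4 by blast
    then show ?thesis using PGSp4 by (simp add: mk_0)
  qed
  from coroot_six[OF this, of 0] show ?thesis by simp
qed

section \<open>The affine Weyl group\<close>

lemma W_aff_comp_form: "linear w \<Longrightarrow> (transl x \<circ> w) \<circ> (transl y \<circ> w') = transl (x + w y) \<circ> (w \<circ> w')"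
  by (simp add: transl_def fun_eq_iff linear_add)

lemma W_aff_group: "group (W_aff_group G)"
proof (rule groupI)
  fix g h assume "g \<in> carrier (W_aff_group G)" "h \<in> carrier (W_aff_group G)"
  then obtain x w y w' where g: "g = transl x \<circ> w" "x \<in> coroot_lattice G" "w \<in> weyl G"
    and h: "h = transl y \<circ> w'" "y \<in> coroot_lattice G" "w' \<in> weyl G" by (auto simp: W_aff_group_def W_aff_def)
  have "g \<circ> h \<in> W_aff G" unfolding g(1) h(1) W_aff_comp_form[OF weyl_linear[OF g(3)]] W_aff_def
    using coroot_add[OF g(2) weyl_coroot[OF g(3) h(2)]] weyl_comp[OF g(3) h(3)] by blast
  then show "g \<otimes>\<^bsub>W_aff_group G\<^esub> h \<in> carrier (W_aff_group G)" by (simp add: W_aff_group_def)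
next
  have "transl 0 \<circ> id \<in> W_aff G" unfolding W_aff_def using coroot_0 weyl_id by blast
  moreover have "transl 0 \<circ> id = id" by (simp add: transl_def fun_eq_iff)
  ultimately show "\<one>\<^bsub>W_aff_group G\<^esub> \<in> carrier (W_aff_group G)" by (simp add: W_aff_group_def)
next
  fix g assume "g \<in> carrier (W_aff_group G)"
  then obtain x w where g: "g = transl x \<circ> w" "x \<in> coroot_lattice G" "w \<in> weyl G" by (auto simp: W_aff_group_def W_aff_def)
  obtain w' where w': "w' \<in> weyl G" "w \<circ> w' = id" "w' \<circ> w = id" using weyl_inv[OF g(3)] by blast
  have "transl (w' (- x)) \<circ> w' \<in> W_aff G" unfolding W_aff_def using w'(1) weyl_coroot[OF w'(1) coroot_minus[OF g(2)]] by blast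
  moreover have "w' (- x) + w' x = 0" using weyl_linear[OF w'(1)] by (simp add: linear_neg)
  then have "(transl (w' (- x)) \<circ> w') \<circ> g = id"
    unfolding g(1) W_aff_comp_form[OF weyl_linear[OF w'(1)]] w'(3) by (simp add: transl_def fun_eq_iff)
  ultimately show "\<exists>y\<in>carrier (W_aff_group G). y \<otimes>\<^bsub>W_aff_group G\<^esub> g = \<one>\<^bsub>W_aff_group G\<^esub>"
    by (auto simp: W_aff_group_def)
qed (auto simp: W_aff_group_def comp_assoc)

lemma transl_W_aff: "transl x \<in> W_aff G \<longleftrightarrow> x \<in> coroot_lattice G"
proof
  assume "transl x \<in> W_aff G"
  then obtain y w where y: "transl x = transl y \<circ> w" "y \<in> coroot_lattice G" "w \<in> weyl G" by (auto simp: W_aff_def)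
  have "x = y" using fun_cong[OF y(1), of 0] linear_0[OF weyl_linear[OF y(3)]] by (simp add: transl_def)
  then show "x \<in> coroot_lattice G" using y(2) by simp
next
  assume "x \<in> coroot_lattice G"
  moreover have "transl x = transl x \<circ> id" by simp
  ultimately show "transl x \<in> W_aff G" unfolding W_aff_def using weyl_id by blast
qed

section \<open>The weights\<close>

lemma alpha_eq_iff[simp]: "alpha i = alpha j \<longleftrightarrow> i = j"
  using alpha_inner[of i i] alpha_inner[of i j] by (auto split: if_splits)

lemma three_other: "\<exists>i. i \<noteq> (m :: 3)"
  by (cases "m = 1") (auto intro: exI[of _ 2] exI[of _ 1])

lemma alpha_nz[simp]: "alpha i \<noteq> 0"
  using alpha_inner[of i i] by auto

lemma wt_Spin_mk: "wt Spin = {# mk 1 0, mk (- 1) 0, mk 0 1, mk 0 (- 1) #}"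
  by (simp add: mk_axis)
lemma wt_St_mk: "wt St = {# mk 1 1, mk 1 (- 1), mk (- 1) 1, mk (- 1) (- 1), 0 #}"
  by (simp add: mk_axis)

lemma UNIV_3_alpha: "range alpha = {alpha 1, alpha 2, alpha 3}"
  unfolding UNIV_3 by simp

lemma wt'_Pi1: "wt' Pi1 = range alpha" unfolding wt'_def UNIV_3_alpha by auto
lemma wt'_Pi2: "wt' Pi2 = range (\<lambda>i. - alpha i)"
proof -
  have "range (\<lambda>i. - alpha i) = {- alpha 1, - alpha 2, - alpha 3}" unfolding UNIV_3 by simp
  then show ?thesis unfolding wt'_def by auto
qed
lemma wt'_Spin: "wt' Spin = {mk 1 0, mk (- 1) 0, mk 0 1, mk 0 (- 1)}"
  unfolding wt'_def wt_Spin_mk by auto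
lemma wt'_St: "wt' St = {mk 1 1, mk 1 (- 1), mk (- 1) 1, mk (- 1) (- 1)}"
  unfolding wt'_def wt_St_mk by auto

lemma wt_mset: "wt \<pi> = mset_set (wt' \<pi>) + replicate_mset (eps \<pi>) 0"
proof (cases \<pi>)
  case Pi1
  have "eps Pi1 = 0" by (simp add: eps_def)
  then show ?thesis unfolding Pi1 wt'_Pi1 UNIV_3_alpha by simp
next
  case Pi2
  have "eps Pi2 = 0" by (simp add: eps_def)
  moreover have "range (\<lambda>i. - alpha i) = {- alpha 1, - alpha 2, - alpha 3}" unfolding UNIV_3 by simp
  ultimately show ?thesis unfolding Pi2 wt'_Pi2 by simp
next
  case Spin
  have "eps Spin = 0" unfolding eps_def wt_Spin_mk by simp
  then show ?thesis unfolding Spin wt'_Spin wt_Spin_mk by simp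
next
  case St
  have "eps St = 1" unfolding eps_def wt_St_mk by simp
  then show ?thesis unfolding St wt'_St wt_St_mk by simp
qed

lemma norm_alpha: "norm (alpha i) = 1" by (simp add: norm_eq_sqrt_inner alpha_inner)

lemma norm_wt': "\<exists>r>0. norm ` wt' \<pi> = {r}"
proof (cases \<pi>)
  case Pi1
  show ?thesis unfolding Pi1 wt'_Pi1 by (intro exI[of _ 1]) (auto simp: norm_alpha image_def)
next
  case Pi2
  show ?thesis unfolding Pi2 wt'_Pi2 by (intro exI[of _ 1]) (auto simp: norm_alpha image_def)
next
  case Spin
  show ?thesis unfolding Spin wt'_Spin by (intro exI[of _ 1]) (simp add: norm_mk)
next
  case St
  show ?thesis unfolding St wt'_St by (intro exI[of _ "sqrt 2"]) (simp add: norm_mk)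
qed

lemma ell_norm: "ell \<pi> > 0" "l \<in> wt' \<pi> \<Longrightarrow> norm l = ell \<pi>"
proof -
  obtain r where r: "r > 0" "norm ` wt' \<pi> = {r}" using norm_wt' by blast
  then have "ell \<pi> = r" unfolding ell_def by (intro the_equality) auto
  then show "ell \<pi> > 0" "l \<in> wt' \<pi> \<Longrightarrow> norm l = ell \<pi>" using r by auto
qed

lemma weyl_wt': assumes "w \<in> weyl G" "\<pi> \<in> reps G" "l \<in> wt' \<pi>" shows "w l \<in> wt' \<pi>"
proof (cases G)
  case PGL3
  obtain p where p: "\<And>i. w (alpha i) = alpha (p i)" "linear w" using assms(1) unfolding PGL3 by (elim weyl_PGL3_E) blast
  have "w (- alpha i) = - alpha (p i)" for i using p by (simp add: linear_neg)
  moreover have "\<pi> = Pi1 \<or> \<pi> = Pi2" using assms(2) PGL3 by auto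
  ultimately show ?thesis using assms(3) p(1) by (auto simp: wt'_Pi1 wt'_Pi2)
next
  case PGSp4
  have "\<pi> = Spin \<or> \<pi> = St" using assms(2) PGSp4 by auto
  then show ?thesis using assms(1,3) unfolding PGSp4
    by (elim disjE weyl_PGSp4_E) (auto simp: wt'_Spin wt'_St)
qed

section \<open>The one-skeleton\<close>

text \<open>Normal vectors scaled so that the walls are the lines on which the inner product with one of them is an integer.\<close>

fun wall_normals :: "grp \<Rightarrow> plane set" where
  "wall_normals PGL3 = {(2 / 3) *\<^sub>R (alpha i - alpha j) | i j. i \<noteq> j}"
| "wall_normals PGSp4 = {mk 1 0, mk 0 1, mk 1 1, mk 1 (- 1)}"

lemma finite_wall_normals: "finite (wall_normals G)"
proof (cases G)
  case PGL3
  have "wall_normals PGL3 \<subseteq> (\<lambda>(i, j). (2 / 3) *\<^sub>R (alpha i - alpha j)) ` UNIV" by auto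
  then show ?thesis unfolding PGL3 by (rule finite_subset) simp
qed simp

lemma skeleton_eq: "one_skeleton G = {x. \<exists>\<theta>\<in>wall_normals G. x \<bullet> \<theta> \<in> \<int>}"
proof (cases G)
  case PGL3
  have wall: "{\<Sum>m\<in>UNIV. d m *\<^sub>R alpha m | d. d i - d j = of_int k} = {x. x \<bullet> ((2 / 3) *\<^sub>R (alpha i - alpha j)) = of_int k}"
    for i j k
  proof (intro equalityI subsetI)
    fix x assume "x \<in> {\<Sum>m\<in>UNIV. d m *\<^sub>R alpha m | d. d i - d j = of_int k}"
    then obtain d where d: "x = (\<Sum>m\<in>UNIV. d m *\<^sub>R alpha m)" "d i - d j = of_int k" by blast
    show "x \<in> {x. x \<bullet> ((2 / 3) *\<^sub>R (alpha i - alpha j)) = of_int k}"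
      using alpha_comb_inner[of d i j] d by simp
  next
    fix x assume x: "x \<in> {x. x \<bullet> ((2 / 3) *\<^sub>R (alpha i - alpha j)) = of_int k}"
    define d where "d m = (2 / 3) * (x \<bullet> alpha m)" for m
    have "x = (\<Sum>m\<in>UNIV. d m *\<^sub>R alpha m)"
      using alpha_frame[of x] by (simp add: d_def scaleR_sum_right)
    moreover have "d i - d j = of_int k" using x by (simp add: d_def inner_diff_right algebra_simps)
    ultimately show "x \<in> {\<Sum>m\<in>UNIV. d m *\<^sub>R alpha m | d. d i - d j = of_int k}" by blast
  qed
  define th where "th i j = (2 / 3) *\<^sub>R (alpha i - alpha j)" for i j
  have os: "x \<in> one_skeleton PGL3 \<longleftrightarrow> (\<exists>i j. i \<noteq> j \<and> (\<exists>k. x \<bullet> th i j = of_int k))" for x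
    unfolding one_skeleton_def walls.simps wall th_def[symmetric] by auto
  have wn': "wall_normals PGL3 = {th i j | i j. i \<noteq> j}" unfolding th_def by (rule wall_normals.simps(1))
  have wn: "(\<exists>\<theta>\<in>wall_normals PGL3. x \<bullet> \<theta> \<in> \<int>) \<longleftrightarrow> (\<exists>i j. i \<noteq> j \<and> x \<bullet> th i j \<in> \<int>)" for x
    unfolding wn' by auto
  have ints: "y \<in> \<int> \<longleftrightarrow> (\<exists>k. y = of_int k)" for y :: real by (auto elim: Ints_cases)
  have "x \<in> one_skeleton PGL3 \<longleftrightarrow> (\<exists>\<theta>\<in>wall_normals PGL3. x \<bullet> \<theta> \<in> \<int>)" for x
    unfolding os wn unfolding ints by (rule refl)
  then show ?thesis unfolding PGL3 by blast
next
  case PGSp4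
  have "x \<in> one_skeleton PGSp4 \<longleftrightarrow> (\<exists>k. x $ 1 = of_int k \<or> x $ 2 = of_int k \<or> x $ 1 + x $ 2 = of_int k \<or> x $ 1 - x $ 2 = of_int k)" for x
    unfolding one_skeleton_def walls.simps by auto
  then have "one_skeleton PGSp4 = {x. x $ 1 \<in> \<int> \<or> x $ 2 \<in> \<int> \<or> x $ 1 + x $ 2 \<in> \<int> \<or> x $ 1 - x $ 2 \<in> \<int>}"
    unfolding Ints_def by auto
  also have "\<dots> = {x. \<exists>\<theta>\<in>wall_normals PGSp4. x \<bullet> \<theta> \<in> \<int>}"
  proof -
    have "x \<bullet> mk 1 0 = x $ 1" "x \<bullet> mk 0 1 = x $ 2" "x \<bullet> mk 1 1 = x $ 1 + x $ 2" "x \<bullet> mk 1 (- 1) = x $ 1 - x $ 2"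
      for x :: plane by (rule mk_cases[of x], simp)+
    then show ?thesis by simp
  qed
  finally show ?thesis unfolding PGSp4 .
qed

lemma wall_normal_integral: assumes "\<theta> \<in> wall_normals G" "x \<in> coweight_lattice G" shows "x \<bullet> \<theta> \<in> \<int>"
proof (cases G)
  case PGL3
  obtain i j where \<theta>: "\<theta> = (2 / 3) *\<^sub>R (alpha i - alpha j)" using assms(1) unfolding PGL3 by auto
  obtain d where x: "x = acomb d" using assms(2) unfolding PGL3 coweight_PGL3 by blast
  have "x \<bullet> \<theta> = of_int (d i - d j)"
    using alpha_comb_inner[of "\<lambda>i. of_int (d i)" i j] by (simp add: x \<theta> acomb_def)
  then show ?thesis by (metis Ints_of_int)
next
  case PGSp4
  obtain p q where x: "x = mk (of_int p) (of_int q)" using assms(2) unfolding PGSp4 coweight_PGSp4 by blast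
  show ?thesis using assms(1) unfolding PGSp4 x by auto
qed

lemma wt'_PGL3: assumes "\<pi> \<in> reps PGL3" "l \<in> wt' \<pi>" obtains e m where "e \<in> {1, - 1 :: real}" "l = e *\<^sub>R alpha m"
  using assms that[of 1] that[of "- 1"] by (auto simp: wt'_Pi1 wt'_Pi2)

lemma wall_parallel: assumes "\<pi> \<in> reps G" "l \<in> wt' \<pi>" shows "\<exists>\<theta>\<in>wall_normals G. l \<bullet> \<theta> = 0"
proof (cases G)
  case PGL3
  obtain e m where l: "l = e *\<^sub>R alpha m" using wt'_PGL3 assms unfolding PGL3 by metis
  obtain i where i: "i \<noteq> m" using three_other by blast
  obtain j where j: "i \<noteq> j" "m \<noteq> j" using three_third[OF i] by metis
  have "l \<bullet> ((2 / 3) *\<^sub>R (alpha i - alpha j)) = 0" using i j by (simp add: l inner_diff_right alpha_inner)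
  moreover have "(2 / 3) *\<^sub>R (alpha i - alpha j) \<in> wall_normals PGL3" using j(1) by auto
  ultimately show ?thesis unfolding PGL3 by blast
next
  case PGSp4
  have "\<pi> = Spin \<or> \<pi> = St" using assms(1) PGSp4 by auto
  then show ?thesis using assms(2) unfolding PGSp4 by (auto simp: wt'_Spin wt'_St)
qed

text \<open>Some wall normal takes the value \<open>1\<close> or \<open>-1\<close> on a weight. As it is integral on the lattice, the weight is primitive.\<close>

lemma wall_transverse: assumes "\<pi> \<in> reps G" "l \<in> wt' \<pi>" shows "\<exists>\<theta>\<in>wall_normals G. l \<bullet> \<theta> = 1 \<or> l \<bullet> \<theta> = - 1"
proof (cases G)
  case PGL3
  obtain e m where l: "e \<in> {1, - 1}" "l = e *\<^sub>R alpha m" using wt'_PGL3 assms unfolding PGL3 by metis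
  obtain i where i: "i \<noteq> m" using three_other by blast
  have "l \<bullet> ((2 / 3) *\<^sub>R (alpha m - alpha i)) = e" using i by (simp add: l inner_diff_right alpha_inner)
  moreover have "(2 / 3) *\<^sub>R (alpha m - alpha i) \<in> wall_normals PGL3" using i by auto
  ultimately show ?thesis unfolding PGL3 using l(1) by blast
next
  case PGSp4
  have "\<pi> = Spin \<or> \<pi> = St" using assms(1) PGSp4 by auto
  then show ?thesis using assms(2) unfolding PGSp4 by (auto simp: wt'_Spin wt'_St)
qed

lemma weight_primitive:
  assumes "\<pi> \<in> reps G" "l \<in> wt' \<pi>" "s *\<^sub>R l \<in> coweight_lattice G" shows "s \<in> \<int>"
proof -
  obtain \<theta> where \<theta>: "\<theta> \<in> wall_normals G" "l \<bullet> \<theta> = 1 \<or> l \<bullet> \<theta> = - 1" using wall_transverse[OF assms(1,2)] by blast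
  have "s * (l \<bullet> \<theta>) \<in> \<int>" using wall_normal_integral[OF \<theta>(1) assms(3)] by simp
  then show ?thesis using \<theta>(2) by (auto simp: minus_in_Ints_iff)
qed

lemma wall_vertex:
  assumes \<pi>: "\<pi> \<in> reps G" "l \<in> wt' \<pi>" and \<theta>: "\<theta> \<in> wall_normals G" "l \<bullet> \<theta> = 0" "v \<bullet> \<theta> \<in> \<int>"
  shows "\<exists>s. v + s *\<^sub>R l \<in> coweight_lattice G"
proof (cases G)
  case PGL3
  obtain e m where l: "e \<in> {1, - 1}" "l = e *\<^sub>R alpha m" using wt'_PGL3 \<pi> unfolding PGL3 by metis
  obtain i j where ij: "i \<noteq> j" "\<theta> = (2 / 3) *\<^sub>R (alpha i - alpha j)" using \<theta>(1) unfolding PGL3 by auto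
  have im: "i \<noteq> m" using \<theta>(2) l ij by (auto simp: inner_diff_right alpha_inner)
  have jm: "j \<noteq> m" using \<theta>(2) l ij by (auto simp: inner_diff_right alpha_inner)
  define d where "d m = (2 / 3) * (v \<bullet> alpha m)" for m
  have v: "v = (\<Sum>m\<in>UNIV. d m *\<^sub>R alpha m)"
    using alpha_frame[of v] by (simp add: d_def scaleR_sum_right)
  have "v \<bullet> \<theta> = d i - d j" by (simp add: ij(2) d_def inner_diff_right algebra_simps)
  then obtain k where k: "d i - d j = of_int k" using \<theta>(3) by (auto elim: Ints_cases)
  have vv: "v = (d i - d j) *\<^sub>R alpha i + (d m - d j) *\<^sub>R alpha m"
    unfolding v by (rule alpha_comb_two) (use ij im jm in auto)
  have lm: "(- e * (d m - d j)) *\<^sub>R l = (- (d m - d j)) *\<^sub>R alpha m"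
    using l(1) unfolding l(2) by (auto simp: scaleR_diff_left)
  have 1: "v + (- e * (d m - d j)) *\<^sub>R l = of_int k *\<^sub>R alpha i"
    unfolding lm using vv unfolding k by (simp add: algebra_simps)
  have "acomb (\<lambda>x. if x = i then k else 0) = of_int k *\<^sub>R alpha i"
    using three_sum[OF ij(1) im jm, of "\<lambda>x. of_int (if x = i then k else 0) *\<^sub>R alpha x"] ij(1) im by (simp add: acomb_def)
  then have "of_int k *\<^sub>R alpha i \<in> coweight_lattice PGL3" unfolding coweight_PGL3 by (metis rangeI)
  then show ?thesis unfolding PGL3 using 1 by metis
next
  case PGSp4
  obtain x y where v: "v = mk x y" by (rule mk_cases)
  have lat: "mk a b \<in> coweight_lattice PGSp4" if "a \<in> \<int>" "b \<in> \<int>" for a b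
    using that unfolding coweight_PGSp4 by (auto elim!: Ints_cases)
  have r: "\<pi> = Spin \<or> \<pi> = St" using \<pi>(1) PGSp4 by auto
  have neg: "- a \<in> \<int> \<longleftrightarrow> a \<in> \<int>" for a :: real by (rule minus_in_Ints_iff)
  have "\<exists>s. (v + s *\<^sub>R l) $ 1 \<in> \<int> \<and> (v + s *\<^sub>R l) $ 2 \<in> \<int>"
  proof -
    have "\<exists>s. x + s * a \<in> \<int> \<and> y + s * b \<in> \<int>"
      if "a \<in> {-1, 0, 1}" "b \<in> {-1, 0, 1}" "a \<noteq> 0 \<or> b \<noteq> 0" "b * x - a * y \<in> \<int>" for a b
    proof (cases "a = 0")
      case True
      then have "b = 1 \<or> b = - 1" "b * x \<in> \<int>" using that by auto
      then have "x + - b * y * a \<in> \<int> \<and> y + - b * y * b \<in> \<int>" using True neg[of x] by auto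
      then show ?thesis by blast
    next
      case False
      then have a: "a = 1 \<or> a = - 1" using that by auto
      have "y + - a * x * b \<in> \<int>"
        using a that(4) neg[of "b * x - y"] neg[of "b * x + y"] by (auto simp: algebra_simps)
      moreover have "x + - a * x * a \<in> \<int>" using a by auto
      ultimately show ?thesis by blast
    qed
    note * = this
    show ?thesis
      using r \<pi>(2) \<theta> *[of "l $ 1" "l $ 2"] neg[of x] neg[of y] neg[of "x - y"] neg[of "x + y"] unfolding PGSp4 v
      by (auto simp: wt'_Spin wt'_St algebra_simps)
  qed
  then obtain s where "(v + s *\<^sub>R l) $ 1 \<in> \<int>" "(v + s *\<^sub>R l) $ 2 \<in> \<int>" by blast
  then show ?thesis unfolding PGSp4 using lat by (metis mk_cases mk_nth)
qed

section \<open>The frame of a glide reflection\<close>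

text \<open>For the chosen \<open>\<alpha>\<close>, the maximum of \<open>\<alpha> \<bullet> \<beta>\<close> is attained at two vectors \<open>\<beta>\<close>; either one forms a basis of the
  coweight lattice together with \<open>\<alpha>\<close>.\<close>

lemma frame_PGL3:
  assumes \<tau>: "\<tau> \<in> reps PGL3" "\<tau>' \<in> reps PGL3" "\<tau>' \<noteq> \<tau>" and \<alpha>: "\<alpha> \<in> wt' \<tau>"
    and \<beta>: "is_arg_max (\<lambda>\<beta>. \<alpha> \<bullet> \<beta>) (\<lambda>\<beta>. \<beta> \<in> wt' \<tau>') \<beta>"
  shows "\<alpha> \<bullet> \<alpha> = 1" "\<alpha> \<bullet> \<beta> = 1 / 2"
    and "\<And>x y. x *\<^sub>R \<alpha> + y *\<^sub>R \<beta> = 0 \<Longrightarrow> x = 0 \<and> y = 0"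
    and "coweight_lattice PGL3 = {of_int p *\<^sub>R \<alpha> + of_int q *\<^sub>R \<beta> | p q. True}"
    and "wt' \<tau> = {\<alpha>, - \<beta>, \<beta> - \<alpha>}" "wt' \<tau>' = {- \<alpha>, \<beta>, \<alpha> - \<beta>}"
proof -
  define e :: real where "e = (if \<tau> = Pi1 then 1 else - 1)"
  have ee: "e * e = 1" by (simp add: e_def)
  have wt: "wt' \<tau> = range (\<lambda>i. e *\<^sub>R alpha i)" "wt' \<tau>' = range (\<lambda>i. - e *\<^sub>R alpha i)"
    using \<tau> by (auto simp: e_def wt'_Pi1 wt'_Pi2)
  obtain i where i: "\<alpha> = e *\<^sub>R alpha i" using \<alpha> wt by blast
  obtain j where j: "\<beta> = - e *\<^sub>R alpha j" using \<beta> wt by (auto simp: is_arg_max_def)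
  have ij: "i \<noteq> j"
  proof
    assume "i = j"
    then have 1: "\<alpha> \<bullet> \<beta> = - 1" using ee by (simp add: i j alpha_inner)
    obtain m where m: "m \<noteq> i" using three_other by blast
    have "\<alpha> \<bullet> (- e *\<^sub>R alpha m) = 1 / 2" using m ee by (simp add: i alpha_inner)
    then have "\<alpha> \<bullet> \<beta> < \<alpha> \<bullet> (- e *\<^sub>R alpha m)" using 1 by linarith
    then show False using \<beta> wt(2) unfolding is_arg_max_def by blast
  qed
  obtain m where m: "i \<noteq> m" "j \<noteq> m" using three_third[OF ij] by metis
  show "\<alpha> \<bullet> \<alpha> = 1" "\<alpha> \<bullet> \<beta> = 1 / 2" using ee ij by (auto simp: i j alpha_inner)
  show "x = 0 \<and> y = 0" if "x *\<^sub>R \<alpha> + y *\<^sub>R \<beta> = 0" for x y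
  proof -
    have "(x *\<^sub>R \<alpha> + y *\<^sub>R \<beta>) \<bullet> alpha i = 0" "(x *\<^sub>R \<alpha> + y *\<^sub>R \<beta>) \<bullet> alpha j = 0" using that by simp_all
    then have "e * (x + y / 2) = 0" "e * (x / 2 + y) = 0"
      using ij by (simp_all add: i j inner_add_left alpha_inner algebra_simps)
    then have "x + y / 2 = 0" "x / 2 + y = 0" using ee by auto
    then show ?thesis by linarith
  qed
  show "coweight_lattice PGL3 = {of_int p *\<^sub>R \<alpha> + of_int q *\<^sub>R \<beta> | p q. True}"
  proof (intro equalityI subsetI)
    fix x assume "x \<in> coweight_lattice PGL3"
    then obtain d where d: "x = acomb d" unfolding coweight_PGL3 by blast
    obtain e' :: int where e': "e = of_int e'" by (simp add: e_def) (metis of_int_1 of_int_minus)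
    have "of_int (e' * (d i - d m)) *\<^sub>R \<alpha> + of_int (- e' * (d j - d m)) *\<^sub>R \<beta> =
      ((e * e) * of_int (d i - d m)) *\<^sub>R alpha i + ((e * e) * of_int (d j - d m)) *\<^sub>R alpha j"
      by (simp add: i j e' algebra_simps)
    then have "x = of_int (e' * (d i - d m)) *\<^sub>R \<alpha> + of_int (- e' * (d j - d m)) *\<^sub>R \<beta>"
      unfolding d acomb_two[OF ij m] ee by simp
    then show "x \<in> {of_int p *\<^sub>R \<alpha> + of_int q *\<^sub>R \<beta> | p q. True}" by blast
  next
    fix x assume "x \<in> {of_int p *\<^sub>R \<alpha> + of_int q *\<^sub>R \<beta> | p q. True}"
    then obtain p q where x: "x = of_int p *\<^sub>R \<alpha> + of_int q *\<^sub>R \<beta>" by blast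
    obtain e' :: int where e': "e = of_int e'" by (simp add: e_def) (metis of_int_1 of_int_minus)
    define d where "d y = (if y = i then p * e' else if y = j then - q * e' else 0)" for y
    have "x = acomb d" unfolding acomb_two[OF ij m] x i j using ij m by (simp add: d_def e')
    then show "x \<in> coweight_lattice PGL3" unfolding coweight_PGL3 by blast
  qed
  have am: "e *\<^sub>R alpha m = \<beta> - \<alpha>" unfolding alpha_third[OF ij m] i j by (simp add: algebra_simps)
  have "card {i, j, m} = 3" using ij m by simp
  then have U: "UNIV = {i, j, m}" by (intro card_subset_eq[symmetric]) auto
  show "wt' \<tau> = {\<alpha>, - \<beta>, \<beta> - \<alpha>}" unfolding wt U using am by (auto simp: i j)
  have "- e *\<^sub>R alpha m = \<alpha> - \<beta>" using am by (metis minus_diff_eq scaleR_minus_left)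
  then show "wt' \<tau>' = {- \<alpha>, \<beta>, \<alpha> - \<beta>}" unfolding wt U by (auto simp: i j)
qed

lemma norm_square_1:
  fixes x y :: int assumes "x \<in> {-1, 0, 1}" "y \<in> {-1, 0, 1}" "x\<^sup>2 + y\<^sup>2 = 1"
  shows "(x = 1 \<and> y = 0) \<or> (x = - 1 \<and> y = 0) \<or> (x = 0 \<and> y = 1) \<or> (x = 0 \<and> y = - 1)"
  using assms by (elim insertE emptyE) simp_all

lemma norm_square_2:
  fixes x y :: int assumes "x \<in> {-1, 0, 1}" "y \<in> {-1, 0, 1}" "x\<^sup>2 + y\<^sup>2 = 2"
  shows "(x = 1 \<and> y = 1) \<or> (x = 1 \<and> y = - 1) \<or> (x = - 1 \<and> y = 1) \<or> (x = - 1 \<and> y = - 1)"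
  using assms by (elim insertE emptyE) simp_all

text \<open>In coordinates, \<open>\<alpha>\<close> and \<open>\<beta>\<close> are an axis vector and an adjacent diagonal vector, in either order.\<close>

lemma frame_PGSp4_cases:
  assumes \<tau>: "\<tau> \<in> reps PGSp4" "\<tau>' \<in> reps PGSp4" "\<tau>' \<noteq> \<tau>" and \<alpha>: "\<alpha> \<in> wt' \<tau>"
    and \<beta>: "is_arg_max (\<lambda>\<beta>. \<alpha> \<bullet> \<beta>) (\<lambda>\<beta>. \<beta> \<in> wt' \<tau>') \<beta>"
  shows "\<exists>a1 a2 b1 b2 :: int. \<alpha> = mk (of_int a1) (of_int a2) \<and> \<beta> = mk (of_int b1) (of_int b2) \<and>
    {a1, a2, b1, b2} \<subseteq> {-1, 0, 1} \<and> a1 * b1 + a2 * b2 = 1 \<and> (a1 * b2 - a2 * b1)\<^sup>2 = 1 \<and>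
    (if \<tau> = Spin then a1\<^sup>2 + a2\<^sup>2 = 1 \<and> b1\<^sup>2 + b2\<^sup>2 = 2 else a1\<^sup>2 + a2\<^sup>2 = 2 \<and> b1\<^sup>2 + b2\<^sup>2 = 1)"
proof -
  have \<beta>': "\<beta> \<in> wt' \<tau>'" and max: "\<And>y. y \<in> wt' \<tau>' \<Longrightarrow> \<alpha> \<bullet> y \<le> \<alpha> \<bullet> \<beta>" using \<beta> by (auto simp: is_arg_max_def not_less)
  have neg1: "- 1 = real_of_int a \<longleftrightarrow> a = - 1" for a by linarith
  have "\<exists>a1 a2 :: int. \<alpha> = mk (of_int a1) (of_int a2) \<and> {a1, a2} \<subseteq> {-1, 0, 1} \<and>
      (if \<tau> = Spin then a1\<^sup>2 + a2\<^sup>2 = 1 else a1\<^sup>2 + a2\<^sup>2 = 2)"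
    using \<tau> \<alpha> by (auto simp: wt'_Spin wt'_St neg1)
  then obtain a1 a2 :: int where a: "\<alpha> = mk (of_int a1) (of_int a2)" "{a1, a2} \<subseteq> {-1, 0, 1}"
      "if \<tau> = Spin then a1\<^sup>2 + a2\<^sup>2 = 1 else a1\<^sup>2 + a2\<^sup>2 = 2" by blast
  have "\<exists>b1 b2 :: int. \<beta> = mk (of_int b1) (of_int b2) \<and> {b1, b2} \<subseteq> {-1, 0, 1} \<and>
      (if \<tau> = Spin then b1\<^sup>2 + b2\<^sup>2 = 2 else b1\<^sup>2 + b2\<^sup>2 = 1)"
    using \<tau> \<beta>' by (auto simp: wt'_Spin wt'_St neg1)
  then obtain b1 b2 :: int where b: "\<beta> = mk (of_int b1) (of_int b2)" "{b1, b2} \<subseteq> {-1, 0, 1}"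
      "if \<tau> = Spin then b1\<^sup>2 + b2\<^sup>2 = 2 else b1\<^sup>2 + b2\<^sup>2 = 1" by blast
  have t: "\<tau> = Spin \<and> \<tau>' = St \<or> \<tau> = St \<and> \<tau>' = Spin" using \<tau> by auto
  have le: "of_int (a1 * c1 + a2 * c2) \<le> (of_int (a1 * b1 + a2 * b2) :: real)" if "mk (of_int c1) (of_int c2) \<in> wt' \<tau>'" for c1 c2
    using max[OF that] by (simp add: a(1) b(1))
  have m: "a1 * c1 + a2 * c2 \<le> a1 * b1 + a2 * b2" if "mk (of_int c1) (of_int c2) \<in> wt' \<tau>'" for c1 c2
    using le[OF that] by (simp only: of_int_le_iff)
  have mem: "a1 \<in> {-1, 0, 1}" "a2 \<in> {-1, 0, 1}" "b1 \<in> {-1, 0, 1}" "b2 \<in> {-1, 0, 1}"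
    using a(2) b(2) by simp_all
  have "a1 * b1 + a2 * b2 = 1 \<and> (a1 * b2 - a2 * b1)\<^sup>2 = 1"
  proof (cases "\<tau> = Spin")
    case True
    then have \<tau>': "\<tau>' = St" using t by auto
    have sq: "a1\<^sup>2 + a2\<^sup>2 = 1" "b1\<^sup>2 + b2\<^sup>2 = 2" using a(3) b(3) True by simp_all
    have "a1 + a2 \<le> a1 * b1 + a2 * b2" "a1 - a2 \<le> a1 * b1 + a2 * b2"
      "- a1 + a2 \<le> a1 * b1 + a2 * b2" "- a1 - a2 \<le> a1 * b1 + a2 * b2"
      using m[of 1 1] m[of 1 "-1"] m[of "-1" 1] m[of "-1" "-1"] by (simp_all add: \<tau>' wt'_St)
    with norm_square_1[OF mem(1,2) sq(1)] norm_square_2[OF mem(3,4) sq(2)] show ?thesis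
      by (elim disjE conjE) simp_all
  next
    case False
    then have \<tau>': "\<tau>' = Spin" using t by auto
    have sq: "a1\<^sup>2 + a2\<^sup>2 = 2" "b1\<^sup>2 + b2\<^sup>2 = 1" using a(3) b(3) False by simp_all
    have "a1 \<le> a1 * b1 + a2 * b2" "a2 \<le> a1 * b1 + a2 * b2"
      "- a1 \<le> a1 * b1 + a2 * b2" "- a2 \<le> a1 * b1 + a2 * b2"
      using m[of 1 0] m[of 0 1] m[of "-1" 0] m[of 0 "-1"] by (simp_all add: \<tau>' wt'_Spin)
    with norm_square_2[OF mem(1,2) sq(1)] norm_square_1[OF mem(3,4) sq(2)] show ?thesis
      by (elim disjE conjE) simp_all
  qed
  then show ?thesis using a b by (intro exI[of _ a1] exI[of _ a2] exI[of _ b1] exI[of _ b2]) (simp split: if_splits)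
qed

text \<open>The frame for \<open>PGSp4\<close>. If \<open>\<alpha>\<close> is a weight of the spin representation, the coefficient of \<open>\<alpha>\<close> of every
  coroot lattice point is even.\<close>

lemma frame_PGSp4:
  assumes \<tau>: "\<tau> \<in> reps PGSp4" "\<tau>' \<in> reps PGSp4" "\<tau>' \<noteq> \<tau>" and \<alpha>: "\<alpha> \<in> wt' \<tau>"
    and \<beta>: "is_arg_max (\<lambda>\<beta>. \<alpha> \<bullet> \<beta>) (\<lambda>\<beta>. \<beta> \<in> wt' \<tau>') \<beta>"
  shows "\<alpha> \<bullet> \<alpha> = (if \<tau> = Spin then 1 else 2)" "\<alpha> \<bullet> \<beta> = 1"
    and "\<And>x y. x *\<^sub>R \<alpha> + y *\<^sub>R \<beta> = 0 \<Longrightarrow> x = 0 \<and> y = 0"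
    and "coweight_lattice PGSp4 = {of_int p *\<^sub>R \<alpha> + of_int q *\<^sub>R \<beta> | p q. True}"
    and "\<tau> = Spin \<Longrightarrow> wt' \<tau> = {\<alpha>, - \<alpha>, \<beta> - \<alpha>, \<alpha> - \<beta>}"
    and "\<tau> = Spin \<Longrightarrow> wt' \<tau>' = {\<beta>, - \<beta>, 2 *\<^sub>R \<alpha> - \<beta>, \<beta> - 2 *\<^sub>R \<alpha>}"
    and "\<tau> = St \<Longrightarrow> wt' \<tau> = {\<alpha>, - \<alpha>, 2 *\<^sub>R \<beta> - \<alpha>, \<alpha> - 2 *\<^sub>R \<beta>}"
    and "\<tau> = St \<Longrightarrow> wt' \<tau>' = {\<beta>, - \<beta>, \<alpha> - \<beta>, \<beta> - \<alpha>}"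
    and "\<And>p q. \<tau> = Spin \<Longrightarrow> of_int p *\<^sub>R \<alpha> + of_int q *\<^sub>R \<beta> \<in> coroot_lattice PGSp4 \<Longrightarrow> even p"
proof -
  obtain a1 a2 b1 b2 :: int where a: "\<alpha> = mk (of_int a1) (of_int a2)" and b: "\<beta> = mk (of_int b1) (of_int b2)"
    and ab: "{a1, a2, b1, b2} \<subseteq> {-1, 0, 1}" and i: "a1 * b1 + a2 * b2 = 1" and D: "(a1 * b2 - a2 * b1)\<^sup>2 = 1"
    and n: "if \<tau> = Spin then a1\<^sup>2 + a2\<^sup>2 = 1 \<and> b1\<^sup>2 + b2\<^sup>2 = 2 else a1\<^sup>2 + a2\<^sup>2 = 2 \<and> b1\<^sup>2 + b2\<^sup>2 = 1"
    using frame_PGSp4_cases[OF assms] by (elim exE conjE) blast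
  have "\<alpha> \<bullet> \<beta> = of_int (a1 * b1 + a2 * b2)" by (simp add: a b)
  then show "\<alpha> \<bullet> \<beta> = 1" unfolding i by simp
  have "\<alpha> \<bullet> \<alpha> = of_int (a1\<^sup>2 + a2\<^sup>2)" by (simp add: a power2_eq_square)
  moreover have "a1\<^sup>2 + a2\<^sup>2 = (if \<tau> = Spin then 1 else 2)" using n by (simp split: if_splits)
  ultimately show "\<alpha> \<bullet> \<alpha> = (if \<tau> = Spin then 1 else 2)" by simp
  let ?D = "a1 * b2 - a2 * b1"
  have DD: "?D * ?D = 1" using D by (simp add: power2_eq_square)
  show "x = 0 \<and> y = 0" if "x *\<^sub>R \<alpha> + y *\<^sub>R \<beta> = 0" for x y
  proof -
    have 1: "x * of_int a1 + y * of_int b1 = 0" "x * of_int a2 + y * of_int b2 = 0" using that by (simp_all add: a b)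
    have "x * of_int ?D = of_int b2 * (x * of_int a1 + y * of_int b1) - of_int b1 * (x * of_int a2 + y * of_int b2)"
      "y * of_int ?D = of_int a1 * (x * of_int a2 + y * of_int b2) - of_int a2 * (x * of_int a1 + y * of_int b1)"
      by (simp_all add: algebra_simps)
    then have "x * of_int ?D = 0" "y * of_int ?D = 0" unfolding 1 by simp_all
    moreover have "(of_int ?D :: real) \<noteq> 0" using DD by (metis mult_zero_left of_int_eq_0_iff zero_neq_one)
    ultimately show ?thesis by simp
  qed
  show "coweight_lattice PGSp4 = {of_int p *\<^sub>R \<alpha> + of_int q *\<^sub>R \<beta> | p q. True}"
  proof (intro equalityI subsetI)
    fix x assume "x \<in> coweight_lattice PGSp4"
    then obtain p q where x: "x = mk (of_int p) (of_int q)" unfolding coweight_PGSp4 by blast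
    have 1: "p = ?D * (p * b2 - q * b1) * a1 + ?D * (a1 * q - a2 * p) * b1"
      "q = ?D * (p * b2 - q * b1) * a2 + ?D * (a1 * q - a2 * p) * b2"
      using DD by algebra+
    have "x = of_int (?D * (p * b2 - q * b1)) *\<^sub>R \<alpha> + of_int (?D * (a1 * q - a2 * p)) *\<^sub>R \<beta>"
      unfolding a b mk_scale mk_add x mk_eq of_int_mult[symmetric] of_int_add[symmetric] of_int_eq_iff
      using 1 by simp
    then show "x \<in> {of_int p *\<^sub>R \<alpha> + of_int q *\<^sub>R \<beta> | p q. True}" by blast
  next
    fix x assume "x \<in> {of_int p *\<^sub>R \<alpha> + of_int q *\<^sub>R \<beta> | p q. True}"
    then obtain p q where "x = of_int p *\<^sub>R \<alpha> + of_int q *\<^sub>R \<beta>" by blast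
    then have "x = mk (of_int (p * a1 + q * b1)) (of_int (p * a2 + q * b2))" by (simp add: a b)
    then show "x \<in> coweight_lattice PGSp4" unfolding coweight_PGSp4 by blast
  qed
  have t: "\<tau> = Spin \<and> \<tau>' = St \<or> \<tau> = St \<and> \<tau>' = Spin" using \<tau> by auto
  have mem: "a1 \<in> {-1, 0, 1}" "a2 \<in> {-1, 0, 1}" "b1 \<in> {-1, 0, 1}" "b2 \<in> {-1, 0, 1}"
    using ab by simp_all
  have Sp: "(a1, a2, b1, b2) \<in> {(1, 0, 1, 1), (1, 0, 1, -1), (-1, 0, -1, 1), (-1, 0, -1, -1),
      (0, 1, 1, 1), (0, 1, -1, 1), (0, -1, 1, -1), (0, -1, -1, -1)}" if "\<tau> = Spin"
  proof -
    have "a1\<^sup>2 + a2\<^sup>2 = 1" "b1\<^sup>2 + b2\<^sup>2 = 2" using n that by simp_all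
    from norm_square_1[OF mem(1,2) this(1)] norm_square_2[OF mem(3,4) this(2)] i show ?thesis
      by (elim disjE conjE) simp_all
  qed
  have St: "(a1, a2, b1, b2) \<in> {(1, 1, 1, 0), (1, -1, 1, 0), (-1, 1, -1, 0), (-1, -1, -1, 0),
      (1, 1, 0, 1), (-1, 1, 0, 1), (1, -1, 0, -1), (-1, -1, 0, -1)}" if "\<tau> = St"
  proof -
    have "a1\<^sup>2 + a2\<^sup>2 = 2" "b1\<^sup>2 + b2\<^sup>2 = 1" using n that by simp_all
    from norm_square_2[OF mem(1,2) this(1)] norm_square_1[OF mem(3,4) this(2)] i show ?thesis
      by (elim disjE conjE) simp_all
  qed
  show "wt' \<tau> = {\<alpha>, - \<alpha>, \<beta> - \<alpha>, \<alpha> - \<beta>}" if "\<tau> = Spin"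
    using Sp[OF that] unfolding that a b wt'_Spin by (elim insertE emptyE; simp; blast)
  show "wt' \<tau>' = {\<beta>, - \<beta>, 2 *\<^sub>R \<alpha> - \<beta>, \<beta> - 2 *\<^sub>R \<alpha>}" if "\<tau> = Spin"
  proof -
    have "\<tau>' = St" using t that by auto
    then show ?thesis using Sp[OF that] unfolding a b by (simp only: wt'_St) (elim insertE emptyE; simp; blast)
  qed
  show "wt' \<tau> = {\<alpha>, - \<alpha>, 2 *\<^sub>R \<beta> - \<alpha>, \<alpha> - 2 *\<^sub>R \<beta>}" if "\<tau> = St"
    using St[OF that] unfolding that a b wt'_St by (elim insertE emptyE; simp; blast)
  show "wt' \<tau>' = {\<beta>, - \<beta>, \<alpha> - \<beta>, \<beta> - \<alpha>}" if "\<tau> = St"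
  proof -
    have "\<tau>' = Spin" using t that by auto
    then show ?thesis using St[OF that] unfolding a b by (simp only: wt'_Spin) (elim insertE emptyE; simp; blast)
  qed
  show "even p" if "\<tau> = Spin" "of_int p *\<^sub>R \<alpha> + of_int q *\<^sub>R \<beta> \<in> coroot_lattice PGSp4" for p q
  proof -
    have "mk (of_int (p * a1 + q * b1)) (of_int (p * a2 + q * b2)) \<in> coroot_lattice PGSp4"
      using that(2) by (simp add: a b)
    then obtain r s where rs: "mk (of_int (p * a1 + q * b1)) (of_int (p * a2 + q * b2)) = mk (of_int r) (of_int s)" "even (r + s)"
      unfolding coroot_PGSp4 by blast
    then have "p * a1 + q * b1 = r" "p * a2 + q * b2 = s" by (simp_all only: mk_eq of_int_eq_iff)
    then have e: "even (p * (a1 + a2) + q * (b1 + b2))" using rs(2) by (simp add: algebra_simps)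
    have "odd (a1 + a2)" "even (b1 + b2)" using n that(1) ab by auto
    then show ?thesis using e by simp
  qed
qed

section \<open>The presentation of the group\<close>

context klein_frame begin

text \<open>The translation \<open>k \<alpha>\<close> is the square of the glide reflection.\<close>

lemma generate_glide_group:
  assumes t: "transl (lp (- (c * int n)) (2 * c)) \<in> W_aff G" and s: "sg \<in> W_aff G"
  shows "generate (W_aff_group G) {transl (lp (- (c * int n)) (2 * c)), sg} = glide_group" (is "?L = _")
proof -
  interpret W: group "W_aff_group G" by (rule W_aff_group)
  let ?\<tau> = "lp (- (c * int n)) (2 * c)"
  have car: "carrier (W_aff_group G) = W_aff G" and mul: "x \<otimes>\<^bsub>W_aff_group G\<^esub> y = x \<circ> y"
    and oneW: "\<one>\<^bsub>W_aff_group G\<^esub> = id" for x y by (simp_all add: W_aff_group_def)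
  have closed: "x \<circ> y \<in> W_aff G" if "x \<in> W_aff G" "y \<in> W_aff G" for x y
    using W.m_closed[of x y] that by (simp add: car mul)
  have inv_transl: "inv\<^bsub>W_aff_group G\<^esub> (transl x) = transl (- x)" if "transl x \<in> W_aff G" for x
    by (rule W.inv_equality) (use that coroot_minus in \<open>simp_all add: car mul oneW transl_comp transl_0 transl_W_aff\<close>)
  have kW: "transl (lp (int k) 0) \<in> W_aff G" using closed[OF s s] by (simp add: sg_comp)
  have "transl (- lp (int k) 0) \<circ> sg \<in> W_aff G"
    using kW coroot_minus s by (intro closed) (simp_all add: transl_W_aff)
  moreover have "(transl (- lp (int k) 0) \<circ> sg) \<circ> sg = id"
    unfolding comp_assoc sg_comp transl_comp by (simp add: transl_0)
  ultimately have inv_sg: "inv\<^bsub>W_aff_group G\<^esub> sg = transl (- lp (int k) 0) \<circ> sg"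
    by (intro W.inv_equality) (simp_all add: car mul oneW s)
  have \<tau>: "?\<tau> \<in> trl" unfolding trl_def by (rule CollectI, rule exI[of _ 0], rule exI[of _ 1]) simp
  have sg_in: "sg \<in> glide_group" using glide_group_glide[OF trl_0] by (simp add: transl_0)
  have "?L \<subseteq> glide_group"
  proof
    fix g assume "g \<in> ?L"
    then show "g \<in> glide_group"
    proof induction
      case one
      show ?case using glide_group_transl[OF trl_0] by (simp only: oneW transl_0)
    next
      case (incl h)
      then show ?case using glide_group_transl[OF \<tau>] sg_in by auto
    next
      case (inv h)
      then have "h = transl ?\<tau> \<or> h = sg" by blast
      then show ?case
        using glide_group_transl[OF trl_minus[OF \<tau>]] glide_group_glide[OF trl_minus[OF trl_k]] inv_transl[OF t] inv_sg
        by metis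
    next
      case (eng g h)
      show ?case unfolding mul using eng.IH by (rule glide_group_comp)
    qed
  qed
  moreover have "glide_group \<subseteq> ?L"
  proof -
    interpret L: subgroup ?L "W_aff_group G"
      by (rule W.generate_is_subgroup) (use t s in \<open>simp add: car\<close>)
    have Lcomp: "x \<circ> y \<in> ?L" if "x \<in> ?L" "y \<in> ?L" for x y using L.m_closed[OF that] by (simp add: mul)
    have tL: "transl ?\<tau> \<in> ?L" and sL: "sg \<in> ?L" by (auto intro: generate.incl)
    have LW: "x \<in> W_aff G" if "x \<in> ?L" for x using L.mem_carrier[OF that] by (simp add: car)
    have neg: "transl (- x) \<in> ?L" if "transl x \<in> ?L" for x
      using L.m_inv_closed[OF that] inv_transl[OF LW[OF that]] by simp
    have pow: "transl (of_nat j *\<^sub>R x) \<in> ?L" if x: "transl x \<in> ?L" for x j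
    proof (induction j)
      case 0
      show ?case using L.one_closed by (simp only: oneW transl_0 of_nat_0 scaleR_zero_left)
    next
      case (Suc j)
      have "transl (of_nat j *\<^sub>R x + x) \<in> ?L" using Lcomp[OF Suc x] by (simp only: transl_comp)
      then show ?case by (simp add: algebra_simps)
    qed
    have powi: "transl (of_int j *\<^sub>R x) \<in> ?L" if x: "transl x \<in> ?L" for x j
    proof (cases "j \<ge> 0")
      case True
      then show ?thesis using pow[OF x, of "nat j"] by simp
    next
      case False
      then show ?thesis using neg[OF pow[OF x, of "nat (- j)"]] by simp
    qed
    have kL: "transl (lp (int k) 0) \<in> ?L" using Lcomp[OF sL sL] by (simp add: sg_comp)
    have trL: "transl x \<in> ?L" if "x \<in> trl" for x
    proof -
      obtain i j where "x = lp (i * int k - j * c * int n) (2 * j * c)" using \<open>x \<in> trl\<close> by (auto simp: trl_def)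
      then have "x = of_int i *\<^sub>R lp (int k) 0 + of_int j *\<^sub>R ?\<tau>" by (simp add: lp_scale lp_add algebra_simps)
      then show ?thesis using Lcomp[OF powi[OF kL, of i] powi[OF tL, of j]] by (simp only: transl_comp)
    qed
    then show ?thesis unfolding glide_group_def using Lcomp[OF _ sL] by blast
  qed
  ultimately show ?thesis by blast
qed

text \<open>If \<open>c = 0\<close>, all translations in the group are multiples of \<open>\<alpha>\<close>, and translations by different multiples of
  \<open>\<beta>\<close> lie in different cosets.\<close>

lemma finite_index_nz:
  assumes \<beta>: "\<And>m. transl (of_int (6 * m) *\<^sub>R \<beta>) \<in> W_aff G"
    and fin: "finite (rcosets\<^bsub>W_aff_group G\<^esub> glide_group)"
  shows "c \<noteq> 0"
proof -
  define f where "f m = glide_group #>\<^bsub>W_aff_group G\<^esub> transl (of_int (6 * m) *\<^sub>R \<beta>)" for m :: int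
  have "range f \<subseteq> rcosets\<^bsub>W_aff_group G\<^esub> glide_group"
    unfolding f_def RCOSETS_def using \<beta> by (auto simp: W_aff_group_def)
  then have "finite (range f)" using fin by (rule finite_subset)
  then have "\<not> inj f" using infinite_UNIV_int finite_imageD by blast
  then obtain m m' where m: "m \<noteq> m'" "f m = f m'" by (auto simp: inj_def)
  have "id \<in> glide_group" using glide_group_transl[OF trl_0] by (simp add: transl_0)
  then have "transl (of_int (6 * m) *\<^sub>R \<beta>) \<in> f m"
    unfolding f_def r_coset_def by (auto simp: W_aff_group_def intro!: bexI[of _ id])
  then obtain \<gamma> where \<gamma>: "\<gamma> \<in> glide_group" "transl (of_int (6 * m) *\<^sub>R \<beta>) = \<gamma> \<circ> transl (of_int (6 * m') *\<^sub>R \<beta>)"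
    unfolding m(2) unfolding f_def r_coset_def by (auto simp: W_aff_group_def)
  have lps: "of_int j *\<^sub>R \<beta> = lp 0 j" for j by (simp add: lp_def)
  have \<gamma>x: "\<gamma> x = x + lp 0 (6 * (m - m'))" for x
  proof -
    have "\<gamma> x = (\<gamma> \<circ> transl (of_int (6 * m') *\<^sub>R \<beta>)) (x - of_int (6 * m') *\<^sub>R \<beta>)" by (simp add: transl_apply)
    also have "\<dots> = x + (of_int (6 * m) *\<^sub>R \<beta> - of_int (6 * m') *\<^sub>R \<beta>)" unfolding \<gamma>(2)[symmetric] by (simp add: transl_apply)
    also have "of_int (6 * m) *\<^sub>R \<beta> - of_int (6 * m') *\<^sub>R \<beta> = lp 0 (6 * (m - m'))" by (simp add: lp_def algebra_simps)
    finally show ?thesis .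
  qed
  show ?thesis using \<gamma>(1)
  proof (cases rule: glide_group_E)
    case (tr t)
    then have "lp 0 (6 * (m - m')) \<in> trl" using \<gamma>x[of 0] by (simp add: transl_apply)
    then obtain i j where "lp 0 (6 * (m - m')) = lp (i * int k - j * c * int n) (2 * j * c)" by (auto simp: trl_def)
    then have "6 * (m - m') = 2 * j * c" by (simp only: lp_inject)
    then show ?thesis using m(1) by auto
  next
    case (gl t)
    have "sg x + t = x + lp 0 (6 * (m - m'))" for x using \<gamma>x[of x] gl(2) by (simp add: transl_apply)
    then have "s0 x + (lp a b + t) = x + lp 0 (6 * (m - m'))" for x by (simp only: sg_def add.assoc)
    from this[of \<beta>] this[of 0] have "s0 \<beta> = \<beta>" by simp
    then have "lp (int n) (- 1) = lp 0 1" by (simp add: s0_\<beta> lp_0_1)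
    then show ?thesis by (simp add: lp_inject)
  qed
qed

text \<open>The relation \<open>t \<sigma> = \<sigma> t\<inverse>\<close> says that the translation vector of \<open>t\<close> is negated by the reflection. Such vectors in
  the lattice are orthogonal to \<open>\<alpha>\<close>, and those in the coroot lattice are multiples of \<open>2 \<beta> - n \<alpha>\<close>.\<close>

lemma antifixed_translation:
  assumes w: "w \<in> lat" "s0 w = - w" and ev: "\<And>p q. n = 2 \<Longrightarrow> w = lp p q \<Longrightarrow> even p"
  shows "\<exists>d. w = lp (- (d * int n)) (2 * d)"
proof -
  obtain p q where pq: "w = lp p q" using w(1) by (rule latE)
  have "lp (p + int n * q) (- q) = lp (- p) (- q)" using w(2) unfolding pq s0_lp lp_minus .
  then have e: "2 * p = - (int n * q)" by (simp only: lp_inject) linarith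
  show ?thesis
  proof (cases "n = 1")
    case True
    then show ?thesis using e pq by (intro exI[of _ "- p"]) (simp add: lp_inject)
  next
    case False
    then have n2: "n = 2" using n_cases by simp
    then obtain p' where "p = 2 * p'" using ev[OF n2 pq] by (auto elim: evenE)
    then show ?thesis using e n2 pq by (intro exI[of _ "- p'"]) (simp add: lp_inject)
  qed
qed

lemma lp_simps: "- \<alpha> = lp (- 1) 0" "- \<beta> = lp 0 (- 1)" "\<beta> - \<alpha> = lp (- 1) 1" "\<alpha> - \<beta> = lp 1 (- 1)"
  "real n *\<^sub>R \<alpha> - \<beta> = lp (int n) (- 1)" "\<beta> - real n *\<^sub>R \<alpha> = lp (- int n) 1"
  by (simp_all add: lp_def)

end

section \<open>The identity\<close>

context klein_lattice begin

text \<open>The four possible sets of weights, in terms of the frame. For \<open>PGL3\<close> one weight is fixed by the reflection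
  and the other two are exchanged; for \<open>PGSp4\<close> either all four weights are moved, or the two weights \<open>\<plusminus> \<alpha>\<close> are
  fixed and the two orthogonal to \<open>\<alpha>\<close> are exchanged.\<close>

lemma directions_PGL3_type:
  assumes "n = 1" "D = {\<alpha>, - \<beta>, \<beta> - \<alpha>}" shows "klein_directions \<alpha> \<beta> n k a b c D {\<alpha>} {- \<beta>}"
proof -
  have D: "D = {lp 1 0, lp 0 (- 1), lp (- 1) 1}" and F: "{\<alpha>} = {lp 1 0}" "{- \<beta>} = {lp 0 (- 1)}"
    unfolding assms(2) by (simp_all add: lp_simps lp_1_0)
  show ?thesis unfolding F by unfold_locales (use assms(1) in \<open>auto simp: D s0_lp lp_inject\<close>)
qed

lemma directions_PGL3_dual:
  assumes "n = 1" "D = {- \<alpha>, \<beta>, \<alpha> - \<beta>}" shows "klein_directions \<alpha> \<beta> n k a b c D {- \<alpha>} {\<beta>}"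
proof -
  have D: "D = {lp (- 1) 0, lp 0 1, lp 1 (- 1)}" and F: "{- \<alpha>} = {lp (- 1) 0}" "{\<beta>} = {lp 0 1}"
    unfolding assms(2) by (simp_all add: lp_simps lp_0_1)
  show ?thesis unfolding F by unfold_locales (use assms(1) in \<open>auto simp: D s0_lp lp_inject\<close>)
qed

lemma directions_PGSp4_other:
  assumes "D = {\<beta>, - \<beta>, real n *\<^sub>R \<alpha> - \<beta>, \<beta> - real n *\<^sub>R \<alpha>}" shows "klein_directions \<alpha> \<beta> n k a b c D {} {\<beta>, - \<beta>}"
proof -
  have D: "D = {lp 0 1, lp 0 (- 1), lp (int n) (- 1), lp (- int n) 1}" and F: "{\<beta>, - \<beta>} = {lp 0 1, lp 0 (- 1)}"
    unfolding assms by (simp_all add: lp_simps lp_0_1)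
  show ?thesis unfolding F by unfold_locales (use n_pos in \<open>auto simp: D s0_lp lp_inject\<close>)
qed

lemma directions_PGSp4_type:
  assumes e: "e * n = 2" and D: "D = {\<alpha>, - \<alpha>, lp (- 1) (int e), - lp (- 1) (int e)}"
  shows "klein_directions \<alpha> \<beta> n k a b c D {\<alpha>, - \<alpha>} {lp (- 1) (int e)}"
proof -
  have ne: "int n * int e = 2" using e by (metis mult.commute of_nat_mult of_nat_numeral)
  have e0: "e \<noteq> 0" "e > 0" using e by (auto intro: gr0I)
  have D: "D = {lp 1 0, lp (- 1) 0, lp (- 1) (int e), lp 1 (- int e)}" and F: "{\<alpha>, - \<alpha>} = {lp 1 0, lp (- 1) 0}"
    unfolding D by (simp_all add: lp_simps(1) lp_1_0 lp_minus)
  show ?thesis unfolding F by unfold_locales (use ne e0 in \<open>auto simp: D s0_lp lp_inject\<close>)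
qed

end

context klein_geodesics begin

text \<open>The zero weights contribute the factor \<open>(1 - u)\<^bsup>-\<epsilon> N\<^esup>\<close> to the L-function.\<close>

lemma L_function_product:
  assumes \<pi>: "\<pi> \<in> reps G" and u: "u \<noteq> 1"
  shows "(1 - u) ^ (eps \<pi> * card (double_cosets G \<Gamma>)) * L_function G \<Gamma> \<pi> u =
    inverse (\<Prod>\<phi>\<in>free_chars \<union> plus_chars. \<Prod>l\<in>D. 1 - \<phi> l * u)"
proof -
  have wt: "wt \<pi> = mset_set D + replicate_mset (eps \<pi>) 0" using wt_mset[of \<pi>] by (simp add: wt_D)
  obtain ls where ls: "mset ls = wt \<pi>" using ex_mset by blast
  have "set ls = set_mset (wt \<pi>)" by (simp flip: ls)
  also have "\<dots> \<subseteq> insert 0 D" unfolding wt using fin_D by auto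
  finally have ls_lat: "set ls \<subseteq> lat" using D_lat by auto
  have inv: "mset (map w ls) = mset ls" if w: "w \<in> weyl G" for w
  proof -
    have "inj w" using W_inv[OF w] by (metis comp_apply id_apply injI)
    then have injD: "inj_on w D" by (rule inj_on_subset) simp
    have "w ` D \<subseteq> D" using weyl_wt'[OF w \<pi>] by (auto simp: wt_D)
    then have "w ` D = D" using fin_D injD by (simp add: endo_inj_surj)
    then have "image_mset w (mset_set D) = mset_set D" using image_mset_mset_set[OF injD] by simp
    then show ?thesis using W_0[OF w] unfolding mset_map ls wt by simp
  qed
  have prod: "(\<Prod>l\<leftarrow>ls. 1 - \<phi> l * u) = (1 - u) ^ eps \<pi> * (\<Prod>l\<in>D. 1 - \<phi> l * u)" if "\<phi> \<in> free_chars \<union> plus_chars" for \<phi>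
  proof -
    have "\<phi> \<in> chars" using that free_chars(2) by blast
    then have \<phi>0: "\<phi> 0 = 1" using chars_charac by (auto simp: charac_def)
    have "(\<Prod>l\<leftarrow>ls. 1 - \<phi> l * u) = prod_mset (image_mset (\<lambda>l. 1 - \<phi> l * u) (wt \<pi>))"
      by (simp flip: ls prod_mset_prod_list mset_map)
    also have "\<dots> = (1 - u) ^ eps \<pi> * (\<Prod>l\<in>D. 1 - \<phi> l * u)"
      unfolding wt by (simp add: prod_unfold_prod_mset \<phi>0 mult.commute)
    finally show ?thesis .
  qed
  let ?A = "\<Prod>\<phi>\<in>free_chars \<union> plus_chars. \<Prod>l\<in>D. 1 - \<phi> l * u"
  let ?N = "card (double_cosets G \<Gamma>)"
  have "L_function G \<Gamma> \<pi> u = (\<Prod>\<phi>\<in>free_chars \<union> plus_chars. inverse (\<Prod>l\<leftarrow>ls. 1 - \<phi> l * u))"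
    by (rule L_function_eq[OF ls_lat inv ls])
  also have "\<dots> = (\<Prod>\<phi>\<in>free_chars \<union> plus_chars. inverse ((1 - u) ^ eps \<pi> * (\<Prod>l\<in>D. 1 - \<phi> l * u)))"
    by (rule prod.cong) (simp_all only: prod)
  also have "\<dots> = inverse (((1 - u) ^ eps \<pi>) ^ ?N * ?A)"
    by (simp add: prod.distrib spherical_basis(2)[OF ls_lat inv, symmetric] prod_inversef[symmetric] o_def power_inverse)
  finally show ?thesis using u by (simp add: power_mult)
qed

lemma klein_product:
  assumes \<pi>: "\<pi> \<in> reps G" and u: "norm u \<noteq> 1"
  shows "(1 - u) ^ (eps \<pi> * card (double_cosets G \<Gamma>)) * L_function G \<Gamma> \<pi> u =
    zeta_function G \<Gamma> \<pi> u * ((\<Prod>\<phi>\<in>minus_chars. \<Prod>l\<in>H. 1 - \<phi> l * u) / (\<Prod>\<phi>\<in>plus_chars. \<Prod>l\<in>H. 1 - \<phi> l * u))"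
    and "(\<Prod>\<phi>\<in>plus_chars. \<Prod>l\<in>H. 1 - \<phi> l * u) \<noteq> 0"
proof -
  have u1: "u \<noteq> 1" using u by auto
  have HD: "H \<subseteq> lat" using D_lat D_split by blast
  have chp: "plus_chars \<subseteq> chars" "minus_chars \<subseteq> chars" using free_chars(2) by blast+
  \<comment> \<open>Characters have absolute value 1, so that no factor vanishes and division is possible.\<close>
  have nz: "1 - \<phi> l * u \<noteq> 0" if "\<phi> \<in> chars" "l \<in> lat" for \<phi> l using chars_norm_less[OF that u] .
  show P: "(\<Prod>\<phi>\<in>plus_chars. \<Prod>l\<in>H. 1 - \<phi> l * u) \<noteq> 0"
    using nz HD chp finite_char_parts fin_D D_split by (simp add: prod_zero_iff subset_iff)
  have "1 - fst i (snd i) * u \<noteq> 0" if "i \<in> idx" for i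
    using nz[of "fst i" "snd i"] idx_chars[of "fst i" "snd i"] that D_lat by auto
  then have B: "(\<Prod>i\<in>idx. 1 - fst i (snd i) * u) \<noteq> 0"
    using family_basis_finite[OF invariants_basis] by (simp add: prod_zero_iff)
  let ?A = "\<Prod>\<phi>\<in>free_chars \<union> plus_chars. \<Prod>l\<in>D. 1 - \<phi> l * u"
  have A: "?A \<noteq> 0"
  proof -
    have "1 - \<phi> l * u \<noteq> 0" if "\<phi> \<in> free_chars \<union> plus_chars" "l \<in> D" for \<phi> l
      using nz that free_chars(2) D_lat by blast
    then show ?thesis using finite_char_parts fin_D by (simp add: prod_zero_iff)
  qed
  show "(1 - u) ^ (eps \<pi> * card (double_cosets G \<Gamma>)) * L_function G \<Gamma> \<pi> u =
    zeta_function G \<Gamma> \<pi> u * ((\<Prod>\<phi>\<in>minus_chars. \<Prod>l\<in>H. 1 - \<phi> l * u) / (\<Prod>\<phi>\<in>plus_chars. \<Prod>l\<in>H. 1 - \<phi> l * u))"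
    unfolding L_function_product[OF \<pi> u1] zeta_function_idx using spherical_product[of u] A B P
    by (simp add: field_simps)
qed

text \<open>The two alternatives for \<open>H\<close> determine the exponent: \<open>d\<close> directions \<open>\<plusminus> \<beta>\<close>, or a single direction orthogonal to \<open>\<alpha>\<close>.\<close>

lemma klein_identity_split:
  assumes \<pi>: "\<pi> \<in> reps G" and u: "norm u \<noteq> 1"
    and H: "(H \<subseteq> {\<beta>, - \<beta>} \<and> d = card H) \<or> (\<exists>e. e * n = 2 \<and> H = {lp (- 1) (int e)} \<and> d = 0)"
  shows "(1 - u) ^ (eps \<pi> * card (double_cosets G \<Gamma>)) * L_function G \<Gamma> \<pi> u =
    zeta_function G \<Gamma> \<pi> u *
      ((1 + u powr of_real (real k / real n)) / (1 - u powr of_real (real k / real n))) ^ (n * d)"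
proof -
  have "real n * real kn = real k" by (simp only: n_kn flip: of_nat_mult)
  then have "real k / real n = real kn" using n_pos by (simp add: field_simps)
  then have powr: "u powr of_real (real k / real n) = u ^ kn" using kn_pos by (simp add: powr_nat')
  have fH: "finite H" using fin_D D_split by simp
  from H show ?thesis
  proof
    assume H: "H \<subseteq> {\<beta>, - \<beta>} \<and> d = card H"
    have gen: "(\<Prod>\<phi>\<in>{\<phi> \<in> fixed_chars. sign_char \<phi> = s}. \<Prod>l\<in>H. 1 - \<phi> l * u) = (1 - s * u ^ kn) ^ (n * d)"
      if s: "s = 1 \<or> s = - 1" for s
    proof -
      have "(\<Prod>\<phi>\<in>{\<phi> \<in> fixed_chars. sign_char \<phi> = s}. \<Prod>l\<in>H. 1 - \<phi> l * u) =
        (\<Prod>l\<in>H. \<Prod>\<phi>\<in>{\<phi> \<in> fixed_chars. sign_char \<phi> = s}. 1 - \<phi> l * u)" by (rule prod.swap)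
      also have "\<dots> = (\<Prod>l\<in>H. (1 - s * u ^ kn) ^ n)"
        by (rule prod.cong) (use H sign_chars_prod_\<beta>[OF s] in auto)
      finally show ?thesis using H by (simp add: power_mult)
    qed
    show ?thesis
      using klein_product(1)[OF \<pi> u] gen[of 1] gen[of "- 1"] unfolding powr
      by (simp add: plus_chars_def minus_chars_def power_divide)
  next
    assume "\<exists>e. e * n = 2 \<and> H = {lp (- 1) (int e)} \<and> d = 0"
    then obtain e where e: "e * n = 2" "H = {lp (- 1) (int e)}" "d = 0" by blast
    have "(\<Prod>\<phi>\<in>minus_chars. \<Prod>l\<in>H. 1 - \<phi> l * u) = (\<Prod>\<phi>\<in>plus_chars. \<Prod>l\<in>H. 1 - \<phi> l * u)"
      using sign_chars_prod_orthogonal[OF _ e(1) refl, of 1 u] sign_chars_prod_orthogonal[OF _ e(1) refl, of "- 1" u]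
      by (simp add: e(2) plus_chars_def minus_chars_def)
    then show ?thesis using klein_product[OF \<pi> u] e(3) by simp
  qed
qed

end

lemma (in klein_rep) klein_identity:
  assumes dir: "klein_directions \<alpha> \<beta> n k a b c (wt' \<pi>) Fx H" and \<pi>: "\<pi> \<in> reps G" and u: "norm u \<noteq> 1"
    and H: "(H \<subseteq> {\<beta>, - \<beta>} \<and> d = card H) \<or> (\<exists>e. e * n = 2 \<and> H = {lp (- 1) (int e)} \<and> d = 0)"
  shows "(1 - u) ^ (eps \<pi> * card (double_cosets G \<Gamma>)) * L_function G \<Gamma> \<pi> u =
    zeta_function G \<Gamma> \<pi> u *
      ((1 + u powr of_real (real k / real n)) / (1 - u powr of_real (real k / real n))) ^ (n * d)"
proof -
  interpret d: klein_directions \<alpha> \<beta> n k a b c "wt' \<pi>" Fx H by (rule dir)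
  interpret g: klein_geodesics \<alpha> \<beta> n k a b c G \<Gamma> "wt' \<pi>" Fx H \<pi> "wall_normals G"
    by unfold_locales
      (use ell_norm finite_wall_normals skeleton_eq wall_normal_integral wall_parallel[OF \<pi>]
        wall_vertex[OF \<pi>] weight_primitive[OF \<pi>] in \<open>simp_all add: lat_G\<close>)
  show ?thesis by (rule g.klein_identity_split[OF \<pi> u H])
qed

text \<open>Every presentation yields the data of a Klein bottle group; finiteness of the index gives \<open>c \<noteq> 0\<close>.\<close>

lemma klein_rep_exists:
  assumes fr: "klein_frame \<alpha> \<beta> n k a b"
    and lat: "coweight_lattice G = {of_int p *\<^sub>R \<alpha> + of_int q *\<^sub>R \<beta> | p q. True}"
    and ev: "\<And>p q. n = 2 \<Longrightarrow> of_int p *\<^sub>R \<alpha> + of_int q *\<^sub>R \<beta> \<in> coroot_lattice G \<Longrightarrow> even p"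
    and t: "t \<in> W_aff G" "t = transl v" and \<sigma>: "\<sigma> \<in> W_aff G"
    and \<sigma>_def: "\<sigma> = (\<lambda>x. (- x + (2 * (x \<bullet> \<alpha>) / (\<alpha> \<bullet> \<alpha>)) *\<^sub>R \<alpha>) + of_int a *\<^sub>R \<alpha> + of_int b *\<^sub>R \<beta>)"
    and rel: "t \<circ> \<sigma> = \<sigma> \<circ> (inv\<^bsub>W_aff_group G\<^esub> t)"
    and \<Gamma>: "\<Gamma> = generate (W_aff_group G) {t, \<sigma>}" and fin: "finite (rcosets\<^bsub>W_aff_group G\<^esub> \<Gamma>)"
  shows "\<exists>c. klein_rep \<alpha> \<beta> n k a b c G \<Gamma>"
proof -
  interpret f: klein_frame \<alpha> \<beta> n k a b 0 by (rule fr)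
  interpret W: group "W_aff_group G" by (rule W_aff_group)
  have latG: "coweight_lattice G = f.lat" unfolding lat f.lat_def f.lp_def ..
  have sg: "\<sigma> = f.sg" unfolding \<sigma>_def by (simp add: f.sg_def f.s0_def f.lp_def fun_eq_iff add.assoc)
  have v: "v \<in> coroot_lattice G" using t by (simp add: transl_W_aff)
  then have vlat: "v \<in> f.lat" using coroot_coweight latG by blast
  have "inv\<^bsub>W_aff_group G\<^esub> t = transl (- v)"
    by (rule W.inv_equality)
      (use t v coroot_minus in \<open>simp_all add: W_aff_group_def transl_comp transl_0 transl_W_aff\<close>)
  then have "(t \<circ> \<sigma>) 0 = (\<sigma> \<circ> transl (- v)) 0" using rel by simp
  then have sv: "f.s0 v = - v" unfolding t(2) sg by (simp add: transl_apply f.sg_def f.s0_minus algebra_simps eq_neg_iff_add_eq_0)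
  obtain c where c: "v = f.lp (- (c * int n)) (2 * c)"
    using f.antifixed_translation[OF vlat sv] ev v unfolding f.lp_def by blast
  interpret fc: klein_frame \<alpha> \<beta> n k a b c by (rule fr)
  have \<Gamma>g: "\<Gamma> = fc.glide_group"
    using fc.generate_glide_group[of G] t \<sigma> unfolding \<Gamma> t(2) sg c by simp
  have "transl (of_int (6 * m) *\<^sub>R \<beta>) \<in> W_aff G" for m
    unfolding transl_W_aff by (rule coroot_six) (simp add: latG)
  then have cnz: "c \<noteq> 0" using fc.finite_index_nz fin unfolding \<Gamma>g by blast
  obtain l w where w: "\<sigma> = transl l \<circ> w" "w \<in> weyl G" using \<sigma> by (auto simp: W_aff_def)
  have "l = f.lp a b" using fun_cong[OF w(1), of 0] linear_0[OF weyl_linear[OF w(2)]] unfolding sg by (simp add: transl_apply f.sg_def)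
  then have "w = f.s0" using w(1) unfolding sg by (simp add: fun_eq_iff transl_def f.sg_def)
  then have s0W: "f.s0 \<in> weyl G" using w(2) by simp
  have "klein_rep \<alpha> \<beta> n k a b c G \<Gamma>"
    by unfold_locales
      (use cnz latG s0W \<Gamma>g weyl_linear weyl_coweight[of _ G] weyl_id weyl_comp weyl_inv weyl_finite in
        \<open>simp_all add: linear_add[OF weyl_linear[of _ G]] linear_scale[OF weyl_linear[of _ G]]\<close>)
  then show ?thesis by blast
qed

theorem theorem4p6:
  fixes G :: grp and \<pi> \<tau> :: wrep and \<Gamma> :: "(plane \<Rightarrow> plane) set" and n k :: nat and u :: complex
  assumes "\<pi> \<in> reps G"
    and "subgroup \<Gamma> (W_aff_group G)"
    and "torsion_free \<Gamma>"
    and "finite (rcosets\<^bsub>W_aff_group G\<^esub> \<Gamma>)"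
    and "is_klein_bottle \<Gamma>"
    and "klein_invariants G \<Gamma> \<tau> n k"
    and "norm u \<noteq> 1"
  shows "(1 - u) ^ (eps \<pi> * card (double_cosets G \<Gamma>)) * L_function G \<Gamma> \<pi> u =
         zeta_function G \<Gamma> \<pi> u *
           ((1 + u powr of_real (real k / real n)) / (1 - u powr of_real (real k / real n)))
             ^ (n * delta G \<pi> \<tau>)"
proof -
  obtain \<alpha> \<beta> a b where pres: "klein_presentation G \<Gamma> \<tau> \<alpha> \<beta> a b"
    and n: "real n = 2 * (\<alpha> \<bullet> \<beta>) / (\<alpha> \<bullet> \<alpha>)" and k: "int k = 2 * a + int n * b" "k > 0"
    using assms(6) unfolding klein_invariants_def by blast
  obtain \<tau>' t \<sigma> v where \<tau>: "\<tau> \<in> reps G" "\<tau>' \<in> reps G" "\<tau>' \<noteq> \<tau>" and \<alpha>: "\<alpha> \<in> wt' \<tau>"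
    and \<beta>: "is_arg_max (\<lambda>\<beta>. \<alpha> \<bullet> \<beta>) (\<lambda>\<beta>. \<beta> \<in> wt' \<tau>') \<beta>"
    and t: "t \<in> W_aff G" "t = transl v" and \<sigma>: "\<sigma> \<in> W_aff G"
    and \<Gamma>: "\<Gamma> = generate (W_aff_group G) {t, \<sigma>}"
    and \<sigma>_def: "\<sigma> = (\<lambda>x. (- x + (2 * (x \<bullet> \<alpha>) / (\<alpha> \<bullet> \<alpha>)) *\<^sub>R \<alpha>) + of_int a *\<^sub>R \<alpha> + of_int b *\<^sub>R \<beta>)"
    and rel: "t \<circ> \<sigma> = \<sigma> \<circ> (inv\<^bsub>W_aff_group G\<^esub> t)"
    using pres unfolding klein_presentation_def by blast
  \<comment> \<open>The translation part of \<open>\<sigma>\<close> lies in the coroot lattice.\<close>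
  have \<sigma>0: "of_int a *\<^sub>R \<alpha> + of_int b *\<^sub>R \<beta> \<in> coroot_lattice G"
  proof -
    obtain l w where w: "\<sigma> = transl l \<circ> w" "l \<in> coroot_lattice G" "w \<in> weyl G" using \<sigma> by (auto simp: W_aff_def)
    have "l = of_int a *\<^sub>R \<alpha> + of_int b *\<^sub>R \<beta>"
      using fun_cong[OF w(1), of 0] linear_0[OF weyl_linear[OF w(3)]] unfolding \<sigma>_def by (simp add: transl_def)
    then show ?thesis using w(2) by simp
  qed
  show ?thesis
  proof (cases G)
    case PGL3
    note f = frame_PGL3[OF \<tau>[unfolded PGL3] \<alpha> \<beta>]
    have n1: "n = 1" using n unfolding f(1,2) by simp
    have fr: "klein_frame \<alpha> \<beta> n k a b" using f(1,2,3) n1 k by unfold_locales auto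
    obtain c where "klein_rep \<alpha> \<beta> n k a b c G \<Gamma>"
      using klein_rep_exists[OF fr _ _ t \<sigma> \<sigma>_def rel \<Gamma> assms(4)] f(4) n1 unfolding PGL3 by auto
    then interpret klein_rep \<alpha> \<beta> n k a b c G \<Gamma> .
    have d: "delta G \<pi> \<tau> = 1" by (simp add: PGL3)
    have "\<pi> = \<tau> \<or> \<pi> = \<tau>'" using assms(1) \<tau> PGL3 by auto
    then show ?thesis
    proof
      assume "\<pi> = \<tau>"
      then show ?thesis using klein_identity[OF directions_PGL3_type[OF n1] assms(1,7), of 1] f(5) d by simp
    next
      assume "\<pi> = \<tau>'"
      then show ?thesis using klein_identity[OF directions_PGL3_dual[OF n1] assms(1,7), of 1] f(6) d by simp
    qed
  next
    case PGSp4
    note f = frame_PGSp4[OF \<tau>[unfolded PGSp4] \<alpha> \<beta>]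
    have t2: "\<tau> = Spin \<and> \<tau>' = St \<or> \<tau> = St \<and> \<tau>' = Spin" using \<tau> PGSp4 by auto
    have nS: "n = (if \<tau> = Spin then 2 else 1)" using n unfolding f(1,2) by (simp split: if_splits)
    have ev: "even p" if "n = 2" "of_int p *\<^sub>R \<alpha> + of_int q *\<^sub>R \<beta> \<in> coroot_lattice G" for p q
      using f(9)[of p q] that nS PGSp4 by (simp split: if_splits)
    have "real n * (\<alpha> \<bullet> \<alpha>) = 2 * (\<alpha> \<bullet> \<beta>)" using nS unfolding f(1,2) by simp
    then have fr: "klein_frame \<alpha> \<beta> n k a b" using f(3) nS k ev[OF _ \<sigma>0] by unfold_locales auto
    have "\<exists>c. klein_rep \<alpha> \<beta> n k a b c G \<Gamma>"
      by (rule klein_rep_exists[OF fr f(4)[folded PGSp4] _ t \<sigma> \<sigma>_def rel \<Gamma> assms(4)]) (rule ev)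
    then obtain c where "klein_rep \<alpha> \<beta> n k a b c G \<Gamma>" by blast
    then interpret klein_rep \<alpha> \<beta> n k a b c G \<Gamma> .
    have \<beta>nz: "\<beta> \<noteq> - \<beta>" using f(3)[of 0 2] by (auto simp: scaleR_2 eq_neg_iff_add_eq_0)
    have "\<pi> = \<tau> \<or> \<pi> = \<tau>'" using assms(1) \<tau> PGSp4 by auto
    then show ?thesis
    proof
      assume \<pi>: "\<pi> = \<tau>"
      \<comment> \<open>With this \<open>e\<close>, the weight of \<open>\<tau>\<close> orthogonal to \<open>\<alpha>\<close> is \<open>e \<beta> - \<alpha>\<close>, up to sign.\<close>
      define e where "e = (if \<tau> = Spin then 1 else 2 :: nat)"
      have en: "e * n = 2" by (simp add: e_def nS)
      have D: "wt' \<pi> = {\<alpha>, - \<alpha>, lp (- 1) (int e), - lp (- 1) (int e)}"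
        using t2 f(5,7) unfolding \<pi> by (auto simp: e_def lp_def algebra_simps)
      have "delta G \<pi> \<tau> = 0" using PGSp4 \<pi> by simp
      then show ?thesis using klein_identity[OF directions_PGSp4_type[OF en D] assms(1,7), of 0] en by auto
    next
      assume \<pi>: "\<pi> = \<tau>'"
      have D: "wt' \<pi> = {\<beta>, - \<beta>, real n *\<^sub>R \<alpha> - \<beta>, \<beta> - real n *\<^sub>R \<alpha>}"
        using t2 f(6,8) unfolding \<pi> by (auto simp: nS)
      have "delta G \<pi> \<tau> = 2" using PGSp4 \<pi> \<tau> by simp
      moreover have "card {\<beta>, - \<beta>} = 2" using \<beta>nz by simp
      ultimately show ?thesis using klein_identity[OF directions_PGSp4_other[OF D] assms(1,7), of 2] by auto
    qed
  qed
qed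

end
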